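(* Let $H$ be an infinite dimensional separable Hilbert space with norm $|\cdot|$ and inner product $(\cdot,\cdot)$, and let $\gamma$ be a Gaussian measure on $H$ whose covariance operator has the form $R(x)=\sum_{i\ge 1} c_i (x,e_i)e_i$, where $(e_i)_{i\ge1}$ is an orthonormal system of $H$, and such that for some given $a>5/2$ one has $c_{i+1}\le c_i/i^{a}$ for all $i\ge 1$. Let $\rho_0$ and $\rho_1$ be Borel probability measures on $H$ with finite relative entropy with respect to $\gamma$. Then the problem $$\inf_{T_\#\rho_0=\rho_1}\int_H |x-T(x)|\,d\rho_0(x),$$ where the infimum runs over Borel maps $T:H\to H$ with $T_\#\rho_0=\rho_1$, has at least one solution $T:H\to H$ (i.e. the infimum is attained by some such Borel map).
   Context: $T_\#\rho_0$ is the push-forward: $T_\#\rho_0(B)=\rho_0(T^{-1}(B))$ for every Borel $B\subset H$. The relative entropy of a probability measure $\rho$ with respect to $\gamma$ is $\mathrm{Ent}_\gamma(\rho)=\int_H f\log f\,d\gamma$ if $\rho=f\gamma$ is absolutely continuous with respect to $\gamma$, and $+\infty$ otherwise. *)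

theory Defs
  imports "HOL-Probability.Probability"
begin

(* Variance zero is admitted: the law is then a point mass. *)
definition gaussian_law :: "real measure \<Rightarrow> bool" where
  "gaussian_law \<nu> \<longleftrightarrow>
     (\<exists>\<mu> \<sigma>. 0 < \<sigma> \<and> \<nu> = density lborel (\<lambda>x. ennreal (normal_density \<mu> \<sigma> x))) \<or>
     (\<exists>\<mu>. \<nu> = return borel \<mu>)"

(* By Riesz representation the maps x \<bullet> h are all the continuous linear functionals
   of a Hilbert space. The measure need not be centred. *)
definition gaussian_measure :: "'h::{real_inner, polish_space} measure \<Rightarrow> bool" where
  "gaussian_measure \<gamma> \<longleftrightarrow>
     prob_space \<gamma> \<and> sets \<gamma> = sets borel \<and>
     (\<forall>h. gaussian_law (distr \<gamma> borel (\<lambda>x. x \<bullet> h)))"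

(* The square integrability clause excludes the default value 0 of the Bochner integral
   at non-integrable functions; every Gaussian measure satisfies it. *)
definition has_covariance_operator ::
    "'h::{real_inner, polish_space} measure \<Rightarrow> ('h \<Rightarrow> 'h) \<Rightarrow> bool" where
  "has_covariance_operator \<gamma> R \<longleftrightarrow>
     bounded_linear R \<and>
     (\<forall>h. integrable \<gamma> (\<lambda>x. (x \<bullet> h)\<^sup>2)) \<and>
     (\<forall>h k. R h \<bullet> k =
        (\<integral>x. (x \<bullet> h - (\<integral>y. y \<bullet> h \<partial>\<gamma>)) * (x \<bullet> k - (\<integral>y. y \<bullet> k \<partial>\<gamma>)) \<partial>\<gamma>))"

(* The integral of f log f is taken as a difference of the integrals of its positive and
   negative parts, so that the value \<infinity> is possible also for \<rho> absolutely continuous.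
   Since f log f \<ge> -1/e, the subtracted term is finite for a probability measure \<gamma>.
   The convention 0 log 0 = 0 holds because ln 0 = 0. *)
definition rel_entropy :: "'a measure \<Rightarrow> 'a measure \<Rightarrow> ereal" where
  "rel_entropy \<gamma> \<rho> =
     (if absolutely_continuous \<gamma> \<rho> then
        let f = (\<lambda>x. enn2real (RN_deriv \<gamma> \<rho> x)) in
          enn2ereal (\<integral>\<^sup>+x. ennreal (f x * ln (f x)) \<partial>\<gamma>)
          - enn2ereal (\<integral>\<^sup>+x. ennreal (- (f x * ln (f x))) \<partial>\<gamma>)
      else \<infinity>)"

definition transport_maps ::
    "'h::topological_space measure \<Rightarrow> 'h measure \<Rightarrow> ('h \<Rightarrow> 'h) set" where
  "transport_maps \<rho>\<^sub>0 \<rho>\<^sub>1 = {T. T \<in> borel \<rightarrow>\<^sub>M borel \<and> distr \<rho>\<^sub>0 borel T = \<rho>\<^sub>1}"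

definition monge_cost ::
    "'h::real_normed_vector measure \<Rightarrow> ('h \<Rightarrow> 'h) \<Rightarrow> ennreal" where
  "monge_cost \<rho>\<^sub>0 T = (\<integral>\<^sup>+x. ennreal (norm (x - T x)) \<partial>\<rho>\<^sub>0)"

end

theory Submission
  imports Defs
begin

text \<open>
Among the couplings minimising the integral of \<open>norm (x - y)\<close>, approximate one that also minimises
the integral of \<open>(norm (x - y))^2\<close>. The approximating plans come from a transport problem between finitely many
Gaussian cells in finitely many coordinates, in which each unit of mass passes at a small time \<open>t\<close> through a site of a
lattice of mesh \<open>s\<close>. Optimality for a smooth uniformly convex perturbation of the cost keeps the interpolants
\<open>(1 - t) x + t y\<close> of the cells sharing a site free of slightly dilated lattice translates, so their
Lebesgue measure is at most \<open>((1 + C s) s)^n\<close>; with the Prekopa-Leindler inequality this bounds the entropy of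
the law at time \<open>t\<close> by the entropies of the two marginals, independently of \<open>t\<close>.

If the conditional probability that the target lies in a set, given the source, were not almost everywhere 0 or 1, mass
would go from a compact set of positive measure to two separated sets of targets. By the entropy bound, interpolants at
time \<open>t\<close> of the mass going to the first stay mostly in that compact set, where they meet sources of mass
going to the second. Swapping the targets of the two costs
little in the integral of \<open>norm (x - y)\<close> and gains more in one of the two integrals, a contradiction. Hence the
target is a function of the source.
\<close>

text \<open>The linear cost cannot decide between two targets on one ray; the quadratic cost breaks
  exactly these ties. Different distances are punished by the quadratic cost, different directions
  by the linear one; either gain is of order \<open>t\<close> per unit of swapped mass, against
  permitted errors of order \<open>t^2\<close>, so mass of fixed size cannot be swappable. Producing
  such mass at time \<open>t\<close> is the obstacle: a density point argument would need a
  differentiation theorem in infinite dimension. A bound on entropy, independent of \<open>t\<close>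
  and of the dimension, replaces it, since mass cannot then hide in sets of small
  \<open>gm\<close>-measure. It is free of the dimension because the mesh \<open>s\<close> is chosen
  after the frame, so that \<open>(1 + C * s) ^ n\<close> tends to 1. Cells have side
  \<open>s^2\<close>: an offset of that size tested against a step of size \<open>s\<close> is of
  third order, like the Taylor error, and is beaten by the \<open>s^2\<close> that convexity
  supplies. No limit coupling is built. Only the numbers \<open>mass (M i) A V\<close> converge,
  along a filter, and countable additivity in the source comes back from domination by
  \<open>rho0\<close>.\<close>

abbreviation marginal :: "'c measure => ('c => 'a::topological_space) => 'a measure => prop" where
 "marginal M h rho \<equiv> (\<And>f. f : borel_measurable borel ==> (\<integral>\<^sup>+u. f (h u) \<partial>M) = (\<integral>\<^sup>+x. f x \<partial>rho))"

abbreviation sq_int :: "('h \<times> 'h::real_normed_vector) measure => ennreal" where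
 "sq_int th \<equiv> \<integral>\<^sup>+v. ennreal ((norm (fst v - snd v))^2) \<partial>th"

abbreviation moment2 :: "'h::real_normed_vector => 'h measure => ennreal" where
 "moment2 x0 rho \<equiv> \<integral>\<^sup>+x. ennreal ((norm (x - x0))^2) \<partial>rho"

abbreviation slack :: "real => real => real => real => real" where
 "slack t eps dl r \<equiv> (1 / (2 * eps) + dl) * r^2 / (t * (1 - t))"

abbreviation orthonormal_on :: "('i => 'h::real_inner) => 'i set => prop" where
 "orthonormal_on e I \<equiv> (\<And>i j. i : I ==> j : I ==> e i \<bullet> e j = (if i = j then 1 else 0))"

abbreviation coord_law :: "'h::{real_inner, polish_space} measure => 'h => ('i => 'h) => 'i set => ('i => real) measure" where
 "coord_law gm x0 e J \<equiv> distr gm (PiM J (\<lambda>_. borel)) (\<lambda>x. \<lambda>i\<in>J. (x - x0) \<bullet> e i)"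

section \<open>Relative entropy\<close>

text \<open>Legendre duality between \<open>a * ln a - a\<close> and \<open>exp\<close>, that is,
  \<open>1 + x <= exp x\<close> at \<open>x = b - ln a\<close>. Most estimates by entropy below are
  this inequality with a suitable slope \<open>b\<close>.\<close>

lemma young_entropy:
 fixes a b :: real
 assumes "a >= 0"
 shows "a * b <= a * ln a - a + exp b"
proof (cases "a = 0")
 case False
 then have a: "a > 0" using assms by simp
 then have "a * (1 + (b - ln a)) <= a * exp (b - ln a)" using a by simp
 also have "a * exp (b - ln a) = exp b" using a by (simp add: exp_diff)
 finally show ?thesis by (simp add: algebra_simps)
qed simp

text \<open>\<open>ennreal\<close> cuts off negative values, so \<open>E\<close> bounds the integral
  of the positive part of \<open>f * ln f\<close> only. Such a bound may be enlarged freely and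
  restricted to subsets, where cancellation would interfere.\<close>

definition entropy_bound :: "'a measure => 'a measure => real => bool" where
 "entropy_bound gm rho E \<longleftrightarrow> (\<exists>f. f : borel_measurable gm \<and> (\<forall>x. 0 <= f x) \<and> rho = density gm (\<lambda>x. ennreal (f x)) \<and>
  0 <= E \<and> (\<integral>\<^sup>+x. ennreal (f x * ln (f x)) \<partial>gm) <= ennreal E)"

lemma rel_entropy_finite_imp_bound:
 assumes g: "prob_space gm" and r: "prob_space rho" and sets: "sets rho = sets gm" and fin: "\<bar>rel_entropy gm rho\<bar> \<noteq> \<infinity>"
 shows "\<exists>E. entropy_bound gm rho E"
proof -
 interpret g: prob_space gm by fact
 interpret r: prob_space rho by fact
 have ac: "absolutely_continuous gm rho" using fin by (auto simp: rel_entropy_def split: if_splits)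
 define f where "f = (\<lambda>x. enn2real (RN_deriv gm rho x))"
 have [measurable]: "f : borel_measurable gm" unfolding f_def by simp
 have "AE x in gm. RN_deriv gm rho x \<noteq> \<infinity>"
  using g.RN_deriv_finite[OF _ ac sets] r.sigma_finite_measure_axioms by simp
 then have "AE x in gm. RN_deriv gm rho x = ennreal (f x)" by eventually_elim (auto simp: f_def less_top)
 then have "density gm (RN_deriv gm rho) = density gm (\<lambda>x. ennreal (f x))"
  by (intro density_cong) auto
 then have rho: "rho = density gm (\<lambda>x. ennreal (f x))" using g.density_RN_deriv[OF ac sets] by simp
 let ?P = "\<integral>\<^sup>+x. ennreal (f x * ln (f x)) \<partial>gm" and ?N = "\<integral>\<^sup>+x. ennreal (- (f x * ln (f x))) \<partial>gm"
 have eq: "rel_entropy gm rho = enn2ereal ?P - enn2ereal ?N" using ac by (simp add: rel_entropy_def f_def)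
 \<comment> \<open>Slope 0 in \<open>young_entropy\<close> gives
   \<open>- (f x * ln (f x)) <= 1 - f x\<close>. With the negative part finite, the difference in
   \<open>rel_entropy\<close> is infinite whenever the positive part is.\<close>
 have "?N <= 1"
 proof -
  have "- (f x * ln (f x)) <= 1" for x
   using young_entropy[of "f x" 0] by (auto simp: f_def) (smt (verit) enn2real_nonneg young_entropy exp_zero mult_zero_right)
  then have "?N <= (\<integral>\<^sup>+x. 1 \<partial>gm)" by (intro nn_integral_mono) (metis ennreal_1 ennreal_leI)
  then show ?thesis by (simp add: g.emeasure_space_1)
 qed
 then have "?N \<noteq> \<infinity>" using neq_top_trans[OF ennreal_one_neq_top] by simp
 then obtain n where n: "?N = ennreal n" "n >= 0" by (cases ?N) auto
 have "?P \<noteq> \<infinity>"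
 proof
  assume P: "?P = \<infinity>"
  have "rel_entropy gm rho = \<infinity>" unfolding eq P n(1) using n(2) by simp
  with fin show False by simp
 qed
 then obtain E where E: "E >= 0" "?P = ennreal E" by (metis ennreal_cases infinity_ennreal_def)
 have "f x >= 0" for x by (simp add: f_def)
 then show ?thesis unfolding entropy_bound_def using rho E by (intro exI[of _ E] exI[of _ f] conjI allI) simp_all
qed

text \<open>Slope \<open>g x\<close> in \<open>young_entropy\<close>. This converts exponential
  moments under \<open>gm\<close> into moments under \<open>rho\<close>.\<close>

lemma entropy_bound_exp:
 assumes "entropy_bound gm rho E" and [measurable]: "g : borel_measurable gm" and g: "\<And>x. 0 <= g x"
 shows "(\<integral>\<^sup>+x. ennreal (g x) \<partial>rho) <= ennreal E + (\<integral>\<^sup>+x. ennreal (exp (g x)) \<partial>gm)"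
proof -
 obtain f where [measurable]: "f : borel_measurable gm" and f: "\<And>x. 0 <= f x" and rho: "rho = density gm (\<lambda>x. ennreal (f x))"
  and E: "0 <= E" "(\<integral>\<^sup>+x. ennreal (f x * ln (f x)) \<partial>gm) <= ennreal E" using assms(1) by (auto simp: entropy_bound_def)
 have "(\<integral>\<^sup>+x. ennreal (g x) \<partial>rho) = (\<integral>\<^sup>+x. ennreal (f x * g x) \<partial>gm)"
  unfolding rho using f by (subst nn_integral_density) (auto simp: ennreal_mult')
 also have "... <= (\<integral>\<^sup>+x. ennreal (f x * ln (f x)) + ennreal (exp (g x)) \<partial>gm)"
 proof (intro nn_integral_mono)
  fix x
  have "ennreal (f x * g x) <= ennreal (max 0 (f x * ln (f x)) + exp (g x))" using young_entropy[OF f[of x], of "g x"] f[of x] by (intro ennreal_leI) auto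
  also have "... = ennreal (f x * ln (f x)) + ennreal (exp (g x))"
   by simp
  finally show "ennreal (f x * g x) <= ennreal (f x * ln (f x)) + ennreal (exp (g x))" .
 qed
 also have "... = (\<integral>\<^sup>+x. ennreal (f x * ln (f x)) \<partial>gm) + (\<integral>\<^sup>+x. ennreal (exp (g x)) \<partial>gm)"
  by (intro nn_integral_add) auto
 also have "... <= ennreal E + (\<integral>\<^sup>+x. ennreal (exp (g x)) \<partial>gm)" using E by simp
 finally show ?thesis .
qed

text \<open>Coarse graining does not raise entropy: Jensen's inequality on each cell, the cells
  adding up to the positive part of \<open>f * ln f\<close>.\<close>

lemma entropy_bound_partition:
 fixes q :: "'a => 'p"
 assumes "entropy_bound gm rho E" and "prob_space gm" "prob_space rho"
  and P: "finite P" "\<And>x. x : space gm ==> q x : P" "\<And>p. p : P ==> {x : space gm. q x = p} : sets gm"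
 defines "a \<equiv> \<lambda>p. measure rho {x : space gm. q x = p}" and "G \<equiv> \<lambda>p. measure gm {x : space gm. q x = p}"
 shows "(\<Sum>p\<in>P. a p * ln (a p / G p)) <= E" and "\<And>p. p : P ==> a p > 0 ==> G p > 0"
proof -
 interpret g: prob_space gm by fact
 interpret r: prob_space rho by fact
 obtain f where [measurable]: "f : borel_measurable gm" and f: "\<And>x. 0 <= f x" and rho: "rho = density gm (\<lambda>x. ennreal (f x))"
  and E: "0 <= E" "(\<integral>\<^sup>+x. ennreal (f x * ln (f x)) \<partial>gm) <= ennreal E" using assms(1) by (auto simp: entropy_bound_def)
 let ?C = "\<lambda>p. {x : space gm. q x = p}"
 have [measurable]: "?C p : sets gm" if "p : P" for p using P(3) that by simp
 show G: "G p > 0" if "p : P" "a p > 0" for p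
 proof (rule ccontr)
  assume "\<not> G p > 0"
  then have "?C p : null_sets rho"
   unfolding G_def using P(3)[OF that(1)] unfolding rho using absolutely_continuousI_density[of "\<lambda>x. ennreal (f x)" gm] by (auto simp: zero_less_measure_iff null_sets_def g.emeasure_eq_measure absolutely_continuous_def)
  then have "a p = 0" unfolding a_def by (simp add: measure_def null_sets_def)
  with that show False by simp
 qed
 have intf: "integrable gm f"
 proof (rule integrableI_nonneg)
  have "(\<integral>\<^sup>+x. ennreal (f x) \<partial>gm) = emeasure rho (space rho)" unfolding rho by (subst emeasure_density) (auto intro!: nn_integral_cong)
  then show "(\<integral>\<^sup>+x. ennreal (f x) \<partial>gm) < \<infinity>" by (simp add: r.emeasure_space_1)
 qed (use f in auto)
 define F where "F = (\<lambda>x. max 0 (f x * ln (f x)))"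
 have nnF: "(\<integral>\<^sup>+x. ennreal (F x) \<partial>gm) <= ennreal E"
  using E(2) by (subst nn_integral_cong[of _ _ "\<lambda>x. ennreal (f x * ln (f x))"]) (auto simp: F_def max_def ennreal_neg)
 have intF: "integrable gm F"
  by (rule integrableI_nonneg) (use nnF in \<open>auto simp: F_def intro: le_less_trans ennreal_less_top\<close>)
 have IF: "(\<integral>x. F x \<partial>gm) <= E"
  using nnF E(1) by (subst integral_eq_nn_integral) (auto simp: F_def intro: enn2real_leI)
 have aint: "a p = (\<integral>x. f x * indicator (?C p) x \<partial>gm)" if "p : P" for p
 proof -
  have "emeasure rho (?C p) = (\<integral>\<^sup>+x. ennreal (f x * indicator (?C p) x) \<partial>gm)"
   unfolding rho using that by (subst emeasure_density) (auto intro!: nn_integral_cong simp: indicator_def)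
  also have "... = ennreal (\<integral>x. f x * indicator (?C p) x \<partial>gm)"
   using that f by (intro nn_integral_eq_integral integrable_real_mult_indicator intf) auto
  finally show ?thesis unfolding a_def measure_def using f by simp
 qed
 have cell: "a p * ln (a p / G p) <= (\<integral>x. F x * indicator (?C p) x \<partial>gm)" if p: "p : P" for p
 proof (cases "a p = 0")
  case True
  then show ?thesis by (auto simp: F_def)
 next
  case False
  then have ap: "a p > 0" unfolding a_def by (simp add: zero_less_measure_iff)
  from G[OF p ap] have Gp: "G p > 0" .
  \<comment> \<open>The optimal slope for this cell: \<open>exp b * G p = a p\<close>, so the last
    two terms of Young's inequality cancel after integration.\<close>
  define b where "b = ln (a p / G p)"
  have eb: "exp b = a p / G p" unfolding b_def using ap Gp by simp
  have "a p * b = (\<integral>x. b * (f x * indicator (?C p) x) \<partial>gm)" using aint[OF p] by simp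
  also have "... <= (\<integral>x. F x * indicator (?C p) x - f x * indicator (?C p) x + exp b * indicator (?C p) x \<partial>gm)"
  proof (intro integral_mono)
   show "integrable gm (\<lambda>x. b * (f x * indicator (?C p) x))"
    using p intf by (intro integrable_mult_right integrable_real_mult_indicator) auto
   show "integrable gm (\<lambda>x. F x * indicator (?C p) x - f x * indicator (?C p) x + exp b * indicator (?C p) x)"
    using p intf intF by (intro Bochner_Integration.integrable_add Bochner_Integration.integrable_diff integrable_mult_right integrable_real_mult_indicator integrable_real_indicator)
     (auto simp: g.emeasure_eq_measure)
   fix x
   have "f x * b <= f x * ln (f x) - f x + exp b" by (rule young_entropy[OF f])
   then show "b * (f x * indicator (?C p) x) <= F x * indicator (?C p) x - f x * indicator (?C p) x + exp b * indicator (?C p) x"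
    by (auto simp: indicator_def F_def mult.commute)
  qed
  also have "... = (\<integral>x. F x * indicator (?C p) x \<partial>gm) - a p + exp b * G p"
  proof -
   have "integrable gm (\<lambda>x. F x * indicator (?C p) x)" "integrable gm (\<lambda>x. f x * indicator (?C p) x)"
    "integrable gm (\<lambda>x. exp b * indicator (?C p) x)"
    using p intf intF by (intro integrable_mult_right integrable_real_mult_indicator integrable_real_indicator; simp add: g.emeasure_eq_measure)+
   then show ?thesis unfolding aint[OF p] G_def by (simp add: Int_def conj_commute conj_left_commute)
  qed
  also have "... = (\<integral>x. F x * indicator (?C p) x \<partial>gm)" unfolding eb using Gp by simp
  finally show ?thesis unfolding b_def .
 qed
 have "(\<Sum>p\<in>P. a p * ln (a p / G p)) <= (\<Sum>p\<in>P. \<integral>x. F x * indicator (?C p) x \<partial>gm)" by (intro sum_mono cell)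
 also have "... = (\<integral>x. (\<Sum>p\<in>P. F x * indicator (?C p) x) \<partial>gm)"
  using intF by (intro Bochner_Integration.integral_sum[symmetric] integrable_real_mult_indicator) auto
 also have "... = (\<integral>x. F x \<partial>gm)"
 proof (intro Bochner_Integration.integral_cong refl)
  fix x assume x: "x : space gm"
  have "(\<Sum>p\<in>P. F x * indicator (?C p) x) = (\<Sum>p\<in>P. if p = q x then F x else 0)"
   using x by (intro sum.cong) (auto simp: indicator_def)
  then show "(\<Sum>p\<in>P. F x * indicator (?C p) x) = F x" using P(1) P(2)[OF x] by simp
 qed
 finally show "(\<Sum>p\<in>P. a p * ln (a p / G p)) <= E" using IF by simp
qed

section \<open>Coordinates of a Gaussian measure\<close>

text \<open>Both shapes of \<open>gaussian_law\<close> are read off from the covariance: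
  \<open>R h \<bullet> h\<close> is the variance of \<open>x \<bullet> h\<close>, so it decides
  between a density and a point mass and fixes the parameters.\<close>

lemma gaussian_law_cases:
 fixes gm :: "'h::{real_inner, polish_space} measure"
 assumes g: "gaussian_measure gm" and cov: "has_covariance_operator gm R"
 defines "m \<equiv> \<lambda>h. \<integral>x. x \<bullet> h \<partial>gm"
 shows "R h \<bullet> h > 0 ==> distributed gm lborel (\<lambda>x. x \<bullet> h) (\<lambda>x. ennreal (normal_density (m h) (sqrt (R h \<bullet> h)) x))"
  and "\<not> R h \<bullet> h > 0 ==> AE x in gm. x \<bullet> h = m h"
  and "R h \<bullet> h >= 0"
proof -
 interpret prob_space gm using g by (simp add: gaussian_measure_def)
 have s [measurable_cong]: "sets gm = sets borel" using g by (simp add: gaussian_measure_def)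
 have var: "R h \<bullet> h = (\<integral>x. (x \<bullet> h - m h)^2 \<partial>gm)"
  using cov unfolding has_covariance_operator_def m_def by (simp add: power2_eq_square)
 show nn: "R h \<bullet> h >= 0" unfolding var by simp
 from g have "gaussian_law (distr gm borel (\<lambda>x. x \<bullet> h))" by (simp add: gaussian_measure_def)
 then consider (n) mu sg where "0 < sg" "distr gm borel (\<lambda>x. x \<bullet> h) = density lborel (\<lambda>x. ennreal (normal_density mu sg x))"
  | (r) mu where "distr gm borel (\<lambda>x. x \<bullet> h) = return borel mu" unfolding gaussian_law_def by blast
 then have "(R h \<bullet> h > 0 --> distributed gm lborel (\<lambda>x. x \<bullet> h) (\<lambda>x. ennreal (normal_density (m h) (sqrt (R h \<bullet> h)) x))) \<and>
  (\<not> R h \<bullet> h > 0 --> (AE x in gm. x \<bullet> h = m h))"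
 proof cases
  case n
  have "distr gm lborel (\<lambda>x. x \<bullet> h) = distr gm borel (\<lambda>x. x \<bullet> h)" by (intro distr_cong) auto
  then have d: "distributed gm lborel (\<lambda>x. x \<bullet> h) (\<lambda>x. ennreal (normal_density mu sg x))"
   using n by (simp add: distributed_def)
  have "m h = mu" using normal_distributed_expectation[OF n(1) d] by (simp add: m_def)
  moreover have "R h \<bullet> h = sg^2" using normal_distributed_variance[OF n(1) d] var by (simp add: m_def)
  ultimately show ?thesis using d n(1) by simp
 next
  case r
  have "AE y in distr gm borel (\<lambda>x. x \<bullet> h). y = mu" unfolding r by (subst AE_return) auto
  then have ae: "AE x in gm. x \<bullet> h = mu" by (subst (asm) AE_distr_iff) auto
  then have "m h = (\<integral>x. mu \<partial>gm)" unfolding m_def by (intro integral_cong_AE) auto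
  then have m: "m h = mu" by (simp add: prob_space)
  have "R h \<bullet> h = (\<integral>x. 0 \<partial>gm)" unfolding var using ae m by (intro integral_cong_AE) auto
  then show ?thesis using ae m by simp
 qed
 then show "R h \<bullet> h > 0 ==> distributed gm lborel (\<lambda>x. x \<bullet> h) (\<lambda>x. ennreal (normal_density (m h) (sqrt (R h \<bullet> h)) x))"
  and "\<not> R h \<bullet> h > 0 ==> AE x in gm. x \<bullet> h = m h" by auto
qed

lemma gaussian_char:
 fixes gm :: "'h::{real_inner, polish_space} measure"
 assumes g: "gaussian_measure gm" and cov: "has_covariance_operator gm R"
 shows "(\<integral>x. iexp (x \<bullet> h) \<partial>gm) = iexp (\<integral>x. x \<bullet> h \<partial>gm) * complex_of_real (exp (- (R h \<bullet> h) / 2))"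
proof -
 interpret prob_space gm using g by (simp add: gaussian_measure_def)
 have s [measurable_cong]: "sets gm = sets borel" using g by (simp add: gaussian_measure_def)
 define m where "m = (\<integral>x. x \<bullet> h \<partial>gm)"
 show ?thesis
 proof (cases "R h \<bullet> h > 0")
  case True
  define sg where "sg = sqrt (R h \<bullet> h)"
  have sg: "sg > 0" "sg^2 = R h \<bullet> h" using True by (auto simp: sg_def)
  have d: "distr gm lborel (\<lambda>x. (x \<bullet> h - m) / sg) = density lborel std_normal_density" using gaussian_law_cases(1)[OF g cov True] sg normal_standard_normal_convert[of sg "\<lambda>x. x \<bullet> h" m] by (simp add: m_def sg_def distributed_def)
  have "(\<integral>x. iexp (x \<bullet> h) \<partial>gm) = (\<integral>x. iexp m * iexp (sg * ((x \<bullet> h - m) / sg)) \<partial>gm)"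
  proof (intro Bochner_Integration.integral_cong refl)
   fix x
   show "iexp (x \<bullet> h) = iexp m * iexp (sg * ((x \<bullet> h - m) / sg))"
    using sg by (simp only: exp_add[symmetric] distrib_left[symmetric] of_real_add[symmetric]) simp
  qed
  also have "... = iexp m * (\<integral>x. iexp (sg * ((x \<bullet> h - m) / sg)) \<partial>gm)" by simp
  also have "(\<integral>x. iexp (sg * ((x \<bullet> h - m) / sg)) \<partial>gm) = (\<integral>y. iexp (sg * y) \<partial>distr gm lborel (\<lambda>x. (x \<bullet> h - m) / sg))"
   by (subst integral_distr) auto
  also have "... = char std_normal_distribution sg" unfolding d char_def by simp
  also have "... = complex_of_real (exp (- (R h \<bullet> h) / 2))" unfolding char_std_normal_distribution using sg by simp
  finally show ?thesis by (simp add: m_def)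
 next
  case False
  with gaussian_law_cases(3)[OF g cov, of h] have R0: "R h \<bullet> h = 0" by simp
  have "AE x in gm. iexp (x \<bullet> h) = iexp m" using gaussian_law_cases(2)[OF g cov False] by (auto simp: m_def)
  then have "(\<integral>x. iexp (x \<bullet> h) \<partial>gm) = (\<integral>x. iexp m \<partial>gm)" by (intro integral_cong_AE) auto
  then show ?thesis by (simp add: R0 m_def prob_space)
 qed
qed

text \<open>Testing with the positive weights \<open>1 + cos\<close> and \<open>1 + sin\<close> reduces the uniqueness of multivariate characteristic
 functions to the real case.\<close>

lemma weighted_char_uniqueness:
 fixes X u :: "'a => real"
 assumes "prob_space M" and X [measurable]: "X : borel_measurable M" and u [measurable]: "u : borel_measurable M"
  and u: "\<And>x. 0 <= u x" "\<And>x. u x <= B"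
  and char: "\<And>s. (\<integral>x. u x * iexp (s * X x) \<partial>M) = (\<integral>x. u x \<partial>M) * (\<integral>x. iexp (s * X x) \<partial>M)"
  and A [measurable]: "A : sets borel"
 shows "(\<integral>x. u x * indicator A (X x) \<partial>M) = (\<integral>x. u x \<partial>M) * measure M {x : space M. X x : A}"
proof -
 interpret prob_space M by fact
 have intu: "integrable M u" by (rule integrable_const_bound[of _ B]) (use u in auto)
 define U where "U = (\<integral>x. u x \<partial>M)"
 show ?thesis
 proof (cases "U = 0")
  case True
  then have ae: "AE x in M. u x = 0" using integral_nonneg_eq_0_iff_AE[OF intu] u unfolding U_def by simp
  have "(\<integral>x. u x * indicator A (X x) \<partial>M) = (\<integral>x. 0 \<partial>M)" using ae by (intro integral_cong_AE) auto
  then show ?thesis using True by (simp add: U_def)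
 next
  case False
  then have U: "U > 0" using u by (simp add: U_def less_le)
  \<comment> \<open>Tilting by \<open>u / U\<close> leaves the characteristic function of
    \<open>X\<close> unchanged, hence also its law; this is the claimed product formula.\<close>
  define N where "N = density M (\<lambda>x. ennreal (u x / U))"
  have sN [measurable_cong]: "sets N = sets M" by (simp add: N_def)
  have spN: "space N = space M" by (simp add: N_def)
  have "emeasure N (space N) = (\<integral>\<^sup>+x. ennreal (u x / U) \<partial>M)"
   unfolding N_def by (subst emeasure_density) (auto intro!: nn_integral_cong)
  also have "... = ennreal (\<integral>x. u x / U \<partial>M)" using intu u U by (intro nn_integral_eq_integral) auto
  also have "... = 1" using U by (simp add: U_def)
  finally interpret N: prob_space N by (rule prob_spaceI)
  have "distr N borel X = distr M borel X"
  proof (rule Levy_uniqueness)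
   show "real_distribution (distr N borel X)" by simp
   show "real_distribution (distr M borel X)" by simp
   show "char (distr N borel X) = char (distr M borel X)"
   proof
    fix s
    have "char (distr N borel X) s = (\<integral>x. iexp (s * X x) \<partial>N)" unfolding char_def by (subst integral_distr) auto
    also have "... = (\<integral>x. (u x / U) *\<^sub>R iexp (s * X x) \<partial>M)"
     unfolding N_def using u U by (subst integral_density) auto
    also have "... = (1 / U) * (\<integral>x. u x * iexp (s * X x) \<partial>M)" by (simp add: scaleR_conv_of_real)
    also have "... = (\<integral>x. iexp (s * X x) \<partial>M)" unfolding char using U by (simp add: U_def)
    also have "... = char (distr M borel X) s" unfolding char_def by (subst integral_distr) auto
    finally show "char (distr N borel X) s = char (distr M borel X) s" .
   qed
  qed
  then have "measure (distr N borel X) A = measure (distr M borel X) A" by simp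
  then have eq: "measure N {x : space M. X x : A} = measure M {x : space M. X x : A}"
   by (simp add: measure_distr Int_def spN conj_commute)
  have "ennreal (measure N {x : space M. X x : A}) = (\<integral>\<^sup>+x. ennreal (u x / U) * indicator {x : space M. X x : A} x \<partial>M)"
   unfolding N.emeasure_eq_measure[symmetric] unfolding N_def by (rule emeasure_density) measurable
  also have "... = (\<integral>\<^sup>+x. ennreal (u x / U * indicator A (X x)) \<partial>M)" by (intro nn_integral_cong) (auto simp: indicator_def)
  also have "... = ennreal (\<integral>x. u x / U * indicator A (X x) \<partial>M)"
  proof (intro nn_integral_eq_integral)
   show "integrable M (\<lambda>x. u x / U * indicator A (X x))"
    by (rule integrable_const_bound[of _ "B / U"]) (use u U in \<open>auto simp: indicator_def divide_right_mono order_trans[OF u(1) u(2)]\<close>)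
  qed (use u U in auto)
  finally have "measure N {x : space M. X x : A} = (\<integral>x. u x / U * indicator A (X x) \<partial>M)"
   using u U by simp
  also have "... = (\<integral>x. (1 / U) * (u x * indicator A (X x)) \<partial>M)" by simp
  finally show ?thesis unfolding eq using U by (simp add: U_def)
 qed
qed

lemma complex_char_uniqueness:
 fixes X :: "'a => real" and W :: "'a => complex"
 assumes "prob_space M" and [measurable]: "X : borel_measurable M" "W : borel_measurable M" "A : sets borel"
  and W: "\<And>x. norm (W x) <= 1"
  and char: "\<And>s. (\<integral>x. W x * iexp (s * X x) \<partial>M) = (\<integral>x. W x \<partial>M) * (\<integral>x. iexp (s * X x) \<partial>M)"
 shows "(\<integral>x. W x * indicator A (X x) \<partial>M) = (\<integral>x. W x \<partial>M) * measure M {x : space M. X x : A}"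
proof -
 interpret prob_space M by fact
 let ?p = "measure M {x : space M. X x : A}"
 have re: "Re (\<integral>x. V x * indicator A (X x) \<partial>M) = Re (\<integral>x. V x \<partial>M) * ?p"
  if [measurable]: "V : borel_measurable M" and V: "\<And>x. norm (V x) <= 1"
   and c: "\<And>s. (\<integral>x. V x * iexp (s * X x) \<partial>M) = (\<integral>x. V x \<partial>M) * (\<integral>x. iexp (s * X x) \<partial>M)" for V
 proof -
  have b: "integrable M (\<lambda>x. f x * u x)"
   if "f : borel_measurable M" "u : borel_measurable M" "\<And>x. norm (f x) <= 1" "\<And>x. norm (u x) <= 1" for f u :: "'a => complex"
   by (rule integrable_const_bound[of _ 1]) (use that in \<open>auto simp: norm_mult mult_le_one\<close>)
  have iV: "integrable M V" using b[of V "\<lambda>_. 1"] V by simp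
  have i: "integrable M (\<lambda>x. iexp (s * X x))" "integrable M (\<lambda>x. V x * iexp (s * X x))" "integrable M (\<lambda>x. V x * indicator A (X x))" for s
   using b[of "\<lambda>_. 1" "\<lambda>x. iexp (s * X x)"] by simp (rule b; auto simp: V indicator_def)+
  have cn: "cnj (iexp (- s * X x)) = iexp (s * X x)" for s x by (simp add: exp_cnj)
  have ic: "integrable M (\<lambda>x. cnj (V x) * iexp (s * X x))" for s
   using integrable_cnj[OF i(2)[of "- s"]] unfolding complex_cnj_mult cn .
  have r: "\<bar>Re (V x)\<bar> <= 1" for x by (rule order_trans[OF abs_Re_le_cmod V])
  have cc: "(\<integral>x. cnj (V x) * iexp (s * X x) \<partial>M) = (\<integral>x. cnj (V x) \<partial>M) * (\<integral>x. iexp (s * X x) \<partial>M)" for s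
   using arg_cong[OF c[of "- s"], of cnj] by (simp only: Bochner_Integration.integral_cnj[symmetric] complex_cnj_mult cn)
  \<comment> \<open>The weight \<open>1 + Re (V x)\<close> lies between 0 and 2. Its product formula
    averages the one for \<open>V\<close> with the conjugate of the one at
    \<open>- s\<close>.\<close>
  have "(\<integral>x. (1 + Re (V x)) * indicator A (X x) \<partial>M) = (\<integral>x. 1 + Re (V x) \<partial>M) * ?p"
  proof (rule weighted_char_uniqueness[OF assms(1), where B = 2])
   fix s
   have "(\<integral>x. complex_of_real (1 + Re (V x)) * iexp (s * X x) \<partial>M) =
     (\<integral>x. iexp (s * X x) + (V x * iexp (s * X x) + cnj (V x) * iexp (s * X x)) / 2 \<partial>M)"
    by (intro Bochner_Integration.integral_cong refl) (simp add: complex_eq_iff field_simps)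
   also have "... = (\<integral>x. iexp (s * X x) \<partial>M) + ((\<integral>x. V x * iexp (s * X x) \<partial>M) + (\<integral>x. cnj (V x) * iexp (s * X x) \<partial>M)) / 2"
    by (simp add: i ic del: of_real_mult)
   also have "... = (1 + ((\<integral>x. V x \<partial>M) + cnj (\<integral>x. V x \<partial>M)) / 2) * (\<integral>x. iexp (s * X x) \<partial>M)"
    by (simp add: c cc field_simps del: of_real_mult)
   finally show "(\<integral>x. complex_of_real (1 + Re (V x)) * iexp (s * X x) \<partial>M) = complex_of_real (\<integral>x. 1 + Re (V x) \<partial>M) * (\<integral>x. iexp (s * X x) \<partial>M)"
    using iV by (simp add: complex_add_cnj prob_space)
   show "0 <= 1 + Re (V x)" "1 + Re (V x) <= 2" for x using r[of x] by linarith+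
  qed auto
  moreover have "(\<integral>x. 1 * indicator A (X x) \<partial>M) = (\<integral>x. 1 \<partial>M) * ?p"
   by (rule weighted_char_uniqueness[OF assms(1), where B = 1]) (auto simp: prob_space)
  moreover have "(\<integral>x. (1 + Re (V x)) * indicator A (X x) \<partial>M) = (\<integral>x. indicator A (X x) + Re (V x * indicator A (X x)) \<partial>M)"
   by (intro Bochner_Integration.integral_cong refl) (simp add: indicator_def)
  moreover have "... = (\<integral>x. indicator A (X x) \<partial>M) + Re (\<integral>x. V x * indicator A (X x) \<partial>M)"
   by (subst Bochner_Integration.integral_add) (use i(3) in \<open>auto intro!: integrable_const_bound[of _ 1] simp del: times_complex.sel\<close>)
  ultimately show ?thesis using iV by (simp add: prob_space algebra_simps)
 qed
 \<comment> \<open>Since \<open>Re (- \<i> * w) = Im w\<close>, the statement about real parts also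
   yields the imaginary part.\<close>
 have "Re (\<integral>x. - \<i> * W x * indicator A (X x) \<partial>M) = Re (\<integral>x. - \<i> * W x \<partial>M) * ?p"
  by (rule re) (use W char in \<open>auto simp: norm_mult mult.assoc\<close>)
 then show ?thesis using re[OF _ W char] by (simp add: complex_eq_iff mult.assoc)
qed

text \<open>Indicators of the coordinates in \<open>F\<close> replace characters one at a time. The
  direction \<open>h\<close> stays arbitrary, orthogonal to the coordinates already treated: the
  induction absorbs \<open>a *\<^sub>R e l\<close> into it, and
  \<open>complex_char_uniqueness\<close> turns the character in \<open>a\<close> into an indicator.
  At \<open>h = 0\<close> this is independence.\<close>

lemma gaussian_coordinates_indep_char:
 fixes gm :: "'h::{real_inner, polish_space} measure" and A :: "nat => real set"
 assumes g: "gaussian_measure gm" and cov: "has_covariance_operator gm R"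
  and on: "PROP orthonormal_on e I" and Re: "\<And>i. i : I ==> R (e i) = c i *\<^sub>R e i"
  and F: "finite F" "F \<subseteq> I" and A [measurable]: "\<And>i. A i : sets borel" and h: "\<And>i. i : F ==> h \<bullet> e i = 0"
 shows "(\<integral>x. complex_of_real (\<Prod>i\<in>F. indicator (A i) (x \<bullet> e i)) * iexp (x \<bullet> h) \<partial>gm) =
  complex_of_real (\<Prod>i\<in>F. measure gm {x. x \<bullet> e i : A i}) * (\<integral>x. iexp (x \<bullet> h) \<partial>gm)"
 using F h
proof (induction F arbitrary: h rule: finite_induct)
 case (insert l F)
 interpret prob_space gm using g by (simp add: gaussian_measure_def)
 have s [measurable_cong]: "sets gm = sets borel" using g by (simp add: gaussian_measure_def)
 interpret R: bounded_linear R using cov by (simp add: has_covariance_operator_def)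
 have ii: "integrable gm (\<lambda>x. x \<bullet> k)" for k
  by (rule square_integrable_imp_integrable) (use cov in \<open>auto simp: has_covariance_operator_def\<close>)
 have l: "l : I" "\<And>i. i : F ==> e l \<bullet> e i = 0" using insert on by auto
 define ph where "ph k = (\<integral>x. iexp (x \<bullet> k) \<partial>gm)" for k
 \<comment> \<open>\<open>e l\<close> is an eigenvector of \<open>R\<close> and \<open>h\<close> is
   orthogonal to it, so the quadratic form has no cross term and the characteristic function
   splits.\<close>
 have fac: "ph (a *\<^sub>R e l + h) = ph (a *\<^sub>R e l) * ph h" for a
 proof -
  have "R h \<bullet> e l = R (e l) \<bullet> h" using cov unfolding has_covariance_operator_def by (simp add: mult.commute)
  moreover have "R (e l) \<bullet> h = 0" using Re[OF l(1)] insert.prems by (simp add: inner_commute)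
  ultimately have "R (a *\<^sub>R e l + h) \<bullet> (a *\<^sub>R e l + h) = R (a *\<^sub>R e l) \<bullet> (a *\<^sub>R e l) + R h \<bullet> h"
   by (simp add: R.add R.scaleR inner_add_left inner_add_right)
  moreover have "(\<integral>x. x \<bullet> (a *\<^sub>R e l + h) \<partial>gm) = (\<integral>x. x \<bullet> (a *\<^sub>R e l) \<partial>gm) + (\<integral>x. x \<bullet> h \<partial>gm)"
   unfolding inner_add_right by (intro Bochner_Integration.integral_add ii)
  moreover have "iexp (u + v) * complex_of_real (exp (- (x + y) / 2)) =
   (iexp u * complex_of_real (exp (- x / 2))) * (iexp v * complex_of_real (exp (- y / 2)))" for u v x y
   by (simp add: exp_add[symmetric] exp_of_real[symmetric] add_divide_distrib diff_divide_distrib algebra_simps)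
  ultimately show ?thesis unfolding ph_def gaussian_char[OF g cov] by (simp only:)
 qed
 define W where "W x = complex_of_real (\<Prod>i\<in>F. indicator (A i) (x \<bullet> e i)) * iexp (x \<bullet> h)" for x
 have "norm (\<Prod>i\<in>F. indicator (A i) (x \<bullet> e i) :: real) <= 1" for x by (auto simp: abs_prod intro!: prod_le_1)
 then have W: "norm (W x) <= 1" for x by (simp add: W_def norm_mult del: of_real_prod)
 have [measurable]: "W : borel_measurable gm" unfolding W_def by measurable
 define P where "P = complex_of_real (\<Prod>i\<in>F. measure gm {x. x \<bullet> e i : A i})"
 have IH: "(\<integral>x. W x * iexp (a * (x \<bullet> e l)) \<partial>gm) = P * (ph (a *\<^sub>R e l) * ph h)" for a
 proof -
  have "(\<integral>x. W x * iexp (a * (x \<bullet> e l)) \<partial>gm) = (\<integral>x. complex_of_real (\<Prod>i\<in>F. indicator (A i) (x \<bullet> e i)) * iexp (x \<bullet> (a *\<^sub>R e l + h)) \<partial>gm)"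
   by (simp add: W_def inner_add_right exp_add distrib_left mult_ac)
  also have "... = P * ph (a *\<^sub>R e l + h)"
   unfolding P_def ph_def by (rule insert.IH) (use insert.prems l in \<open>auto simp: inner_add_left\<close>)
  finally show ?thesis by (simp add: fac)
 qed
 have ph: "ph 0 = 1" "(\<integral>x. iexp (a * (x \<bullet> e l)) \<partial>gm) = ph (a *\<^sub>R e l)" for a by (simp_all add: ph_def prob_space)
 have EW: "(\<integral>x. W x \<partial>gm) = P * ph h" using IH[of 0] ph(1) by simp
 have "(\<integral>x. W x * indicator (A l) (x \<bullet> e l) \<partial>gm) = (\<integral>x. W x \<partial>gm) * measure gm {x : space gm. x \<bullet> e l : A l}"
  by (rule complex_char_uniqueness) (auto simp only: IH ph(2) EW mult_ac intro: prob_space_axioms W, measurable)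
 moreover have "complex_of_real (indicator S y) = indicator S y" for S and y :: real by (simp add: indicator_def)
 ultimately show ?case unfolding EW using insert.hyps sets_eq_imp_space_eq[OF s] by (simp add: W_def ph_def P_def mult_ac)
qed simp

section \<open>Orthonormal expansions and the choice of the base point\<close>

lemma countable_dense_subset:
 fixes N :: "'a::{metric_space, second_countable_topology} set"
 obtains D where "countable D" "D \<subseteq> N" "\<And>x eps. x : N ==> eps > 0 ==> \<exists>d\<in>D. dist d x < eps"
proof -
 obtain B :: "'a set set" where B: "countable B" "topological_basis B" using ex_countable_basis by auto
 define D where "D = (\<lambda>U. SOME p. p : U \<inter> N) ` {U : B. U \<inter> N \<noteq> {}}"
 have pick: "(SOME p. p : U \<inter> N) : U \<inter> N" if "U \<inter> N \<noteq> {}" for U using someI_ex[of "\<lambda>p. p : U \<inter> N"] that by auto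
 have "\<exists>d\<in>D. dist d x < eps" if x: "x : N" "eps > 0" for x eps
 proof -
  obtain U where U: "U : B" "x : U" "U \<subseteq> ball x eps"
   using topological_basisE[OF B(2) open_ball, of x x eps] x by auto
  then have ne: "U \<inter> N \<noteq> {}" using x by auto
  from pick[OF this] U have "dist (SOME p. p : U \<inter> N) x < eps" by (auto simp: dist_commute)
  then show ?thesis using ne U unfolding D_def by auto
 qed
 moreover have "countable D" "D \<subseteq> N" unfolding D_def using B(1) pick by auto
 ultimately show thesis using that by simp
qed

lemma orthonormal_partial_sums:
 fixes e :: "nat => 'h::real_inner"
 assumes on: "PROP orthonormal_on e I" and F: "finite F" "F \<subseteq> I"
 shows "(norm (\<Sum>i\<in>F. a i *\<^sub>R e i))^2 = (\<Sum>i\<in>F. (a i)^2)"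
  and "k : F ==> (\<Sum>i\<in>F. a i *\<^sub>R e i) \<bullet> e k = a k"
  and "k : I ==> k \<notin> F ==> (\<Sum>i\<in>F. a i *\<^sub>R e i) \<bullet> e k = 0"
  and "(\<Sum>i\<in>F. (p \<bullet> e i)^2) + (norm (p - (\<Sum>i\<in>F. (p \<bullet> e i) *\<^sub>R e i)))^2 = (norm p)^2"
proof -
 have ip: "(\<Sum>i\<in>F. a i *\<^sub>R e i) \<bullet> e k = (\<Sum>i\<in>F. if i = k then a i else 0)" if "k : I" for k a
  unfolding inner_sum_left using on F that by (intro sum.cong) auto
 show in1: "(\<Sum>i\<in>F. a i *\<^sub>R e i) \<bullet> e k = a k" if "k : F" for k a using ip[of k a] that F by auto
 show "k : I ==> k \<notin> F ==> (\<Sum>i\<in>F. a i *\<^sub>R e i) \<bullet> e k = 0" using ip[of k a] F by auto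
 have sq: "(\<Sum>i\<in>F. a i *\<^sub>R e i) \<bullet> (\<Sum>i\<in>F. a i *\<^sub>R e i) = (\<Sum>i\<in>F. (a i)^2)" for a
  by (simp only: inner_sum_right[of "\<Sum>i\<in>F. a i *\<^sub>R e i"] inner_scaleR_right) (simp add: in1 power2_eq_square)
 then show "(norm (\<Sum>i\<in>F. a i *\<^sub>R e i))^2 = (\<Sum>i\<in>F. (a i)^2)" by (simp add: power2_norm_eq_inner)
 have px: "p \<bullet> (\<Sum>i\<in>F. (p \<bullet> e i) *\<^sub>R e i) = (\<Sum>i\<in>F. (p \<bullet> e i)^2)"
  by (simp add: inner_sum_right power2_eq_square)
 show "(\<Sum>i\<in>F. (p \<bullet> e i)^2) + (norm (p - (\<Sum>i\<in>F. (p \<bullet> e i) *\<^sub>R e i)))^2 = (norm p)^2"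
  unfolding power2_norm_eq_inner inner_diff_left inner_diff_right
  using px sq[of "\<lambda>i. p \<bullet> e i"] by (simp add: inner_commute)
qed

text \<open>The hypothesis on \<open>p\<close> says that \<open>p\<close> is orthogonal to whatever
  the \<open>e i\<close> do not see. Bessel's inequality makes the partial sums Cauchy; the
  difference \<open>r\<close> between \<open>p\<close> and their limit is orthogonal to all
  \<open>e i\<close>, hence to \<open>p\<close> and to the limit, so
  \<open>r \<bullet> r = 0\<close>.\<close>

lemma orthonormal_expansion:
 fixes e :: "nat => 'h::{real_inner, complete_space}"
 assumes on: "PROP orthonormal_on e I"
  and p: "\<And>h. (\<And>i. i : I ==> h \<bullet> e i = 0) ==> p \<bullet> h = 0"
 shows "(\<lambda>n. p - (\<Sum>i\<in>I \<inter> {..<n}. (p \<bullet> e i) *\<^sub>R e i)) \<longlonglongrightarrow> 0"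
proof -
 define S where "S n = (\<Sum>i\<in>I \<inter> {..<n}. (p \<bullet> e i) *\<^sub>R e i)" for n
 define a where "a i = (if i : I then (p \<bullet> e i)^2 else 0)" for i
 have suma: "(\<Sum>i\<in>I \<inter> X. (p \<bullet> e i)^2) = sum a X" if "finite X" for X
  unfolding a_def using sum.inter_restrict[OF that, of _ I] by (simp add: Int_commute)
 have "summable a"
 proof (rule summableI_nonneg_bounded)
  show "sum a {..<n} <= (norm p)^2" for n
  proof -
   have "sum a {..<n} + (norm (p - (\<Sum>i\<in>I \<inter> {..<n}. (p \<bullet> e i) *\<^sub>R e i)))^2 = (norm p)^2"
    unfolding suma[OF finite_lessThan, symmetric] by (rule orthonormal_partial_sums(4)[OF on]) auto
   then show ?thesis using zero_le_power2[of "norm (p - (\<Sum>i\<in>I \<inter> {..<n}. (p \<bullet> e i) *\<^sub>R e i))"] by linarith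
  qed
 qed (auto simp: a_def)
 have diffS: "(norm (S m - S n))^2 = sum a {n..<m}" if "n <= m" for m n
 proof -
  have eq: "I \<inter> {..<m} = (I \<inter> {..<n}) \<union> (I \<inter> {n..<m})" using that by auto
  have "S m = (\<Sum>i\<in>(I \<inter> {..<n}) \<union> (I \<inter> {n..<m}). (p \<bullet> e i) *\<^sub>R e i)"
   unfolding S_def by (rule sum.cong[OF eq refl])
  also have "... = S n + (\<Sum>i\<in>I \<inter> {n..<m}. (p \<bullet> e i) *\<^sub>R e i)"
   unfolding S_def by (rule sum.union_disjoint) auto
  finally have "S m = S n + (\<Sum>i\<in>I \<inter> {n..<m}. (p \<bullet> e i) *\<^sub>R e i)" .
  then have "norm (S m - S n) = norm (\<Sum>i\<in>I \<inter> {n..<m}. (p \<bullet> e i) *\<^sub>R e i)" by simp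
  then show ?thesis unfolding suma[OF finite_atLeastLessThan, symmetric]
   by (simp only:) (rule orthonormal_partial_sums(1)[OF on], auto)
 qed
 have "Cauchy S"
 proof (rule metric_CauchyI)
  fix eps :: real assume eps: "eps > 0"
  obtain M where M: "\<And>m n. m >= M ==> norm (sum a {m..<n}) < eps^2"
   using \<open>summable a\<close>[unfolded summable_Cauchy, rule_format, of "eps^2"] eps by auto
  have "norm (S m - S n) < eps" if "M <= n" "n <= m" for m n
  proof -
   have "(norm (S m - S n))^2 < eps^2" using diffS[OF that(2)] M[OF that(1), of m] by simp
   then show ?thesis using eps by (simp add: power2_less_imp_less)
  qed
  note less = this
  have "dist (S m) (S n) < eps" if "M <= m" "M <= n" for m n
   using less[of n m] less[of m n] that by (cases "n <= m") (simp_all add: dist_norm norm_minus_commute[of "S m" "S n"])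
  then show "\<exists>M. \<forall>m\<ge>M. \<forall>n\<ge>M. dist (S m) (S n) < eps" by auto
 qed
 then obtain q where q: "S \<longlonglongrightarrow> q" using Cauchy_convergent_iff convergent_def by auto
 have qk: "q \<bullet> e k = p \<bullet> e k" if "k : I" for k
 proof (rule LIMSEQ_unique)
  show "(\<lambda>n. S n \<bullet> e k) \<longlonglongrightarrow> q \<bullet> e k" by (intro tendsto_intros q)
  have "eventually (\<lambda>n. S n \<bullet> e k = p \<bullet> e k) sequentially"
   using eventually_gt_at_top[of k]
  proof eventually_elim
   case (elim n)
   then show ?case unfolding S_def using that by (intro orthonormal_partial_sums(2)[OF on]) auto
  qed
  then show "(\<lambda>n. S n \<bullet> e k) \<longlonglongrightarrow> p \<bullet> e k" by (rule tendsto_eventually)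
 qed
 define r where "r = p - q"
 have re: "r \<bullet> e i = 0" if "i : I" for i using qk[OF that] by (simp add: r_def inner_diff_left)
 have "p \<bullet> r = 0" by (rule p) (rule re)
 moreover have "q \<bullet> r = 0"
 proof (rule LIMSEQ_unique)
  show "(\<lambda>n. S n \<bullet> r) \<longlonglongrightarrow> q \<bullet> r" by (intro tendsto_intros q)
  have "S n \<bullet> r = 0" for n
   unfolding S_def inner_sum_left by (intro sum.neutral) (auto simp: inner_commute[of "e _" r] re)
  then show "(\<lambda>n. S n \<bullet> r) \<longlonglongrightarrow> 0" by simp
 qed
 ultimately have "r \<bullet> r = 0" by (simp add: r_def inner_diff_left)
 then show ?thesis using tendsto_diff[OF tendsto_const q, of p] by (simp add: r_def S_def)
qed

text \<open>\<open>x0\<close> is a generic point rather than the mean: its components in directions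
  of variance zero equal the means, and its other coordinates differ from the means by a square
  summable sequence. This suffices for all three conclusions and spares constructing the mean;
  \<open>bt\<close> holds the coordinates of the mean relative to \<open>x0\<close>.\<close>

lemma gaussian_coordinates:
 fixes gm :: "'h::{real_inner, polish_space} measure"
 assumes g: "gaussian_measure gm" and cov: "has_covariance_operator gm R"
  and on: "\<And>i j. i >= 1 ==> j >= 1 ==> e i \<bullet> e j = (if i = j then 1 else 0)"
  and diag: "\<And>x. ((\<lambda>i. (c i * (x \<bullet> e i)) *\<^sub>R e i) has_sum R x) {1..}"
  and a: "a > 5 / 2" and decay: "\<And>i. i >= 1 ==> c (i + 1) <= c i / real i powr a"
 defines "I \<equiv> {i. 1 <= i \<and> 0 < c i}"
 obtains x0 bt where
  "\<And>J. finite J ==> J \<subseteq> I ==> coord_law gm x0 e J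
    = PiM J (\<lambda>i. density lborel (\<lambda>s. ennreal (normal_density (bt i) (sqrt (c i)) s)))"
  "AE x in gm. (\<lambda>n. (x - x0) - (\<Sum>i\<in>I \<inter> {..<n}. ((x - x0) \<bullet> e i) *\<^sub>R e i)) \<longlonglongrightarrow> 0"
  "\<And>rho E. entropy_bound gm rho E ==> (moment2 x0 rho) < \<infinity>"
proof -
 interpret prob_space gm using g by (simp add: gaussian_measure_def)
 have s [measurable_cong]: "sets gm = sets borel" using g by (simp add: gaussian_measure_def)
 have sp: "space gm = UNIV" using sets_eq_imp_space_eq[OF s] by simp
 have onI: "PROP orthonormal_on e I" using on by (auto simp: I_def)
 have Re: "R (e l) = c l *\<^sub>R e l" if "l >= 1" for l
 proof -
  have "((\<lambda>i. (c i * (e l \<bullet> e i)) *\<^sub>R e i) has_sum c l *\<^sub>R e l) {1..}"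
   by (rule has_sum_finite_neutralI[of "{l}"]) (use that on in auto)
  then show ?thesis using has_sum_unique diag by blast
 qed
 have c0: "c l >= 0" if "l >= 1" for l
  using gaussian_law_cases(3)[OF g cov, of "e l"] Re[OF that] on[OF that that] by simp
 define m where "m h = (\<integral>x. x \<bullet> h \<partial>gm)" for h
 \<comment> \<open>From \<open>i = 2\<close> on, \<open>i powr a >= 2\<close>, so successive
   variances at least halve; the ratio test starts there because \<open>1 powr a = 1\<close> gives
   no gain.\<close>
 have summ: "summable c"
 proof (rule summable_ratio_test[of "1/2" 2])
  fix n :: nat assume n: "2 <= n"
  have "2 powr 1 <= (2::real) powr a" using a by (intro powr_mono) auto
  also have "... <= real n powr a" using n a by (intro powr_mono2) auto
  finally have "c n / real n powr a <= c n / 2" using c0[of n] n by (intro divide_left_mono) auto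
  moreover have "c (Suc n) <= c n / real n powr a" using decay[of n] n by simp
  moreover have "c n >= 0" "c (Suc n) >= 0" using c0 n by auto
  ultimately show "norm (c (Suc n)) <= 1/2 * norm (c n)"
   by (simp only: real_norm_def)
 qed simp
 have law: "distributed gm lborel (\<lambda>x. x \<bullet> e i) (\<lambda>s. ennreal (normal_density (m (e i)) (sqrt (c i)) s))" if "i : I" for i
  using gaussian_law_cases(1)[OF g cov, of "e i"] Re[of i] on[of i i] that by (simp add: I_def m_def)
 have std: "(\<integral>\<^sup>+x. ennreal (exp ((x \<bullet> e i - m (e i))^2 / (8 * c i))) \<partial>gm) = (\<integral>\<^sup>+s. ennreal (std_normal_density s * exp (s^2 / 8)) \<partial>lborel)"
  and var: "(\<integral>\<^sup>+x. ennreal ((x \<bullet> e i - m (e i))^2) \<partial>gm) = ennreal (c i)" if i: "i : I" for i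
 proof -
  have ci: "c i > 0" using i by (simp add: I_def)
  have "distributed gm lborel (\<lambda>x. (x \<bullet> e i - m (e i)) / sqrt (c i)) (\<lambda>x. ennreal (std_normal_density x))"
   using law[OF i] normal_standard_normal_convert[of "sqrt (c i)" "\<lambda>x. x \<bullet> e i" "m (e i)"] ci by simp
  from distributed_nn_integral[OF this, of "\<lambda>s. ennreal (exp (s^2 / 8))"]
  show "(\<integral>\<^sup>+x. ennreal (exp ((x \<bullet> e i - m (e i))^2 / (8 * c i))) \<partial>gm) = (\<integral>\<^sup>+s. ennreal (std_normal_density s * exp (s^2 / 8)) \<partial>lborel)"
   using ci by (simp add: power_divide ennreal_mult' mult.commute)
  have "integrable gm (\<lambda>x. (x \<bullet> e i - m (e i))^2)"
  proof -
   have q: "integrable gm (\<lambda>x. (x \<bullet> e i)^2)" using cov by (simp add: has_covariance_operator_def)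
   have "integrable gm (\<lambda>x. x \<bullet> e i)" by (rule square_integrable_imp_integrable[OF _ q]) measurable
   with q show ?thesis by (simp add: power2_diff)
  qed
  moreover have "(\<integral>x. (x \<bullet> e i - m (e i))^2 \<partial>gm) = c i"
   using normal_distributed_variance[OF _ law[OF i]] ci by (simp add: m_def)
  ultimately show "(\<integral>\<^sup>+x. ennreal ((x \<bullet> e i - m (e i))^2) \<partial>gm) = ennreal (c i)"
   by (subst nn_integral_eq_integral) auto
 qed
 \<comment> \<open>On \<open>N\<close> the covariance vanishes, so each \<open>x \<bullet> h\<close>
   is almost surely constant. A countable dense subset of \<open>N\<close> collects these
   uncountably many null sets into one.\<close>
 define N where "N = {h. \<forall>i\<in>I. h \<bullet> e i = 0}"
 have AEN: "AE x in gm. x \<bullet> h = m h" if "h : N" for h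
 proof -
  have "((\<lambda>i. (c i * (h \<bullet> e i)) *\<^sub>R e i) has_sum 0) {1..}"
   using that c0 by (intro has_sum_0) (force simp: N_def I_def less_le)
  then have "R h = 0" using has_sum_unique diag by blast
  then show ?thesis using gaussian_law_cases(2)[OF g cov, of h] by (simp add: m_def)
 qed
 obtain D where D: "countable D" "D \<subseteq> N" "\<And>x eps. x : N ==> eps > 0 ==> \<exists>d\<in>D. dist d x < eps"
  using countable_dense_subset[of N] by auto
 have AED: "AE x in gm. \<forall>h\<in>D. x \<bullet> h = m h" using D AEN by (subst AE_ball_countable) auto
 define w where "w i x = (if i : I then (x \<bullet> e i - m (e i))^2 else 0)" for i x
 have wm [measurable]: "w i : borel_measurable gm" for i unfolding w_def by simp
 have wnn: "(\<integral>\<^sup>+x. ennreal (w i x) \<partial>gm) <= ennreal (\<bar>c i\<bar>)" for i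
  using var[of i] by (cases "i : I") (auto simp: w_def I_def)
 have AEs: "AE x in gm. (\<Sum>i. ennreal (w i x)) < \<infinity>"
 proof -
  have sa: "summable (\<lambda>i. \<bar>c i\<bar>)"
  proof (subst summable_Suc_iff[symmetric])
   show "summable (\<lambda>i. \<bar>c (Suc i)\<bar>)" using summ c0 by (simp add: summable_Suc_iff)
  qed
  have "(\<integral>\<^sup>+x. (\<Sum>i. ennreal (w i x)) \<partial>gm) = (\<Sum>i. \<integral>\<^sup>+x. ennreal (w i x) \<partial>gm)" by (intro nn_integral_suminf) measurable
  also have "... <= (\<Sum>i. ennreal \<bar>c i\<bar>)" by (intro suminf_le wnn) auto
  also have "... < \<infinity>" using sa by (simp add: suminf_ennreal_eq[OF _ summable_sums])
  finally show ?thesis using nn_integral_PInf_AE[of "\<lambda>x. \<Sum>i. ennreal (w i x)" gm] by (simp add: less_top)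
 qed
 obtain x0 where x0: "\<forall>h\<in>D. x0 \<bullet> h = m h" "(\<Sum>i. ennreal (w i x0)) < \<infinity>"
 proof -
  have ae: "AE x in gm. (\<forall>h\<in>D. x \<bullet> h = m h) \<and> (\<Sum>i. ennreal (w i x)) < \<infinity>" using AED AEs by simp
  have "\<exists>x. (\<forall>h\<in>D. x \<bullet> h = m h) \<and> (\<Sum>i. ennreal (w i x)) < \<infinity>"
  proof (rule ccontr)
   assume no: "\<not> ?thesis"
   have "AE x in gm. False" using ae by (rule eventually_mono) (use no in blast)
   then show False by simp
  qed
  then show thesis using that by auto
 qed
 define bt where "bt i = m (e i) - x0 \<bullet> e i" for i
 have swsum: "summable (\<lambda>i. w i x0)"
  using x0(2) by (intro summable_suminf_not_top) (auto simp: w_def)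
 have "coord_law gm x0 e J
    = PiM J (\<lambda>i. density lborel (\<lambda>s. ennreal (normal_density (bt i) (sqrt (c i)) s)))" if J: "finite J" "J \<subseteq> I" for J
 proof -
  \<comment> \<open>Outside \<open>J\<close> the variance may vanish; the filler
    \<open>return borel 0\<close> makes every factor a probability measure, as the product
    construction asks for all indices.\<close>
  define Q where "Q i = (if i : J then density lborel (\<lambda>s. ennreal (normal_density (bt i) (sqrt (c i)) s)) else return borel 0)" for i
  have pQ: "prob_space (Q i)" for i using J prob_space_normal_density[of "sqrt (c i)" "bt i"]
   by (auto simp: Q_def I_def intro: prob_space_return)
  interpret Q: product_sigma_finite Q by (intro product_sigma_finite.intro prob_space_imp_sigma_finite pQ)
  have Qs: "sets (Q i) = sets borel" for i by (simp add: Q_def)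
  have "coord_law gm x0 e J = PiM J Q"
  proof (rule Q.PiM_eqI[OF J(1)])
   show "sets (coord_law gm x0 e J) = sets (PiM J Q)"
    by (simp add: Qs cong: sets_PiM_cong)
   fix A assume A: "\<And>i. i : J ==> A i : sets (Q i)"
   define A' where "A' i = (if i : J then (\<lambda>s. s - x0 \<bullet> e i) -` A i else UNIV)" for i
   have A'm [measurable]: "A' i : sets borel" for i
   proof (cases "i : J")
    case True
    then have [measurable]: "A i : sets borel" using A Qs by auto
    have "(\<lambda>s. s - x0 \<bullet> e i) -` A i \<inter> space borel : sets borel" by (rule measurable_sets[of _ borel borel]) auto
    then show ?thesis by (simp add: A'_def)
   qed (simp add: A'_def)
   have pm: "(\<lambda>x. \<lambda>i\<in>J. (x - x0) \<bullet> e i) : gm \<rightarrow>\<^sub>M PiM J (\<lambda>_. borel)" by simp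
   have "emeasure (coord_law gm x0 e J) (PiE J A)
    = emeasure gm ((\<lambda>x. \<lambda>i\<in>J. (x - x0) \<bullet> e i) -` PiE J A \<inter> space gm)"
    using pm A Qs J by (intro emeasure_distr) (auto intro!: sets_PiM_I_finite)
   also have "(\<lambda>x. \<lambda>i\<in>J. (x - x0) \<bullet> e i) -` PiE J A \<inter> space gm = {x. \<forall>i\<in>J. x \<bullet> e i : A' i}"
    by (auto simp: A'_def sp inner_diff_left)
   also have "emeasure gm ... = ennreal (\<Prod>i\<in>J. measure gm {x. x \<bullet> e i : A' i})"
   proof -
    have ind: "(\<Prod>i\<in>J. indicator (A' i) (x \<bullet> e i) :: real) = indicator {x. \<forall>i\<in>J. x \<bullet> e i : A' i} x" for x
     using J(1) by (auto simp: indicator_def)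
    have "(\<integral>x. complex_of_real (\<Prod>i\<in>J. indicator (A' i) (x \<bullet> e i)) * iexp (x \<bullet> 0) \<partial>gm) =
      complex_of_real (\<Prod>i\<in>J. measure gm {x. x \<bullet> e i : A' i}) * (\<integral>x. iexp (x \<bullet> 0) \<partial>gm)"
     by (rule gaussian_coordinates_indep_char[OF g cov onI _ J, where c = c]) (auto simp: Re I_def)
    moreover have "(\<integral>x. complex_of_real (\<Prod>i\<in>J. indicator (A' i) (x \<bullet> e i)) * iexp (x \<bullet> 0) \<partial>gm)
      = complex_of_real (\<integral>x. indicator {x. \<forall>i\<in>J. x \<bullet> e i : A' i} x \<partial>gm)"
     unfolding ind by simp
    ultimately have "complex_of_real (measure gm {x. \<forall>i\<in>J. x \<bullet> e i : A' i}) = complex_of_real (\<Prod>i\<in>J. measure gm {x. x \<bullet> e i : A' i})"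
     using prob_space by simp
    then show ?thesis unfolding emeasure_eq_measure of_real_eq_iff by simp
   qed
   also have "... = (\<Prod>i\<in>J. ennreal (measure gm {x. x \<bullet> e i : A' i}))" by (simp add: prod_ennreal)
   also have "... = (\<Prod>i\<in>J. emeasure (Q i) (A i))"
   proof (intro prod.cong refl)
    fix i assume i: "i : J"
    then have iI: "i : I" and ci: "c i > 0" using J by (auto simp: I_def)
    have [measurable]: "A i : sets borel" using A[OF i] Qs by auto
    have "distributed gm lborel (\<lambda>x. - (x0 \<bullet> e i) + 1 * (x \<bullet> e i)) (\<lambda>s. ennreal (normal_density (- (x0 \<bullet> e i) + 1 * m (e i)) (\<bar>1\<bar> * sqrt (c i)) s))"
     by (rule normal_density_affine[OF law[OF iI]]) (use ci in auto)
    then have d: "distr gm lborel (\<lambda>x. x \<bullet> e i - x0 \<bullet> e i) = Q i" using i by (simp add: bt_def distributed_def Q_def)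
    have "emeasure (Q i) (A i) = emeasure gm ((\<lambda>x. x \<bullet> e i - x0 \<bullet> e i) -` A i \<inter> space gm)"
     unfolding d[symmetric] by (rule emeasure_distr) auto
    also have "(\<lambda>x. x \<bullet> e i - x0 \<bullet> e i) -` A i \<inter> space gm = {x. x \<bullet> e i : A' i}" using i by (auto simp: A'_def sp)
    finally show "ennreal (measure gm {x. x \<bullet> e i : A' i}) = emeasure (Q i) (A i)" by (simp add: emeasure_eq_measure)
   qed
   finally show "emeasure (coord_law gm x0 e J) (PiE J A) = (\<Prod>i\<in>J. emeasure (Q i) (A i))" .
  qed
  also have "PiM J Q = PiM J (\<lambda>i. density lborel (\<lambda>s. ennreal (normal_density (bt i) (sqrt (c i)) s)))"
   by (rule PiM_cong) (auto simp: Q_def)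
  finally show ?thesis .
 qed
 moreover have AEt: "AE x in gm. (\<lambda>n. (x - x0) - (\<Sum>i\<in>I \<inter> {..<n}. ((x - x0) \<bullet> e i) *\<^sub>R e i)) \<longlonglongrightarrow> 0"
  using AED
 proof eventually_elim
  case (elim x)
  show ?case
  proof (rule orthonormal_expansion[OF onI])
   fix h assume h: "\<And>i. i : I ==> h \<bullet> e i = 0"
   then have hN: "h : N" by (simp add: N_def)
   show "(x - x0) \<bullet> h = 0"
   proof (rule ccontr)
    assume nz: "(x - x0) \<bullet> h \<noteq> 0"
    then have nx: "norm (x - x0) > 0" by auto
    define eps where "eps = \<bar>(x - x0) \<bullet> h\<bar> / norm (x - x0)"
    have "eps > 0" using nz nx by (simp add: eps_def)
    then obtain d where d: "d : D" "dist d h < eps" using D(3)[OF hN] by auto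
    have "\<bar>(x - x0) \<bullet> h\<bar> = \<bar>(x - x0) \<bullet> (d - h)\<bar>" using elim x0(1) d(1) by (simp add: inner_diff_left inner_diff_right)
    also have "... <= norm (x - x0) * norm (d - h)" by (rule Cauchy_Schwarz_ineq2)
    also have "... < norm (x - x0) * eps" using nx d(2) by (simp add: dist_norm)
    finally show False using nx by (simp add: eps_def)
   qed
  qed
 qed
 moreover have "(moment2 x0 rho) < \<infinity>" if eb: "entropy_bound gm rho E" for rho E
 proof -
  obtain f where fm: "f : borel_measurable gm" and E: "0 <= E" and rho: "rho = density gm (\<lambda>x. ennreal (f x))"
   using eb by (auto simp: entropy_bound_def)
  have sr [measurable_cong]: "sets rho = sets borel" using rho s by simp
  have AEr: "AE x in rho. (\<lambda>n. (x - x0) - (\<Sum>i\<in>I \<inter> {..<n}. ((x - x0) \<bullet> e i) *\<^sub>R e i)) \<longlonglongrightarrow> 0"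
   unfolding rho using AEt fm by (subst AE_density) auto
  \<comment> \<open>Scaling by \<open>8 * c i\<close> makes this exponential moment independent of
    the coordinate. The bound for coordinate \<open>i\<close> is then \<open>16 * c i\<close> times
    a constant plus a multiple of \<open>w i x0\<close>, and both are summable.\<close>
  define K where "K = (\<integral>\<^sup>+s. ennreal (std_normal_density s * exp (s^2 / 8)) \<partial>lborel)"
  have Kfin: "K < \<infinity>"
  proof -
   have "std_normal_density s * exp (s^2 / 8) <= 2 * normal_density 0 2 s" for s :: real
   proof -
    have "std_normal_density s * exp (s^2 / 8) = 1 / sqrt (2 * pi) * exp (- (s^2) / 2 + s^2 / 8)"
     unfolding exp_add std_normal_density_def by simp
    also have "... <= 1 / sqrt (2 * pi) * exp (- (s^2) / 8)" by (intro mult_left_mono) auto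
    also have "... = 2 * normal_density 0 2 s"
    proof -
     show ?thesis using real_sqrt_mult[of 4 2] by (simp add: normal_density_def real_sqrt_mult)
    qed
    finally show ?thesis .
   qed
   then have "K <= (\<integral>\<^sup>+s. ennreal (2 * normal_density 0 2 s) \<partial>lborel)" unfolding K_def by (intro nn_integral_mono ennreal_leI)
   also have "... = ennreal (\<integral>s. 2 * normal_density 0 2 s \<partial>lborel)"
    by (intro nn_integral_eq_integral integrable_mult_right integrable_normal_density) auto
   also have "... < \<infinity>" by simp
   finally show ?thesis .
  qed
  define v where "v i x = (if i : I then ((x - x0) \<bullet> e i)^2 else 0)" for i x
  have vm [measurable]: "v i : borel_measurable rho" for i unfolding v_def by simp
  have vb: "(\<integral>\<^sup>+x. ennreal (v i x) \<partial>rho) <= ennreal (16 * \<bar>c i\<bar>) * (ennreal E + K) + ennreal (2 * w i x0) * emeasure rho (space rho)" for i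
  proof (cases "i : I")
   case True
   then have ci: "c i > 0" by (simp add: I_def)
   have "(\<integral>\<^sup>+x. ennreal (v i x) \<partial>rho) <= (\<integral>\<^sup>+x. ennreal (16 * c i) * ennreal ((x \<bullet> e i - m (e i))^2 / (8 * c i)) + ennreal (2 * w i x0) \<partial>rho)"
   proof (intro nn_integral_mono)
    fix x
    have sq2: "(u - y)^2 <= 2 * u^2 + 2 * y^2" for u y :: real
     using zero_le_power2[of "u + y"] by (simp add: power2_eq_square algebra_simps)
    have "v i x <= 2 * (x \<bullet> e i - m (e i))^2 + 2 * w i x0"
     using sq2[of "x \<bullet> e i - m (e i)" "x0 \<bullet> e i - m (e i)"] by (simp add: v_def w_def inner_diff_left)
    also have "2 * (x \<bullet> e i - m (e i))^2 = (16 * c i) * ((x \<bullet> e i - m (e i))^2 / (8 * c i))" using ci by simp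
    finally have "ennreal (v i x) <= ennreal ((16 * c i) * ((x \<bullet> e i - m (e i))^2 / (8 * c i)) + 2 * w i x0)"
     by (rule ennreal_leI)
    also have "... = ennreal (16 * c i) * ennreal ((x \<bullet> e i - m (e i))^2 / (8 * c i)) + ennreal (2 * w i x0)"
     using ci by (subst ennreal_plus) (auto simp: w_def simp flip: ennreal_mult')
    finally show "ennreal (v i x) <= ennreal (16 * c i) * ennreal ((x \<bullet> e i - m (e i))^2 / (8 * c i)) + ennreal (2 * w i x0)" .
   qed
   also have "... = ennreal (16 * c i) * (\<integral>\<^sup>+x. ennreal ((x \<bullet> e i - m (e i))^2 / (8 * c i)) \<partial>rho) + ennreal (2 * w i x0) * emeasure rho (space rho)"
    by (subst nn_integral_add) (auto simp: nn_integral_cmult)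
   also have "... <= ennreal (16 * c i) * (ennreal E + K) + ennreal (2 * w i x0) * emeasure rho (space rho)"
    using entropy_bound_exp[OF eb, of "\<lambda>x. (x \<bullet> e i - m (e i))^2 / (8 * c i)"] ci std[OF True]
    by (intro add_right_mono mult_left_mono) (auto simp: K_def)
   finally show ?thesis using ci by simp
  qed (simp add: v_def)
  have fr: "emeasure rho (space rho) < \<infinity>"
   using entropy_bound_exp[OF eb, of "\<lambda>_. 1"] by (auto simp: emeasure_space_1 intro: le_less_trans[of _ "ennreal E + ennreal (exp 1)"])
  have lim: "AE x in rho. ennreal ((norm (x - x0))^2) <= (\<Sum>i. ennreal (v i x))"
   using AEr
  proof eventually_elim
   case (elim x)
   let ?p = "x - x0" and ?S = "\<lambda>n. \<Sum>i\<in>I \<inter> {..<n}. ((x - x0) \<bullet> e i) *\<^sub>R e i"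
   have "(\<lambda>n. (norm ?p)^2 - (norm (?p - ?S n))^2) \<longlonglongrightarrow> (norm ?p)^2 - (norm (0::'h))^2"
    by (intro tendsto_intros elim)
   moreover have "(norm ?p)^2 - (norm (?p - ?S n))^2 = (\<Sum>i<n. v i x)" for n
   proof -
    have "(\<Sum>i\<in>I \<inter> {..<n}. (?p \<bullet> e i)^2) + (norm (?p - ?S n))^2 = (norm ?p)^2"
     by (rule orthonormal_partial_sums(4)[OF onI]) auto
    moreover have "(\<Sum>i<n. v i x) = (\<Sum>i\<in>I \<inter> {..<n}. (?p \<bullet> e i)^2)"
     using sum.inter_restrict[of "{..<n}" "\<lambda>i. (?p \<bullet> e i)^2" I] by (simp add: v_def Int_commute)
    ultimately show ?thesis by simp
   qed
   ultimately have "(\<lambda>i. v i x) sums (norm ?p)^2" by (simp add: sums_def)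
   then have "(\<Sum>i. ennreal (v i x)) = ennreal ((norm ?p)^2)" by (intro suminf_ennreal_eq) (auto simp: v_def)
   then show ?case by simp
  qed
  have "(moment2 x0 rho) <= (\<integral>\<^sup>+x. (\<Sum>i. ennreal (v i x)) \<partial>rho)" by (intro nn_integral_mono_AE lim)
  also have "... = (\<Sum>i. \<integral>\<^sup>+x. ennreal (v i x) \<partial>rho)" by (intro nn_integral_suminf) measurable
  also have "... <= (\<Sum>i. ennreal (16 * \<bar>c i\<bar>) * (ennreal E + K) + ennreal (2 * w i x0) * emeasure rho (space rho))" by (intro suminf_le vb) auto
  also have "... = (\<Sum>i. ennreal (16 * \<bar>c i\<bar>)) * (ennreal E + K) + (\<Sum>i. ennreal (2 * w i x0)) * emeasure rho (space rho)"
   by (simp add: suminf_add[symmetric])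
  also have "... < \<infinity>"
  proof -
   have "summable (\<lambda>i. \<bar>c (Suc i)\<bar>)" using summ c0 by (simp add: summable_Suc_iff)
   then have "summable (\<lambda>i. 16 * \<bar>c i\<bar>)" by (intro summable_mult) (simp add: summable_Suc_iff[of "\<lambda>i. \<bar>c i\<bar>"])
   then have "(\<Sum>i. ennreal (16 * \<bar>c i\<bar>)) < \<infinity>" by (simp add: suminf_ennreal_eq[OF _ summable_sums])
   moreover have "(\<Sum>i. ennreal (2 * w i x0)) < \<infinity>"
    using summable_mult[OF swsum, of 2] by (subst suminf_ennreal_eq[OF _ summable_sums]) (auto simp: w_def)
   ultimately show ?thesis using Kfin fr by (simp add: ennreal_mult_less_top)
  qed
  finally show ?thesis .
 qed
 ultimately show thesis using that by blast
qed

section \<open>Prekopa-Leindler inequality and lattice packing\<close>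

text \<open>Cut \<open>A\<close> near its supremum at \<open>p\<close> and \<open>B\<close> near its
  infimum at \<open>q\<close>. The points of \<open>A\<close> up to \<open>p\<close>, paired with
  \<open>q\<close>, land left of \<open>r\<close>; the points of \<open>B\<close> from
  \<open>q\<close> on, paired with \<open>p\<close>, land right of it. So the two scaled copies
  share at most the point \<open>r\<close>. Each cut loses at most \<open>eta\<close>, the price for
  extrema that need not be attained.\<close>

lemma brunn_minkowski_real:
 fixes A B C :: "real set"
 assumes t: "0 < t" "t < 1" and meas: "A : sets borel" "B : sets borel" "C : sets borel"
  and bd: "A \<subseteq> {-L..L}" "B \<subseteq> {-L..L}" "C \<subseteq> {-L..L}" and ne: "A \<noteq> {}" "B \<noteq> {}"
  and sub: "\<And>x y. x : A ==> y : B ==> (1 - t) * x + t * y : C"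
 shows "(1 - t) * measure lborel A + t * measure lborel B <= measure lborel C"
proof (rule field_le_epsilon)
 fix eta :: real assume eta: "eta > 0"
 have fin: "S : fmeasurable lborel" if "S : sets borel" "S \<subseteq> {-L..L}" for S
  by (rule fmeasurableI2[OF _ that(2)]) (use that in \<open>auto intro!: fmeasurableI simp: emeasure_lborel_Icc_eq\<close>)
 have fmIcc: "{a..b} : fmeasurable lborel" for a b :: real
  by (intro fmeasurableI) (auto simp: emeasure_lborel_Icc_eq)
 have bdd: "bdd_above A" "bdd_below B" using bd by (meson bdd_above_Icc bdd_above_mono bdd_below_Icc bdd_below_mono)+
 obtain p where p: "p : A" "p > Sup A - eta" using less_cSup_iff[OF ne(1) bdd(1), of "Sup A - eta"] eta by auto
 obtain q where q: "q : B" "q < Inf B + eta" using cInf_less_iff[OF ne(2) bdd(2), of "Inf B + eta"] eta by auto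
 define r where "r = (1 - t) * p + t * q"
 have mA: "measure lborel A <= measure lborel (A \<inter> {..p}) + eta"
 proof -
  have "A \<subseteq> (A \<inter> {..p}) \<union> {p..p+eta}" using p(2) cSup_upper[OF _ bdd(1)] by force
  then have "measure lborel A <= measure lborel ((A \<inter> {..p}) \<union> {p..p+eta})"
   using meas bd by (intro measure_mono_fmeasurable fmeasurable.Un fmIcc fin[of "A \<inter> {..p}"]) auto
  also have "... <= measure lborel (A \<inter> {..p}) + measure lborel {p..p+eta}"
   using meas by (intro measure_Un_le) auto
  finally show ?thesis using eta by simp
 qed
 have mB: "measure lborel B <= measure lborel (B \<inter> {q..}) + eta"
 proof -
  have "B \<subseteq> (B \<inter> {q..}) \<union> {q-eta..q}" using q(2) cInf_lower[OF _ bdd(2)] by force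
  then have "measure lborel B <= measure lborel ((B \<inter> {q..}) \<union> {q-eta..q})"
   using meas bd by (intro measure_mono_fmeasurable fmeasurable.Un fmIcc fin[of "B \<inter> {q..}"]) auto
  also have "... <= measure lborel (B \<inter> {q..}) + measure lborel {q-eta..q}"
   using meas by (intro measure_Un_le) auto
  finally show ?thesis using eta by simp
 qed
 have aff: "c * measure lborel X <= measure lborel Y"
  if c: "c > 0" and X: "X : sets borel" "X \<subseteq> {-L..L}" and Y: "Y : sets borel" "Y \<subseteq> {-L..L}"
   and m: "\<And>x. x : X ==> u + c * x : Y" for X Y u and c :: real
 proof -
  have "emeasure lborel Y = (\<integral>\<^sup>+x. indicator Y x \<partial>lborel)" using Y by simp
  also have "... = ennreal \<bar>c\<bar> * (\<integral>\<^sup>+x. indicator Y (u + c * x) \<partial>lborel)"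
   using Y c by (intro nn_integral_real_affine) auto
  also have "... >= ennreal \<bar>c\<bar> * (\<integral>\<^sup>+x. indicator X x \<partial>lborel)"
   using m by (intro mult_left_mono nn_integral_mono) (auto simp: indicator_def)
  finally show ?thesis using X c fin[OF X] fin[OF Y] c
   by (simp add: emeasure_eq_measure2 flip: ennreal_mult')
 qed
 have 1: "(1 - t) * measure lborel (A \<inter> {..p}) <= measure lborel (C \<inter> {..r})"
 proof (rule aff)
  show "t * q + (1 - t) * x : C \<inter> {..r}" if "x : A \<inter> {..p}" for x
   using that sub[of x q] q t by (auto simp: r_def add.commute)
 qed (use meas bd t in auto)
 have 2: "t * measure lborel (B \<inter> {q..}) <= measure lborel (C \<inter> {r..})"
 proof (rule aff)
  show "(1 - t) * p + t * y : C \<inter> {r..}" if "y : B \<inter> {q..}" for y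
   using that sub[of p y] p t by (auto simp: r_def)
 qed (use meas bd t in auto)
 have "measure lborel (C \<inter> {r..}) <= measure lborel (C \<inter> {r<..}) + measure lborel {r}"
 proof -
  have "measure lborel (C \<inter> {r..}) <= measure lborel ((C \<inter> {r<..}) \<union> {r})"
   using meas bd fmIcc[of r r] by (intro measure_mono_fmeasurable fmeasurable.Un fin[of "C \<inter> {r<..}"]) auto
  also have "... <= measure lborel (C \<inter> {r<..}) + measure lborel {r}"
   using meas by (intro measure_Un_le) auto
  finally show ?thesis .
 qed
 moreover have "measure lborel C = measure lborel (C \<inter> {..r}) + measure lborel (C \<inter> {r<..})"
 proof -
  have "C = (C \<inter> {..r}) \<union> (C \<inter> {r<..})" by auto
  moreover have "measure lborel ((C \<inter> {..r}) \<union> (C \<inter> {r<..})) = measure lborel (C \<inter> {..r}) + measure lborel (C \<inter> {r<..})"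
   using fmeasurableD2[OF fin[of "C \<inter> {..r}"]] fmeasurableD2[OF fin[of "C \<inter> {r<..}"]] meas bd
   by (intro measure_Union) (auto simp: less_top)
  ultimately show ?thesis by simp
 qed
 ultimately have "(1 - t) * measure lborel (A \<inter> {..p}) + t * measure lborel (B \<inter> {q..}) <= measure lborel C"
  using 1 2 by simp
 moreover have "(1 - t) * measure lborel A <= (1 - t) * (measure lborel (A \<inter> {..p}) + eta)"
  using mA t by simp
 moreover have "t * measure lborel B <= t * (measure lborel (B \<inter> {q..}) + eta)"
  using mB t by simp
 ultimately show "(1 - t) * measure lborel A + t * measure lborel B <= measure lborel C + eta"
  by (simp add: algebra_simps)
qed

text \<open>Levels are scaled to the unit interval, so that functions with different suprema can be
  compared at the same relative height \<open>s\<close>.\<close>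

lemma layer_cake_truncated:
 fixes h :: "real => real"
 assumes [measurable]: "h : borel_measurable borel" and h: "\<And>x. 0 <= h x" and c: "c > 0"
 shows "(\<integral>\<^sup>+x. ennreal (min (h x) c) \<partial>lborel) =
  ennreal c * (\<integral>\<^sup>+s. emeasure lborel {x. s * c < h x} * indicator {0<..<1} s \<partial>lborel)"
proof -
 have "ennreal (min (h x) c) = ennreal c * (\<integral>\<^sup>+s. indicator {s. s * c < h x} s * indicator {0<..<1} s \<partial>lborel)" for x
 proof -
  have "(\<integral>\<^sup>+s. indicator {s. s * c < h x} s * indicator {0<..<1} s \<partial>lborel) = (\<integral>\<^sup>+s. indicator {0<..<min (h x / c) 1} s \<partial>lborel)"
   using c by (intro nn_integral_cong) (auto simp: indicator_def field_simps)
  also have "... = ennreal (min (h x / c) 1)"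
   using h[of x] c by simp
  finally show ?thesis using c by (simp add: min_def flip: ennreal_mult')
 qed
 then have "(\<integral>\<^sup>+x. ennreal (min (h x) c) \<partial>lborel) = (\<integral>\<^sup>+x. ennreal c * (\<integral>\<^sup>+s. indicator {s. s * c < h x} s * indicator {0<..<1} s \<partial>lborel) \<partial>lborel)"
  by simp
 also have "... = ennreal c * (\<integral>\<^sup>+x. \<integral>\<^sup>+s. indicator {s. s * c < h x} s * indicator {0<..<1} s \<partial>lborel \<partial>lborel)"
  by (intro nn_integral_cmult) measurable
 also have "(\<integral>\<^sup>+x. \<integral>\<^sup>+s. indicator {s. s * c < h x} s * indicator {0<..<1} s \<partial>lborel \<partial>lborel)
   = (\<integral>\<^sup>+s. \<integral>\<^sup>+x. indicator {s. s * c < h x} s * indicator {0<..<1} s \<partial>lborel \<partial>lborel)"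
  by (intro lborel_pair.Fubini') measurable
 also have "... = (\<integral>\<^sup>+s. emeasure lborel {x. s * c < h x} * indicator {0<..<1} s \<partial>lborel)"
 proof (intro nn_integral_cong)
  fix s :: real
  have "(\<integral>\<^sup>+x. indicator {s. s * c < h x} s * indicator {0<..<1} s \<partial>lborel) = (\<integral>\<^sup>+x. indicator {x. s * c < h x} x \<partial>lborel) * indicator {0<..<1} s"
   by (subst nn_integral_multc[symmetric]) (auto intro!: nn_integral_cong simp: indicator_def)
  then show "(\<integral>\<^sup>+x. indicator {s. s * c < h x} s * indicator {0<..<1} s \<partial>lborel) = emeasure lborel {x. s * c < h x} * indicator {0<..<1} s"
   by simp
 qed
 finally show ?thesis .
qed

lemma prekopa_leindler_real:
 fixes f g h :: "real => real"
 assumes t: "0 < t" "t < 1"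
  and meas [measurable]: "f : borel_measurable borel" "g : borel_measurable borel" "h : borel_measurable borel"
  and f: "\<And>x. 0 <= f x" "\<And>x. f x <= B" "\<And>x. f x \<noteq> 0 ==> \<bar>x\<bar> <= L"
  and g: "\<And>x. 0 <= g x" "\<And>x. g x <= B" "\<And>x. g x \<noteq> 0 ==> \<bar>x\<bar> <= L"
  and h: "\<And>x. 0 <= h x" "\<And>x. h x <= B" "\<And>x. h x \<noteq> 0 ==> \<bar>x\<bar> <= L"
  and fgh: "\<And>x y. f x powr (1 - t) * g y powr t <= h ((1 - t) * x + t * y)"
 shows "(LINT x|lborel. f x) powr (1 - t) * (LINT x|lborel. g x) powr t <= (LINT x|lborel. h x)"
proof (cases "(LINT x|lborel. f x) = 0 \<or> (LINT x|lborel. g x) = 0")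
 case True
 then show ?thesis using h by auto
next
 case False
 have int: "integrable lborel u" if [measurable]: "u : borel_measurable borel" and u: "\<And>x. 0 <= u x" "\<And>x. u x <= B" "\<And>x. u x \<noteq> 0 ==> \<bar>x\<bar> <= L" for u :: "real => real"
 proof (rule Bochner_Integration.integrable_bound)
  show "integrable lborel (\<lambda>x. indicator {-L..L} x * B)"
   by (intro integrable_mult_left integrable_real_indicator) (auto simp: emeasure_lborel_Icc_eq)
  show "AE x in lborel. norm (u x) <= norm (indicator {- L..L} x * B)"
  proof (intro AE_I2)
   fix x show "norm (u x) <= norm (indicator {- L..L} x * B)"
    using u(1)[of x] u(2)[of x] u(3)[of x] by (cases "u x = 0") (auto simp: indicator_def)
  qed
 qed simp
 note intf = int[OF meas(1) f] and intg = int[OF meas(2) g] and inth = int[OF meas(3) h]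
 define a where "a = (SUP x. f x)" define b where "b = (SUP x. g x)"
 have bddf: "bdd_above (range f)" and bddg: "bdd_above (range g)" using f g by (auto intro!: bdd_aboveI)
 have fa: "f x <= a" and gb: "g x <= b" for x unfolding a_def b_def by (auto intro: cSUP_upper bddf bddg)
 have a: "a > 0"
 proof (rule ccontr)
  assume "\<not> a > 0" then have "f x = 0" for x using fa[of x] f(1)[of x] by simp
  then show False using False by simp
 qed
 have b: "b > 0"
 proof (rule ccontr)
  assume "\<not> b > 0" then have "g x = 0" for x using gb[of x] g(1)[of x] by simp
  then show False using False by simp
 qed
 \<comment> \<open>The geometric mean of the suprema: points at relative height \<open>s\<close> in
   \<open>f\<close> and in \<open>g\<close> combine to a point at relative height \<open>s\<close>
   in \<open>h\<close>. With absolute heights one of the level sets could be empty and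
   Brunn-Minkowski would not apply. At the end Young's inequality turns the arithmetic mean back
   into the geometric one.\<close>
 define c where "c = a powr (1 - t) * b powr t"
 have c: "c > 0" using a b by (simp add: c_def)
 define u where "u = (\<lambda>s. measure lborel {x. s * a < f x})"
 define v where "v = (\<lambda>s. measure lborel {x. s * b < g x})"
 have lev: "(1 - t) * u s + t * v s <= measure lborel {x. s * c < h x}" if s: "0 < s" "s < 1" for s
  unfolding u_def v_def
 proof (rule brunn_minkowski_real[OF t])
  show "{x. s * a < f x} \<subseteq> {-L..L}" "{x. s * b < g x} \<subseteq> {-L..L}" "{x. s * c < h x} \<subseteq> {-L..L}"
  proof -
   have "{x. k < w x} \<subseteq> {-L..L}" if "k > 0" "\<And>x. w x \<noteq> 0 ==> \<bar>x\<bar> <= L" for k and w :: "real => real"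
   proof
    fix x assume "x : {x. k < w x}"
    then have "w x \<noteq> 0" using that(1) by auto
    from that(2)[OF this] show "x : {-L..L}" by auto
   qed
   then show "{x. s * a < f x} \<subseteq> {-L..L}" "{x. s * b < g x} \<subseteq> {-L..L}" "{x. s * c < h x} \<subseteq> {-L..L}"
    using f(3) g(3) h(3) s a b c by auto
  qed
  show "{x. s * a < f x} \<noteq> {}" using s a less_cSUP_iff[OF _ bddf, of "s * a"] by (auto simp: a_def)
  show "{x. s * b < g x} \<noteq> {}" using s b less_cSUP_iff[OF _ bddg, of "s * b"] by (auto simp: b_def)
  fix x y assume "x : {x. s * a < f x}" "y : {x. s * b < g x}"
  then have xy: "s * a < f x" "s * b < g y" by auto
  have "s * c = (s * a) powr (1 - t) * (s * b) powr t"
   using s by (simp add: c_def powr_mult flip: powr_add)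
  also have "... < f x powr (1 - t) * g y powr t"
   using xy s a b t less_trans[OF _ xy(1), of 0]
   by (intro mult_strict_mono powr_less_mono2) (auto simp: less_imp_le)
  also have "... <= h ((1 - t) * x + t * y)" by (rule fgh)
  finally show "(1 - t) * x + t * y : {x. s * c < h x}" by simp
 qed measurable
 have emf: "emeasure lborel {x. s * k < w x} = ennreal (measure lborel {x. s * k < w x})"
  if [measurable]: "w : borel_measurable borel" and w: "\<And>x. w x \<noteq> 0 ==> \<bar>x\<bar> <= L" and "0 < s" "0 < k" for s k and w :: "real => real"
 proof -
  have "{x. s * k < w x} \<subseteq> {-L..L}"
  proof
   fix x assume "x : {x. s * k < w x}"
   then show "x : {-L..L}" using mult_pos_pos[OF that(3,4)] w[of x] by auto
  qed
  moreover have "{x. s * k < w x} : sets lborel" by simp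
  ultimately have "{x. s * k < w x} : fmeasurable lborel"
   by (rule fmeasurableI2[rotated]) (auto intro!: fmeasurableI simp: emeasure_lborel_Icc_eq)
  then show ?thesis by (rule emeasure_eq_measure2)
 qed
 have lf: "ennreal (LINT x|lborel. f x) = ennreal a * (\<integral>\<^sup>+s. ennreal (u s) * indicator {0<..<1} s \<partial>lborel)"
 proof -
  have "ennreal (LINT x|lborel. f x) = (\<integral>\<^sup>+x. ennreal (f x) \<partial>lborel)"
   using intf f by (intro nn_integral_eq_integral[symmetric]) auto
  also have "... = (\<integral>\<^sup>+x. ennreal (min (f x) a) \<partial>lborel)" using fa by simp
  also have "... = ennreal a * (\<integral>\<^sup>+s. emeasure lborel {x. s * a < f x} * indicator {0<..<1} s \<partial>lborel)"
   using f a by (intro layer_cake_truncated) auto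
  also have "(\<integral>\<^sup>+s. emeasure lborel {x. s * a < f x} * indicator {0<..<1} s \<partial>lborel) = (\<integral>\<^sup>+s. ennreal (u s) * indicator {0<..<1} s \<partial>lborel)"
   using emf[OF meas(1) f(3) _ a] by (intro nn_integral_cong) (auto simp: indicator_def u_def)
  finally show ?thesis .
 qed
 have lg: "ennreal (LINT x|lborel. g x) = ennreal b * (\<integral>\<^sup>+s. ennreal (v s) * indicator {0<..<1} s \<partial>lborel)"
 proof -
  have "ennreal (LINT x|lborel. g x) = (\<integral>\<^sup>+x. ennreal (g x) \<partial>lborel)"
   using intg g by (intro nn_integral_eq_integral[symmetric]) auto
  also have "... = (\<integral>\<^sup>+x. ennreal (min (g x) b) \<partial>lborel)" using gb by simp
  also have "... = ennreal b * (\<integral>\<^sup>+s. emeasure lborel {x. s * b < g x} * indicator {0<..<1} s \<partial>lborel)"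
   using g b by (intro layer_cake_truncated) auto
  also have "(\<integral>\<^sup>+s. emeasure lborel {x. s * b < g x} * indicator {0<..<1} s \<partial>lborel) = (\<integral>\<^sup>+s. ennreal (v s) * indicator {0<..<1} s \<partial>lborel)"
   using emf[OF meas(2) g(3) _ b] by (intro nn_integral_cong) (auto simp: indicator_def v_def)
  finally show ?thesis .
 qed
 have lh: "ennreal c * (\<integral>\<^sup>+s. ennreal ((1 - t) * u s + t * v s) * indicator {0<..<1} s \<partial>lborel) <= ennreal (LINT x|lborel. h x)"
 proof -
  have "ennreal c * (\<integral>\<^sup>+s. ennreal ((1 - t) * u s + t * v s) * indicator {0<..<1} s \<partial>lborel)
   <= ennreal c * (\<integral>\<^sup>+s. emeasure lborel {x. s * c < h x} * indicator {0<..<1} s \<partial>lborel)"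
   using emf[OF meas(3) h(3) _ c] lev by (intro mult_left_mono nn_integral_mono) (auto simp: indicator_def intro!: ennreal_leI)
  also have "... = (\<integral>\<^sup>+x. ennreal (min (h x) c) \<partial>lborel)"
   using h c by (intro layer_cake_truncated[symmetric]) auto
  also have "... <= (\<integral>\<^sup>+x. ennreal (h x) \<partial>lborel)" by (intro nn_integral_mono ennreal_leI) auto
  also have "... = ennreal (LINT x|lborel. h x)"
   using inth h by (intro nn_integral_eq_integral) auto
  finally show ?thesis .
 qed
 have mu [measurable]: "u : borel_measurable borel" "v : borel_measurable borel"
  unfolding u_def v_def measure_def by auto
 have nn: "u s >= 0" "v s >= 0" for s by (auto simp: u_def v_def)
 define U where "U = (\<integral>\<^sup>+s. ennreal (u s) * indicator {0<..<1} s \<partial>lborel)"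
 define V where "V = (\<integral>\<^sup>+s. ennreal (v s) * indicator {0<..<1} s \<partial>lborel)"
 define F where "F = (LINT x|lborel. f x)" define G where "G = (LINT x|lborel. g x)"
 have FG: "F > 0" "G > 0" using False f g unfolding F_def G_def
  by (simp_all add: less_le)
 have Uf: "U = ennreal (F / a)"
  using arg_cong[OF lf[folded U_def F_def], of "\<lambda>x. ennreal (1 / a) * x"] a
  by (simp add: mult.assoc[symmetric] flip: ennreal_mult')
 have Vf: "V = ennreal (G / b)"
  using arg_cong[OF lg[folded V_def G_def], of "\<lambda>x. ennreal (1 / b) * x"] b
  by (simp add: mult.assoc[symmetric] flip: ennreal_mult')
 have "(\<integral>\<^sup>+s. ennreal ((1 - t) * u s + t * v s) * indicator {0<..<1} s \<partial>lborel) = ennreal (1 - t) * U + ennreal t * V"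
 proof -
  have "(\<integral>\<^sup>+s. ennreal ((1 - t) * u s + t * v s) * indicator {0<..<1} s \<partial>lborel) =
   (\<integral>\<^sup>+s. ennreal (1 - t) * (ennreal (u s) * indicator {0<..<1} s) + ennreal t * (ennreal (v s) * indicator {0<..<1} s) \<partial>lborel)"
   using t nn by (intro nn_integral_cong) (auto simp: indicator_def ennreal_mult)
  then show ?thesis unfolding U_def V_def by (simp add: nn_integral_add nn_integral_cmult)
 qed
 then have 1: "c * ((1 - t) * (F / a) + t * (G / b)) <= (LINT x|lborel. h x)"
  using lh unfolding Uf Vf using t a b c FG h by (simp flip: ennreal_plus ennreal_mult')
 have "(F / a) powr (1 - t) * (G / b) powr t <= (1 - t) * (F / a) + t * (G / b)"
  using t a b FG by (intro Youngs_inequality_0) auto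
 then have "c * ((F / a) powr (1 - t) * (G / b) powr t) <= c * ((1 - t) * (F / a) + t * (G / b))"
  using c by simp
 moreover have "c * ((F / a) powr (1 - t) * (G / b) powr t) = F powr (1 - t) * G powr t"
  using a b by (simp add: c_def powr_divide)
 ultimately show ?thesis using 1 unfolding F_def G_def by simp
qed

section \<open>Product Lebesgue measure: several coordinates and lattice translates\<close>

abbreviation (input) lebPi :: "'i set => ('i => real) measure" where
 "lebPi J \<equiv> PiM J (\<lambda>_. lborel)"

interpretation lebPi: product_sigma_finite "\<lambda>_. lborel :: real measure"
 by unfold_locales

lemma integrable_lebPi_bounded:
 fixes f :: "('i => real) => real"
 assumes J: "finite J" and [measurable]: "f : borel_measurable (lebPi J)"
  and f: "\<And>x. 0 <= f x" "\<And>x. f x <= B" "\<And>x. f x \<noteq> 0 ==> \<forall>i\<in>J. \<bar>x i\<bar> <= L"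
 shows "integrable (lebPi J) f"
proof (rule Bochner_Integration.integrable_bound)
 let ?Q = "PiE J (\<lambda>_. {-L..L})"
 show "integrable (lebPi J) (\<lambda>x. indicator ?Q x * B)"
  using J
  using J by (simp add: lebPi.emeasure_PiM emeasure_lborel_Icc_eq power_less_top_ennreal)
 show "AE x in lebPi J. norm (f x) <= norm (indicator ?Q x * B)"
 proof (intro AE_I2)
  fix x assume "x : space (lebPi J)"
  then have "x : extensional J" by (auto simp: space_PiM PiE_def)
  then show "norm (f x) <= norm (indicator ?Q x * B)"
   using f(1)[of x] f(2)[of x] f(3)[of x]
   by (cases "f x = 0") (auto simp: indicator_def PiE_iff abs_le_iff minus_le_iff)
 qed
qed simp

text \<open>Induction on the coordinates: the one-dimensional inequality for the sections shows that
  the partial integrals again satisfy the hypothesis. \<open>B\<close> is generalised because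
  integrating out a coordinate multiplies the bound by the length of the interval.\<close>

lemma prekopa_leindler:
 fixes f g h :: "('i => real) => real"
 assumes t: "0 < t" "t < 1" and J: "finite J"
  and "f : borel_measurable (lebPi J)" "g : borel_measurable (lebPi J)" "h : borel_measurable (lebPi J)"
  and "\<And>x. 0 <= f x" "\<And>x. f x <= B" "\<And>x. f x \<noteq> 0 ==> \<forall>i\<in>J. \<bar>x i\<bar> <= L"
  and "\<And>x. 0 <= g x" "\<And>x. g x <= B" "\<And>x. g x \<noteq> 0 ==> \<forall>i\<in>J. \<bar>x i\<bar> <= L"
  and "\<And>x. 0 <= h x" "\<And>x. h x <= B" "\<And>x. h x \<noteq> 0 ==> \<forall>i\<in>J. \<bar>x i\<bar> <= L"
  and "\<And>x y. x : extensional J ==> y : extensional J ==>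
   f x powr (1 - t) * g y powr t <= h (\<lambda>i\<in>J. (1 - t) * x i + t * y i)"
 shows "(LINT x|lebPi J. f x) powr (1 - t) * (LINT x|lebPi J. g x) powr t <= (LINT x|lebPi J. h x)"
 using J assms(4-)
proof (induction J arbitrary: f g h B rule: finite_induct)
 case empty
 moreover have "(LINT x|lebPi {}. u x) = u (\<lambda>_. undefined)" for u :: "('i => real) => real"
  by (simp add: PiM_empty lebesgue_integral_count_space_finite)
 ultimately show ?case using empty.prems(13)[of "\<lambda>_. undefined" "\<lambda>_. undefined"] by simp
next
 case (insert k J)
 note meas = insert.prems(1-3) and f = insert.prems(4-6) and g = insert.prems(7-9) and h = insert.prems(10-12) and fgh = insert.prems(13)
 \<comment> \<open>Sections of \<open>u\<close> are controlled only at extensional points; the value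
   0 elsewhere lets the pointwise hypotheses of the induction hold at every function.\<close>
 define red where "red u = (\<lambda>x :: 'i => real. if x : extensional J then (LINT y|lborel. u (x(k := y))) else 0)" for u :: "('i => real) => real"
 have secm: "(\<lambda>y. u (x(k := y))) : borel_measurable borel" if "u : borel_measurable (lebPi (insert k J))" "x : extensional J" for u x
 proof -
  have "(\<lambda>y. x(k := y)) : borel \<rightarrow>\<^sub>M lebPi (insert k J)"
   using that(2) by (intro measurable_PiM_single') (auto simp: extensional_def PiE_iff space_PiM intro: measurable_const)
  then show ?thesis using that(1) by simp
 qed
 have redp: "red u : borel_measurable (lebPi J)" "0 <= red u x" "red u x <= B * (2 * \<bar>L\<bar>)" "red u x \<noteq> 0 ==> \<forall>i\<in>J. \<bar>x i\<bar> <= L"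
  "(LINT x|lebPi (insert k J). u x) = (LINT x|lebPi J. red u x)"
  if um: "u : borel_measurable (lebPi (insert k J))" and u: "\<And>x. 0 <= u x" "\<And>x. u x <= B" "\<And>x. u x \<noteq> 0 ==> \<forall>i\<in>insert k J. \<bar>x i\<bar> <= L" for u x
 proof -
  note [measurable] = um
  have B: "B >= 0" using u(1,2)[of undefined] by simp
  have eq: "x : space (lebPi J) ==> red u x = (LINT y|lborel. u (x(k := y)))" for x
   by (auto simp: red_def space_PiM PiE_def)
  then show "red u : borel_measurable (lebPi J)" by (subst measurable_cong[OF eq]) auto
  show "0 <= red u x" unfolding red_def using u(1) by simp
  show "red u x <= B * (2 * \<bar>L\<bar>)"
  proof (cases "x : extensional J")
   case True
   have "(LINT y|lborel. u (x(k := y))) <= (LINT y|lborel. indicator {-\<bar>L\<bar>..\<bar>L\<bar>} y * B)"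
   proof (rule integral_mono_AE')
    show "integrable lborel (\<lambda>y. indicator {-\<bar>L\<bar>..\<bar>L\<bar>} y * B)"
     by simp
    show "AE y in lborel. u (x(k := y)) <= indicator {-\<bar>L\<bar>..\<bar>L\<bar>} y * B"
    proof (intro AE_I2)
     fix y show "u (x(k := y)) <= indicator {-\<bar>L\<bar>..\<bar>L\<bar>} y * B"
      using u(1,2,3)[of "x(k := y)"] B by (cases "u (x(k := y)) = 0") (auto simp: indicator_def abs_le_iff)
    qed
    show "AE y in lborel. 0 <= indicator {-\<bar>L\<bar>..\<bar>L\<bar>} y * B" using B by simp
   qed
   also have "... = B * (2 * \<bar>L\<bar>)" by simp
   finally show ?thesis using True by (simp add: red_def)
  qed (use B in \<open>simp add: red_def\<close>)
  show "red u x \<noteq> 0 ==> \<forall>i\<in>J. \<bar>x i\<bar> <= L"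
  proof -
   assume "red u x \<noteq> 0"
   then have "\<exists>y. u (x(k := y)) \<noteq> 0" by (rule contrapos_np) (simp add: red_def)
   then obtain y where "u (x(k := y)) \<noteq> 0" by auto
   from u(3)[OF this] show ?thesis using insert.hyps by (metis fun_upd_apply insertCI)
  qed
  have "(LINT x|lebPi (insert k J). u x) = (LINT x|lebPi J. LINT y|lborel. u (x(k := y)))"
   using insert.hyps u um by (intro lebPi.product_integral_insert integrable_lebPi_bounded[of _ _ B L]) auto
  then show "(LINT x|lebPi (insert k J). u x) = (LINT x|lebPi J. red u x)"
   by (simp add: eq cong: Bochner_Integration.integral_cong)
 qed
 note rf = redp[OF meas(1) f] and rg = redp[OF meas(2) g] and rh = redp[OF meas(3) h]
 have "red f x powr (1 - t) * red g y powr t <= red h (\<lambda>i\<in>J. (1 - t) * x i + t * y i)"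
  if x: "x : extensional J" and y: "y : extensional J" for x y
 proof -
  let ?z = "\<lambda>i\<in>J. (1 - t) * x i + t * y i"
  have "(LINT s|lborel. f (x(k := s))) powr (1 - t) * (LINT s|lborel. g (y(k := s))) powr t <= (LINT s|lborel. h (?z(k := s)))"
  proof (rule prekopa_leindler_real[OF t, where B = B and L = L])
   show "\<bar>s\<bar> <= L" if "f (x(k := s)) \<noteq> 0" for s using f(3)[OF that] by simp
   show "\<bar>s\<bar> <= L" if "g (y(k := s)) \<noteq> 0" for s using g(3)[OF that] by simp
   show "\<bar>s\<bar> <= L" if "h (?z(k := s)) \<noteq> 0" for s using h(3)[OF that] by simp
   fix a b :: real
   have "f (x(k := a)) powr (1 - t) * g (y(k := b)) powr t <= h (\<lambda>i\<in>insert k J. (1 - t) * (x(k := a)) i + t * (y(k := b)) i)"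
    using x y by (intro fgh) (auto simp: extensional_def)
   also have "(\<lambda>i\<in>insert k J. (1 - t) * (x(k := a)) i + t * (y(k := b)) i) = ?z(k := (1 - t) * a + t * b)"
    by auto
   finally show "f (x(k := a)) powr (1 - t) * g (y(k := b)) powr t <= h (?z(k := (1 - t) * a + t * b))" .
  qed (use f(1,2) g(1,2) h(1,2) x y meas secm in \<open>simp_all\<close>)
  then show ?thesis using x y by (simp add: red_def)
 qed
 then have "(LINT x|lebPi J. red f x) powr (1 - t) * (LINT x|lebPi J. red g x) powr t <= (LINT x|lebPi J. red h x)"
  by (intro insert.IH[where B = "B * (2 * \<bar>L\<bar>)"] rf(1-4) rg(1-4) rh(1-4))
 then show ?case using rf(5) rg(5) rh(5) by simp
qed

lemma lebPi_shift:
 fixes c :: "'i => real"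
 assumes J: "finite J" and f: "f : borel_measurable (lebPi J)"
 shows "(\<integral>\<^sup>+x. f (\<lambda>i\<in>J. x i + c i) \<partial>lebPi J) = (\<integral>\<^sup>+x. f x \<partial>lebPi J)"
proof -
 have "distr (lebPi J) (lebPi J) (\<lambda>x. \<lambda>i\<in>J. x i + c i) = lebPi J"
 proof (rule lebPi.PiM_eqI)
  fix A :: "'i => real set" assume A: "\<And>i. i : J ==> A i : sets lborel"
  have sh: "emeasure lborel {x. x + u : X} = emeasure lborel X" if [measurable]: "X : sets borel" for X and u :: real
  proof -
   have "emeasure lborel X = (\<integral>\<^sup>+x. indicator X x \<partial>lborel)" by simp
   also have "... = (\<integral>\<^sup>+x. indicator X (u + 1 * x) \<partial>lborel)" using nn_integral_real_affine[of "indicator X" 1 u] by simp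
   also have "... = (\<integral>\<^sup>+x. indicator {x. x + u : X} x \<partial>lborel)" by (intro nn_integral_cong) (auto simp: indicator_def add.commute)
   finally show ?thesis by simp
  qed
  have "emeasure (distr (lebPi J) (lebPi J) (\<lambda>x. \<lambda>i\<in>J. x i + c i)) (PiE J A)
    = emeasure (lebPi J) ((\<lambda>x. \<lambda>i\<in>J. x i + c i) -` PiE J A \<inter> space (lebPi J))"
   using A J by (intro emeasure_distr) (auto intro!: sets_PiM_I_finite)
  also have "(\<lambda>x. \<lambda>i\<in>J. x i + c i) -` PiE J A \<inter> space (lebPi J) = PiE J (\<lambda>i. {x. x + c i : A i})"
   by (auto simp: space_PiM)
  also have "emeasure (lebPi J) ... = (\<Prod>i\<in>J. emeasure lborel {x. x + c i : A i})"
  proof (rule lebPi.emeasure_PiM[OF J])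
   fix i assume "i : J" then have [measurable]: "A i : sets borel" using A by simp
   show "{x. x + c i : A i} : sets lborel" by simp
  qed
  also have "... = (\<Prod>i\<in>J. emeasure lborel (A i))" using A by (intro prod.cong sh) auto
  finally show "emeasure (distr (lebPi J) (lebPi J) (\<lambda>x. \<lambda>i\<in>J. x i + c i)) (PiE J A) = (\<Prod>i\<in>J. emeasure lborel (A i))" .
 qed (use J in auto)
 then have "(\<integral>\<^sup>+x. f x \<partial>lebPi J) = (\<integral>\<^sup>+x. f x \<partial>distr (lebPi J) (lebPi J) (\<lambda>x. \<lambda>i\<in>J. x i + c i))" by simp
 also have "... = (\<integral>\<^sup>+x. f (\<lambda>i\<in>J. x i + c i) \<partial>lebPi J)" using f by (intro nn_integral_distr) auto
 finally show ?thesis by simp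
qed

text \<open>Blichfeldt's argument: reduce \<open>S\<close> modulo the lattice into the cube
  \<open>Q\<close>. By \<open>sep\<close> no point of \<open>Q\<close> is hit twice, so the volume
  of \<open>S\<close> is at most that of \<open>Q\<close>.\<close>

lemma lattice_packing:
 fixes S :: "('i => real) set"
 assumes J: "finite J" and s: "s > 0" and S: "S : sets (lebPi J)" and bd: "\<And>x i. x : S ==> i : J ==> \<bar>x i\<bar> <= L"
  and sep: "\<And>x y (k :: 'i => int). [|x : S; y : S; \<And>i. i : J ==> y i - x i = s * real_of_int (k i)|] ==> \<forall>i\<in>J. k i = (0::int)"
 shows "emeasure (lebPi J) S <= ennreal (s ^ card J)"
proof -
 define M :: int where "M = \<lceil>\<bar>L\<bar> / s\<rceil> + 1"
 define KK where "KK = PiE J (\<lambda>_. {-M..M})"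
 have fKK: "finite KK" unfolding KK_def using J by (intro finite_PiE) auto
 define Q where "Q = PiE J (\<lambda>_. {0..<s})"
 have Qs [measurable]: "Q : sets (lebPi J)" unfolding Q_def using J by simp
 note S[measurable]
 have one: "indicator S x <= (\<Sum>k\<in>KK. indicator S x * indicator Q (\<lambda>i\<in>J. x i + (- s * k i)) :: ennreal)" for x
 proof (cases "x : S")
  case True
  define k where "k = (\<lambda>i\<in>J. \<lfloor>x i / s\<rfloor>)"
  have "k : KK"
  proof -
   have "\<bar>\<lfloor>x i / s\<rfloor>\<bar> <= M" if "i : J" for i
   proof -
    have "\<bar>x i / s\<bar> <= \<bar>L\<bar> / s" using bd[OF True that] s by (simp add: divide_right_mono)
    then show ?thesis unfolding M_def by linarith
   qed
   then show ?thesis unfolding KK_def k_def by force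
  qed
  moreover have "(\<lambda>i\<in>J. x i + (- s * k i)) : Q"
  proof -
   have "0 <= x i - s * \<lfloor>x i / s\<rfloor> \<and> x i - s * \<lfloor>x i / s\<rfloor> < s" for i
    using floor_divide_lower[OF s, of "x i"] floor_divide_upper[OF s, of "x i"] by (simp add: algebra_simps)
   then show ?thesis unfolding Q_def k_def by auto
  qed
  ultimately have "(1::ennreal) <= (\<Sum>k\<in>{k}. indicator S x * indicator Q (\<lambda>i\<in>J. x i + (- s * k i)))" using True by simp
  also have "... <= (\<Sum>k\<in>KK. indicator S x * indicator Q (\<lambda>i\<in>J. x i + (- s * k i)))"
   using fKK \<open>k : KK\<close> by (intro sum_mono2) auto
  finally show ?thesis using True by simp
 qed simp
 have "emeasure (lebPi J) S = (\<integral>\<^sup>+x. indicator S x \<partial>lebPi J)" by simp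
 also have "... <= (\<integral>\<^sup>+x. (\<Sum>k\<in>KK. indicator S x * indicator Q (\<lambda>i\<in>J. x i + (- s * k i))) \<partial>lebPi J)"
  using one by (intro nn_integral_mono)
 also have "... = (\<Sum>k\<in>KK. \<integral>\<^sup>+x. indicator S x * indicator Q (\<lambda>i\<in>J. x i + (- s * k i)) \<partial>lebPi J)"
  by (intro nn_integral_sum) measurable
 also have "... = (\<Sum>k\<in>KK. \<integral>\<^sup>+x. indicator S (\<lambda>i\<in>J. x i + s * k i) * indicator Q x \<partial>lebPi J)"
 proof (intro sum.cong refl)
  fix k assume "k : KK"
  have "(\<integral>\<^sup>+x. indicator S x * indicator Q (\<lambda>i\<in>J. x i + (- s * k i)) \<partial>lebPi J)
   = (\<integral>\<^sup>+x. indicator S (\<lambda>i\<in>J. x i + s * k i) * indicator Q (\<lambda>i\<in>J. (\<lambda>i\<in>J. x i + s * k i) i + (- s * k i)) \<partial>lebPi J)"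
   by (rule lebPi_shift[OF J, symmetric]) measurable
  also have "... = (\<integral>\<^sup>+x. indicator S (\<lambda>i\<in>J. x i + s * k i) * indicator Q x \<partial>lebPi J)"
  proof (intro nn_integral_cong)
   fix x assume "x : space (lebPi J)"
   then have "(\<lambda>i\<in>J. (\<lambda>i\<in>J. x i + s * k i) i + (- s * k i)) = x"
    by (auto simp: space_PiM fun_eq_iff)
   then show "indicator S (\<lambda>i\<in>J. x i + s * k i) * indicator Q (\<lambda>i\<in>J. (\<lambda>i\<in>J. x i + s * k i) i + (- s * k i))
    = (indicator S (\<lambda>i\<in>J. x i + s * k i) * indicator Q x :: ennreal)" by simp
  qed
  finally show "(\<integral>\<^sup>+x. indicator S x * indicator Q (\<lambda>i\<in>J. x i + (- s * k i)) \<partial>lebPi J)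
   = (\<integral>\<^sup>+x. indicator S (\<lambda>i\<in>J. x i + s * k i) * indicator Q x \<partial>lebPi J)" .
 qed
 also have "... = (\<integral>\<^sup>+x. (\<Sum>k\<in>KK. indicator S (\<lambda>i\<in>J. x i + s * k i) * indicator Q x) \<partial>lebPi J)"
  by (intro nn_integral_sum[symmetric]) measurable
 also have "... <= (\<integral>\<^sup>+x. indicator Q x \<partial>lebPi J)"
 proof (intro nn_integral_mono)
  fix x :: "'i => real"
  have "(\<Sum>k\<in>KK. indicator S (\<lambda>i\<in>J. x i + s * k i)) <= (1::ennreal)"
  proof (cases "\<exists>k0\<in>KK. (\<lambda>i\<in>J. x i + s * k0 i) : S")
   case True
   then obtain k0 where k0: "k0 : KK" "(\<lambda>i\<in>J. x i + s * k0 i) : S" by auto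
   have "k = k0" if "k : KK" "(\<lambda>i\<in>J. x i + s * k i) : S" for k
   proof -
    have "\<forall>i\<in>J. k i - k0 i = 0"
      using sep[OF k0(2) that(2), of "\<lambda>i. k i - k0 i"] by (simp add: algebra_simps)
    then show ?thesis
     by (intro PiE_ext[OF that(1)[unfolded KK_def] k0(1)[unfolded KK_def]]) simp
   qed
   then have uniq: "(\<lambda>i\<in>J. x i + s * k i) : S \<longleftrightarrow> k = k0" if "k : KK" for k
    using k0(2) that by auto
   have "(\<Sum>k\<in>KK. indicator S (\<lambda>i\<in>J. x i + s * k i)) = (\<Sum>k\<in>KK. if k = k0 then 1 else (0::ennreal))"
   proof (rule sum.cong[OF refl])
    fix k assume "k : KK"
    from uniq[OF this] show "indicator S (\<lambda>i\<in>J. x i + s * k i) = (if k = k0 then 1 else (0::ennreal))"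
     by auto
   qed
   also have "... = 1" using fKK k0(1) by simp
   finally show ?thesis by simp
  next
   case False
   then show ?thesis by simp
  qed
  then show "(\<Sum>k\<in>KK. indicator S (\<lambda>i\<in>J. x i + s * k i) * indicator Q x) <= (indicator Q x :: ennreal)"
   by (simp add: indicator_def)
 qed
 also have "... = emeasure (lebPi J) Q" by simp
 also have "... = ennreal (s ^ card J)"
  unfolding Q_def using J s by (subst lebPi.emeasure_PiM) (auto simp: prod_ennreal ennreal_power)
 finally show ?thesis .
qed

section \<open>The perturbed cost and its excess\<close>

text \<open>The square root is the norm of the pair \<open>(eps, v)\<close>: convex, and smooth for
  \<open>eps > 0\<close>. The term with \<open>dl\<close> supplies uniform convexity and is at the
  same time the weight of the secondary cost.\<close>

definition reg_cost :: "real => real => 'a::real_inner => real" where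
 "reg_cost eps dl v = sqrt (eps^2 + (norm v)^2) + dl * (norm v)^2"

text \<open>For \<open>v = x - y\<close> this is the extra cost of a path from \<open>x\<close> to
  \<open>y\<close> that at time \<open>t\<close> misses the interpolant by \<open>d\<close>, each
  leg being charged for its velocity. Convexity makes it nonnegative when
  \<open>dl >= 0\<close>.\<close>

definition cost_excess :: "real => real => real => 'a::real_inner => 'a => real" where
 "cost_excess t eps dl v d =
  t * reg_cost eps dl (v - d /\<^sub>R t) + (1 - t) * reg_cost eps dl (v + d /\<^sub>R (1 - t)) - reg_cost eps dl v"

text \<open>Half the second derivative of \<open>reg_cost\<close> at \<open>v\<close>, multiplied by
  \<open>1 / t + 1 / (1 - t)\<close>, the joint contribution of the two legs. It is polarised so
  that two different increments can be paired.\<close>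

definition excess_form :: "real => real => real => 'a::real_inner => 'a => 'a => real" where
 "excess_form t eps dl v d w =
  ((1 / (2 * sqrt (eps^2 + (norm v)^2)) + dl) * (d \<bullet> w)
   - (v \<bullet> d) * (v \<bullet> w) / (2 * sqrt (eps^2 + (norm v)^2) ^ 3)) / (t * (1 - t))"

text \<open>With \<open>a = sqrt (N^2 + s) - N\<close> one has \<open>s = a * (2 * N + a)\<close>,
  and the remainder is exactly \<open>a ^ 3 * (4 * N + a) / (8 * N ^ 3)\<close>; no derivatives
  enter.\<close>

lemma sqrt_taylor2:
 fixes N s :: real
 assumes N: "N > 0" and s: "N^2 + s >= 0"
 shows "\<bar>sqrt (N^2 + s) - N - s / (2 * N) + s^2 / (8 * N ^ 3)\<bar> <= \<bar>s\<bar> ^ 3 / N ^ 5"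
proof -
 define a where "a = sqrt (N^2 + s) - N"
 have aN: "a >= - N" using s by (simp add: a_def)
 have sa: "s = a * (2 * N + a)" using s by (simp add: a_def power2_eq_square algebra_simps)
 have eq: "sqrt (N^2 + s) - N - s / (2 * N) + s^2 / (8 * N ^ 3) = a ^ 3 * (4 * N + a) / (8 * N ^ 3)"
 proof -
  have "sqrt (N^2 + s) - N = a" by (simp add: a_def)
  then show ?thesis using N unfolding sa by (simp add: field_simps power2_eq_square power3_eq_cube)
 qed
 have "(4 * N + a) / (8 * N ^ 3) <= (2 * N + a) ^ 3 / N ^ 5"
 proof -
  have "N^2 * (2 * N + a) <= (2 * N + a)^2 * (2 * N + a)"
   using aN N by simp
  then have 1: "N^2 * (2 * N + a) <= (2 * N + a) ^ 3" by (simp add: power3_eq_cube power2_eq_square)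
  have "(4 * N + a) / (8 * N ^ 3) <= (8 * (2 * N + a)) / (8 * N ^ 3)"
   using aN N by (intro divide_right_mono) auto
  also have "... = N^2 * (2 * N + a) / N ^ 5" using N by (simp add: field_simps)
  also have "... <= (2 * N + a) ^ 3 / N ^ 5" using N 1 by (intro divide_right_mono) auto
  finally show ?thesis .
 qed
 moreover have "\<bar>a ^ 3 * (4 * N + a) / (8 * N ^ 3)\<bar> = \<bar>a\<bar> ^ 3 * ((4 * N + a) / (8 * N ^ 3))"
  using aN N by (simp add: abs_mult power_abs)
 ultimately have "\<bar>a ^ 3 * (4 * N + a) / (8 * N ^ 3)\<bar> <= \<bar>a\<bar> ^ 3 * ((2 * N + a) ^ 3 / N ^ 5)"
  by (metis abs_ge_zero mult_left_mono zero_le_power)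
 also have "... = \<bar>s\<bar> ^ 3 / N ^ 5"
  unfolding sa using aN N by (simp add: abs_mult power_mult_distrib)
 finally show ?thesis using eq by simp
qed

lemma norm_add_scaleR_sq:
 fixes v d :: "'a::real_inner"
 shows "(norm (v + a *\<^sub>R d))^2 = (norm v)^2 + 2 * a * (v \<bullet> d) + a^2 * (norm d)^2"
 unfolding power2_norm_eq_inner by (simp add: inner_simps inner_commute power2_eq_square algebra_simps)

lemma norm_diff_divideR_sq:
 fixes v d :: "'a::real_inner"
 shows "(norm (v - d /\<^sub>R t))^2 = (norm v)^2 - 2 * (v \<bullet> d) / t + (norm d)^2 / t^2"
 using norm_add_scaleR_sq[of v "- inverse t" d] by (simp add: divide_inverse power_inverse mult.commute mult.left_commute)

lemma norm_add_divideR_sq: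
 fixes v d :: "'a::real_inner"
 shows "(norm (v + d /\<^sub>R t))^2 = (norm v)^2 + 2 * (v \<bullet> d) / t + (norm d)^2 / t^2"
 using norm_add_scaleR_sq[of v "inverse t" d] by (simp add: divide_inverse power_inverse mult.commute mult.left_commute)

lemma convex_comb_sq_aux:
 fixes t p q :: real
 assumes "0 < t" "t < 1"
 shows "t * (- 2 * p / t + q / t^2) + (1 - t) * (2 * p / (1 - t) + q / (1 - t)^2) = q / (t * (1 - t))"
proof -
 define u where "u = 1 - t"
 have u: "u > 0" "t + u = 1" using assms by (auto simp: u_def)
 have "t * (- 2 * p / t + q / t^2) = - 2 * p + q / t" using assms by (simp add: field_simps power2_eq_square)
 moreover have "u * (2 * p / u + q / u^2) = 2 * p + q / u" using u by (simp add: field_simps power2_eq_square)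
 moreover have "q / t + q / u = q * (t + u) / (t * u)" using assms u(1) by (simp add: field_simps)
 ultimately show ?thesis using u unfolding u_def[symmetric] by simp
qed

lemma cost_excess_split:
 assumes "0 < t" "t < 1"
 shows "cost_excess t eps dl v d =
  (t * sqrt (eps^2 + (norm (v - d /\<^sub>R t))^2) + (1 - t) * sqrt (eps^2 + (norm (v + d /\<^sub>R (1 - t)))^2)
    - sqrt (eps^2 + (norm v)^2)) + dl * (norm d)^2 / (t * (1 - t))"
proof -
 have n1: "(norm (v - d /\<^sub>R t))^2 = (norm v)^2 - 2 * (v \<bullet> d) / t + (norm d)^2 / t^2"
  by (rule norm_diff_divideR_sq)
 have n2: "(norm (v + d /\<^sub>R (1-t)))^2 = (norm v)^2 + 2 * (v \<bullet> d) / (1-t) + (norm d)^2 / (1-t)^2"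
  by (rule norm_add_divideR_sq)
 have "dl * (t * (norm (v - d /\<^sub>R t))^2 + (1 - t) * (norm (v + d /\<^sub>R (1-t)))^2 - (norm v)^2) = dl * ((norm d)^2 / (t * (1-t)))"
  using convex_comb_sq_aux[OF assms, of "v \<bullet> d" "(norm d)^2"] unfolding n1 n2
  by (simp add: algebra_simps)
 then show ?thesis unfolding cost_excess_def reg_cost_def by (simp add: algebra_simps)
qed

lemma sqrt_taylor1:
 fixes N s :: real
 assumes N: "N > 0" and s: "N^2 + s >= 0"
 shows "sqrt (N^2 + s) <= N + s / (2 * N)"
proof -
 have "N + s / (2 * N) = (2 * N^2 + s) / (2 * N)" using N by (simp add: field_simps power2_eq_square)
 also have "... >= 0" using N s zero_le_power2[of N] by (intro divide_nonneg_pos) (linarith+)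
 finally have nn: "N + s / (2 * N) >= 0" .
 show ?thesis using N nn by (simp add: power2_sum power_divide real_le_lsqrt)
qed

text \<open>Lower bound: convexity of the norm of \<open>(eps, v)\<close> leaves the exact
  contribution of the quadratic term. Upper bound: the square root lies below its tangent, the terms
  linear in \<open>d\<close> cancel, and \<open>N >= eps\<close>; so it does not involve
  \<open>v\<close>.\<close>

lemma cost_excess_bounds:
 assumes t: "0 < t" "t < 1" and e: "0 < eps"
 shows "dl * (norm d)^2 / (t * (1 - t)) <= cost_excess t eps dl v d"
  and "cost_excess t eps dl v d <= slack t eps dl (norm d)"
proof -
 let ?r = "\<lambda>v. sqrt (eps^2 + (norm v)^2)"
 have nP: "?r v = norm (eps, v)" for v :: 'a by (simp add: norm_Pair)
 have "(eps, v) = t *\<^sub>R (eps, v - d /\<^sub>R t) + (1 - t) *\<^sub>R (eps, v + d /\<^sub>R (1 - t))"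
 proof -
  have "t *\<^sub>R (v - d /\<^sub>R t) = t *\<^sub>R v - d" "(1 - t) *\<^sub>R (v + d /\<^sub>R (1 - t)) = (1 - t) *\<^sub>R v + d"
   using t by (simp_all add: scaleR_right_distrib scaleR_right_diff_distrib)
  then show ?thesis by (simp add: scaleR_left_diff_distrib left_diff_distrib)
 qed
 then have "norm (eps, v) <= norm (t *\<^sub>R (eps, v - d /\<^sub>R t)) + norm ((1 - t) *\<^sub>R (eps, v + d /\<^sub>R (1 - t)))"
  by (metis norm_triangle_ineq)
 then have "?r v <= t * ?r (v - d /\<^sub>R t) + (1 - t) * ?r (v + d /\<^sub>R (1 - t))"
  unfolding nP using t by (simp only: norm_scaleR)
 then show "dl * (norm d)^2 / (t * (1 - t)) <= cost_excess t eps dl v d"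
  unfolding cost_excess_split[OF t] by simp
 define N where "N = ?r v"
 have N: "N >= eps" unfolding N_def by simp
 then have N: "N >= eps" "N > 0" using e by auto
 have N2: "N^2 = eps^2 + (norm v)^2" unfolding N_def by simp
 define s1 where "s1 = - 2 * (v \<bullet> d) / t + (norm d)^2 / t^2"
 define s2 where "s2 = 2 * (v \<bullet> d) / (1-t) + (norm d)^2 / (1-t)^2"
 have n1: "eps^2 + (norm (v - d /\<^sub>R t))^2 = N^2 + s1"
  unfolding N2 s1_def norm_diff_divideR_sq by simp
 have n2: "eps^2 + (norm (v + d /\<^sub>R (1-t)))^2 = N^2 + s2"
  unfolding N2 s2_def norm_add_divideR_sq by simp
 have p1: "N^2 + s1 >= 0" "N^2 + s2 >= 0" unfolding n1[symmetric] n2[symmetric] by auto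
 have ts: "t * s1 + (1 - t) * s2 = (norm d)^2 / (t * (1 - t))"
  unfolding s1_def s2_def by (rule convex_comb_sq_aux[OF t])
 have "t * ?r (v - d /\<^sub>R t) + (1 - t) * ?r (v + d /\<^sub>R (1 - t)) <= t * (N + s1 / (2*N)) + (1-t) * (N + s2 / (2*N))"
  unfolding n1 n2 using t N p1 by (intro add_mono mult_left_mono sqrt_taylor1) auto
 also have "... = N + (t * s1 + (1 - t) * s2) / (2 * N)" using N by (simp add: field_simps)
 also have "... <= N + (norm d)^2 / (t * (1 - t)) / (2 * eps)"
  unfolding ts using t N e by (intro add_left_mono divide_left_mono) auto
 finally show "cost_excess t eps dl v d <= slack t eps dl (norm d)"
  unfolding cost_excess_split[OF t] N_def[symmetric] distrib_right add_divide_distrib by (simp add: mult_ac)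
qed

text \<open>\<open>sqrt_taylor2\<close> expands in
  \<open>s = 2 * (v \<bullet> h) + (norm h)^2\<close>, which mixes first and second order in
  \<open>h\<close>; regrouping by order produces the second summand of the constant. What matters is
  uniformity over \<open>norm v <= R\<close>.\<close>

lemma regularised_norm_taylor:
 fixes v h :: "'a::real_inner"
 assumes e: "0 < eps" and v: "norm v <= R" and h: "norm h <= H"
 defines "N \<equiv> sqrt (eps^2 + (norm v)^2)"
 shows "\<bar>sqrt (eps^2 + (norm (v + h))^2) - (N + (v \<bullet> h) / N + ((norm h)^2 - ((v \<bullet> h) / N)^2) / (2 * N))\<bar>
  <= ((2 * R + H) ^ 3 / eps ^ 5 + (4 * R + H) / (8 * eps ^ 3)) * norm h ^ 3"
proof -
 define p where "p = v \<bullet> h" define q where "q = norm h" define s where "s = 2 * p + q^2"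
 have N: "eps <= N" "0 < N" using e real_le_rsqrt[of eps "eps^2 + (norm v)^2"] by (auto simp: N_def add_pos_nonneg)
 have n: "eps^2 + (norm (v + h))^2 = N^2 + s"
  using norm_add_scaleR_sq[of v 1 h] by (simp add: N_def s_def p_def q_def)
 have q: "0 <= q" "q^2 <= H * q" using h by (auto simp: q_def power2_eq_square mult_right_mono)
 have p: "\<bar>p\<bar> <= R * q" unfolding p_def q_def by (meson Cauchy_Schwarz_ineq2 order_trans mult_right_mono norm_ge_zero v)
 have s: "\<bar>s\<bar> <= (2 * R + H) * q" "\<bar>4 * p + q^2\<bar> <= (4 * R + H) * q" using p q zero_le_power2[of q] unfolding s_def distrib_right by linarith+
 have "\<bar>sqrt (N^2 + s) - N - s / (2 * N) + s^2 / (8 * N ^ 3)\<bar> <= \<bar>s\<bar> ^ 3 / N ^ 5"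
  using N n by (intro sqrt_taylor2) (auto simp flip: n)
 also have "... <= ((2 * R + H) * q) ^ 3 / eps ^ 5" using s(1) N e order_trans[OF abs_ge_zero s(1)] by (intro frac_le power_mono) auto
 finally have 1: "\<bar>sqrt (N^2 + s) - N - s / (2 * N) + s^2 / (8 * N ^ 3)\<bar> <= (2 * R + H) ^ 3 / eps ^ 5 * q ^ 3" by (simp add: power_mult_distrib)
 have "\<bar>4 * p + q^2\<bar> * q^2 / (8 * N ^ 3) <= (4 * R + H) * q * q^2 / (8 * eps ^ 3)"
  using s(2) N e order_trans[OF abs_ge_zero s(2)] by (intro frac_le mult_right_mono mult_left_mono power_mono) auto
 moreover have "(4 * R + H) * q * q^2 / (8 * eps ^ 3) = (4 * R + H) / (8 * eps ^ 3) * q ^ 3" by (simp add: power2_eq_square power3_eq_cube)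
 ultimately have 2: "\<bar>(4 * p + q^2) * q^2 / (8 * N ^ 3)\<bar> <= (4 * R + H) / (8 * eps ^ 3) * q ^ 3" using N by (simp add: abs_mult)
 have "s / (2 * N) - s^2 / (8 * N ^ 3) = p / N + (q^2 - (p / N)^2) / (2 * N) - (4 * p + q^2) * q^2 / (8 * N ^ 3)"
  using N unfolding s_def by (simp add: field_simps power2_eq_square power3_eq_cube)
 then have "\<bar>sqrt (N^2 + s) - (N + p / N + (q^2 - (p / N)^2) / (2 * N))\<bar> <= (2 * R + H) ^ 3 / eps ^ 5 * q ^ 3 + (4 * R + H) / (8 * eps ^ 3) * q ^ 3"
  using 1 2 by linarith
 then show ?thesis unfolding n p_def[symmetric] q_def[symmetric] by (simp only: distrib_right)
qed

lemma cost_excess_taylor: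
 assumes t: "0 < t" "t < 1" and e: "0 < eps" and RD: "0 <= R" "0 <= D"
 obtains C where "C >= 0"
  "\<And>v d :: 'a::real_inner. norm v <= R ==> norm d <= D ==>
   \<bar>cost_excess t eps dl v d - excess_form t eps dl v d d\<bar> <= C * norm d ^ 3"
proof -
 define H where "H = D / t + D / (1 - t)"
 define K where "K = (2 * R + H) ^ 3 / eps ^ 5 + (4 * R + H) / (8 * eps ^ 3)"
 have H: "D / t <= H" "D / (1 - t) <= H" "0 <= H" unfolding H_def using t RD by auto
 have K: "0 <= K" unfolding K_def using H RD e by simp
 have "\<bar>cost_excess t eps dl v d - excess_form t eps dl v d d\<bar> <= (K / t^2 + K / (1 - t)^2) * norm d ^ 3"
  if v: "norm v <= R" and d: "norm d <= D" for v d :: 'a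
 proof -
  define N where "N = sqrt (eps^2 + (norm v)^2)"
  define g where "g = ((norm d)^2 - ((v \<bullet> d) / N)^2) / (2 * N)"
  have E: "\<bar>sqrt (eps^2 + (norm (v + a *\<^sub>R d))^2) - (N + a * ((v \<bullet> d) / N) + a^2 * g)\<bar> <= K * (\<bar>a\<bar> * norm d) ^ 3" if "\<bar>a\<bar> * D <= H" for a
   using regularised_norm_taylor[OF e v, of "a *\<^sub>R d" H] order_trans[OF mult_left_mono[OF d, of "\<bar>a\<bar>"] that]
   by (simp add: K_def N_def g_def power_mult_distrib power_divide right_diff_distrib diff_divide_distrib)
  define x where "x a = N + a * ((v \<bullet> d) / N) + a^2 * g" for a
  define y where "y a = sqrt (eps^2 + (norm (v + a *\<^sub>R d))^2)" for a
  let ?G = "excess_form t eps dl v d d - dl * (norm d)^2 / (t * (1 - t))"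
  have dd: "d \<bullet> d = (norm d)^2" by (simp add: power2_norm_eq_inner)
  have G: "?G = g / (t * (1 - t))"
   unfolding excess_form_def N_def[symmetric] g_def dd diff_divide_distrib[symmetric]
   by (rule arg_cong2[where f = "(/)"]) (simp_all add: distrib_right diff_divide_distrib power2_eq_square power3_eq_cube)
  have xx: "t * x (- 1 / t) + (1 - t) * x (1 / (1 - t)) = N + ?G"
   using convex_comb_sq_aux[OF t, of "(v \<bullet> d) / N / 2" g] t unfolding G x_def by (simp add: power_divide algebra_simps)
  have "cost_excess t eps dl v d - excess_form t eps dl v d d = t * y (- 1 / t) + (1 - t) * y (1 / (1 - t)) - (N + ?G)"
   unfolding cost_excess_split[OF t] N_def[symmetric] y_def by (simp add: divide_inverse)
  also have "... = t * (y (- 1 / t) - x (- 1 / t)) + (1 - t) * (y (1 / (1 - t)) - x (1 / (1 - t)))"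
   unfolding xx[symmetric] by (simp add: right_diff_distrib)
  also have "\<bar>...\<bar> <= t * (K * (\<bar>- 1 / t\<bar> * norm d) ^ 3) + (1 - t) * (K * (\<bar>1 / (1 - t)\<bar> * norm d) ^ 3)"
  proof -
   have "\<bar>a * z\<bar> <= a * b" if "0 <= a" "\<bar>z\<bar> <= b" for a b z :: real using that by (simp add: abs_mult mult_left_mono)
   moreover have "\<bar>y (- 1 / t) - x (- 1 / t)\<bar> <= K * (\<bar>- 1 / t\<bar> * norm d) ^ 3" "\<bar>y (1 / (1 - t)) - x (1 / (1 - t))\<bar> <= K * (\<bar>1 / (1 - t)\<bar> * norm d) ^ 3"
    unfolding x_def y_def using t H by (intro E; simp)+
   ultimately show ?thesis using t by (intro order_trans[OF abs_triangle_ineq] add_mono) auto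
  qed
  also have "... = (K / t^2 + K / (1 - t)^2) * norm d ^ 3"
   using t by (simp add: power2_eq_square power3_eq_cube distrib_right)
  finally show ?thesis .
 qed
 then show thesis using that[of "K / t^2 + K / (1 - t)^2"] K by auto
qed

lemma excess_form_add:
 "excess_form t eps dl v (d + w) (d + w) = excess_form t eps dl v d d + 2 * excess_form t eps dl v d w + excess_form t eps dl v w w"
 unfolding excess_form_def
 unfolding inner_add_left inner_add_right distrib_left distrib_right add_divide_distrib diff_divide_distrib
 by (simp add: inner_commute[of w d] algebra_simps)

lemma excess_form_diff_left:
 "excess_form t eps dl v (d - d') w = excess_form t eps dl v d w - excess_form t eps dl v d' w"
 unfolding excess_form_def
 unfolding inner_diff_left inner_diff_right left_diff_distrib right_diff_distrib diff_divide_distrib by simp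

lemma excess_form_scale_left:
 "excess_form t eps dl v (a *\<^sub>R d) w = a * excess_form t eps dl v d w"
 unfolding excess_form_def by (simp add: right_diff_distrib mult_ac)

lemma excess_form_minus_right:
 "excess_form t eps dl v d (- w) = - excess_form t eps dl v d w"
proof -
 have sym: "excess_form t eps dl v d w = excess_form t eps dl v w d" for w
  unfolding excess_form_def by (simp add: inner_commute[of w d])
 show ?thesis using excess_form_scale_left[of t eps dl v "-1" w d] by (simp add: sym)
qed

lemma inner_mult_inner_bound:
 fixes v u d w :: "'a::real_inner"
 shows "\<bar>(v \<bullet> d) * (u \<bullet> w)\<bar> <= norm v * norm u * (norm d * norm w)"
proof -
 have "\<bar>v \<bullet> d\<bar> * \<bar>u \<bullet> w\<bar> <= (norm v * norm d) * (norm u * norm w)"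
  by (intro mult_mono Cauchy_Schwarz_ineq2) auto
 then show ?thesis by (simp add: abs_mult mult_ac)
qed

text \<open>Boundedness, coercivity and Lipschitz dependence on \<open>v\<close>. Everything is
  expressed through \<open>u v\<close>, the quotient of \<open>v\<close> by \<open>N v\<close>: it
  has norm at most 1, which makes the form without the term in \<open>dl\<close> nonnegative, and it
  is Lipschitz in \<open>v\<close> with constant \<open>2 / eps\<close>.\<close>

lemma excess_form_bounds:
 assumes t: "0 < t" "t < 1" and e: "0 < eps" and d: "0 <= dl"
 shows "\<bar>excess_form t eps dl v d w\<bar> <= (1 / eps + dl) / (t * (1 - t)) * (norm d * norm w)"
  and "dl * (norm w)^2 / (t * (1 - t)) <= excess_form t eps dl v w w"
  and "\<bar>excess_form t eps dl v d w - excess_form t eps dl v' d w\<bar> <= 3 / eps^2 / (t * (1 - t)) * norm (v - v') * (norm d * norm w)"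
proof -
 define N where "N v = sqrt (eps^2 + (norm v)^2)" for v :: 'a
 define u where "u v = v /\<^sub>R N v" for v
 define P where "P = norm d * norm w"
 have N: "N v >= norm v" "N v >= eps" "0 < N v" "inverse (N v) <= 1 / eps" for v
  using e by (auto simp: N_def real_le_rsqrt add_pos_nonneg divide_inverse intro!: le_imp_inverse_le)
 have u: "norm (u v) <= 1" for v using N(1,3)[of v] by (simp add: u_def field_simps)
 have P: "0 <= P" "\<bar>d \<bullet> w\<bar> <= P" by (simp_all add: P_def Cauchy_Schwarz_ineq2)
 have uu: "\<bar>(x \<bullet> d) * (y \<bullet> w)\<bar> <= norm x * norm y * P" for x y unfolding P_def by (rule inner_mult_inner_bound)
 have i: "1 / (2 * N v) = inverse (N v) / 2" "x / (2 * N v ^ 3) = x * inverse (N v) ^ 3 / 2" for v x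
  using N(3)[of v] by (simp_all add: field_simps)
 have Q: "excess_form t eps dl v d w = (inverse (N v) * (d \<bullet> w - (u v \<bullet> d) * (u v \<bullet> w)) / 2 + dl * (d \<bullet> w)) / (t * (1 - t))" for v d w
  unfolding excess_form_def N_def[symmetric] u_def i inner_scaleR_left
  by (rule arg_cong2[where f = "(/)", OF _ refl]) (simp only: distrib_left distrib_right right_diff_distrib diff_divide_distrib power3_eq_cube mult_ac, simp)
 have b: "\<bar>d \<bullet> w - (u v \<bullet> d) * (u v \<bullet> w)\<bar> <= 2 * P" for v
  using uu[of "u v" "u v"] mult_mono[OF u u, of v v] P mult_right_mono[of "norm (u v) * norm (u v)" 1 P] by simp
 have "\<bar>inverse (N v) * (d \<bullet> w - (u v \<bullet> d) * (u v \<bullet> w))\<bar> <= 1 / eps * (2 * P)"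
  unfolding abs_mult using b N[of v] e by (intro mult_mono) auto
 moreover have "\<bar>dl * (d \<bullet> w)\<bar> <= dl * P" using P d by (simp add: abs_mult mult_left_mono)
 ultimately have "\<bar>inverse (N v) * (d \<bullet> w - (u v \<bullet> d) * (u v \<bullet> w)) / 2 + dl * (d \<bullet> w)\<bar> <= (1 / eps + dl) * P"
  by (simp add: distrib_right)
 then show "\<bar>excess_form t eps dl v d w\<bar> <= (1 / eps + dl) / (t * (1 - t)) * (norm d * norm w)"
  unfolding Q P_def using t by (simp add: divide_right_mono)
 have "(u v \<bullet> w) * (u v \<bullet> w) <= 1 * 1 * (norm w * norm w)"
  using inner_mult_inner_bound[of "u v" w "u v" w] mult_mono[OF u u, of v v] by (smt (verit) mult_right_mono norm_ge_zero mult_nonneg_nonneg)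
 then have "0 <= inverse (N v) * (w \<bullet> w - (u v \<bullet> w) * (u v \<bullet> w)) / 2" using N(3)[of v] by (simp add: power2_norm_eq_inner[symmetric] power2_eq_square)
 then show "dl * (norm w)^2 / (t * (1 - t)) <= excess_form t eps dl v w w"
  unfolding Q using t by (intro divide_right_mono) (auto simp: power2_norm_eq_inner)
 define D where "D = norm (v - v')"
 have "\<bar>N v' - N v\<bar> <= D"
  using norm_triangle_ineq3[of "(eps, v')" "(eps, v)"] by (simp add: N_def D_def norm_Pair norm_minus_commute)
 moreover have iN: "inverse (N v) - inverse (N v') = (N v' - N v) * (inverse (N v) * inverse (N v'))" using N(3)[of v] N(3)[of v'] by (simp add: field_simps)
 ultimately have di: "\<bar>inverse (N v) - inverse (N v')\<bar> <= D * (inverse (N v) * inverse (N v'))"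
  using N(3)[of v] N(3)[of v'] by (simp add: abs_mult mult_right_mono)
 also have "... <= D * (1 / eps * (1 / eps))" using N e by (intro mult_left_mono mult_mono) (auto simp: D_def less_imp_le)
 finally have dN: "\<bar>inverse (N v) - inverse (N v')\<bar> <= D / eps^2" by (simp add: power2_eq_square)
 have "norm (u v - u v') <= norm (inverse (N v) *\<^sub>R (v - v')) + norm ((inverse (N v) - inverse (N v')) *\<^sub>R v')"
  unfolding u_def by (rule order_trans[OF _ norm_triangle_ineq]) (simp add: algebra_simps)
 also have "... <= 1 / eps * D + D * (inverse (N v) * inverse (N v')) * N v'"
  unfolding norm_scaleR D_def[symmetric] using e N(3,4)[of v] N(1,3)[of v'] di by (intro add_mono mult_mono) (auto simp: D_def)
 also have "... = 1 / eps * D + D * inverse (N v)" using N(3)[of v'] by simp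
 also have "... <= 1 / eps * D + D * (1 / eps)" using N(4)[of v] by (intro add_left_mono mult_left_mono) (auto simp: D_def)
 finally have du: "norm (u v - u v') <= 2 * D / eps" by simp
 let ?g = "\<lambda>v. d \<bullet> w - (u v \<bullet> d) * (u v \<bullet> w)"
 have "?g v' - ?g v = ((u v - u v') \<bullet> d) * (u v \<bullet> w) + (u v' \<bullet> d) * ((u v - u v') \<bullet> w)" by (simp add: inner_diff_left algebra_simps)
 then have "\<bar>?g v' - ?g v\<bar> <= norm (u v - u v') * norm (u v) * P + norm (u v') * norm (u v - u v') * P"
  using uu[of "u v - u v'" "u v"] uu[of "u v'" "u v - u v'"] by linarith
 also have "... <= (2 * D / eps) * 1 * P + 1 * (2 * D / eps) * P" using u du P by (intro add_mono mult_right_mono mult_mono) (auto intro: order_trans[OF norm_ge_zero])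
 finally have dg: "\<bar>?g v' - ?g v\<bar> <= 4 * D / eps * P" by simp
 have "excess_form t eps dl v d w - excess_form t eps dl v' d w = ((inverse (N v) - inverse (N v')) * ?g v + inverse (N v') * (?g v - ?g v')) / 2 / (t * (1 - t))"
  unfolding Q diff_divide_distrib[symmetric] by (simp add: algebra_simps diff_divide_distrib add_divide_distrib)
 moreover have "\<bar>(inverse (N v) - inverse (N v')) * ?g v\<bar> <= D / eps^2 * (2 * P)" unfolding abs_mult using dN b by (intro mult_mono) auto
 moreover have "\<bar>inverse (N v') * (?g v - ?g v')\<bar> <= 1 / eps * (4 * D / eps * P)"
  unfolding abs_mult using dg N(3,4)[of v'] e by (intro mult_mono) auto
 ultimately have "\<bar>excess_form t eps dl v d w - excess_form t eps dl v' d w\<bar> <= (D / eps^2 * (2 * P) + 1 / eps * (4 * D / eps * P)) / 2 / (t * (1 - t))"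
  using t by (simp add: divide_right_mono)
 also have "... = 3 / eps^2 / (t * (1 - t)) * D * P" by (simp add: power2_eq_square add_divide_distrib)
 finally show "\<bar>excess_form t eps dl v d w - excess_form t eps dl v' d w\<bar> <= 3 / eps^2 / (t * (1 - t)) * norm (v - v') * (norm d * norm w)"
  by (simp add: D_def P_def)
qed

text \<open>The differences of the excess along two opposite lattice steps \<open>w\<close> and \<open>-w\<close> are governed by the same
 quadratic form up to third order, so two displacements that both beat their neighbours cannot
 differ by a vector noticeably longer than a lattice step.\<close>

lemma excess_lattice_gap:
 fixes R K :: real
 assumes t: "0 < t" "t < 1" and e: "0 < eps" and d: "0 < dl" and R: "0 <= R" and K: "0 <= K"
 obtains C where "C >= 0"
  "\<And>s rho v v' d d' du du' (w :: 'a::real_inner).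
   [|0 < s; s <= 1; norm v <= R; norm v' <= R; norm (v - v') <= K * s; norm d <= K * s; norm d' <= K * s;
    norm (du - d) <= K * s^2; norm (du' - d') <= K * s^2; s <= norm w; norm w <= K * s;
    cost_excess t eps dl v d <= cost_excess t eps dl v (d + w);
    cost_excess t eps dl v' d' <= cost_excess t eps dl v' (d' - w);
    du' - du = rho *\<^sub>R w; rho >= 1|] ==> rho - 1 <= C * s"
proof -
 obtain CT where CT: "CT >= 0" "\<And>v d :: 'a. norm v <= R ==> norm d <= 2 * K ==>
   \<bar>cost_excess t eps dl v d - excess_form t eps dl v d d\<bar> <= CT * norm d ^ 3"
  using cost_excess_taylor[OF t e R, of "2 * K" dl] K by auto
 define CL where "CL = 3 / eps^2 / (t * (1 - t))"
 have CL: "CL >= 0" using t by (simp add: CL_def)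
 define CB where "CB = (1 / eps + dl) / (t * (1 - t))"
 have CB: "CB >= 0" unfolding CB_def using t e d by auto
 have CBb: "\<bar>excess_form t eps dl v d w\<bar> <= CB * (norm d * norm w)" for v d w :: 'a
  unfolding CB_def using d by (intro excess_form_bounds(1) t e) auto
 define C0 where "C0 = 2 * (CT * (2 * K) ^ 3 + CT * K ^ 3) + CL * K ^ 3 + 2 * (CL * K ^ 3) + 4 * (CB * K^2)"
 have C0: "C0 >= 0" unfolding C0_def using CT CL CB K by auto
 define C where "C = C0 * (t * (1 - t)) / dl"
 have "rho - 1 <= C * s"
  if s: "0 < s" "s <= 1" and v: "norm v <= R" "norm v' <= R" "norm (v - v') <= K * s"
   and dd: "norm d <= K * s" "norm d' <= K * s" and du: "norm (du - d) <= K * s^2" "norm (du' - d') <= K * s^2"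
   and w: "s <= norm w" "norm w <= K * s"
   and S1: "cost_excess t eps dl v d <= cost_excess t eps dl v (d + w)"
   and S2: "cost_excess t eps dl v' d' <= cost_excess t eps dl v' (d' - w)"
   and rho: "du' - du = rho *\<^sub>R w" "rho >= 1" for s rho and v v' d d' du du' w :: 'a
 proof -
  let ?Q = "excess_form t eps dl"
  have Ks: "K * s <= K" using s K by (simp add: mult_left_le)
  \<comment> \<open>Minimality of \<open>p\<close> against the competitor \<open>p + z\<close>,
    expanded to second order; the error is cubic because \<open>p\<close> and \<open>z\<close> are
    of size \<open>s\<close>.\<close>
  have step: "2 * ?Q u p z + ?Q u z z >= - (CT * (2 * K) ^ 3 + CT * K ^ 3) * s ^ 3"
   if "norm u <= R" "norm p <= K * s" "norm z <= K * s" "cost_excess t eps dl u p <= cost_excess t eps dl u (p + z)" for u p z :: 'a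
  proof -
   have pz: "norm (p + z) <= 2 * K * s" using norm_triangle_ineq[of p z] that by simp
   have "\<bar>cost_excess t eps dl u p - ?Q u p p\<bar> <= CT * norm p ^ 3"
    using that Ks K by (intro CT) auto
   also have "... <= CT * (K * s) ^ 3" using that CT by (intro mult_left_mono power_mono) auto
   finally have 1: "\<bar>cost_excess t eps dl u p - ?Q u p p\<bar> <= CT * (K * s) ^ 3" .
   have "\<bar>cost_excess t eps dl u (p + z) - ?Q u (p + z) (p + z)\<bar> <= CT * norm (p + z) ^ 3"
    using that Ks K pz by (intro CT) auto
   also have "... <= CT * (2 * K * s) ^ 3" using pz CT by (intro mult_left_mono power_mono) auto
   finally have 2: "\<bar>cost_excess t eps dl u (p + z) - ?Q u (p + z) (p + z)\<bar> <= CT * (2 * K * s) ^ 3" .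
   have "?Q u (p + z) (p + z) = ?Q u p p + 2 * ?Q u p z + ?Q u z z" by (rule excess_form_add)
   with 1 2 that(4) show ?thesis by (simp add: algebra_simps)
  qed
  have A: "2 * ?Q v d w + ?Q v w w >= - (CT * (2 * K) ^ 3 + CT * K ^ 3) * s ^ 3"
   using v dd w S1 by (intro step) auto
  have B: "- (2 * ?Q v' d' w) + ?Q v' w w >= - (CT * (2 * K) ^ 3 + CT * K ^ 3) * s ^ 3"
   using step[of v' d' "- w"] v dd w S2 excess_form_scale_left[of t eps dl v' "-1" w w]
   by (simp add: excess_form_minus_right)
  have sq: "CL * norm (v - v') * (norm x * norm y) <= CL * K ^ 3 * s ^ 3"
   if "norm x <= K * s" "norm y <= K * s" for x y :: 'a
  proof -
   have "CL * norm (v - v') * (norm x * norm y) <= CL * (K * s) * ((K * s) * (K * s))"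
    using that v CL K s by (intro mult_mono mult_nonneg_nonneg) auto
   then show ?thesis by (simp add: power3_eq_cube mult_ac)
  qed
  have L1: "\<bar>?Q v d' w - ?Q v' d' w\<bar> <= CL * K ^ 3 * s ^ 3"
   using excess_form_bounds(3)[OF t e less_imp_le[OF d], of v d' w v', folded CL_def] sq[of d' w] dd w by simp
  have L2: "\<bar>?Q v w w - ?Q v' w w\<bar> <= CL * K ^ 3 * s ^ 3"
   using excess_form_bounds(3)[OF t e less_imp_le[OF d], of v w w v', folded CL_def] sq[of w w] dd w by simp
  have bb: "\<bar>?Q v x w\<bar> <= CB * K^2 * s ^ 3" if "norm x <= K * s^2" for x
  proof -
   have "\<bar>?Q v x w\<bar> <= CB * (norm x * norm w)" by (rule CBb)
   also have "... <= CB * ((K * s^2) * (K * s))" using that w CB K by (intro mult_left_mono mult_mono) auto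
   finally show ?thesis by (simp add: power2_eq_square power3_eq_cube mult_ac)
  qed
  have D1: "\<bar>?Q v du w - ?Q v d w\<bar> <= CB * K^2 * s ^ 3" using bb[OF du(1)] by (simp add: excess_form_diff_left)
  have D2: "\<bar>?Q v du' w - ?Q v d' w\<bar> <= CB * K^2 * s ^ 3" using bb[OF du(2)] by (simp add: excess_form_diff_left)
  \<comment> \<open>Adding \<open>A\<close> and \<open>B\<close>, with base point moved to
    \<open>v\<close>, bounds twice the form at \<open>d - d'\<close> and \<open>w\<close> plus twice
    the form at \<open>w\<close> and \<open>w\<close> below by minus a multiple of
    \<open>s ^ 3\<close>. Passing from \<open>d\<close>, \<open>d'\<close> to \<open>du\<close>,
    \<open>du'\<close> costs another multiple of \<open>s ^ 3\<close>. The first pairing becomes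
    \<open>- rho\<close> times the form at \<open>w\<close>, which coercivity keeps of order
    \<open>s^2\<close>.\<close>
  have "?Q v du' w - ?Q v du w = rho * ?Q v w w"
   using rho(1) by (metis excess_form_diff_left excess_form_scale_left)
  with A B L1 L2 D1 D2 have "2 * ((rho - 1) * ?Q v w w) <= C0 * s ^ 3"
   unfolding C0_def by (simp add: algebra_simps)
  moreover have "(rho - 1) * (dl * s^2 / (t * (1-t))) <= (rho - 1) * ?Q v w w"
  proof -
   have "dl * s^2 / (t * (1-t)) <= dl * (norm w)^2 / (t * (1-t))"
    using t d s w by (intro divide_right_mono mult_left_mono power_mono) auto
   also have "... <= ?Q v w w" by (rule excess_form_bounds(2)[OF t e less_imp_le[OF d]])
   finally show ?thesis using rho by (intro mult_left_mono) auto
  qed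
  moreover have "(rho - 1) * (dl * s^2 / (t * (1-t))) >= 0" using rho d t by auto
  moreover have "2 * B <= C ==> A <= B ==> 0 <= A ==> A <= C" for A B C :: real by simp
  ultimately have "(rho - 1) * (dl * s^2 / (t * (1-t))) <= C0 * s ^ 3" by metis
  also have "... = C * s * (dl * s^2 / (t * (1-t)))"
   unfolding C_def using t d by (simp add: power2_eq_square power3_eq_cube)
  finally show ?thesis
  proof (rule mult_right_le_imp_le)
   show "0 < dl * s^2 / (t * (1-t))" using t d s by auto
  qed
 qed
 moreover have "C >= 0" unfolding C_def using C0 t d by auto
 ultimately show thesis using that by simp
qed

section \<open>Discrete transport and conditioning on a finite index\<close>

text \<open>Tychonoff. The cube receives finite transport plans here, and later the masses of all
  pairs of sets at once.\<close>

lemma compact_unit_cube: "compact (PiE UNIV (\<lambda>_ :: 'i. {0..1 :: real}))"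
proof -
 have "compactin (product_topology (\<lambda>_ :: 'i. euclidean :: real topology) UNIV) (PiE UNIV (\<lambda>_. {0..1}))"
  by (subst compactin_PiE) auto
 then show ?thesis by (simp add: euclidean_product_topology)
qed

lemma finite_transport_optimal:
 fixes a :: "'p => real" and b :: "'q => real" and C :: "'p => 'q => real"
 assumes fin: "finite P" "finite Q" and nn: "\<And>p. 0 <= a p" "\<And>q. 0 <= b q" and tot: "sum a P = 1" "sum b Q = 1"
 obtains pl :: "'p => 'q => real" where "\<And>p q. 0 <= pl p q"
  "\<And>p. p : P ==> (\<Sum>q\<in>Q. pl p q) = a p" "\<And>q. q : Q ==> (\<Sum>p\<in>P. pl p q) = b q"
  "\<And>pl' :: 'p => 'q => real. [|\<And>p q. 0 <= pl' p q; \<And>p. p : P ==> (\<Sum>q\<in>Q. pl' p q) = a p;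
    \<And>q. q : Q ==> (\<Sum>p\<in>P. pl' p q) = b q|]
   ==> (\<Sum>p\<in>P. \<Sum>q\<in>Q. pl p q * C p q) <= (\<Sum>p\<in>P. \<Sum>q\<in>Q. pl' p q * C p q)"
  "\<And>p q p' q'. [|p : P; q : Q; p' : P; q' : Q; pl p q > 0; pl p' q' > 0|] ==> C p q + C p' q' <= C p q' + C p' q"
proof -
 define feas where "feas = {f :: 'p \<times> 'q => real. f : PiE UNIV (\<lambda>_. {0..1}) \<and>
  (\<forall>p\<in>P. (\<Sum>q\<in>Q. f (p, q)) = a p) \<and> (\<forall>q\<in>Q. (\<Sum>p\<in>P. f (p, q)) = b q)}"
 have cont: "continuous_on UNIV (\<lambda>f :: 'p \<times> 'q => real. f x)" for x by simp
 have "closed {f :: 'p \<times> 'q => real. (\<forall>p\<in>P. (\<Sum>q\<in>Q. f (p, q)) = a p) \<and> (\<forall>q\<in>Q. (\<Sum>p\<in>P. f (p, q)) = b q)}"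
 proof -
  have "{f :: 'p \<times> 'q => real. (\<forall>p\<in>P. (\<Sum>q\<in>Q. f (p, q)) = a p) \<and> (\<forall>q\<in>Q. (\<Sum>p\<in>P. f (p, q)) = b q)}
   = (\<Inter>p\<in>P. {f. (\<Sum>q\<in>Q. f (p, q)) = a p}) \<inter> (\<Inter>q\<in>Q. {f. (\<Sum>p\<in>P. f (p, q)) = b q})" by auto
  then show ?thesis
   by (simp only:) (intro closed_Int closed_INT ballI closed_Collect_eq continuous_on_sum cont continuous_on_const)
 qed
 then have "compact (PiE UNIV (\<lambda>_. {0..1}) \<inter> {f :: 'p \<times> 'q => real. (\<forall>p\<in>P. (\<Sum>q\<in>Q. f (p, q)) = a p) \<and> (\<forall>q\<in>Q. (\<Sum>p\<in>P. f (p, q)) = b q)})"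
  by (rule compact_Int_closed[OF compact_unit_cube])
 then have comp: "compact feas" unfolding feas_def by (simp add: Int_def)
 have a1: "a p <= 1" if "p : P" for p using member_le_sum[OF that, of a] nn fin tot by simp
 have b1: "b q <= 1" if "q : Q" for q using member_le_sum[OF that, of b] nn fin tot by simp
 define f0 where "f0 = (\<lambda>(p, q). if p : P \<and> q : Q then a p * b q else 0)"
 have "f0 : feas"
 proof -
  have "(\<Sum>q\<in>Q. f0 (p, q)) = a p" if "p : P" for p using that tot by (simp add: f0_def sum_distrib_left[symmetric])
  moreover have "(\<Sum>p\<in>P. f0 (p, q)) = b q" if "q : Q" for q using that tot by (simp add: f0_def sum_distrib_right[symmetric])
  moreover have "f0 x : {0..1}" for x using nn a1 b1 by (auto simp: f0_def mult_le_one split: prod.splits)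
  ultimately show ?thesis by (auto simp: feas_def)
 qed
 then have ne: "feas \<noteq> {}" by auto
 have "continuous_on feas (\<lambda>f. \<Sum>p\<in>P. \<Sum>q\<in>Q. f (p, q) * C p q)"
  by (intro continuous_on_sum continuous_on_mult continuous_on_const continuous_on_subset[OF cont]) auto
 from continuous_attains_inf[OF comp ne this] obtain f where f: "f : feas"
  "\<And>g. g : feas ==> (\<Sum>p\<in>P. \<Sum>q\<in>Q. f (p, q) * C p q) <= (\<Sum>p\<in>P. \<Sum>q\<in>Q. g (p, q) * C p q)" by auto
 define pl where "pl p q = f (p, q)" for p q
 have p0: "0 <= pl p q" for p q using f(1) by (auto simp: pl_def feas_def)
 have p1: "(\<Sum>q\<in>Q. pl p q) = a p" if "p : P" for p using f(1) that by (auto simp: pl_def feas_def)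
 have p2: "(\<Sum>p\<in>P. pl p q) = b q" if "q : Q" for q using f(1) that by (auto simp: pl_def feas_def)
 have p3: "(\<Sum>p\<in>P. \<Sum>q\<in>Q. pl p q * C p q) <= (\<Sum>p\<in>P. \<Sum>q\<in>Q. pl' p q * C p q)"
  if 0: "\<And>p q. 0 <= pl' p q" and 1: "\<And>p. p : P ==> (\<Sum>q\<in>Q. pl' p q) = a p" and 2: "\<And>q. q : Q ==> (\<Sum>p\<in>P. pl' p q) = b q"
  for pl' :: "'p => 'q => real"
 proof -
  define g where "g = (\<lambda>(p, q). if p : P \<and> q : Q then pl' p q else 0)"
  have "g : feas"
  proof -
   have "pl' p q <= 1" if "p : P" "q : Q" for p q
    using member_le_sum[OF that(2), of "pl' p"] 0 fin 1[OF that(1)] a1[OF that(1)] by simp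
   then show ?thesis using 0 1 2 by (auto simp: feas_def g_def)
  qed
  from f(2)[OF this] have "(\<Sum>p\<in>P. \<Sum>q\<in>Q. f (p, q) * C p q) <= (\<Sum>p\<in>P. \<Sum>q\<in>Q. g (p, q) * C p q)" .
  also have "... = (\<Sum>p\<in>P. \<Sum>q\<in>Q. pl' p q * C p q)" by (intro sum.cong refl) (simp add: g_def)
  finally show ?thesis by (simp add: pl_def)
 qed
 have p4: "C p q + C p' q' <= C p q' + C p' q"
  if pq: "p : P" "q : Q" "p' : P" "q' : Q" and pos: "pl p q > 0" "pl p' q' > 0" for p q p' q'
 proof -
  define tau where "tau = min (pl p q) (pl p' q')"
  have tau: "tau > 0" "tau <= pl p q" "tau <= pl p' q'" using pos by (auto simp: tau_def)
  \<comment> \<open>\<open>u x * v y\<close> has zero row and column sums, is \<open>-1\<close> at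
    \<open>(p, q)\<close> and \<open>(p', q')\<close> and \<open>1\<close> at the two crossed
    places: mass \<open>tau\<close> moves around a 4-cycle. If \<open>p = p'\<close> or
    \<open>q = q'\<close>, it vanishes.\<close>
  define u where "u x = (if x = p then 1 else 0) - (if x = p' then 1 else (0::real))" for x
  define v where "v y = (if y = q' then 1 else 0) - (if y = q then 1 else (0::real))" for y
  define pl' where "pl' x y = pl x y + tau * (u x * v y)" for x y
  have su: "(\<Sum>x\<in>P. u x * c x) = c p - c p'" for c
   unfolding u_def using pq fin by (simp add: left_diff_distrib sum_subtractf if_distrib[of "\<lambda>z. z * _"] cong: if_cong)
  have sv: "(\<Sum>y\<in>Q. v y * c y) = c q' - c q" for c
   unfolding v_def using pq fin by (simp add: left_diff_distrib sum_subtractf if_distrib[of "\<lambda>z. z * _"] cong: if_cong)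
  have "(\<Sum>x\<in>P. \<Sum>y\<in>Q. pl x y * C x y) <= (\<Sum>x\<in>P. \<Sum>y\<in>Q. pl' x y * C x y)"
  proof (rule p3)
   show "0 <= pl' x y" for x y using tau p0[of x y] unfolding pl'_def u_def v_def by auto
   show "(\<Sum>y\<in>Q. pl' x y) = a x" if "x : P" for x
    using sv[of "\<lambda>_. 1"] p1[OF that] by (simp add: pl'_def sum.distrib sum_distrib_left[symmetric])
   show "(\<Sum>x\<in>P. pl' x y) = b y" if "y : Q" for y
    using su[of "\<lambda>_. 1"] p2[OF that] by (simp add: pl'_def sum.distrib sum_distrib_left[symmetric] sum_distrib_right[symmetric])
  qed
  also have "... = (\<Sum>x\<in>P. \<Sum>y\<in>Q. pl x y * C x y) + tau * (\<Sum>x\<in>P. u x * (\<Sum>y\<in>Q. v y * C x y))"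
   by (simp add: pl'_def distrib_left sum.distrib sum_distrib_left mult_ac)
  also have "(\<Sum>x\<in>P. u x * (\<Sum>y\<in>Q. v y * C x y)) = (C p q' - C p q) - (C p' q' - C p' q)"
   unfolding sv su ..
  finally show ?thesis using tau(1) by (simp add: zero_le_mult_iff)
 qed
 show thesis using that[of pl] p0 p1 p2 p3 p4 by simp
qed

section \<open>Entropy of finite sums and gluing along finite indices\<close>

lemma log_sum_ineq:
 fixes x y :: "'a => real"
 assumes "finite S" and x: "\<And>i. i : S ==> 0 <= x i" and y: "\<And>i. i : S ==> 0 < y i"
 shows "sum x S * ln (sum x S / sum y S) <= (\<Sum>i\<in>S. x i * ln (x i / y i))"
proof (cases "sum x S = 0")
 case True
 then have "x i = 0" if "i : S" for i using sum_nonneg_eq_0_iff[OF assms(1)] x that by auto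
 then show ?thesis by simp
next
 case False
 then have X: "sum x S > 0" using sum_nonneg[of S x] x by simp
 then have Y: "sum y S > 0" using y assms(1) by (intro sum_pos) auto
 define r where "r = sum x S / sum y S"
 have r: "r > 0" using X Y by (simp add: r_def)
 have "x i * ln r + x i - r * y i <= x i * ln (x i / y i)" if i: "i : S" for i
 proof (cases "x i = 0")
  case True then show ?thesis using y[OF i] r by simp
 next
  case False
  then have xi: "x i > 0" using x[OF i] by simp
  have yi: "y i > 0" by (rule y[OF i])
  have "ln (r * y i / x i) <= r * y i / x i - 1" using xi yi r by (intro ln_le_minus_one) auto
  then have "x i * ln (r * y i / x i) <= x i * (r * y i / x i - 1)" using xi by simp
  also have "... = r * y i - x i" using xi by (simp add: field_simps)
  moreover have "ln (r * y i / x i) = ln r - ln (x i / y i)" using xi yi r by (simp add: ln_div ln_mult)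
  ultimately show ?thesis by (simp add: algebra_simps)
 qed
 then have "(\<Sum>i\<in>S. x i * ln r + x i - r * y i) <= (\<Sum>i\<in>S. x i * ln (x i / y i))" by (rule sum_mono)
 moreover have "(\<Sum>i\<in>S. x i * ln r + x i - r * y i) = sum x S * ln r + sum x S - r * sum y S"
  by (simp add: sum.distrib sum_subtractf sum_distrib_right sum_distrib_left)
 moreover have "r * sum y S = sum x S" using Y by (simp add: r_def)
 ultimately show ?thesis by (simp add: r_def)
qed

text \<open>Mass leaving one cell may be split between several labels; monotonicity of the logarithm shows that this only helps.\<close>

lemma label_entropy:
 fixes pl :: "'p => 'q => real" and zt :: "'p => 'q => 'l" and G :: "'p => real"
 assumes fin: "finite P" "finite Q" "finite Lm" and zt: "\<And>p q. p : P ==> q : Q ==> zt p q : Lm"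
  and pl: "\<And>p q. 0 <= pl p q" and G: "\<And>p. p : P ==> (\<Sum>q\<in>Q. pl p q) > 0 ==> G p > 0"
 defines "w \<equiv> \<lambda>l. \<Sum>p\<in>P. \<Sum>q\<in>Q. if zt p q = l then pl p q else 0"
  and "A \<equiv> \<lambda>l. {p : P. \<exists>q\<in>Q. zt p q = l \<and> pl p q > 0}"
 shows "(\<Sum>l\<in>Lm. w l * ln (w l / sum G (A l))) <= (\<Sum>p\<in>P. (\<Sum>q\<in>Q. pl p q) * ln ((\<Sum>q\<in>Q. pl p q) / G p))"
  and "\<And>l. w l > 0 ==> A l \<noteq> {} \<and> sum G (A l) > 0"
proof -
 define a where "a p = (\<Sum>q\<in>Q. pl p q)" for p
 define b where "b l p = (\<Sum>q\<in>Q. if zt p q = l then pl p q else 0)" for l p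
 have b0: "b l p >= 0" for l p unfolding b_def using pl by (intro sum_nonneg) auto
 have ba: "b l p <= a p" for l p unfolding b_def a_def using pl by (intro sum_mono) auto
 have bA: "b l p = 0" if "p : P" "p \<notin> A l" for l p
  unfolding b_def using that pl by (intro sum.neutral) (force simp: A_def less_le)
 have bpos: "b l p > 0" if pA: "p : A l" for l p
 proof -
  obtain q where "q : Q" "zt p q = l" "pl p q > 0" using pA unfolding A_def by auto
  then show ?thesis unfolding b_def using pl fin by (intro sum_pos2[of _ q]) auto
 qed
 have wA: "w l = sum (b l) (A l)" for l
 proof -
  have "w l = sum (b l) P" by (simp add: w_def b_def)
  also have "... = sum (b l) (A l)" using bA fin by (intro sum.mono_neutral_right) (auto simp: A_def)
  finally show ?thesis .
 qed
 have finA: "finite (A l)" for l using fin by (simp add: A_def)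
 have GA: "G p > 0" if "p : A l" for p l
 proof -
  show ?thesis using that bpos[OF that] ba[of l p] G[of p] by (simp add: A_def a_def)
 qed
 have ab: "(\<Sum>l\<in>Lm. b l p) = a p" if "p : P" for p
  unfolding b_def a_def using fin zt that by (subst sum.swap) (auto intro!: sum.cong)
 have "(\<Sum>l\<in>Lm. w l * ln (w l / sum G (A l))) <= (\<Sum>l\<in>Lm. \<Sum>p\<in>A l. b l p * ln (b l p / G p))"
  unfolding wA by (intro sum_mono log_sum_ineq finA b0 GA)
 also have "... <= (\<Sum>l\<in>Lm. \<Sum>p\<in>A l. b l p * ln (a p / G p))"
  using GA bpos ba b0
  by (intro sum_mono mult_left_mono ln_mono divide_right_mono divide_pos_pos) (auto intro: less_imp_le less_le_trans)
 also have "... = (\<Sum>l\<in>Lm. \<Sum>p\<in>P. b l p * ln (a p / G p))"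
  using bA fin by (intro sum.cong sum.mono_neutral_left refl) (auto simp: A_def)
 also have "... = (\<Sum>p\<in>P. (\<Sum>l\<in>Lm. b l p) * ln (a p / G p))"
  by (subst sum.swap) (simp add: sum_distrib_right)
 also have "... = (\<Sum>p\<in>P. a p * ln (a p / G p))" by (intro sum.cong refl) (simp add: ab)
 finally show "(\<Sum>l\<in>Lm. w l * ln (w l / sum G (A l))) <= (\<Sum>p\<in>P. (\<Sum>q\<in>Q. pl p q) * ln ((\<Sum>q\<in>Q. pl p q) / G p))"
  by (simp add: a_def)
 show "A l \<noteq> {} \<and> sum G (A l) > 0" if "w l > 0" for l
 proof -
  show ?thesis using that unfolding wA using GA finA by (auto intro: sum_pos)
 qed
qed

lemma nn_integral_finite_index:
 fixes ph :: "'p => ennreal"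
 assumes P: "finite P" and q: "q : M \<rightarrow>\<^sub>M count_space P"
 shows "(\<integral>\<^sup>+x. ph (q x) \<partial>M) = (\<Sum>p\<in>P. ph p * emeasure M {x : space M. q x = p})"
proof -
 have [measurable]: "{x : space M. q x = p} : sets M" if "p : P" for p
  using measurable_sets[OF q, of "{p}"] that by (simp add: Int_def conj_commute)
 have "(\<integral>\<^sup>+x. ph (q x) \<partial>M) = (\<integral>\<^sup>+x. (\<Sum>p\<in>P. ph p * indicator {x : space M. q x = p} x) \<partial>M)"
 proof (intro nn_integral_cong)
  fix x assume x: "x : space M"
  then have "q x : P" using measurable_space[OF q] by simp
  moreover have "(\<Sum>p\<in>P. ph p * indicator {x : space M. q x = p} x) = (\<Sum>p\<in>P. if p = q x then ph p else 0)"
   using x by (intro sum.cong) (auto simp: indicator_def)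
  ultimately show "ph (q x) = (\<Sum>p\<in>P. ph p * indicator {x : space M. q x = p} x)" using P by simp
 qed
 also have "... = (\<Sum>p\<in>P. ph p * emeasure M {x : space M. q x = p})"
  by (subst nn_integral_sum) (auto intro!: sum.cong nn_integral_cmult_indicator)
 finally show ?thesis .
qed

lemma finite_index_conditional:
 assumes "prob_space A" and P: "finite P" and q: "qa : A \<rightarrow>\<^sub>M count_space P"
 obtains K where "\<And>p. prob_space (K p)" "\<And>p. sets (K p) = sets A"
  "\<And>f :: _ => ennreal. f : borel_measurable A ==> (\<integral>\<^sup>+x. f x \<partial>A) = (\<Sum>p\<in>P. ennreal (measure A {x : space A. qa x = p}) * (\<integral>\<^sup>+x. f x \<partial>K p))"
  "\<And>p. p : P ==> 0 < measure A {x : space A. qa x = p} ==> AE x in K p. qa x = p"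
proof -
 interpret prob_space A by fact
 define S where "S p = {x : space A. qa x = p}" for p
 have S [measurable]: "S p : sets A" if "p : P" for p
  using measurable_sets[OF q, of "{p}"] that by (simp add: S_def vimage_def Int_def conj_commute)
 \<comment> \<open>Cells of mass zero get the placeholder \<open>A\<close>; their weight in the sum
   is zero.\<close>
 define K where "K p = (if p : P \<and> 0 < measure A (S p) then uniform_measure A (S p) else A)" for p
 show thesis
 proof (rule that[of K, folded S_def])
  show "prob_space (K p)" for p
   by (auto simp: K_def emeasure_eq_measure intro!: prob_space_uniform_measure prob_space_axioms)
  show "AE x in K p. qa x = p" if "p : P" "0 < measure A (S p)" for p
  proof -
   have K: "K p = uniform_measure A (S p)" using that by (simp add: K_def)
   show ?thesis unfolding K using S[OF that(1)] by (auto simp: S_def intro!: AE_uniform_measureI)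
  qed
  fix f :: "_ => ennreal" assume [measurable]: "f : borel_measurable A"
  have "(\<integral>\<^sup>+x. f x \<partial>A) = (\<integral>\<^sup>+x. (\<Sum>p\<in>P. f x * indicator (S p) x) \<partial>A)"
   using P measurable_space[OF q] by (intro nn_integral_cong) (auto simp: S_def indicator_def sum.If_cases if_distrib[of "(*) _"] cong: if_cong)
  also have "... = (\<Sum>p\<in>P. \<integral>\<^sup>+x. f x * indicator (S p) x \<partial>A)" by (intro nn_integral_sum) measurable
  also have "... = (\<Sum>p\<in>P. ennreal (measure A (S p)) * (\<integral>\<^sup>+x. f x \<partial>K p))"
  proof (intro sum.cong refl)
   fix p assume p: "p : P"
   show "(\<integral>\<^sup>+x. f x * indicator (S p) x \<partial>A) = ennreal (measure A (S p)) * (\<integral>\<^sup>+x. f x \<partial>K p)"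
   proof (cases "0 < measure A (S p)")
    case True
    then show ?thesis using p by (simp add: K_def nn_integral_uniform_measure emeasure_eq_measure ennreal_times_divide mult_divide_eq_ennreal mult.commute[of "ennreal _"])
   next
    case False
    then have "measure A (S p) = 0" by (simp add: zero_less_measure_iff)
    moreover from this have "AE x in A. x \<notin> S p" using S[OF p] by (intro AE_not_in) (simp add: null_sets_def emeasure_eq_measure)
    then have "(\<integral>\<^sup>+x. f x * indicator (S p) x \<partial>A) = (\<integral>\<^sup>+x. 0 \<partial>A)" by (intro nn_integral_cong_AE) (auto simp: indicator_def)
    ultimately show ?thesis by simp
   qed
  qed
  finally show "(\<integral>\<^sup>+x. f x \<partial>A) = (\<Sum>p\<in>P. ennreal (measure A (S p)) * (\<integral>\<^sup>+x. f x \<partial>K p))" .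
 qed (simp add: K_def)
qed

text \<open>A gluing: draw a pair of indices from \<open>pl\<close>, then independently a source
  from \<open>A\<close> conditioned on the first index, a target from \<open>B\<close> conditioned
  on the second, and a third point with density \<open>kp p q\<close>. The row and column sums of
  \<open>pl\<close> restore the marginals.\<close>

lemma finite_index_kernel:
 fixes A :: "'a measure" and B :: "'b measure" and Z :: "'c measure" and pl :: "'p => 'q => real"
  and kp :: "'p => 'q => 'c => ennreal"
 assumes "prob_space A" "prob_space B" "prob_space Z" and fin: "finite P" "finite Q"
  and q [measurable]: "qa : A \<rightarrow>\<^sub>M count_space P" "qb : B \<rightarrow>\<^sub>M count_space Q"
  and pl: "\<And>p q. 0 <= pl p q" "\<And>p. p : P ==> (\<Sum>q\<in>Q. pl p q) = measure A {x : space A. qa x = p}"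
   "\<And>q. q : Q ==> (\<Sum>p\<in>P. pl p q) = measure B {x : space B. qb x = q}"
  and kp [measurable]: "\<And>p q. kp p q : borel_measurable Z" and kp1: "\<And>p q. (\<integral>\<^sup>+z. kp p q z \<partial>Z) = 1"
 obtains M where "prob_space M" "sets M = sets (A \<Otimes>\<^sub>M (B \<Otimes>\<^sub>M Z))"
  "\<And>f. f : borel_measurable A ==> (\<integral>\<^sup>+u. f (fst u) \<partial>M) = (\<integral>\<^sup>+x. f x \<partial>A)"
  "\<And>f. f : borel_measurable B ==> (\<integral>\<^sup>+u. f (fst (snd u)) \<partial>M) = (\<integral>\<^sup>+x. f x \<partial>B)"
  "\<And>F :: 'p => 'q => 'c => ennreal. (\<And>p q. F p q : borel_measurable Z) ==>
   (\<integral>\<^sup>+u. F (qa (fst u)) (qb (fst (snd u))) (snd (snd u)) \<partial>M) =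
   (\<Sum>p\<in>P. \<Sum>q\<in>Q. ennreal (pl p q) * (\<integral>\<^sup>+z. kp p q z * F p q z \<partial>Z))"
proof -
 define a where "a p = measure A {x : space A. qa x = p}" for p
 define b where "b q = measure B {x : space B. qb x = q}" for q
 have sa: "p : P ==> (\<Sum>q\<in>Q. pl p q) = a p" and sb: "q : Q ==> (\<Sum>p\<in>P. pl p q) = b q" for p q using pl by (simp_all add: a_def b_def)
 obtain KA where KA: "\<And>p. prob_space (KA p)" "\<And>p. sets (KA p) = sets A"
  and IA: "\<And>f. f : borel_measurable A ==> (\<integral>\<^sup>+x. f x \<partial>A) = (\<Sum>p\<in>P. ennreal (a p) * (\<integral>\<^sup>+x. f x \<partial>KA p))"
  and aeA: "\<And>p. p : P ==> 0 < a p ==> AE x in KA p. qa x = p"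
  by (rule finite_index_conditional[OF assms(1) fin(1) q(1), folded a_def]) blast
 obtain KB where KB: "\<And>p. prob_space (KB p)" "\<And>p. sets (KB p) = sets B"
  and IB: "\<And>f. f : borel_measurable B ==> (\<integral>\<^sup>+x. f x \<partial>B) = (\<Sum>p\<in>Q. ennreal (b p) * (\<integral>\<^sup>+x. f x \<partial>KB p))"
  and aeB: "\<And>q. q : Q ==> 0 < b q ==> AE x in KB q. qb x = q"
  by (rule finite_index_conditional[OF assms(2) fin(2) q(2), folded b_def]) blast
 note [measurable_cong] = KA(2) KB(2)
 define T where "T = (\<lambda>(p, q). KA p \<Otimes>\<^sub>M (KB q \<Otimes>\<^sub>M density Z (kp p q)))"
 define R where "R = point_measure (P \<times> Q) (\<lambda>(p, q). ennreal (pl p q))"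
 define M where "M = R \<bind> T"
 have KZ: "prob_space (density Z (kp p q))" for p q
  using kp1 by (intro prob_spaceI) (simp add: emeasure_density nn_integral_indicator cong: nn_integral_cong)
 have KZ1: "emeasure (density Z (kp p q)) (space Z) = 1" for p q using prob_space.emeasure_space_1[OF KZ, of p q] by simp
 have T: "prob_space (T v)" "sets (T v) = sets (A \<Otimes>\<^sub>M (B \<Otimes>\<^sub>M Z))" for v
  by (cases v; simp add: T_def prob_space_pair KA KB KZ cong: sets_pair_measure_cong)+
 have IT: "(\<integral>\<^sup>+u. h u \<partial>T (p, q)) = (\<integral>\<^sup>+x. \<integral>\<^sup>+y. \<integral>\<^sup>+z. h (x, y, z) \<partial>density Z (kp p q) \<partial>KB q \<partial>KA p)"
  if [measurable]: "h : borel_measurable (A \<Otimes>\<^sub>M (B \<Otimes>\<^sub>M Z))" for h p q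
 proof -
  interpret KZ: prob_space "density Z (kp p q)" by (rule KZ)
  interpret KBZ: prob_space "KB q \<Otimes>\<^sub>M density Z (kp p q)" by (intro prob_space_pair KB KZ)
  have "(\<integral>\<^sup>+u. h u \<partial>T (p, q)) = (\<integral>\<^sup>+x. \<integral>\<^sup>+v. h (x, v) \<partial>(KB q \<Otimes>\<^sub>M density Z (kp p q)) \<partial>KA p)"
   unfolding T_def prod.case by (rule KBZ.nn_integral_fst[symmetric]) measurable
  also have "... = (\<integral>\<^sup>+x. \<integral>\<^sup>+y. \<integral>\<^sup>+z. h (x, y, z) \<partial>density Z (kp p q) \<partial>KB q \<partial>KA p)"
  proof (intro nn_integral_cong KZ.nn_integral_fst[symmetric])
   fix x assume "x : space (KA p)"
   then have "x : space A" using sets_eq_imp_space_eq[OF KA(2)] by simp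
   then show "(\<lambda>v. h (x, v)) : borel_measurable (KB q \<Otimes>\<^sub>M density Z (kp p q))" by measurable
  qed
  finally show ?thesis .
 qed
 have E: "(\<integral>\<^sup>+u. h u \<partial>M) = (\<Sum>p\<in>P. \<Sum>q\<in>Q. ennreal (pl p q) * (\<integral>\<^sup>+x. \<integral>\<^sup>+y. \<integral>\<^sup>+z. h (x, y, z) \<partial>density Z (kp p q) \<partial>KB q \<partial>KA p))"
  if [measurable]: "h : borel_measurable (A \<Otimes>\<^sub>M (B \<Otimes>\<^sub>M Z))" for h
 proof -
  have "T : R \<rightarrow>\<^sub>M subprob_algebra (A \<Otimes>\<^sub>M (B \<Otimes>\<^sub>M Z))"
   using T prob_space_imp_subprob_space[OF T(1)] by (auto simp: R_def space_subprob_algebra)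
  then show ?thesis unfolding M_def using fin
   by (subst nn_integral_bind) (auto simp: R_def nn_integral_point_measure_finite IT sum.cartesian_product case_prod_unfold intro!: sum.cong)
 qed
 have m1: "(\<integral>\<^sup>+u. f (fst u) \<partial>M) = (\<integral>\<^sup>+x. f x \<partial>A)" if [measurable]: "f : borel_measurable A" for f
  using KA KB pl(1) by (simp add: KZ1 E IA prob_space.emeasure_space_1 sum_distrib_right[symmetric] sum_ennreal sa)
 have m2: "(\<integral>\<^sup>+u. f (fst (snd u)) \<partial>M) = (\<integral>\<^sup>+y. f y \<partial>B)" if [measurable]: "f : borel_measurable B" for f
  using KA KB pl(1) by (simp add: KZ1 E IB prob_space.emeasure_space_1 sum.swap[of _ Q P] sum_distrib_right[symmetric] sum_ennreal sb)
 have m3: "(\<integral>\<^sup>+u. F (qa (fst u)) (qb (fst (snd u))) (snd (snd u)) \<partial>M) =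
   (\<Sum>p\<in>P. \<Sum>q\<in>Q. ennreal (pl p q) * (\<integral>\<^sup>+z. kp p q z * F p q z \<partial>Z))"
  if [measurable]: "\<And>p q. F p q : borel_measurable Z" for F :: "'p => 'q => 'c => ennreal"
 proof -
  have "(\<lambda>u. F p (qb (fst (snd u))) (snd (snd u))) : borel_measurable (A \<Otimes>\<^sub>M (B \<Otimes>\<^sub>M Z))" for p
   by (rule measurable_compose_countable'[where I = Q and g = "\<lambda>u. qb (fst (snd u))"]) (use fin countable_finite in measurable)
  then have mF: "(\<lambda>u. F (qa (fst u)) (qb (fst (snd u))) (snd (snd u))) : borel_measurable (A \<Otimes>\<^sub>M (B \<Otimes>\<^sub>M Z))"
   by (rule measurable_compose_countable'[where I = P and g = "\<lambda>u. qa (fst u)"]) (use fin countable_finite in measurable)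
  show ?thesis unfolding E[OF mF]
  proof (intro sum.cong refl)
   fix p q assume pq: "p : P" "q : Q"
   let ?I = "\<lambda>p' q'. \<integral>\<^sup>+z. F p' q' z \<partial>density Z (kp p q)"
   show "ennreal (pl p q) * (\<integral>\<^sup>+x. \<integral>\<^sup>+y. \<integral>\<^sup>+z. F (qa (fst (x, y, z))) (qb (fst (snd (x, y, z)))) (snd (snd (x, y, z))) \<partial>density Z (kp p q) \<partial>KB q \<partial>KA p)
     = ennreal (pl p q) * (\<integral>\<^sup>+z. kp p q z * F p q z \<partial>Z)"
   proof (cases "pl p q = 0")
    case False
    then have "0 < pl p q" using pl(1)[of p q] by simp
    then have ab: "0 < a p" "0 < b q"
     using pq sa sb fin pl(1) member_le_sum[of q Q "pl p"] member_le_sum[of p P "\<lambda>p. pl p q"] by force+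
    have "(\<integral>\<^sup>+x. \<integral>\<^sup>+y. ?I (qa x) (qb y) \<partial>KB q \<partial>KA p) = (\<integral>\<^sup>+x. \<integral>\<^sup>+y. ?I (qa x) q \<partial>KB q \<partial>KA p)"
     by (intro nn_integral_cong nn_integral_cong_AE) (use aeB[OF pq(2) ab(2)] in auto)
    also have "... = (\<integral>\<^sup>+x. \<integral>\<^sup>+y. ?I p q \<partial>KB q \<partial>KA p)"
     by (intro nn_integral_cong_AE) (use aeA[OF pq(1) ab(1)] in auto)
    finally show ?thesis using KA KB by (simp add: prob_space.emeasure_space_1 nn_integral_density)
   qed simp
  qed
 qed
 have "sets M = sets (A \<Otimes>\<^sub>M (B \<Otimes>\<^sub>M Z))"
  unfolding M_def
 proof (rule sets_bind[OF T(2)])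
  obtain x y where "x : space A" "y : space B" using prob_space.not_empty[OF assms(1)] prob_space.not_empty[OF assms(2)] by blast
  then show "space R \<noteq> {}" using measurable_space[OF q(1)] measurable_space[OF q(2)] by (auto simp: R_def space_point_measure)
 qed
 moreover have "prob_space M"
  using m1[of "\<lambda>_. 1"] assms(1) by (intro prob_spaceI) (simp add: prob_space.emeasure_space_1)
 ultimately show thesis using m1 m2 m3 that by blast
qed

section \<open>Gaussian cells and sites\<close>

definition cube :: "'i set => ('i => real) => real => ('i => real) set" where
 "cube J p s = PiE J (\<lambda>i. {p i..<p i + s})"

lemma sets_cube [measurable]: "finite J ==> cube J p s : sets (lebPi J)"
 unfolding cube_def by (intro sets_PiM_I_finite) auto

text \<open>Cost of going from \<open>x\<close> to \<open>z\<close> in time \<open>t\<close> and on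
  to \<open>y\<close> in time \<open>1 - t\<close>. It is a function of \<open>x\<close> and
  \<open>z\<close> plus a function of \<open>z\<close> and \<open>y\<close>; hence two pairs served
  by one \<open>z\<close> may exchange targets at no cost.\<close>

definition chain_cost :: "real => real => real => 'a::real_inner => 'a => 'a => real" where
 "chain_cost t eps dl x y z = t * reg_cost eps dl ((x - z) /\<^sub>R t) + (1 - t) * reg_cost eps dl ((z - y) /\<^sub>R (1 - t))"

lemma chain_cost_excess:
 assumes t: "0 < t" "t < 1"
 shows "chain_cost t eps dl x y z =
  reg_cost eps dl (x - y) + cost_excess t eps dl (x - y) (z - ((1 - t) *\<^sub>R x + t *\<^sub>R y))"
proof -
 define d where "d = z - ((1 - t) *\<^sub>R x + t *\<^sub>R y)"
 have "x - z = t *\<^sub>R (x - y) - d" "z - y = (1 - t) *\<^sub>R (x - y) + d"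
  by (simp_all add: d_def algebra_simps)
 then show ?thesis using t unfolding chain_cost_def cost_excess_def d_def[symmetric] by (simp_all add: scaleR_right_diff_distrib scaleR_right_distrib)
qed

definition gauss_density :: "'i set => ('i => real) => ('i => real) => ('i => real) => real" where
 "gauss_density J bt sg u = (\<Prod>i\<in>J. normal_density (bt i) (sg i) (u i))"

abbreviation (input) gaussPi :: "'i set => ('i => real) => ('i => real) => ('i => real) measure" where
 "gaussPi J bt sg \<equiv> PiM J (\<lambda>i. density lborel (\<lambda>s. ennreal (normal_density (bt i) (sg i) s)))"

lemma borel_measurable_gauss_density [measurable]: "finite J ==> gauss_density J bt sg : borel_measurable (lebPi J)"
 unfolding gauss_density_def by measurable

lemma gaussPi_eq_density:
 assumes J: "finite J" and sg: "\<And>i. i : J ==> 0 < sg i"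
 shows "gaussPi J bt sg = density (lebPi J) (\<lambda>u. ennreal (gauss_density J bt sg u))"
proof -
 define Q where "Q i = density lborel (\<lambda>s. ennreal (normal_density (bt i) (if i : J then sg i else 1) s))" for i
 have pQ: "prob_space (Q i)" for i unfolding Q_def using sg by (intro prob_space_normal_density) auto
 interpret Q: product_sigma_finite Q by (intro product_sigma_finite.intro prob_space_imp_sigma_finite pQ)
 have "gaussPi J bt sg = PiM J Q" by (rule PiM_cong) (auto simp: Q_def)
 also have "... = density (lebPi J) (\<lambda>u. ennreal (gauss_density J bt sg u))"
 proof (rule Q.PiM_eqI[OF J, symmetric])
  show "sets (density (lebPi J) (\<lambda>u. ennreal (gauss_density J bt sg u))) = sets (PiM J Q)"
   by (simp add: Q_def cong: sets_PiM_cong)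
  fix A assume A: "\<And>i. i : J ==> A i : sets (Q i)"
  then have A [measurable]: "i : J ==> A i : sets borel" for i by (simp add: Q_def)
  have PA: "PiE J A : sets (lebPi J)" using A J by simp
  have "emeasure (density (lebPi J) (\<lambda>u. ennreal (gauss_density J bt sg u))) (PiE J A)
   = (\<integral>\<^sup>+u. ennreal (gauss_density J bt sg u) * indicator (PiE J A) u \<partial>lebPi J)"
   using J PA by (intro emeasure_density) measurable
  also have "... = (\<integral>\<^sup>+u. (\<Prod>i\<in>J. ennreal (normal_density (bt i) (sg i) (u i)) * indicator (A i) (u i)) \<partial>lebPi J)"
  proof (intro nn_integral_cong)
   fix u assume "u : space (lebPi J)"
   then show "ennreal (gauss_density J bt sg u) * indicator (PiE J A) u = (\<Prod>i\<in>J. ennreal (normal_density (bt i) (sg i) (u i)) * indicator (A i) (u i))"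
    using J by (auto simp: indicator_def space_PiM PiE_iff gauss_density_def prod.distrib prod_ennreal)
  qed
  also have "... = (\<Prod>i\<in>J. \<integral>\<^sup>+s. ennreal (normal_density (bt i) (sg i) s) * indicator (A i) s \<partial>lborel)"
   using J by (intro lebPi.product_nn_integral_prod) auto
  also have "... = (\<Prod>i\<in>J. emeasure (Q i) (A i))"
   by (intro prod.cong refl) (simp add: Q_def emeasure_density)
  finally show "emeasure (density (lebPi J) (\<lambda>u. ennreal (gauss_density J bt sg u))) (PiE J A) = (\<Prod>i\<in>J. emeasure (Q i) (A i))" .
 qed
 finally show ?thesis .
qed

lemma gauss_density_pos: "(\<And>i. i : J ==> 0 < sg i) ==> 0 < gauss_density J bt sg u"
 unfolding gauss_density_def by (intro prod_pos) (simp add: normal_density_pos)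

lemma gauss_density_le: "(\<And>i. i : J ==> 0 < sg i) ==> gauss_density J bt sg u <= (\<Prod>i\<in>J. 1 / sqrt (2 * pi * (sg i)^2))"
 unfolding gauss_density_def by (intro prod_mono) (auto simp: normal_density_def divide_right_mono)

lemma gauss_density_log_concave:
 assumes t: "0 < t" "t < 1" and sg: "\<And>i. i : J ==> 0 < sg i"
 shows "gauss_density J bt sg u powr (1 - t) * gauss_density J bt sg v powr t <= gauss_density J bt sg (\<lambda>i\<in>J. (1 - t) * u i + t * v i)"
proof -
 have one: "normal_density m s x powr (1 - t) * normal_density m s y powr t <= normal_density m s ((1 - t) * x + t * y)"
  if s: "s > 0" for m s x y :: real
 proof -
  define c where "c = 1 / sqrt (2 * pi * s^2)"
  have c: "c > 0" unfolding c_def using s by simp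
  have nd: "normal_density m s x = c * exp (- ((x - m)^2) / (2 * s^2))" for x by (simp add: normal_density_def c_def)
  have "normal_density m s x powr (1 - t) * normal_density m s y powr t =
   (c powr (1 - t) * c powr t) * exp ((1 - t) * (- ((x - m)^2) / (2 * s^2)) + t * (- ((y - m)^2) / (2 * s^2)))"
   unfolding nd exp_add by (simp add: powr_mult exp_powr_real mult.commute[of _ "1 - t"])
  also have "c powr (1 - t) * c powr t = c" using c by (simp flip: powr_add)
  also have "exp ((1 - t) * (- ((x - m)^2) / (2 * s^2)) + t * (- ((y - m)^2) / (2 * s^2))) <= exp (- (((1 - t) * x + t * y - m)^2) / (2 * s^2))"
  proof -
   have "(1 - t) * (x - m)^2 + t * (y - m)^2 - ((1 - t) * x + t * y - m)^2 = t * (1 - t) * (x - y)^2"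
    by (simp add: power2_eq_square algebra_simps)
   moreover have "t * (1 - t) * (x - y)^2 >= 0" using t by simp
   ultimately have "((1 - t) * x + t * y - m)^2 / (2 * s^2) <= ((1 - t) * (x - m)^2 + t * (y - m)^2) / (2 * s^2)"
    by (intro divide_right_mono) auto
   then show ?thesis by (simp add: add_divide_distrib)
  qed
  finally show ?thesis unfolding nd using c by simp
 qed
 have "gauss_density J bt sg u powr (1 - t) * gauss_density J bt sg v powr t =
  (\<Prod>i\<in>J. normal_density (bt i) (sg i) (u i) powr (1 - t) * normal_density (bt i) (sg i) (v i) powr t)"
  unfolding gauss_density_def by (simp add: prod_powr_distrib prod.distrib)
 also have "... <= (\<Prod>i\<in>J. normal_density (bt i) (sg i) ((1 - t) * u i + t * v i))"
  using one sg by (intro prod_mono) auto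
 also have "... = gauss_density J bt sg (\<lambda>i\<in>J. (1 - t) * u i + t * v i)"
  unfolding gauss_density_def by simp
 finally show ?thesis .
qed

lemma gauss_density_ratio:
 assumes J: "finite J" and sg: "\<And>i. i : J ==> 0 < sg i" and L: "0 <= L"
 obtains K where "K >= 0" "\<And>u v eta. (\<And>i. i : J ==> \<bar>u i\<bar> <= L) ==> (\<And>i. i : J ==> \<bar>v i\<bar> <= L) ==>
   (\<And>i. i : J ==> \<bar>u i - v i\<bar> <= eta) ==> gauss_density J bt sg u <= exp (K * eta) * gauss_density J bt sg v"
proof -
 define k where "k i = (2 * L + 2 * \<bar>bt i\<bar>) / (2 * (sg i)^2)" for i
 have k: "k i >= 0" for i unfolding k_def using L by simp
 have "gauss_density J bt sg u <= exp (sum k J * eta) * gauss_density J bt sg v"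
  if u: "\<And>i. i : J ==> \<bar>u i\<bar> <= L" and v: "\<And>i. i : J ==> \<bar>v i\<bar> <= L" and uv: "\<And>i. i : J ==> \<bar>u i - v i\<bar> <= eta" for u v eta
 proof -
  have "normal_density (bt i) (sg i) (u i) <= exp (k i * eta) * normal_density (bt i) (sg i) (v i)" if i: "i : J" for i
  proof -
   have "(v i - bt i)^2 - (u i - bt i)^2 = (v i - u i) * (v i + u i - 2 * bt i)" by (simp add: power2_eq_square algebra_simps)
   also have "... <= \<bar>v i - u i\<bar> * \<bar>v i + u i - 2 * bt i\<bar>" by (simp flip: abs_mult)
   also have "... <= eta * (2 * L + 2 * \<bar>bt i\<bar>)"
   proof (intro mult_mono)
    show "\<bar>v i + u i - 2 * bt i\<bar> <= 2 * L + 2 * \<bar>bt i\<bar>" using u[OF i] v[OF i] by simp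
   qed (use uv[OF i] in \<open>auto simp: abs_minus_commute\<close>)
   finally have "((v i - bt i)^2 - (u i - bt i)^2) / (2 * (sg i)^2) <= eta * (2 * L + 2 * \<bar>bt i\<bar>) / (2 * (sg i)^2)"
    by (intro divide_right_mono) auto
   then have "- ((u i - bt i)^2) / (2 * (sg i)^2) <= k i * eta + - ((v i - bt i)^2) / (2 * (sg i)^2)"
    by (simp add: k_def diff_divide_distrib mult.commute)
   then have "exp (- ((u i - bt i)^2) / (2 * (sg i)^2)) <= exp (k i * eta) * exp (- ((v i - bt i)^2) / (2 * (sg i)^2))"
    by (simp flip: exp_add)
   then have "exp (- ((u i - bt i)^2) / (2 * (sg i)^2)) / sqrt (2 * pi * (sg i)^2) <= exp (k i * eta) * exp (- ((v i - bt i)^2) / (2 * (sg i)^2)) / sqrt (2 * pi * (sg i)^2)"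
    by (intro divide_right_mono) auto
   then show ?thesis by (simp add: normal_density_def)
  qed
  then have "gauss_density J bt sg u <= (\<Prod>i\<in>J. exp (k i * eta) * normal_density (bt i) (sg i) (v i))"
   unfolding gauss_density_def by (intro prod_mono) (auto simp: normal_density_nonneg)
  also have "... = exp (sum k J * eta) * gauss_density J bt sg v"
   unfolding gauss_density_def using J by (simp add: prod.distrib exp_sum sum_distrib_right)
  finally show ?thesis .
 qed
 moreover have "sum k J >= 0" by (intro sum_nonneg k)
 ultimately show thesis using that by simp
qed

lemma measure_gaussPi:
 assumes J: "finite J" and sg: "\<And>i. i : J ==> 0 < sg i" and X: "X : sets (lebPi J)"
  and bd: "\<And>x i. x : X ==> i : J ==> \<bar>x i\<bar> <= L"
 shows "measure (gaussPi J bt sg) X = (LINT u|lebPi J. indicator X u * gauss_density J bt sg u)"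
  and "integrable (lebPi J) (\<lambda>u. indicator X u * gauss_density J bt sg u)"
proof -
 note [measurable] = X borel_measurable_gauss_density[OF J]
 define B where "B = (\<Prod>i\<in>J. 1 / sqrt (2 * pi * (sg i)^2))"
 have B: "0 <= gauss_density J bt sg u" "gauss_density J bt sg u <= B" for u
  unfolding B_def using gauss_density_le[of J sg bt u] gauss_density_pos[of J sg bt u] sg by auto
 have B0: "0 <= B" using B[of undefined] by simp
 show i: "integrable (lebPi J) (\<lambda>u. indicator X u * gauss_density J bt sg u)"
  by (rule integrable_lebPi_bounded[OF J, of _ B L]) (use bd B B0 in \<open>auto simp: indicator_def\<close>)
 have ge: "gaussPi J bt sg = density (lebPi J) (\<lambda>u. ennreal (gauss_density J bt sg u))"
  by (rule gaussPi_eq_density[OF J]) (rule sg)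
 have "emeasure (gaussPi J bt sg) X = (\<integral>\<^sup>+u. ennreal (indicator X u * gauss_density J bt sg u) \<partial>lebPi J)"
  unfolding ge using J by (subst emeasure_density) (auto intro!: nn_integral_cong simp: indicator_def)
 also have "... = ennreal (LINT u|lebPi J. indicator X u * gauss_density J bt sg u)"
  using i B by (intro nn_integral_eq_integral) auto
 finally show "measure (gaussPi J bt sg) X = (LINT u|lebPi J. indicator X u * gauss_density J bt sg u)"
  using B by (simp add: measure_def)
qed

text \<open>Log-concavity passes from the density to the measure: Prekopa-Leindler for the densities
  cut off at \<open>A\<close>, \<open>B\<close> and \<open>M\<close>.\<close>

lemma gaussPi_brunn_minkowski:
 assumes t: "0 < t" "t < 1" and J: "finite J" and sg: "\<And>i. i : J ==> 0 < sg i"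
  and meas: "A : sets (lebPi J)" "B : sets (lebPi J)" "M : sets (lebPi J)"
  and bd: "\<And>x i. x : A \<union> B \<union> M ==> i : J ==> \<bar>x i\<bar> <= L"
  and sub: "\<And>x y. x : A ==> y : B ==> (\<lambda>i\<in>J. (1 - t) * x i + t * y i) : M"
 shows "measure (gaussPi J bt sg) A powr (1 - t) * measure (gaussPi J bt sg) B powr t <= measure (gaussPi J bt sg) M"
proof -
 note [measurable] = meas borel_measurable_gauss_density[OF J]
 define b where "b = (\<Prod>i\<in>J. 1 / sqrt (2 * pi * (sg i)^2))"
 have b: "0 <= gauss_density J bt sg u" "gauss_density J bt sg u <= b" for u
  unfolding b_def using gauss_density_le[of J sg bt u] gauss_density_pos[of J sg bt u] sg by auto
 have b0: "0 <= b" using b[of undefined] by simp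
 have bX: "0 <= indicator X x * gauss_density J bt sg x" "indicator X x * gauss_density J bt sg x <= b" for X x
  using b b0 by (auto simp: indicator_def)
 have m: "measure (gaussPi J bt sg) X = (LINT u|lebPi J. indicator X u * gauss_density J bt sg u)" if "X : {A, B, M}" for X
  by (rule measure_gaussPi(1)[OF J sg, where X = X and L = L]) (use that meas bd in auto)
 show ?thesis
  unfolding m[of A, simplified] m[of B, simplified] m[of M, simplified]
 proof (rule prekopa_leindler[OF t J, where B = b and L = L])
  fix x y :: "'a => real" assume "x : extensional J" "y : extensional J"
  show "(indicator A x * gauss_density J bt sg x) powr (1 - t) * (indicator B y * gauss_density J bt sg y) powr t
    <= indicator M (\<lambda>i\<in>J. (1 - t) * x i + t * y i) * gauss_density J bt sg (\<lambda>i\<in>J. (1 - t) * x i + t * y i)"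
  proof (cases "x : A \<and> y : B")
   case True
   then show ?thesis using sub gauss_density_log_concave[OF t sg, where J = J and bt = bt and u = x and v = y] by simp
  next
   case False
   then show ?thesis using b(1) by auto
  qed
 qed (use bd bX in \<open>auto simp: indicator_def split: if_splits\<close>)
qed

section \<open>The two lattices and the packing of interpolants\<close>

abbreviation lat :: "real => (nat => int) => nat => real" where
 "lat s k i \<equiv> s * real_of_int (k i)"

abbreviation mid :: "real => real => (nat => int) => (nat => int) => nat => real" where
 "mid t s k k' i \<equiv> (1 - t) * lat (s^2) k i + t * lat (s^2) k' i"

abbreviation cubes :: "nat set => real => (nat => int) set => (nat => real) set" where
 "cubes J s A \<equiv> (\<Union>k\<in>A. cube J (lat (s^2) k) (s^2))"

locale frame =
 fixes J :: "nat set" and e :: "nat => 'h::real_inner" and x0 :: 'h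
 assumes finJ: "finite J" and on: "PROP orthonormal_on e J"
begin

definition vec :: "(nat => real) => 'h" where
 "vec u = x0 + (\<Sum>i\<in>J. u i *\<^sub>R e i)"

text \<open>Demanded for every source in \<open>A\<close> with every target in \<open>B\<close>,
  matched or not; this is what cyclical monotonicity yields for the mass through one site. Competing
  sites range over the box of size \<open>L + 2\<close>, because interpolants lie in the box of size
  \<open>L + 1\<close> and the steps compared stay within distance 1 of them.\<close>

abbreviation site_opt :: "real => real => real => real => real => (nat => int) set => (nat => int) set => (nat => int) => bool" where
 "site_opt t eps dl L s A B l \<equiv> \<forall>k\<in>A. \<forall>k'\<in>B. \<forall>l'. (\<forall>i\<in>J. \<bar>lat s l' i\<bar> <= L + 2) -->
  chain_cost t eps dl (vec (lat (s^2) k)) (vec (lat (s^2) k')) (vec (lat s l))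
  <= chain_cost t eps dl (vec (lat (s^2) k)) (vec (lat (s^2) k')) (vec (lat s l'))"

abbreviation site_near :: "real => real => real => (nat => int) set => (nat => int) set => (nat => int) => bool" where
 "site_near t C s A B l \<equiv> \<forall>k\<in>A. \<forall>k'\<in>B. norm (vec (lat s l) - vec (mid t s k k')) <= C * s"

abbreviation in_box :: "real => real => (nat => int) set => prop" where
 "in_box s L A \<equiv> (\<And>k i. k : A ==> i : J ==> \<bar>lat (s^2) k i\<bar> <= L + 1)"

lemma norm_e: "i : J ==> norm (e i) = 1"
 using on[of i i] by (simp add: norm_eq_1)

lemma vec_diff: "vec u - vec v = (\<Sum>i\<in>J. (u i - v i) *\<^sub>R e i)"
 by (simp add: vec_def scaleR_left_diff_distrib sum_subtractf)

lemma norm_vec_diff_le: "(\<And>i. i : J ==> \<bar>u i - v i\<bar> <= m) ==> norm (vec u - vec v) <= real (card J) * m"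
 unfolding vec_diff using norm_e by (intro sum_norm_bound) auto

lemma coord_le_norm_vec_diff:
 assumes i: "i : J" shows "\<bar>u i - v i\<bar> <= norm (vec u - vec v)"
proof -
 have "(vec u - vec v) \<bullet> e i = (\<Sum>j\<in>J. if j = i then u i - v i else 0)"
  unfolding vec_diff inner_sum_left using on i by (intro sum.cong) auto
 then show ?thesis using finJ i Cauchy_Schwarz_ineq2[of "vec u - vec v" "e i"] norm_e[OF i] by simp
qed

lemma vec_convex: "(1 - t) *\<^sub>R vec u + t *\<^sub>R vec v = vec (\<lambda>i. (1 - t) * u i + t * v i)"
proof -
 have "vec (\<lambda>i. (1 - t) * u i + t * v i) = x0 + ((1 - t) *\<^sub>R (\<Sum>i\<in>J. u i *\<^sub>R e i) + t *\<^sub>R (\<Sum>i\<in>J. v i *\<^sub>R e i))"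
  unfolding vec_def by (simp add: scaleR_left_distrib sum.distrib scaleR_sum_right)
 then show ?thesis by (simp add: vec_def algebra_simps)
qed

text \<open>Suppose two points of the union differ by \<open>rho\<close> times a nonzero vector
  \<open>w\<close> of the lattice of mesh \<open>s\<close>, with \<open>rho = 1 + C * s\<close>. The
  sites displaced by \<open>w\<close> and \<open>- w\<close> are both admissible competitors for
  \<open>l\<close>, and \<open>excess_lattice_gap\<close> forces \<open>rho - 1 <= Cg * s\<close>,
  against the choice \<open>C > Cg\<close>. So \<open>lattice_packing\<close> applies with mesh
  \<open>rho * s\<close>.\<close>

lemma site_geometry:
 assumes t: "0 < t" "t < 1" and eps: "0 < eps" and dl: "0 < dl" and L: "0 <= L"
 obtains C s0 where "C >= 0" "0 < s0" "s0 <= 1"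
  "\<And>(s :: real) A B l. [|0 < s; s <= s0; finite A; finite B;
   PROP in_box s L A;
   PROP in_box s L B;
   site_opt t eps dl L s A B l|]
   ==> site_near t C s A B l \<and>
    emeasure (lebPi J) (\<Union>k\<in>A. \<Union>k'\<in>B. cube J (mid t s k k') (s^2))
     <= ennreal (((1 + C * s) * s) ^ card J)"
proof -
 define n where "n = real (card J)"
 have n: "n >= 0" by (simp add: n_def)
 \<comment> \<open>The quadratic lower bound for the excess at the optimal site, compared with the
   upper bound at the rounded interpolant, which is off by at most \<open>n * s\<close>, gives
   \<open>norm d <= C1 * s\<close>.\<close>
 define C1 where "C1 = n * sqrt (1 / (2 * eps * dl) + 1)"
 have C1: "C1 >= 0" unfolding C1_def using n eps dl by auto
 define T where "T = 1 / t + 1 / (1 - t)"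
 have T: "T >= 1 / t" "T >= 1 / (1 - t)" "T >= 1" unfolding T_def using t by (auto intro: add_increasing2)
 define K where "K = 2 * (C1 + n) * T"
 have Kb: "K >= 2 * (C1 + n)" unfolding K_def using T(3) C1 n mult_left_mono[of 1 T "2 * (C1 + n)"] by simp
 then have K: "K >= 0" "K >= C1" "K >= n" using C1 n by auto
 define R where "R = 2 * n * (L + 1)"
 have R: "R >= 0" unfolding R_def using n L by simp
 obtain Cg where Cg: "Cg >= 0"
  "\<And>s rho v v' d d' du du' (w :: 'h).
   [|0 < s; s <= 1; norm v <= R; norm v' <= R; norm (v - v') <= K * s; norm d <= K * s; norm d' <= K * s;
    norm (du - d) <= K * s^2; norm (du' - d') <= K * s^2; s <= norm w; norm w <= K * s;
    cost_excess t eps dl v d <= cost_excess t eps dl v (d + w);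
    cost_excess t eps dl v' d' <= cost_excess t eps dl v' (d' - w);
    du' - du = rho *\<^sub>R w; rho >= 1|] ==> rho - 1 <= Cg * s"
  using excess_lattice_gap[OF t eps dl R K(1)] by auto
 define C where "C = max C1 (Cg + 1)"
 \<comment> \<open>Ensures \<open>3 * (C1 + n) * s <= 1\<close>, which keeps the displaced sites
   inside the box of admissible ones.\<close>
 define s0 where "s0 = 1 / (3 * (C1 + n) + 1)"
 have C: "C >= 0" "C >= C1" "C > Cg" using C1 by (auto simp: C_def)
 have s0: "0 < s0" "s0 <= 1" unfolding s0_def using C1 n by auto
 show thesis
 proof (rule that[OF C(1) s0])
  fix s and A B :: "(nat => int) set" and l :: "nat => int"
  assume s: "0 < s" "s <= s0" and fin: "finite A" "finite B"
   and A: "PROP in_box s L A"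
   and B: "PROP in_box s L B"
   and opt: "site_opt t eps dl L s A B l"
  have s1: "s <= 1" using s s0 by simp
  have ss: "s^2 <= s" using s s1 by (simp add: power2_eq_square)
  have s3: "3 * (C1 + n) * s <= 1"
  proof -
   have "(3 * (C1 + n) + 1) * s <= (3 * (C1 + n) + 1) * s0" using s C1 n by simp
   also have "... = 1" unfolding s0_def using C1 n by simp
   finally show ?thesis using s by (simp add: algebra_simps)
  qed
  define m where "m k k' i = (1 - t) * (lat (s^2) k i) + t * (lat (s^2) k' i)" for k k' :: "nat => int" and i
  define xk where "xk k = vec (lat (s^2) k)" for k :: "nat => int"
  define z where "z = vec (lat s l)"
  have mv: "(1 - t) *\<^sub>R xk k + t *\<^sub>R xk k' = vec (m k k')" for k k' unfolding xk_def m_def by (rule vec_convex)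
  have mb: "\<bar>m k k' i\<bar> <= L + 1" if "k : A" "k' : B" "i : J" for k k' i
  proof -
   have "\<bar>m k k' i\<bar> <= (1 - t) * \<bar>lat (s^2) k i\<bar> + t * \<bar>lat (s^2) k' i\<bar>"
    unfolding m_def using t by (intro order_trans[OF abs_triangle_ineq]) (simp add: abs_mult)
   also have "... <= (1 - t) * (L + 1) + t * (L + 1)" using A B that t by (intro add_mono mult_left_mono) auto
   finally show ?thesis by (simp add: algebra_simps)
  qed
  define v where "v k k' = xk k - xk k'" for k k'
  define d where "d k k' = z - vec (m k k')" for k k'
  have ex: "cost_excess t eps dl (v k k') (d k k') <= cost_excess t eps dl (v k k') (vec (lat s l') - vec (m k k'))"
   if "k : A" "k' : B" "\<And>i. i : J ==> \<bar>lat s l' i\<bar> <= L + 2" for k k' l'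
   using opt[rule_format, OF that] unfolding chain_cost_excess[OF t] xk_def[symmetric] z_def[symmetric] mv
   by (simp add: v_def d_def)
  have dC: "norm (d k k') <= C1 * s" if k: "k : A" "k' : B" for k k'
  proof -
   define l' where "l' i = \<lfloor>m k k' i / s\<rfloor>" for i
   have near: "\<bar>lat s l' i - m k k' i\<bar> <= s" for i
    using floor_divide_lower[OF s(1), of "m k k' i"] floor_divide_upper[OF s(1), of "m k k' i"]
    unfolding l'_def by (simp add: algebra_simps)
   have "cost_excess t eps dl (v k k') (d k k') <= cost_excess t eps dl (v k k') (vec (lat s l') - vec (m k k'))"
    using near mb[OF k] s1 by (intro ex k) (smt (verit))
   also have "... <= slack t eps dl (norm (vec (lat s l') - vec (m k k')))"
    by (rule cost_excess_bounds(2)[OF t eps])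
   also have "... <= slack t eps dl (n * s)"
    using near t eps dl unfolding n_def
    by (intro divide_right_mono mult_left_mono power_mono norm_vec_diff_le) auto
   finally have "dl * (norm (d k k'))^2 / (t * (1 - t)) <= slack t eps dl (n * s)"
    using cost_excess_bounds(1)[OF t eps, of dl "d k k'" "v k k'"] by simp
   then have "dl * (norm (d k k'))^2 <= (1 / (2 * eps) + dl) * (n * s)^2"
    using t by (simp add: divide_le_cancel)
   also have "... = dl * (C1 * s)^2"
   proof -
    have "(C1 * s)^2 = (n * s)^2 * (1 / (2 * eps * dl) + 1)"
     unfolding C1_def using eps dl by (simp add: power_mult_distrib)
    moreover have "1 / (2 * eps) + dl = dl * (1 / (2 * eps * dl) + 1)" using dl by (simp add: field_simps)
    ultimately show ?thesis by simp
   qed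
   finally have "(norm (d k k'))^2 <= (C1 * s)^2" using dl by simp
   then show ?thesis by (rule power2_le_imp_le) (use C1 s in simp)
  qed
  have vR: "norm (v k k') <= R" if "k : A" "k' : B" for k k'
  proof -
   have "norm (v k k') <= real (card J) * (2 * (L + 1))"
    unfolding v_def xk_def
   proof (rule norm_vec_diff_le)
    fix i assume "i : J"
    then show "\<bar>lat (s^2) k i - lat (s^2) k' i\<bar> <= 2 * (L + 1)"
     using A[OF that(1)] B[OF that(2)] by (smt (verit))
   qed
   then show ?thesis by (simp add: R_def n_def algebra_simps)
  qed
  \<comment> \<open>All interpolants served by one site are within \<open>2 * C1 * s\<close> of each
    other. Varying the source alone divides this by \<open>1 - t\<close>, varying the target alone
    by \<open>t\<close>; so the displacements from source to target are close as well. This is where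
    optimality for unmatched pairs is used.\<close>
  have vv: "norm (v k k' - v p p') <= K * s" if k: "k : A" "k' : B" and p: "p : A" "p' : B" for k k' p p'
  proof -
   have dd: "norm (vec (m k k') - vec (m q q')) <= 2 * C1 * s" if "q : A" "q' : B" for q q'
    using dC[OF k] dC[OF that] norm_triangle_ineq4[of "d q q'" "d k k'"] by (simp add: d_def)
   have "(1 - t) *\<^sub>R (xk k - xk p) = vec (m k k') - vec (m p k')" "t *\<^sub>R (xk k' - xk p') = vec (m k k') - vec (m k p')"
    unfolding mv[symmetric] by (simp_all add: algebra_simps)
   from arg_cong[OF this(1), of norm] arg_cong[OF this(2), of norm]
   have b1: "(1 - t) * norm (xk k - xk p) <= 2 * C1 * s" and b2: "t * norm (xk k' - xk p') <= 2 * C1 * s"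
    using dd[OF p(1) k(2)] dd[OF k(1) p(2)] t by simp_all
   have "norm (v k k' - v p p') <= norm (xk k - xk p) + norm (xk k' - xk p')"
    unfolding v_def by norm
   also have "norm (xk k - xk p) <= 2 * C1 * s * (1 / (1 - t))" using b1 t by (simp add: field_simps)
   also have "norm (xk k' - xk p') <= 2 * C1 * s * (1 / t)" using b2 t by (simp add: field_simps)
   finally have "norm (v k k' - v p p') <= 2 * C1 * T * s" by (simp add: T_def algebra_simps)
   also have "... <= K * s" unfolding K_def using n T s by simp
   finally show ?thesis by simp
  qed
  define M where "M = (\<Union>k\<in>A. \<Union>k'\<in>B. cube J (m k k') (s^2))"
  have cubeM: "\<bar>x i - m k k' i\<bar> <= s^2" if "x : cube J (m k k') (s^2)" "i : J" for x k k' i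
   using that by (auto simp: cube_def PiE_iff)
  define rho where "rho = 1 + C * s"
  have rho: "rho >= 1" unfolding rho_def using C s by simp
  have "emeasure (lebPi J) M <= ennreal ((rho * s) ^ card J)"
  proof (rule lattice_packing[OF finJ])
   show "0 < rho * s" using rho s by simp
   show "M : sets (lebPi J)" unfolding M_def using fin finJ by (intro sets.finite_UN) auto
   show "\<bar>x i\<bar> <= L + 2" if x: "x : M" and i: "i : J" for x i
   proof -
    obtain k k' where k: "k : A" "k' : B" "x : cube J (m k k') (s^2)" using x by (auto simp: M_def)
    show ?thesis using cubeM[OF k(3) i] mb[OF k(1,2) i] ss s1 by simp
   qed
   fix x y :: "nat => real" and k :: "nat => int"
   assume x: "x : M" and y: "y : M" and yx: "\<And>i. i : J ==> y i - x i = lat (rho * s) k i"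
   show "\<forall>i\<in>J. k i = 0"
   proof (rule ccontr)
    assume "\<not> (\<forall>i\<in>J. k i = 0)"
    then obtain j where j: "j : J" "k j \<noteq> 0" by auto
    obtain a a' where a: "a : A" "a' : B" "x : cube J (m a a') (s^2)" using x by (auto simp: M_def)
    obtain b b' where b: "b : A" "b' : B" "y : cube J (m b b') (s^2)" using y by (auto simp: M_def)
    define w where "w = vec (lat s k) - vec (\<lambda>i. 0)"
    have w_sum: "w = (\<Sum>i\<in>J. (lat s k i) *\<^sub>R e i)" by (simp add: w_def vec_diff)
    have yxw: "vec y - vec x = rho *\<^sub>R w"
     unfolding vec_diff w_sum scaleR_sum_right using yx by (intro sum.cong refl) (simp add: mult_ac)
    have zw: "vec (\<lambda>i. s * real_of_int (l i + k i)) = z + w" "vec (\<lambda>i. s * real_of_int (l i - k i)) = z - w"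
     unfolding z_def w_sum vec_def
     by (simp_all add: distrib_left right_diff_distrib scaleR_left_distrib scaleR_left_diff_distrib sum.distrib sum_subtractf)
    have near: "norm ((z - vec x) - d k k') <= n * s^2" if "x : cube J (m k k') (s^2)" for x k k'
     unfolding n_def d_def using norm_vec_diff_le[of "m k k'" x "s^2"] cubeM[OF that] by (simp add: abs_minus_commute)
    note dx = near[OF a(3)] and dy = near[OF b(3)]
    have nss: "n * s^2 <= n * s" using ss n by (intro mult_left_mono)
    have wb: "norm w <= 2 * (C1 + n) * s"
    proof -
     have "rho * norm w <= norm (z - vec x) + norm (z - vec y)"
      using yxw rho norm_triangle_ineq4[of "z - vec x" "z - vec y"] by simp
     moreover have "norm (z - vec x) <= norm (d a a') + n * s^2" using norm_triangle_sub[of "z - vec x" "d a a'"] dx by simp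
     moreover have "norm (z - vec y) <= norm (d b b') + n * s^2" using norm_triangle_sub[of "z - vec y" "d b b'"] dy by simp
     moreover have "norm w <= rho * norm w" using rho by (simp add: mult_le_cancel_right1)
     ultimately show ?thesis using dC[OF a(1,2)] dC[OF b(1,2)] nss by (simp add: algebra_simps)
    qed
    have wl: "s <= norm w"
    proof -
     have "s * 1 <= s * \<bar>real_of_int (k j)\<bar>" using s j by simp
     also have "... = \<bar>s * real_of_int (k j) - 0\<bar>" using s by (simp add: abs_mult)
     also have "... <= norm w" unfolding w_def by (rule coord_le_norm_vec_diff[OF j(1)])
     finally show ?thesis by simp
    qed
    have site: "\<bar>lat s l i\<bar> + \<bar>lat s k i\<bar> <= L + 2" if "i : J" for i
    proof -
     have "\<bar>lat s k i - 0\<bar> <= norm w" unfolding w_def by (rule coord_le_norm_vec_diff[OF that])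
     moreover have "\<bar>lat s l i - m a a' i\<bar> <= norm (d a a')" unfolding d_def z_def by (rule coord_le_norm_vec_diff[OF that])
     moreover have "C1 * s + 2 * (C1 + n) * s <= 3 * (C1 + n) * s" using n s by (simp add: algebra_simps)
     ultimately show ?thesis using mb[OF a(1,2) that] dC[OF a(1,2)] wb s3 by simp
    qed
    \<comment> \<open>The roles are crossed: the cell pair of \<open>y\<close> competes with the
      site moved by \<open>w\<close> and that of \<open>x\<close> with the site moved by
      \<open>- w\<close>, because \<open>du' - du = vec y - vec x\<close>.\<close>
    have "rho - 1 <= Cg * s"
    proof (rule Cg(2)[where v = "v b b'" and v' = "v a a'" and d = "d b b'" and d' = "d a a'" and du = "z - vec y" and du' = "z - vec x" and w = w])
     show "cost_excess t eps dl (v b b') (d b b') <= cost_excess t eps dl (v b b') (d b b' + w)"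
     proof -
      have "cost_excess t eps dl (v b b') (d b b') <= cost_excess t eps dl (v b b') (vec (\<lambda>i. s * (l i + k i)) - vec (m b b'))"
       using ex[OF b(1,2), of "\<lambda>i. l i + k i"] site by (force simp: distrib_left)
      then show ?thesis using zw(1) by (simp add: d_def algebra_simps)
     qed
     show "cost_excess t eps dl (v a a') (d a a') <= cost_excess t eps dl (v a a') (d a a' - w)"
     proof -
      have "cost_excess t eps dl (v a a') (d a a') <= cost_excess t eps dl (v a a') (vec (\<lambda>i. s * (l i - k i)) - vec (m a a'))"
       using ex[OF a(1,2), of "\<lambda>i. l i - k i"] site by (force simp: right_diff_distrib)
      then show ?thesis unfolding zw(2) d_def by (simp add: algebra_simps)
     qed
     show "norm (d b b') <= K * s" "norm (d a a') <= K * s"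
      using dC a b K(2) s by (meson mult_right_mono less_imp_le order_trans)+
     show "norm (z - vec y - d b b') <= K * s^2" "norm (z - vec x - d a a') <= K * s^2"
      using dx dy K(3) by (meson mult_right_mono zero_le_power2 order_trans)+
     show "norm w <= K * s" using wb Kb s by (meson mult_right_mono less_imp_le order_trans)
     show "z - vec x - (z - vec y) = rho *\<^sub>R w" using yxw by simp
    qed (use s s1 vR a b vv wl rho in auto)
    moreover have "rho - 1 > Cg * s" unfolding rho_def using C s by simp
    ultimately show False by simp
   qed
  qed
  moreover have "norm (d k k') <= C * s" if "k : A" "k' : B" for k k'
   using dC[OF that] C(2) s by (meson mult_right_mono less_imp_le order_trans)
  ultimately show "site_near t C s A B l \<and>
    emeasure (lebPi J) (\<Union>k\<in>A. \<Union>k'\<in>B. cube J (mid t s k k') (s^2))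
     <= ennreal (((1 + C * s) * s) ^ card J)"
   unfolding M_def d_def z_def m_def rho_def by simp
 qed
qed

text \<open>Brunn-Minkowski bounds the measures of sources and targets by that of the interpolants.
  Near the site the Gaussian density is constant up to a factor \<open>exp\<close> of order
  \<open>s\<close>, so the packing bound compares the interpolants with the cell of the
  site.\<close>

lemma site_gauss:
 assumes t: "0 < t" "t < 1" and eps: "0 < eps" and dl: "0 < dl" and L: "0 <= L" and sg: "\<And>i. i : J ==> 0 < sg i"
 obtains C s0 where "C >= 0" "0 < s0" "s0 <= 1"
  "\<And>s l. 0 < s ==> 0 < measure (gaussPi J bt sg) (cube J (lat s l) s)"
  "\<And>(s :: real) A B l. [|0 < s; s <= s0; finite A; finite B;
   PROP in_box s L A;
   PROP in_box s L B;
   site_opt t eps dl L s A B l|]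
   ==> site_near t C s A B l \<and>
    measure (gaussPi J bt sg) (cubes J s A) powr (1 - t)
     * measure (gaussPi J bt sg) (cubes J s B) powr t
    <= 2 * measure (gaussPi J bt sg) (cube J (lat s l) s)"
proof -
 let ?Gm = "gaussPi J bt sg" and ?g = "gauss_density J bt sg"
 note [measurable] = borel_measurable_gauss_density[OF finJ]
 obtain C s1 where C: "C >= 0" and s1: "0 < s1" "s1 <= 1" and geo:
  "\<And>(s :: real) A B l. [|0 < s; s <= s1; finite A; finite B;
   PROP in_box s L A;
   PROP in_box s L B;
   site_opt t eps dl L s A B l|]
   ==> site_near t C s A B l \<and>
    emeasure (lebPi J) (\<Union>k\<in>A. \<Union>k'\<in>B. cube J (mid t s k k') (s^2))
     <= ennreal (((1 + C * s) * s) ^ card J)"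
 proof (rule site_geometry[OF t eps dl L], goal_cases)
  case (1 C s0)
  show ?case by (rule 1(1)[OF 1(2-5)])
 qed
 obtain K where K: "K >= 0" "\<And>u v eta. (\<And>i. i : J ==> \<bar>u i\<bar> <= L + 3) ==> (\<And>i. i : J ==> \<bar>v i\<bar> <= L + 3) ==>
   (\<And>i. i : J ==> \<bar>u i - v i\<bar> <= eta) ==> ?g u <= exp (K * eta) * ?g v"
 proof (rule gauss_density_ratio[OF finJ, where sg = sg and L = "L + 3" and bt = bt], goal_cases)
  case (1 i) show ?case by (rule sg[OF 1(2)])
 next
  case 2 then show ?case using L by simp
 next
  case (3 K) show ?case by (rule 3(1)[OF 3(2,3)])
 qed
 have gpos: "0 < ?g u" for u by (rule gauss_density_pos) (rule sg)
 have vol: "emeasure (lebPi J) (cube J p s) = ennreal (s ^ card J)" if "s > 0" for p s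
  unfolding cube_def using finJ that by (subst lebPi.emeasure_PiM) (auto simp: prod_ennreal ennreal_power)
 have cell_pos: "0 < measure ?Gm (cube J (lat s l) s)" if s: "0 < s" for s l
 proof -
  have "emeasure ?Gm (cube J (lat s l) s) \<noteq> 0"
  proof
   assume "emeasure ?Gm (cube J (lat s l) s) = 0"
   then have "cube J (lat s l) s : null_sets (density (lebPi J) (\<lambda>u. ennreal (?g u)))"
    using finJ by (simp add: gaussPi_eq_density[OF finJ sg] null_sets_def)
   then have "AE u in lebPi J. u : cube J (lat s l) s --> ennreal (?g u) = 0"
    by (subst (asm) null_sets_density_iff) auto
   then have "AE u in lebPi J. u \<notin> cube J (lat s l) s"
    by (auto simp: ennreal_eq_0_iff not_le[THEN iffD2, OF gpos])
   then show False using finJ sets.sets_into_space[OF sets_cube[OF finJ, of "lat s l" s]]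
    using vol[OF s] s by (subst (asm) AE_iff_measurable[of "cube J (lat s l) s"]) auto
  qed
  moreover have "prob_space ?Gm"
   using finJ sg by (intro prob_space_PiM prob_space_normal_density)  auto
  ultimately show ?thesis using finite_measure.emeasure_eq_measure[OF prob_space.finite_measure, of ?Gm]
   by (simp add: zero_less_measure_iff)
 qed
 \<comment> \<open>The number of coordinates is fixed at this point, so the distortion tends to 1
   with \<open>s\<close>; the 2 stands for any number above 1.\<close>
 have "((\<lambda>s. exp (2 * (K * (C + 2)) * s) * (1 + C * s) ^ card J) \<longlongrightarrow> exp (2 * (K * (C + 2)) * 0) * (1 + C * 0) ^ card J) (at_right 0)"
  by (intro tendsto_intros)
 then have "eventually (\<lambda>s. exp (2 * (K * (C + 2)) * s) * (1 + C * s) ^ card J < 2) (at_right 0)"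
  by (rule order_tendstoD) auto
 then obtain s2 where s2: "s2 > 0" "\<And>s. 0 < s ==> s < s2 ==> exp (2 * (K * (C + 2)) * s) * (1 + C * s) ^ card J < 2"
  by (auto simp: eventually_at_right_field)
 define s0 where "s0 = min s1 (min (s2 / 2) (1 / (C + 1)))"
 have s0: "0 < s0" "s0 <= 1" "s0 <= s1" "s0 < s2" "s0 <= 1 / (C + 1)" using s1 s2 C by (auto simp: s0_def)
 show thesis
 proof (rule that[OF C s0(1,2) cell_pos])
  fix s and A B :: "(nat => int) set" and l :: "nat => int"
  assume s: "0 < s" "s <= s0" and fin: "finite A" "finite B"
   and A: "PROP in_box s L A"
   and B: "PROP in_box s L B"
   and opt: "site_opt t eps dl L s A B l"
  define m where "m k k' i = (1 - t) * (lat (s^2) k i) + t * (lat (s^2) k' i)" for k k' :: "nat => int" and i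
  define p where "p i = lat s l i" for i
  define UA where "UA = (cubes J s A)"
  define UB where "UB = (cubes J s B)"
  define M where "M = (\<Union>k\<in>A. \<Union>k'\<in>B. cube J (m k k') (s^2))"
  have g12: "(\<forall>k\<in>A. \<forall>k'\<in>B. norm (vec p - vec (m k k')) <= C * s)" "emeasure (lebPi J) M <= ennreal (((1 + C * s) * s) ^ card J)"
   using geo[OF s(1) order_trans[OF s(2) s0(3)] fin _ _ opt] A B unfolding M_def m_def p_def by auto
  have s1': "s <= 1" using s s0 by simp
  then have ss: "s^2 <= s" using s by (simp add: power2_eq_square)
  have "C * s <= C * (1 / (C + 1))" using s s0 C by (intro mult_left_mono) auto
  also have "... <= 1" using C by simp
  finally have Cs: "C * s <= 1" .
  have ss1: "s^2 <= 1" using ss s1' by simp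
  have "measure ?Gm UA powr (1 - t) * measure ?Gm UB powr t <= 2 * measure ?Gm (cube J p s)"
  proof (cases "A = {} \<or> B = {}")
   case True
   then show ?thesis by (auto simp: UA_def UB_def)
  next
   case False
   then obtain a b where ab: "a : A" "b : B" by auto
   have mb: "\<bar>m k k' i\<bar> <= L + 1" if "k : A" "k' : B" "i : J" for k k' i
   proof -
    have "\<bar>m k k' i\<bar> <= (1 - t) * \<bar>lat (s^2) k i\<bar> + t * \<bar>lat (s^2) k' i\<bar>"
     unfolding m_def using t by (intro order_trans[OF abs_triangle_ineq]) (simp add: abs_mult)
    also have "... <= (1 - t) * (L + 1) + t * (L + 1)" using A B that t by (intro add_mono mult_left_mono) auto
    finally show ?thesis by (simp add: algebra_simps)
   qed
   have cub: "\<bar>x i - q i\<bar> <= r" if "x : cube J q r" "i : J" for x q r i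
    using that by (auto simp: cube_def PiE_iff)
   have pm: "\<bar>p i - m k k' i\<bar> <= C * s" if "k : A" "k' : B" "i : J" for k k' i
    using coord_le_norm_vec_diff[OF that(3), of p "m k k'"] g12(1) that by force
   have pb: "\<bar>p i\<bar> <= L + 2" if "i : J" for i using pm[OF ab that] mb[OF ab that] Cs by simp
   have UAm [measurable]: "UA : sets (lebPi J)" "UB : sets (lebPi J)" "M : sets (lebPi J)" "cube J p s : sets (lebPi J)"
    unfolding UA_def UB_def M_def using fin finJ by (auto intro!: sets.finite_UN)
   have Mb: "\<bar>x i\<bar> <= L + 2" "\<bar>x i - p i\<bar> <= (C + 2) * s" if x: "x : M" and i: "i : J" for x i
   proof -
    obtain k k' where k: "k : A" "k' : B" "x : cube J (m k k') (s^2)" using x by (auto simp: M_def)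
    show "\<bar>x i\<bar> <= L + 2" using cub[OF k(3) i] mb[OF k(1,2) i] ss1 by simp
    show "\<bar>x i - p i\<bar> <= (C + 2) * s" using cub[OF k(3) i] pm[OF k(1,2) i] ss by (simp add: algebra_simps)
   qed
   have UAb: "\<bar>x i\<bar> <= L + 2" if x: "x : UA \<union> UB" and i: "i : J" for x i
   proof -
    obtain k where k: "k : A \<union> B" "x : cube J (lat (s^2) k) (s^2)" using x by (auto simp: UA_def UB_def)
    have "\<bar>lat (s^2) k i\<bar> <= L + 1" using k(1) A[OF _ i] B[OF _ i] by auto
    then show ?thesis using cub[OF k(2) i] ss1 by simp
   qed
   have pc: "\<bar>x i\<bar> <= L + 3" "\<bar>p i - x i\<bar> <= (C + 2) * s" if "x : cube J p s" "i : J" for x i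
   proof -
    show "\<bar>x i\<bar> <= L + 3" using cub[OF that] pb[OF that(2)] s1' by simp
    have "0 <= C * s" using C s by simp
    then show "\<bar>p i - x i\<bar> <= (C + 2) * s" using cub[OF that] s unfolding distrib_right by simp
   qed
   have "measure ?Gm UA powr (1 - t) * measure ?Gm UB powr t <= measure ?Gm M"
   proof (rule gaussPi_brunn_minkowski[OF t finJ sg UAm(1-3), where L = "L + 2"])
    show "\<bar>x i\<bar> <= L + 2" if "x : UA \<union> UB \<union> M" "i : J" for x i using that UAb Mb by auto
    fix x y assume "x : UA" "y : UB"
    then obtain k k' where k: "k : A" "x : cube J (lat (s^2) k) (s^2)"
     "k' : B" "y : cube J (lat (s^2) k') (s^2)" by (auto simp: UA_def UB_def)
    have "(\<lambda>i\<in>J. (1 - t) * x i + t * y i) : cube J (m k k') (s^2)"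
    proof -
     have "m k k' i <= (1 - t) * x i + t * y i \<and> (1 - t) * x i + t * y i < m k k' i + s^2" if "i : J" for i
     proof -
      have x: "lat (s^2) k i <= x i" "x i < lat (s^2) k i + s^2"
       and y: "lat (s^2) k' i <= y i" "y i < lat (s^2) k' i + s^2"
       using k that by (auto simp: cube_def PiE_iff)
      have "m k k' i <= (1 - t) * x i + t * y i" unfolding m_def using x y t by (intro add_mono mult_left_mono) auto
      moreover have "(1 - t) * x i + t * y i < (1 - t) * (lat (s^2) k i + s^2) + t * (lat (s^2) k' i + s^2)"
       using x y t by (intro add_strict_mono mult_strict_left_mono) auto
      ultimately show ?thesis by (simp add: m_def algebra_simps)
     qed
     then show ?thesis by (simp add: cube_def)
    qed
    then show "(\<lambda>i\<in>J. (1 - t) * x i + t * y i) : M" using k by (auto simp: M_def)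
   qed
   also have "measure ?Gm M = (LINT u|lebPi J. indicator M u * ?g u)"
    by (rule measure_gaussPi(1)[OF finJ sg UAm(3)]) (use Mb in auto)
   also have "... <= (LINT u|lebPi J. indicator M u * (exp (K * ((C + 2) * s)) * ?g p))"
   proof (rule integral_mono)
    show "integrable (lebPi J) (\<lambda>u. indicator M u * ?g u)"
     by (rule measure_gaussPi(2)[OF finJ sg UAm(3)]) (use Mb in auto)
    show "integrable (lebPi J) (\<lambda>u. indicator M u * (exp (K * ((C + 2) * s)) * ?g p))"
     using g12(2) by (intro integrable_mult_left integrable_real_indicator UAm le_less_trans[OF g12(2)]) auto
    fix u
    have "?g u <= exp (K * ((C + 2) * s)) * ?g p" if "u : M"
     using Mb[OF that] pb by (intro K(2)) (force intro: order_trans)+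
    then show "indicator M u * ?g u <= indicator M u * (exp (K * ((C + 2) * s)) * ?g p)" by (simp add: indicator_def)
   qed
   also have "... = measure (lebPi J) M * (exp (K * ((C + 2) * s)) * ?g p)"
    by simp
   also have "... <= (((1 + C * s) * s) ^ card J) * (exp (K * ((C + 2) * s)) * ?g p)"
   proof (intro mult_right_mono)
    have "measure (lebPi J) M <= enn2real (ennreal (((1 + C * s) * s) ^ card J))"
     unfolding measure_def by (rule enn2real_mono[OF g12(2)]) simp
    then show "measure (lebPi J) M <= ((1 + C * s) * s) ^ card J" using C s by simp
    show "0 <= exp (K * ((C + 2) * s)) * ?g p" using gpos[of p] by simp
   qed
   also have "... = (1 + C * s) ^ card J * exp (K * ((C + 2) * s)) * (s ^ card J * ?g p)"
    by (simp add: power_mult_distrib)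
   also have "s ^ card J * ?g p <= exp (K * ((C + 2) * s)) * measure ?Gm (cube J p s)"
   proof -
    have "s ^ card J * ?g p = (LINT u|lebPi J. indicator (cube J p s) u * ?g p)"
     using vol[OF s(1), of p] s by (simp add: measure_def)
    also have "... <= (LINT u|lebPi J. exp (K * ((C + 2) * s)) * (indicator (cube J p s) u * ?g u))"
    proof (rule integral_mono)
     show "integrable (lebPi J) (\<lambda>u. indicator (cube J p s) u * ?g p)"
      using vol[OF s(1), of p] by simp
     show "integrable (lebPi J) (\<lambda>u. exp (K * ((C + 2) * s)) * (indicator (cube J p s) u * ?g u))"
      by (intro integrable_mult_right measure_gaussPi(2)[OF finJ sg UAm(4)]) (use pc in auto)
     fix u
     have "?g p <= exp (K * ((C + 2) * s)) * ?g u" if "u : cube J p s"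
      using pc[OF that] pb by (intro K(2)) (force intro: order_trans)+
     then show "indicator (cube J p s) u * ?g p <= exp (K * ((C + 2) * s)) * (indicator (cube J p s) u * ?g u)"
      by (simp add: indicator_def)
    qed
    also have "... = exp (K * ((C + 2) * s)) * measure ?Gm (cube J p s)"
     using measure_gaussPi(1)[OF finJ sg UAm(4), where L = "L + 3" and bt = bt] pc by simp
    finally show ?thesis .
   qed
   finally have "measure ?Gm UA powr (1 - t) * measure ?Gm UB powr t \<le>
    (1 + C * s) ^ card J * exp (K * ((C + 2) * s)) * (exp (K * ((C + 2) * s)) * measure ?Gm (cube J p s))"
    using C s by (simp add: mult_left_mono)
   also have "... = (exp (2 * (K * (C + 2)) * s) * (1 + C * s) ^ card J) * measure ?Gm (cube J p s)"
   proof -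
    have "exp (2 * (K * (C + 2)) * s) = exp (K * ((C + 2) * s)) * exp (K * ((C + 2) * s))"
     unfolding exp_add[symmetric] by simp
    then show ?thesis by simp
   qed
   also have "... <= 2 * measure ?Gm (cube J p s)"
    using s2(2)[of s] s s0 by (intro mult_right_mono) auto
   finally show ?thesis .
  qed
  then show "site_near t C s A B l \<and>
    measure ?Gm (cubes J s A) powr (1 - t)
     * measure ?Gm (cubes J s B) powr t
    <= 2 * measure ?Gm (cube J (lat s l) s)"
   using g12(1) unfolding UA_def UB_def p_def m_def by simp
 qed
qed

end

text \<open>Uniform integrability from entropy. In a cell where the density is \<open>a\<close>, use
  Young's inequality with slope \<open>N\<close> on \<open>S\<close> and slope 0 off
  \<open>S\<close>, weighted by the measures of the two parts. A large \<open>N\<close> followed by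
  a small \<open>measure gm S\<close> makes the mass in \<open>S\<close> small. The 2 in
  \<open>mult\<close> lets every point lie in two cells.\<close>

lemma weighted_cells_bound:
 fixes cell :: "'l => 'a set"
 assumes "prob_space gm" and fin: "finite Lm" and cell: "\<And>l. l : Lm ==> cell l : sets gm" and S: "S : sets gm"
  and pos: "\<And>l. l : Lm ==> 0 < measure gm (cell l)" and w: "\<And>l. l : Lm ==> 0 <= w l"
  and mult: "\<And>T. T : sets gm ==> (\<Sum>l\<in>Lm. measure gm (T \<inter> cell l)) <= 2 * measure gm T"
  and ent: "(\<Sum>l\<in>Lm. w l * ln (w l / measure gm (cell l))) <= E" and N: "0 <= N"
 shows "N * (\<Sum>l\<in>Lm. w l * (measure gm (S \<inter> cell l) / measure gm (cell l))) <= E + 2 + 2 * exp N * measure gm S"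
proof -
 interpret prob_space gm by fact
 have "N * (w l * (prob (S \<inter> cell l) / prob (cell l))) <= w l * ln (w l / prob (cell l)) + prob (cell l) + exp N * prob (S \<inter> cell l)"
  if l: "l : Lm" for l
 proof -
  define a where "a = w l / prob (cell l)"
  define u where "u = prob (S \<inter> cell l)"
  have a: "a >= 0" unfolding a_def using w[OF l] by simp
  have u: "0 <= u" "u <= prob (cell l)" unfolding u_def using cell[OF l] by (auto intro!: finite_measure_mono)
  have "u * (a * N) <= u * (a * ln a - a + exp N)" using young_entropy[OF a, of N] u by (intro mult_left_mono) auto
  moreover have "0 <= (prob (cell l) - u) * (a * ln a - a + 1)" using young_entropy[OF a, of 0] u by simp
  ultimately have "N * (a * u) <= prob (cell l) * (a * ln a) - prob (cell l) * a + exp N * u + prob (cell l) - u"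
   by (simp add: algebra_simps)
  moreover have aw: "prob (cell l) * a = w l" using pos[OF l] by (simp add: a_def)
  moreover from aw have "prob (cell l) * (a * ln a) = w l * ln a" by simp
  ultimately have "N * (a * u) <= w l * ln a + prob (cell l) + exp N * u" using w[OF l] u by simp
  then show ?thesis by (simp add: a_def u_def)
 qed
 then have "(\<Sum>l\<in>Lm. N * (w l * (prob (S \<inter> cell l) / prob (cell l))))
  <= (\<Sum>l\<in>Lm. w l * ln (w l / prob (cell l)) + prob (cell l) + exp N * prob (S \<inter> cell l))" by (intro sum_mono)
 also have "... = (\<Sum>l\<in>Lm. w l * ln (w l / prob (cell l))) + (\<Sum>l\<in>Lm. prob (cell l)) + exp N * (\<Sum>l\<in>Lm. prob (S \<inter> cell l))"
  by (simp add: sum.distrib sum_distrib_left)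
 also have "... <= E + 2 + exp N * (2 * prob S)"
 proof (intro add_mono mult_left_mono mult)
  show "(\<Sum>l\<in>Lm. prob (cell l)) <= 2" using cell sets.sets_into_space mult[of "space gm"] by (simp add: prob_space)
 qed (use ent S in auto)
 finally show ?thesis by (simp add: sum_distrib_left)
qed

section \<open>Couplings with interpolants of bounded entropy\<close>

definition couplings :: "'h::topological_space measure => 'h measure => ('h \<times> 'h) measure set" where
 "couplings rho0 rho1 = {th. prob_space th \<and> sets th = sets (borel \<Otimes>\<^sub>M borel) \<and> distr th borel fst = rho0 \<and> distr th borel snd = rho1}"

definition pert_cost :: "real => 'h::real_normed_vector => 'h => real" where
 "pert_cost dl x y = norm (x - y) + dl * (norm (x - y))^2"

abbreviation pert_int :: "real => ('h \<times> 'h::real_normed_vector) measure => ennreal" where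
 "pert_int dl th \<equiv> \<integral>\<^sup>+v. ennreal (pert_cost dl (fst v) (snd v)) \<partial>th"

text \<open>The output of \<open>site_gauss\<close> for one mesh enters as the assumption
  \<open>site\<close>, so that \<open>s\<close> can be chosen afterwards subject to all smallness
  requirements at once.\<close>

locale grid = frame J e x0 for J :: "nat set" and e :: "nat => 'h::{real_inner, polish_space}" and x0 :: 'h +
 fixes gm rho0 rho1 :: "'h measure" and bt sg :: "nat => real" and t eps dl L s C E :: real
 assumes g: "prob_space gm" "sets gm = sets borel" and r0: "prob_space rho0" "sets rho0 = sets borel" "entropy_bound gm rho0 E"
  and r1: "prob_space rho1" "sets rho1 = sets borel" "entropy_bound gm rho1 E"
  and law: "coord_law gm x0 e J = gaussPi J bt sg"
  and t: "0 < t" "t < 1" and ep: "0 < eps" and d: "0 < dl" and L: "0 <= L" and s: "0 < s" "s <= 1" and C: "0 <= C"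
  and cellpos: "\<And>l :: nat => int. 0 < measure (gaussPi J bt sg) (cube J (lat s l) s)"
  and site: "\<And>A B l. [|finite A; finite B;
   \<forall>k\<in>A. \<forall>i\<in>J. \<bar>lat (s^2) k i\<bar> <= L + 1; \<forall>k\<in>B. \<forall>i\<in>J. \<bar>lat (s^2) k i\<bar> <= L + 1;
   site_opt t eps dl L s A B l|]
   ==> site_near t C s A B l \<and>
    measure (gaussPi J bt sg) (cubes J s A) powr (1 - t)
     * measure (gaussPi J bt sg) (cubes J s B) powr t
    <= 2 * measure (gaussPi J bt sg) (cube J (lat s l) s)"
begin

definition co :: "'h => nat => real" where "co x = (\<lambda>i\<in>J. (x - x0) \<bullet> e i)"

text \<open>\<open>None\<close> collects the points outside the box of size \<open>L\<close>. They
  are represented by the base point \<open>x0\<close>, and the error is paid by the tail of a second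
  moment.\<close>

definition idx :: "'h => (nat => int) option" where
 "idx x = (if \<forall>i\<in>J. \<bar>co x i\<bar> <= L then Some (\<lambda>i\<in>J. \<lfloor>co x i / s^2\<rfloor>) else None)"

definition pts :: "(nat => int) set" where
 "pts = {k : extensional J. \<forall>i\<in>J. \<bar>lat (s^2) k i\<bar> <= L + 1}"

definition sites :: "(nat => int) set" where
 "sites = {l : extensional J. \<forall>i\<in>J. \<bar>lat s l i\<bar> <= L + 2}"

definition pos :: "(nat => int) option => nat => real" where
 "pos p i = (case p of None => 0 | Some k => lat (s^2) k i)"

definition rep :: "'h => 'h" where "rep x = vec (pos (idx x))"

definition P :: "(nat => int) option set" where "P = insert None (Some ` pts)"

text \<open>Mass with an endpoint outside the box passes through no site; it is spread according to
  \<open>gm\<close> itself, so the bound for its label is trivial.\<close>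

definition cell :: "(nat => int) option => 'h set" where
 "cell l = (case l of None => UNIV | Some k => {x. co x : cube J (lat s k) s})"

lemma finite_bounded_ints:
 assumes "0 < r" shows "finite {k : extensional J. \<forall>i\<in>J. \<bar>lat r k i\<bar> <= B}"
proof (rule finite_subset)
 have "- \<lceil>B / r\<rceil> <= k \<and> k <= \<lceil>B / r\<rceil>" if "\<bar>r * real_of_int k\<bar> <= B" for k
 proof -
  have "real_of_int \<bar>k\<bar> <= B / r" using that assms by (simp add: field_simps)
  then show ?thesis by linarith
 qed
 then show "{k : extensional J. \<forall>i\<in>J. \<bar>lat r k i\<bar> <= B} \<subseteq> PiE J (\<lambda>_. {- \<lceil>B / r\<rceil>..\<lceil>B / r\<rceil>})"
  by (auto simp: extensional_def)
qed (use finJ in \<open>auto intro!: finite_PiE\<close>)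

lemma finite_pts: "finite pts" unfolding pts_def using s by (intro finite_bounded_ints) auto
lemma finite_sites: "finite sites" unfolding sites_def using s by (intro finite_bounded_ints) auto
lemma finite_P: "finite P" unfolding P_def using finite_pts by simp

lemma co_measurable [measurable]: "co : borel \<rightarrow>\<^sub>M PiM J (\<lambda>_. borel)"
 unfolding co_def by (intro measurable_restrict) measurable

lemma co_in_cube: "co x : cube J p r \<longleftrightarrow> (\<forall>i\<in>J. p i <= co x i \<and> co x i < p i + r)"
 unfolding cube_def co_def by (auto simp: PiE_iff)

lemma co_component [measurable]: "(\<lambda>x. co x i) : borel_measurable borel" if "i : J"
 using that unfolding co_def by simp

lemma floor_grid: "\<lfloor>x / r\<rfloor> = k \<longleftrightarrow> r * real_of_int k <= x \<and> x < r * real_of_int k + r" if "0 < r" for x r :: real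
 using that by (simp add: floor_eq_iff field_simps)

lemma idx_Some: "idx x = Some k \<longleftrightarrow> (\<forall>i\<in>J. \<bar>co x i\<bar> <= L) \<and> k : extensional J \<and> co x : cube J (lat (s^2) k) (s^2)"
proof -
 show ?thesis using s unfolding idx_def co_in_cube by (auto simp: fun_eq_iff extensional_def floor_grid)
qed

lemma idx_in_P: "idx x : P"
proof (cases "idx x")
 case (Some k)
 then have k: "\<And>i. i : J ==> \<bar>co x i\<bar> <= L" "k : extensional J" "\<And>i. i : J ==> lat (s^2) k i <= co x i \<and> co x i < lat (s^2) k i + s^2"
  unfolding idx_Some co_in_cube by auto
 have "s^2 <= 1" using s by (simp add: power_le_one)
 then have "k : pts" unfolding pts_def using k by force
 then show ?thesis using Some by (simp add: P_def)
qed (simp add: P_def)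

lemma sets_idx: "{x. idx x = p} : sets borel"
proof (cases p)
 case None
 have "{x. idx x = None} = {x. \<not> (\<forall>i\<in>J. \<bar>co x i\<bar> <= L)}" by (auto simp: idx_def)
 also have "... : sets borel" by simp
 finally show ?thesis using None by simp
next
 case (Some k)
 have "{x. idx x = Some k} = {x. (\<forall>i\<in>J. \<bar>co x i\<bar> <= L) \<and> k : extensional J \<and> (\<forall>i\<in>J. lat (s^2) k i <= co x i \<and> co x i < lat (s^2) k i + s^2)}"
  by (simp add: idx_Some co_in_cube)
 also have "... : sets borel" by simp
 finally show ?thesis using Some by simp
qed

lemma idx_measurable [measurable]: "idx : borel \<rightarrow>\<^sub>M count_space P"
 using finite_P idx_in_P sets_idx by (subst measurable_count_space_eq2) (auto simp: vimage_def)

lemma sets_cell [measurable]: "cell l : sets borel"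
proof (cases l)
 case (Some k)
 have "cell l = co -` cube J (lat s k) s \<inter> space borel" using Some by (auto simp: cell_def)
 also have "... : sets borel"
  by (rule measurable_sets[OF co_measurable]) (use finJ in \<open>auto simp: cube_def intro!: sets_PiM_I_finite\<close>)
 finally show ?thesis .
qed (simp add: cell_def)

lemma measure_co: "X : sets (lebPi J) ==> measure gm {x. co x : X} = measure (gaussPi J bt sg) X"
proof -
 assume X: "X : sets (lebPi J)"
 have [simp]: "space gm = UNIV" using sets_eq_imp_space_eq[OF g(2)] by simp
 have m: "co : gm \<rightarrow>\<^sub>M PiM J (\<lambda>_. borel)" using co_measurable g(2) by simp
 have X': "X : sets (PiM J (\<lambda>_. borel :: real measure))" using X by (simp cong: sets_PiM_cong)
 have "measure (gaussPi J bt sg) X = measure (distr gm (PiM J (\<lambda>_. borel)) co) X"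
  using law unfolding co_def by simp
 also have "... = measure gm {x. co x : X}" using X' m by (subst measure_distr) (auto simp: vimage_def)
 finally show "measure gm {x. co x : X} = measure (gaussPi J bt sg) X" by simp
qed

lemma cell_pos: "0 < measure gm (cell l)"
proof (cases l)
 case None
 show ?thesis using sets_eq_imp_space_eq[OF g(2)] None prob_space.prob_space[OF g(1)] by (simp add: cell_def)
next
 case (Some k)
 then show ?thesis unfolding cell_def using cellpos[of k] finJ by (simp add: measure_co)
qed

lemma measure_cell: "measure gm (cell (Some k)) = measure (gaussPi J bt sg) (cube J (lat s k) s)"
 unfolding cell_def using finJ by (simp add: measure_co)

lemma cell_mult:
 assumes T: "T : sets gm"
 shows "(\<Sum>l\<in>insert None (Some ` sites). measure gm (T \<inter> cell l)) <= 2 * measure gm T"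
proof -
 interpret g: prob_space gm by (rule g)
 have T' [measurable]: "T : sets borel" using T g by simp
 have d: "disjoint_family_on (\<lambda>k. T \<inter> cell (Some k)) sites"
 proof (unfold disjoint_family_on_def, intro ballI impI)
  fix k k' assume k: "k : sites" "k' : sites" "k \<noteq> k'"
  have "k = k'" if x: "x : cell (Some k)" "x : cell (Some k')" for x
  proof -
   have "k i = k' i" if "i : J" for i
    using x that floor_grid[of s "co x i" "k i"] floor_grid[of s "co x i" "k' i"] by (auto simp: cell_def co_in_cube)
   then show ?thesis using k(1,2) by (auto simp: sites_def intro: extensionalityI)
  qed
  then show "T \<inter> cell (Some k) \<inter> (T \<inter> cell (Some k')) = {}" using k(3) by auto
 qed
 have "(\<Sum>l\<in>insert None (Some ` sites). measure gm (T \<inter> cell l)) = measure gm T + (\<Sum>k\<in>sites. measure gm (T \<inter> cell (Some k)))"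
  using finite_sites by (simp add: sum.reindex cell_def)
 also have "(\<Sum>k\<in>sites. measure gm (T \<inter> cell (Some k))) = measure gm (\<Union>k\<in>sites. T \<inter> cell (Some k))"
 proof (rule g.finite_measure_finite_Union[symmetric, OF finite_sites _ d])
  show "(\<lambda>k. T \<inter> cell (Some k)) ` sites \<subseteq> sets gm" unfolding g(2) by auto
 qed
 also have "... <= measure gm T" using T by (intro g.finite_measure_mono) auto
 finally show ?thesis by simp
qed

lemma measure_idx_union:
 assumes "A \<subseteq> pts"
 shows "(\<Sum>k\<in>A. measure gm {x. idx x = Some k}) <= measure (gaussPi J bt sg) (cubes J s A)"
proof -
 interpret g: prob_space gm by (rule g)
 have fA: "finite A" using assms finite_pts finite_subset by auto
 have "(\<Sum>k\<in>A. measure gm {x. idx x = Some k}) = measure gm (\<Union>k\<in>A. {x. idx x = Some k})"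
 proof (rule g.finite_measure_finite_Union[symmetric, OF fA])
  show "(\<lambda>k. {x. idx x = Some k}) ` A \<subseteq> sets gm" unfolding g(2) by auto
  show "disjoint_family_on (\<lambda>k. {x. idx x = Some k}) A" unfolding disjoint_family_on_def by auto
 qed
 also have "... <= measure gm {x. co x : (cubes J s A)}"
 proof (intro g.finite_measure_mono)
  have "co -` (cubes J s A) \<inter> space borel : sets borel"
   by (rule measurable_sets[OF co_measurable]) (use finJ fA in \<open>auto simp: cube_def intro!: sets_PiM_I_finite sets.finite_UN\<close>)
  then show "{x. co x : (cubes J s A)} : sets gm" using g(2) by (simp add: vimage_def)
  show "(\<Union>k\<in>A. {x. idx x = Some k}) \<subseteq> {x. co x : (cubes J s A)}"
   using idx_Some by auto
 qed
 also have "... = measure (gaussPi J bt sg) (cubes J s A)"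
  by (rule measure_co) (use finJ fA in \<open>auto intro!: sets.finite_UN\<close>)
 finally show ?thesis .
qed

end

lemma reg_cost_bounds:
 assumes "0 < eps"
 shows "norm v + dl * (norm v)^2 <= reg_cost eps dl v" "reg_cost eps dl v <= norm v + dl * (norm v)^2 + eps"
proof -
 show "norm v + dl * (norm v)^2 <= reg_cost eps dl v" unfolding reg_cost_def by simp
 have "eps^2 + (norm v)^2 <= (norm v + eps)^2" using assms by (simp add: power2_sum)
 then have "sqrt (eps^2 + (norm v)^2) <= norm v + eps" using assms by (intro real_le_lsqrt) auto
 then show "reg_cost eps dl v <= norm v + dl * (norm v)^2 + eps" unfolding reg_cost_def by simp
qed

lemma sum_relabel:
 fixes pl :: "'p => 'q => real"
 assumes "finite Lm" and zt: "\<And>p q. p : P ==> q : Q ==> zt p q : Lm"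
 shows "(\<Sum>l\<in>Lm. (\<Sum>p\<in>P. \<Sum>q\<in>Q. if zt p q = l then pl p q else 0) * v l) = (\<Sum>p\<in>P. \<Sum>q\<in>Q. pl p q * v (zt p q))"
proof -
 have "(\<Sum>l\<in>Lm. (\<Sum>p\<in>P. \<Sum>q\<in>Q. if zt p q = l then pl p q else 0) * v l)
  = (\<Sum>l\<in>Lm. \<Sum>p\<in>P. \<Sum>q\<in>Q. if zt p q = l then pl p q * v l else 0)"
  by (simp add: sum_distrib_right if_distrib[where f = "\<lambda>x. x * _"] cong: if_cong)
 also have "... = (\<Sum>p\<in>P. \<Sum>q\<in>Q. \<Sum>l\<in>Lm. if zt p q = l then pl p q * v l else 0)"
  by (subst sum.swap, intro sum.cong refl, subst sum.swap, rule refl)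
 also have "... = (\<Sum>p\<in>P. \<Sum>q\<in>Q. pl p q * v (zt p q))"
  using assms by simp
 finally show ?thesis .
qed

context grid
begin

definition cc :: "(nat => int) option => (nat => int) option => (nat => int) => real" where
 "cc p p' l = chain_cost t eps dl (vec (pos p)) (vec (pos p')) (vec (lat s l))"

definition zt0 :: "(nat => int) option => (nat => int) option => nat => int" where
 "zt0 p p' = arg_min_on (cc p p') sites"

definition zt :: "(nat => int) option => (nat => int) option => (nat => int) option" where
 "zt p p' = (if p = None \<or> p' = None then None else Some (zt0 p p'))"

text \<open>The site is part of the discrete cost, minimised pair by pair. Optimality of the plan
  for this cost, rather than for \<open>reg_cost\<close>, makes the site optimal for unmatched pairs
  too.\<close>

definition cst :: "(nat => int) option => (nat => int) option => real" where
 "cst p p' = cc p p' (zt0 p p')"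

lemma sites_ne: "sites \<noteq> {}"
proof -
 have "(\<lambda>i\<in>J. 0) : sites" using L by (simp add: sites_def)
 then show ?thesis by auto
qed

lemma zt0: "zt0 p p' : sites" "l : sites ==> cst p p' <= cc p p' l"
 unfolding cst_def zt0_def using arg_min_if_finite(1)[OF finite_sites sites_ne] arg_min_least[OF finite_sites sites_ne] by auto

lemma vec_cong: "(\<And>i. i : J ==> u i = v i) ==> vec u = vec v"
 unfolding vec_def by simp

lemma cst_le: "(\<And>i. i : J ==> \<bar>lat s l i\<bar> <= L + 2) ==> cst p p' <= cc p p' l"
proof -
 assume l: "\<And>i. i : J ==> \<bar>lat s l i\<bar> <= L + 2"
 \<comment> \<open>Elements of \<open>sites\<close> are extensional; restricting \<open>l\<close> to
   \<open>J\<close> does not move the point.\<close>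
 have "vec (\<lambda>i. s * real_of_int ((\<lambda>i\<in>J. l i) i)) = vec (lat s l)" by (rule vec_cong) simp
 then have "cc p p' (\<lambda>i\<in>J. l i) = cc p p' l" unfolding cc_def by simp
 then show ?thesis using zt0(2)[of "\<lambda>i\<in>J. l i" p p'] l by (simp add: sites_def)
qed

lemma pos_bound: "p : P ==> i : J ==> \<bar>pos p i\<bar> <= L + 1"
 using L by (auto simp: P_def pts_def pos_def)

text \<open>Forcing the mass through sites changes the cost little: the lower bound is convexity,
  the upper bound routes through the interpolant rounded to the lattice. The error vanishes if
  \<open>eps\<close> is made small first and \<open>s\<close> afterwards.\<close>

lemma cst_bounds:
 shows "pert_cost dl (vec (pos p)) (vec (pos p')) <= cst p p'"
  and "p : P ==> p' : P ==>
   cst p p' <= pert_cost dl (vec (pos p)) (vec (pos p')) + (eps + slack t eps dl (real (card J) * s))"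
proof -
 let ?m = "\<lambda>i. (1 - t) * pos p i + t * pos p' i"
 have cce: "cc p p' l = reg_cost eps dl (vec (pos p) - vec (pos p')) + cost_excess t eps dl (vec (pos p) - vec (pos p')) (vec (lat s l) - vec ?m)" for l
  unfolding cc_def chain_cost_excess[OF t] vec_convex ..
 have "0 <= dl * (norm (d'::'h))^2 / (t * (1 - t))" for d' using d t by simp
 then have "0 <= cost_excess t eps dl (v::'h) d'" for v d' using cost_excess_bounds(1)[OF t ep, where dl = dl and v = v and d = d'] order_trans by auto
 then show "pert_cost dl (vec (pos p)) (vec (pos p')) <= cst p p'"
  unfolding cst_def cce pert_cost_def using reg_cost_bounds(1)[OF ep, of "vec (pos p) - vec (pos p')" dl] by (smt (verit))
 assume pp: "p : P" "p' : P"
 define l where "l i = \<lfloor>?m i / s\<rfloor>" for i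
 have lm: "\<bar>lat s l i - ?m i\<bar> <= s" for i
  using floor_grid[OF s(1), of "?m i" "l i"] by (auto simp: l_def)
 have "cst p p' <= cc p p' l"
 proof (rule cst_le)
  fix i assume i: "i : J"
  have "\<bar>?m i\<bar> <= (1 - t) * \<bar>pos p i\<bar> + t * \<bar>pos p' i\<bar>" using t by (intro order_trans[OF abs_triangle_ineq]) (simp add: abs_mult)
  also have "... <= (1 - t) * (L + 1) + t * (L + 1)" using pos_bound[OF pp(1) i] pos_bound[OF pp(2) i] t by (intro add_mono mult_left_mono) auto
  finally show "\<bar>lat s l i\<bar> <= L + 2" using lm[of i] s by (simp add: algebra_simps)
 qed
 also have "... <= (pert_cost dl (vec (pos p)) (vec (pos p')) + eps) + slack t eps dl (real (card J) * s)"
  unfolding cce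
 proof (rule add_mono)
  show "reg_cost eps dl (vec (pos p) - vec (pos p')) <= pert_cost dl (vec (pos p)) (vec (pos p')) + eps"
   unfolding pert_cost_def by (rule reg_cost_bounds(2)[OF ep])
  have "norm (vec (lat s l) - vec ?m) <= real (card J) * s" using lm by (intro norm_vec_diff_le)
  then have "(norm (vec (lat s l) - vec ?m))^2 <= (real (card J) * s)^2" by (intro power_mono) auto
  then have "slack t eps dl (norm (vec (lat s l) - vec ?m)) <= slack t eps dl (real (card J) * s)"
   using t ep d by (intro divide_right_mono mult_left_mono) auto
  then show "cost_excess t eps dl (vec (pos p) - vec (pos p')) (vec (lat s l) - vec ?m) <= slack t eps dl (real (card J) * s)"
   using cost_excess_bounds(2)[OF t ep] order_trans by blast
 qed
 finally show "cst p p' <= pert_cost dl (vec (pos p)) (vec (pos p')) + (eps + slack t eps dl (real (card J) * s))"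
  by simp
qed

lemma index_total:
 assumes "prob_space rho" "sets rho = sets borel"
 shows "(\<Sum>p\<in>P. measure rho {x : space rho. idx x = p}) = 1"
proof -
 interpret prob_space rho by fact
 have m: "idx : rho \<rightarrow>\<^sub>M count_space P" using idx_measurable assms(2) by simp
 have "(\<integral>\<^sup>+x. 1 \<partial>rho) = (\<Sum>p\<in>P. 1 * emeasure rho {x : space rho. idx x = p})"
  by (rule nn_integral_finite_index[OF finite_P m])
 then show ?thesis by (simp add: emeasure_eq_measure prob_space)
qed

lemma rep_measurable [measurable]: "rep : borel \<rightarrow>\<^sub>M borel"
 unfolding rep_def by (rule measurable_compose[OF idx_measurable]) simp

lemma vec_co_measurable [measurable]: "(\<lambda>x. vec (co x)) : borel \<rightarrow>\<^sub>M borel"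
 unfolding vec_def by measurable

text \<open>Every coupling induces a competitor for the discrete problem, with exactly its own
  rounded cost.\<close>

lemma coupling_index_cost:
 assumes th: "th : couplings rho0 rho1"
 obtains pl' where "\<And>p q. 0 <= pl' p q" "\<And>p. p : P ==> (\<Sum>q\<in>P. pl' p q) = measure rho0 {x : space rho0. idx x = p}"
  "\<And>q. q : P ==> (\<Sum>p\<in>P. pl' p q) = measure rho1 {x : space rho1. idx x = q}"
  "\<And>ph. (\<And>p q. 0 <= ph p q) ==> (\<integral>\<^sup>+v. ennreal (ph (idx (fst v)) (idx (snd v))) \<partial>th) = ennreal (\<Sum>p\<in>P. \<Sum>q\<in>P. pl' p q * ph p q)"
proof -
 have th': "prob_space th" "sets th = sets (borel \<Otimes>\<^sub>M borel)" "distr th borel fst = rho0" "distr th borel snd = rho1"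
  using th by (auto simp: couplings_def)
 interpret prob_space th by fact
 note [measurable_cong] = th'(2)
 have sp: "space th = UNIV" using sets_eq_imp_space_eq[OF th'(2)] by (simp add: space_pair_measure)
 define j where "j v = (idx (fst v), idx (snd v))" for v
 define pl' where "pl' p q = prob {v : space th. j v = (p, q)}" for p q
 have j1: "(\<lambda>v. idx (fst v)) : th \<rightarrow>\<^sub>M count_space P" "(\<lambda>v. idx (snd v)) : th \<rightarrow>\<^sub>M count_space P"
  by auto
 have sp1: "{v. idx (fst v) = p} : sets th" "{v. idx (snd v) = p} : sets th" if "p : P" for p
  using measurable_sets[OF j1(1), of "{p}"] measurable_sets[OF j1(2), of "{p}"] that by (auto simp: vimage_def sp)
 have spj: "{v. j v = (p, q)} : sets th" if "p : P" "q : P" for p q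
 proof -
  have "{v. j v = (p, q)} = {v. idx (fst v) = p} \<inter> {v. idx (snd v) = q}" by (auto simp: j_def)
  then show ?thesis using sp1 that by auto
 qed
 have jm: "j : th \<rightarrow>\<^sub>M count_space (P \<times> P)"
  using finite_P idx_in_P spj by (subst measurable_count_space_eq2) (auto simp: vimage_def sp j_def)
 have row: "(\<Sum>q\<in>P. pl' p q) = prob {v. idx (fst v) = p}" if "p : P" for p
 proof -
  have "(\<Sum>q\<in>P. pl' p q) = prob (\<Union>q\<in>P. {v : space th. j v = (p, q)})" unfolding pl'_def
   by (rule finite_measure_finite_Union[symmetric, OF finite_P]) (use spj that in \<open>auto simp: sp disjoint_family_on_def\<close>)
  also have "(\<Union>q\<in>P. {v : space th. j v = (p, q)}) = {v. idx (fst v) = p}" using idx_in_P by (auto simp: j_def sp)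
  finally show ?thesis .
 qed
 have col: "(\<Sum>p\<in>P. pl' p q) = prob {v. idx (snd v) = q}" if "q : P" for q
 proof -
  have "(\<Sum>p\<in>P. pl' p q) = prob (\<Union>p\<in>P. {v : space th. j v = (p, q)})" unfolding pl'_def
   by (rule finite_measure_finite_Union[symmetric, OF finite_P]) (use spj that in \<open>auto simp: sp disjoint_family_on_def\<close>)
  also have "(\<Union>p\<in>P. {v : space th. j v = (p, q)}) = {v. idx (snd v) = q}" using idx_in_P by (auto simp: j_def sp)
  finally show ?thesis .
 qed
 show thesis
 proof
  show "0 <= pl' p q" for p q by (simp add: pl'_def)
  show "(\<Sum>q\<in>P. pl' p q) = measure rho0 {x : space rho0. idx x = p}" if "p : P" for p
   unfolding row[OF that] th'(3)[symmetric] by (subst measure_distr) (auto simp: sp vimage_def sets_idx)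
  show "(\<Sum>p\<in>P. pl' p q) = measure rho1 {x : space rho1. idx x = q}" if "q : P" for q
   unfolding col[OF that] th'(4)[symmetric] by (subst measure_distr) (auto simp: sp vimage_def sets_idx)
  fix ph :: "(nat => int) option => (nat => int) option => real" assume ph: "\<And>p q. 0 <= ph p q"
  have "(\<integral>\<^sup>+v. ennreal (ph (idx (fst v)) (idx (snd v))) \<partial>th) = (\<integral>\<^sup>+v. (case j v of (p, q) => ennreal (ph p q)) \<partial>th)"
   by (simp add: j_def)
  also have "... = (\<Sum>r\<in>P \<times> P. (case r of (p, q) => ennreal (ph p q)) * emeasure th {v : space th. j v = r})"
   by (rule nn_integral_finite_index) (use finite_P jm in auto)
  also have "... = (\<Sum>r\<in>P \<times> P. ennreal (case r of (p, q) => pl' p q * ph p q))"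
   using ph by (intro sum.cong refl) (auto simp: pl'_def emeasure_eq_measure ennreal_mult mult.commute)
  also have "... = ennreal (\<Sum>r\<in>P \<times> P. case r of (p, q) => pl' p q * ph p q)"
   using ph by (intro sum_ennreal) (auto simp: pl'_def)
  also have "(\<Sum>r\<in>P \<times> P. case r of (p, q) => pl' p q * ph p q) = (\<Sum>p\<in>P. \<Sum>q\<in>P. pl' p q * ph p q)"
   by (simp add: sum.cartesian_product)
  finally show "(\<integral>\<^sup>+v. ennreal (ph (idx (fst v)) (idx (snd v))) \<partial>th) = ennreal (\<Sum>p\<in>P. \<Sum>q\<in>P. pl' p q * ph p q)" .
 qed
qed

end

context grid
begin

text \<open>Solve the finite problem for \<open>cst\<close> and spread the mass: sources and targets
  inside their cells according to \<open>rho0\<close> and \<open>rho1\<close>, the third point over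
  the cell of the site according to \<open>gm\<close>. The entropy of the site weights relative to
  their cells stays below \<open>E + 1\<close>; the last clause is the consequence for single
  sets.\<close>

lemma discrete_plan:
 obtains M where "prob_space M" "sets M = sets (borel \<Otimes>\<^sub>M (borel \<Otimes>\<^sub>M borel))"
  "PROP marginal M fst rho0"
  "PROP marginal M (\<lambda>u. fst (snd u)) rho1"
  "\<And>th. th : couplings rho0 rho1 ==> (\<integral>\<^sup>+u. ennreal (pert_cost dl (rep (fst u)) (rep (fst (snd u)))) \<partial>M)
   <= (\<integral>\<^sup>+v. ennreal (pert_cost dl (rep (fst v)) (rep (snd v))) \<partial>th)
    + ennreal (eps + slack t eps dl (real (card J) * s))"
  "AE u in M. idx (fst u) \<noteq> None --> idx (fst (snd u)) \<noteq> None -->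
   norm (vec (co (snd (snd u))) - ((1 - t) *\<^sub>R rep (fst u) + t *\<^sub>R rep (fst (snd u)))) <= (C + real (card J)) * s"
  "\<And>S N. S : sets borel ==> 0 <= N ==> N * measure M {u. snd (snd u) : S} <= E + 3 + 2 * exp N * measure gm S"
proof -
 interpret g: prob_space gm by (rule g)
 have spg: "space gm = UNIV" "space rho0 = UNIV" "space rho1 = UNIV"
  using sets_eq_imp_space_eq[OF g(2)] sets_eq_imp_space_eq[OF r0(2)] sets_eq_imp_space_eq[OF r1(2)] by auto
 define a where "a p = measure rho0 {x. idx x = p}" for p
 define b where "b p = measure rho1 {x. idx x = p}" for p
 define G where "G p = measure gm {x. idx x = p}" for p
 have ab: "0 <= a p" "0 <= b p" "sum a P = 1" "sum b P = 1" for p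
  using index_total[OF r0(1,2)] index_total[OF r1(1,2)] by (auto simp: a_def b_def spg)
 obtain pl where pl: "\<And>p q. 0 <= pl p q" "\<And>p. p : P ==> (\<Sum>q\<in>P. pl p q) = a p" "\<And>q. q : P ==> (\<Sum>p\<in>P. pl p q) = b q"
  and opt: "\<And>pl'. [|\<And>p q. 0 <= pl' p q; \<And>p. p : P ==> (\<Sum>q\<in>P. pl' p q) = a p;
    \<And>q. q : P ==> (\<Sum>p\<in>P. pl' p q) = b q|]
   ==> (\<Sum>p\<in>P. \<Sum>q\<in>P. pl p q * cst p q) <= (\<Sum>p\<in>P. \<Sum>q\<in>P. pl' p q * cst p q)"
  and swap: "\<And>p q p' q'. [|p : P; q : P; p' : P; q' : P; pl p q > 0; pl p' q' > 0|] ==> cst p q + cst p' q' <= cst p q' + cst p' q"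
  by (rule finite_transport_optimal[OF finite_P finite_P ab, of cst]) blast
 define Lm where "Lm = insert None (Some ` sites)"
 have fLm: "finite Lm" unfolding Lm_def using finite_sites by simp
 have ztLm: "zt p q : Lm" for p q using zt0(1) by (auto simp: zt_def Lm_def)
 define w where "w l = (\<Sum>p\<in>P. \<Sum>q\<in>P. if zt p q = l then pl p q else 0)" for l
 have w': "w l = (\<Sum>q\<in>P. \<Sum>p\<in>P. if zt p q = l then pl p q else 0)" for l unfolding w_def by (rule sum.swap)
 define A where "A l = {p : P. \<exists>q\<in>P. zt p q = l \<and> pl p q > 0}" for l
 define B where "B l = {q : P. \<exists>p\<in>P. zt p q = l \<and> pl p q > 0}" for l
 have w0: "0 <= w l" for l unfolding w_def using pl(1) by (intro sum_nonneg) auto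
 have part0: "(\<Sum>p\<in>P. a p * ln (a p / G p)) <= E" "\<And>p. p : P ==> a p > 0 ==> G p > 0"
  using entropy_bound_partition[OF r0(3) g(1) r0(1) finite_P, of idx] idx_in_P by (auto simp: a_def G_def spg g(2))
 have part1: "(\<Sum>p\<in>P. b p * ln (b p / G p)) <= E" "\<And>p. p : P ==> b p > 0 ==> G p > 0"
  using entropy_bound_partition[OF r1(3) g(1) r1(1) finite_P, of idx] idx_in_P by (auto simp: b_def G_def spg g(2))
 have lab0: "(\<Sum>l\<in>Lm. w l * ln (w l / sum G (A l))) <= (\<Sum>p\<in>P. (\<Sum>q\<in>P. pl p q) * ln ((\<Sum>q\<in>P. pl p q) / G p))"
  "\<And>l. w l > 0 ==> A l \<noteq> {} \<and> sum G (A l) > 0"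
 proof -
  have G: "\<And>p. p : P ==> (\<Sum>q\<in>P. pl p q) > 0 ==> G p > 0" using pl(2) part0(2) by simp
  note L = label_entropy[OF finite_P finite_P fLm, where zt = zt and pl = pl and G = G, OF ztLm pl(1) G, folded w_def A_def]
  show "(\<Sum>l\<in>Lm. w l * ln (w l / sum G (A l))) <= (\<Sum>p\<in>P. (\<Sum>q\<in>P. pl p q) * ln ((\<Sum>q\<in>P. pl p q) / G p))" by (rule L(1))
  show "A l \<noteq> {} \<and> sum G (A l) > 0" if "w l > 0" for l by (rule L(2)) (use that in auto)
 qed
 have lab1: "(\<Sum>l\<in>Lm. w l * ln (w l / sum G (B l))) <= (\<Sum>q\<in>P. (\<Sum>p\<in>P. pl p q) * ln ((\<Sum>p\<in>P. pl p q) / G q))"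
  "\<And>l. w l > 0 ==> B l \<noteq> {} \<and> sum G (B l) > 0"
 proof -
  have G: "\<And>q. q : P ==> (\<Sum>p\<in>P. pl p q) > 0 ==> G q > 0" using pl(3) part1(2) by simp
  note L = label_entropy[OF finite_P finite_P fLm, where zt = "\<lambda>q p. zt p q" and pl = "\<lambda>q p. pl p q" and G = G, OF ztLm pl(1) G, folded w' B_def]
  show "(\<Sum>l\<in>Lm. w l * ln (w l / sum G (B l))) <= (\<Sum>q\<in>P. (\<Sum>p\<in>P. pl p q) * ln ((\<Sum>p\<in>P. pl p q) / G q))" by (rule L(1))
  show "B l \<noteq> {} \<and> sum G (B l) > 0" if "w l > 0" for l by (rule L(2)) (use that in auto)
 qed
 have e0: "(\<Sum>l\<in>Lm. w l * ln (w l / sum G (A l))) <= E" using lab0(1) part0(1) pl(2) by simp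
 have e1: "(\<Sum>l\<in>Lm. w l * ln (w l / sum G (B l))) <= E" using lab1(1) part1(1) pl(3) by simp
 have gsum: "sum G X <= 1" if "X \<subseteq> P" for X
 proof -
  have "sum G X <= sum G P" using that finite_P by (intro sum_mono2) (auto simp: G_def)
  then show ?thesis using index_total[OF g] by (simp add: G_def spg)
 qed
 have G0: "0 <= G p" for p by (simp add: G_def)
 define unS :: "(nat => int) option set => (nat => int) set" where "unS X = {k. Some k : X}" for X
 have unS: "X = Some ` unS X" "finite (unS X)" "unS X \<subseteq> pts" if "X \<subseteq> P" "None \<notin> X" for X
 proof -
  show "X = Some ` unS X"
  proof (intro set_eqI iffI)
   fix p assume "p : X"
   then show "p : Some ` unS X" using that(2) unfolding unS_def by (cases p) auto
  qed (auto simp: unS_def)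
  show "unS X \<subseteq> pts" using that unfolding unS_def P_def by auto
  then show "finite (unS X)" using finite_pts finite_subset by auto
 qed
 have posS: "pos (Some k) = (lat (s^2) k)" for k by (simp add: pos_def fun_eq_iff)
 have site_l: "site_near t C s (unS (A (Some l))) (unS (B (Some l))) l \<and>
    measure (gaussPi J bt sg) (cubes J s (unS (A (Some l)))) powr (1 - t)
     * measure (gaussPi J bt sg) (cubes J s (unS (B (Some l)))) powr t
    <= 2 * measure (gaussPi J bt sg) (cube J (lat s l) s)" for l
 proof (rule site)
  have A: "A (Some l) \<subseteq> P" "None \<notin> A (Some l)" and B: "B (Some l) \<subseteq> P" "None \<notin> B (Some l)" by (auto simp: A_def B_def zt_def)
  show "finite (unS (A (Some l)))" "finite (unS (B (Some l)))" using unS A B by auto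
  show "\<forall>k\<in>unS (A (Some l)). \<forall>i\<in>J. \<bar>lat (s^2) k i\<bar> <= L + 1" "\<forall>k\<in>unS (B (Some l)). \<forall>i\<in>J. \<bar>lat (s^2) k i\<bar> <= L + 1"
   using unS(3)[OF A] unS(3)[OF B] by (auto simp: pts_def)
  show "site_opt t eps dl L s (unS (A (Some l))) (unS (B (Some l))) l"
  proof (intro ballI allI impI)
   fix k k' l' assume "k : unS (A (Some l))" "k' : unS (B (Some l))" and l': "\<forall>i\<in>J. \<bar>lat s l' i\<bar> <= L + 2"
   then obtain p q where pq: "Some k : P" "q : P" "zt (Some k) q = Some l" "pl (Some k) q > 0"
    "Some k' : P" "p : P" "zt p (Some k') = Some l" "pl p (Some k') > 0" by (auto simp: unS_def A_def B_def)
   have l: "l = zt0 (Some k) q" "l = zt0 p (Some k')" using pq(3,7) by (auto simp: zt_def split: if_splits)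
   \<comment> \<open>Two pairs use \<open>l\<close>, one leaving \<open>Some k\<close>, the other
     arriving at \<open>Some k'\<close>. After the exchange, the pair \<open>p\<close>,
     \<open>q\<close> is bounded by its cost through \<open>l\<close> and the pair of
     \<open>k\<close> and \<open>k'\<close> by its cost through \<open>l'\<close>. Costs through one
     site split, so the terms of \<open>p\<close> and \<open>q\<close> cancel.\<close>
   have "cst (Some k) q + cst p (Some k') <= cst (Some k) (Some k') + cst p q"
    using swap[OF pq(1,2) pq(6,5) pq(4,8)] .
   also have "... <= cc (Some k) (Some k') l' + cc p q l"
    using cst_le[of l' "Some k" "Some k'"] l' zt0(2)[OF zt0(1), of p q "Some k" q] unfolding l(1) by auto
   finally have "cc (Some k) q l + cc p (Some k') l <= cc (Some k) (Some k') l' + cc p q l"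
    using l unfolding cst_def by simp
   moreover have "cc (Some k) q l + cc p (Some k') l = cc (Some k) (Some k') l + cc p q l" by (simp add: cc_def chain_cost_def)
   ultimately show "chain_cost t eps dl (vec (lat (s^2) k)) (vec (lat (s^2) k')) (vec (lat s l))
    <= chain_cost t eps dl (vec (lat (s^2) k)) (vec (lat (s^2) k')) (vec (lat s l'))"
    by (simp add: cc_def posS)
  qed
 qed
 \<comment> \<open>For a genuine site this is the conclusion of \<open>site\<close>; for
   \<open>None\<close> the cell has measure 1 and the left side is at most 1.\<close>
 have gcell: "sum G (A l) powr (1 - t) * sum G (B l) powr t <= 2 * measure gm (cell l)" for l
 proof (cases l)
  case None
  have "0 <= sum G (A l)" "0 <= sum G (B l)" "sum G (A l) <= 1" "sum G (B l) <= 1"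
   by (auto intro!: sum_nonneg gsum[of "A l"] gsum[of "B l"] simp: G0) (auto simp: A_def B_def)
  then have "sum G (A l) powr (1 - t) * sum G (B l) powr t <= 1 * 1"
   using t by (intro mult_mono) (auto intro: powr_le1)
  moreover have "measure gm (cell l) = 1" using g.prob_space None by (simp add: cell_def spg)
  ultimately show ?thesis by simp
 next
  case (Some k)
  have A: "A (Some k) \<subseteq> P" "None \<notin> A (Some k)" and B: "B (Some k) \<subseteq> P" "None \<notin> B (Some k)" by (auto simp: A_def B_def zt_def)
  have le: "sum G X <= measure (gaussPi J bt sg) (cubes J s (unS X))"
   if X: "X \<subseteq> P" "None \<notin> X" for X
  proof -
   have "sum G X = sum G (Some ` unS X)" using unS(1)[OF X] by simp
   also have "... = (\<Sum>k\<in>unS X. measure gm {x. idx x = Some k})" by (simp add: sum.reindex G_def)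
   also have "... <= measure (gaussPi J bt sg) (cubes J s (unS X))"
    by (rule measure_idx_union[OF unS(3)[OF X]])
   finally show ?thesis .
  qed
  have "sum G (A l) powr (1 - t) * sum G (B l) powr t \<le>
    measure (gaussPi J bt sg) (cubes J s (unS (A (Some k)))) powr (1 - t)
     * measure (gaussPi J bt sg) (cubes J s (unS (B (Some k)))) powr t"
   unfolding Some using t le[OF A] le[OF B]
   by (intro mult_mono powr_mono2) (auto intro!: sum_nonneg simp: G_def)
  also have "... <= 2 * measure gm (cell l)" using site_l[of k] unfolding Some measure_cell by simp
  finally show ?thesis .
 qed
 have wtot: "(\<Sum>l\<in>Lm. w l) = 1"
  using sum_relabel[OF fLm, of P P zt pl "\<lambda>_. 1"] ztLm pl(2) ab(3) by (simp add: w_def)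
 \<comment> \<open>The logarithm of \<open>gcell\<close> splits the entropy of the sites, with
   weights \<open>1 - t\<close> and \<open>t\<close>, into the two label entropies, each at most
   \<open>E\<close>. The factor 2 contributes \<open>ln 2\<close>, since \<open>w\<close> has total
   mass 1.\<close>
 have "(\<Sum>l\<in>Lm. w l * ln (w l / measure gm (cell l))) \<le>
  (\<Sum>l\<in>Lm. (1 - t) * (w l * ln (w l / sum G (A l))) + t * (w l * ln (w l / sum G (B l))) + ln 2 * w l)"
 proof (intro sum_mono)
  fix l assume "l : Lm"
  show "w l * ln (w l / measure gm (cell l)) <= (1 - t) * (w l * ln (w l / sum G (A l))) + t * (w l * ln (w l / sum G (B l))) + ln 2 * w l"
  proof (cases "w l = 0")
   case False
   then have w: "w l > 0" using w0[of l] by simp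
   then have p: "sum G (A l) > 0" "sum G (B l) > 0" using lab0(2)[of l] lab1(2)[of l] by auto
   have "ln (sum G (A l) powr (1 - t) * sum G (B l) powr t) <= ln (2 * measure gm (cell l))"
    using gcell[of l] p by (subst ln_le_cancel_iff) (auto intro: cell_pos)
   then have "ln (w l) - ln (measure gm (cell l)) <= (1 - t) * (ln (w l) - ln (sum G (A l))) + t * (ln (w l) - ln (sum G (B l))) + ln 2"
    using p cell_pos[of l] by (simp add: ln_mult ln_powr algebra_simps)
   then have "w l * ln (w l / measure gm (cell l)) <= w l * ((1 - t) * ln (w l / sum G (A l)) + t * ln (w l / sum G (B l)) + ln 2)"
    using p w cell_pos[of l] w by (simp add: ln_div)
   then show ?thesis by (simp add: algebra_simps)
  qed simp
 qed
 also have "... = (1 - t) * (\<Sum>l\<in>Lm. w l * ln (w l / sum G (A l))) + t * (\<Sum>l\<in>Lm. w l * ln (w l / sum G (B l))) + ln 2 * (\<Sum>l\<in>Lm. w l)"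
  by (simp add: sum.distrib sum_distrib_left)
 also have "... <= (1 - t) * E + t * E + 1 * 1"
  unfolding wtot using e0 e1 t ln_2_less_1 by (intro add_mono mult_left_mono) auto
 finally have ent: "(\<Sum>l\<in>Lm. w l * ln (w l / measure gm (cell l))) <= E + 1" by (simp add: algebra_simps)
 define kp where "kp p q z = ennreal (1 / measure gm (cell (zt p q))) * indicator (cell (zt p q)) z" for p q z
 have kpm [measurable]: "kp p q : borel_measurable gm" for p q
  unfolding kp_def using sets_cell[of "zt p q"] g(2) by simp
 have kpI: "(\<integral>\<^sup>+z. kp p q z * indicator S z \<partial>gm) = ennreal (measure gm (S \<inter> cell (zt p q)) / measure gm (cell (zt p q)))"
  if "S : sets borel" for p q S
 proof -
  have "(\<integral>\<^sup>+z. kp p q z * indicator S z \<partial>gm) = (\<integral>\<^sup>+z. ennreal (1 / measure gm (cell (zt p q))) * indicator (S \<inter> cell (zt p q)) z \<partial>gm)"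
   by (intro nn_integral_cong) (auto simp: kp_def indicator_def)
  also have "... = ennreal (1 / measure gm (cell (zt p q))) * emeasure gm (S \<inter> cell (zt p q))"
   using that sets_cell[of "zt p q"] g(2) by (intro nn_integral_cmult_indicator) auto
  finally show ?thesis by (simp add: g.emeasure_eq_measure ennreal_mult[symmetric])
 qed
 have kp1: "(\<integral>\<^sup>+z. kp p q z \<partial>gm) = 1" for p q
  using kpI[of UNIV p q] cell_pos[of "zt p q"] by simp
 have im: "idx : rho0 \<rightarrow>\<^sub>M count_space P" "idx : rho1 \<rightarrow>\<^sub>M count_space P"
  using idx_measurable r0(2) r1(2) by auto
 have pla: "p : P ==> (\<Sum>q\<in>P. pl p q) = measure rho0 {x : space rho0. idx x = p}"
  "q : P ==> (\<Sum>p\<in>P. pl p q) = measure rho1 {x : space rho1. idx x = q}" for p q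
  using pl(2,3) by (simp_all add: a_def b_def spg)
 obtain M where pM: "prob_space M" and sM0: "sets M = sets (rho0 \<Otimes>\<^sub>M (rho1 \<Otimes>\<^sub>M gm))"
  and M0: "\<And>f. f : borel_measurable rho0 ==> (\<integral>\<^sup>+u. f (fst u) \<partial>M) = (\<integral>\<^sup>+x. f x \<partial>rho0)"
  and M1: "\<And>f. f : borel_measurable rho1 ==> (\<integral>\<^sup>+u. f (fst (snd u)) \<partial>M) = (\<integral>\<^sup>+x. f x \<partial>rho1)"
  and MF: "\<And>F :: (nat => int) option => (nat => int) option => 'h => ennreal. (\<And>p q. F p q : borel_measurable gm) ==>
   (\<integral>\<^sup>+u. F (idx (fst u)) (idx (fst (snd u))) (snd (snd u)) \<partial>M) =
   (\<Sum>p\<in>P. \<Sum>q\<in>P. ennreal (pl p q) * (\<integral>\<^sup>+z. kp p q z * F p q z \<partial>gm))"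
 proof (rule finite_index_kernel[OF r0(1) r1(1) g(1) finite_P finite_P im, where pl = pl and kp = kp], goal_cases)
  qed (use pl(1) pla kpm kp1 in auto)
 have sM: "sets M = sets (borel \<Otimes>\<^sub>M (borel \<Otimes>\<^sub>M borel))"
  unfolding sM0 using r0(2) r1(2) g(2) by simp
 note [measurable_cong] = sM
 have spM: "space M = UNIV" using sets_eq_imp_space_eq[OF sM] by (simp add: space_pair_measure)
 show thesis
 proof (rule that[OF pM sM])
  show "(\<integral>\<^sup>+u. f (fst u) \<partial>M) = (\<integral>\<^sup>+x. f x \<partial>rho0)" if "f : borel_measurable borel" for f
   by (rule M0) (use that r0(2) in \<open>simp cong: measurable_cong_sets\<close>)
  show "(\<integral>\<^sup>+u. f (fst (snd u)) \<partial>M) = (\<integral>\<^sup>+x. f x \<partial>rho1)" if "f : borel_measurable borel" for f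
   by (rule M1) (use that r1(2) in \<open>simp cong: measurable_cong_sets\<close>)
  let ?K = "eps + slack t eps dl (real (card J) * s)"
  have K0: "0 <= ?K" using ep d t by simp
  let ?pc = "\<lambda>p q. pert_cost dl (vec (pos p)) (vec (pos q))"
  have pc0: "0 <= ?pc p q" for p q using d by (simp add: pert_cost_def)
  show "(\<integral>\<^sup>+u. ennreal (pert_cost dl (rep (fst u)) (rep (fst (snd u)))) \<partial>M)
   <= (\<integral>\<^sup>+v. ennreal (pert_cost dl (rep (fst v)) (rep (snd v))) \<partial>th) + ennreal ?K" if th: "th : couplings rho0 rho1" for th
  proof -
   obtain pl' where pl': "\<And>p q. 0 <= pl' p q" "\<And>p. p : P ==> (\<Sum>q\<in>P. pl' p q) = measure rho0 {x : space rho0. idx x = p}"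
    "\<And>q. q : P ==> (\<Sum>p\<in>P. pl' p q) = measure rho1 {x : space rho1. idx x = q}"
    and thI: "\<And>ph. (\<And>p q. 0 <= ph p q) ==> (\<integral>\<^sup>+v. ennreal (ph (idx (fst v)) (idx (snd v))) \<partial>th) = ennreal (\<Sum>p\<in>P. \<Sum>q\<in>P. pl' p q * ph p q)"
    by (rule coupling_index_cost[OF th]) blast
   have tot: "(\<Sum>p\<in>P. \<Sum>q\<in>P. pl' p q) = 1" using pl'(2) ab(3) by (simp add: a_def spg)
   have "(\<Sum>p\<in>P. \<Sum>q\<in>P. pl p q * ?pc p q) <= (\<Sum>p\<in>P. \<Sum>q\<in>P. pl p q * cst p q)"
    using pl(1) cst_bounds(1) by (intro sum_mono mult_left_mono)
   also have "... <= (\<Sum>p\<in>P. \<Sum>q\<in>P. pl' p q * cst p q)"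
    using pl' by (intro opt) (simp_all add: a_def b_def spg)
   also have "... <= (\<Sum>p\<in>P. \<Sum>q\<in>P. pl' p q * (?pc p q + ?K))"
    using pl'(1) cst_bounds(2) by (intro sum_mono mult_left_mono)
   also have "... = (\<Sum>p\<in>P. \<Sum>q\<in>P. pl' p q * ?pc p q) + (\<Sum>p\<in>P. \<Sum>q\<in>P. pl' p q) * ?K"
    by (simp only: distrib_left sum.distrib sum_distrib_right)
   finally have le: "(\<Sum>p\<in>P. \<Sum>q\<in>P. pl p q * ?pc p q) <= (\<Sum>p\<in>P. \<Sum>q\<in>P. pl' p q * ?pc p q) + ?K" unfolding tot by simp
   have "(\<integral>\<^sup>+u. ennreal (pert_cost dl (rep (fst u)) (rep (fst (snd u)))) \<partial>M) = (\<Sum>p\<in>P. \<Sum>q\<in>P. ennreal (pl p q) * (\<integral>\<^sup>+z. kp p q z * ennreal (?pc p q) \<partial>gm))"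
    unfolding rep_def by (rule MF[of "\<lambda>p q z. ennreal (?pc p q)"]) simp
   also have "... = (\<Sum>p\<in>P. \<Sum>q\<in>P. ennreal (pl p q * ?pc p q))"
    using pl(1) pc0 by (simp add: nn_integral_multc kp1 ennreal_mult)
   also have "... = ennreal (\<Sum>p\<in>P. \<Sum>q\<in>P. pl p q * ?pc p q)"
    using pl(1) pc0 by (simp add: sum_nonneg)
   also have "... <= ennreal ((\<Sum>p\<in>P. \<Sum>q\<in>P. pl' p q * ?pc p q) + ?K)" by (rule ennreal_leI[OF le])
   also have "... = ennreal (\<Sum>p\<in>P. \<Sum>q\<in>P. pl' p q * ?pc p q) + ennreal ?K"
    by (rule ennreal_plus) (use K0 pl'(1) pc0 in \<open>auto intro!: sum_nonneg\<close>)
   also have "ennreal (\<Sum>p\<in>P. \<Sum>q\<in>P. pl' p q * ?pc p q) = (\<integral>\<^sup>+v. ennreal (pert_cost dl (rep (fst v)) (rep (snd v))) \<partial>th)"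
    unfolding rep_def by (rule thI[OF pc0, symmetric])
   finally show ?thesis .
  qed
  show "AE u in M. idx (fst u) \<noteq> None --> idx (fst (snd u)) \<noteq> None -->
   norm (vec (co (snd (snd u))) - ((1 - t) *\<^sub>R rep (fst u) + t *\<^sub>R rep (fst (snd u)))) <= (C + real (card J)) * s"
  proof -
   define bad where "bad p q = {z. p \<noteq> None \<and> q \<noteq> None \<and> (C + real (card J)) * s < norm (vec (co z) - ((1 - t) *\<^sub>R vec (pos p) + t *\<^sub>R vec (pos q)))}" for p q
   have bm: "bad p q : sets borel" for p q unfolding bad_def by simp
   have em: "S \<inter> cell (zt p q) = {}" if Sb: "S = bad p q" and pp: "pl p q > 0" "p : P" "q : P" for S p q
   proof (rule ccontr)
    assume "S \<inter> cell (zt p q) \<noteq> {}"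
    then obtain z where z: "z : bad p q" "z : cell (zt p q)" using Sb by auto
    then obtain k k' where k: "p = Some k" "q = Some k'" by (auto simp: bad_def)
    define l where "l = zt0 p q"
    have zl: "zt p q = Some l" by (simp add: zt_def k l_def)
    have 1: "norm (vec (lat s l) - vec (mid t s k k')) <= C * s"
     using pp k zl site_l[of l] by (auto simp: unS_def A_def B_def)
    have 2: "norm (vec (co z) - vec (lat s l)) <= real (card J) * s"
     using z(2) unfolding zl cell_def by (intro norm_vec_diff_le) (auto simp: co_in_cube)
    have "(1 - t) *\<^sub>R vec (pos p) + t *\<^sub>R vec (pos q) = vec (mid t s k k')"
     unfolding vec_convex by (simp add: k pos_def)
    then show False using 1 2 norm_triangle_ineq[of "vec (co z) - vec (lat s l)" "vec (lat s l) - vec (mid t s k k')"]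
     using z(1) by (simp add: distrib_right bad_def)
   qed
   have "(\<integral>\<^sup>+u. indicator (bad (idx (fst u)) (idx (fst (snd u)))) (snd (snd u)) \<partial>M)
    = (\<Sum>p\<in>P. \<Sum>q\<in>P. ennreal (pl p q) * (\<integral>\<^sup>+z. kp p q z * indicator (bad p q) z \<partial>gm))"
    by (rule MF[of "\<lambda>p q. indicator (bad p q)"]) (use bm g(2) in auto)
   also have "... = 0"
    unfolding kpI[OF bm] using em[OF refl] pl(1) by (intro sum.neutral ballI) (auto simp: less_le)
   finally have z: "(\<integral>\<^sup>+u. indicator (bad (idx (fst u)) (idx (fst (snd u)))) (snd (snd u)) \<partial>M) = 0" .
   define bad' where "bad' = {u : space M. idx (fst u) \<noteq> None \<and> idx (fst (snd u)) \<noteq> None \<and>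
    (C + real (card J)) * s < norm (vec (co (snd (snd u))) - ((1 - t) *\<^sub>R rep (fst u) + t *\<^sub>R rep (fst (snd u))))}"
   have bm': "bad' : sets M" unfolding bad'_def by measurable
   have "emeasure M bad' = (\<integral>\<^sup>+u. indicator bad' u \<partial>M)" using bm' by simp
   also have "... = 0" unfolding z[symmetric] by (intro nn_integral_cong) (auto simp: bad'_def bad_def rep_def indicator_def)
   finally show ?thesis using bm' by (intro AE_I[of _ _ bad']) (auto simp: bad'_def)
  qed
  show "N * measure M {u. snd (snd u) : S} <= E + 3 + 2 * exp N * measure gm S" if S: "S : sets borel" and N: "0 <= N" for S N
  proof -
   let ?v = "\<lambda>l. measure gm (S \<inter> cell l) / measure gm (cell l)"
   have "emeasure M {u. snd (snd u) : S} = (\<integral>\<^sup>+u. indicator S (snd (snd u)) \<partial>M)"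
   proof -
    have Sm: "{u. snd (snd u) : S} : sets M" using S measurable_sets[of "\<lambda>u. snd (snd u)" M borel S] by (simp add: vimage_def spM)
    have "emeasure M {u. snd (snd u) : S} = (\<integral>\<^sup>+u. indicator {u. snd (snd u) : S} u \<partial>M)" using Sm by simp
    then show ?thesis by (simp add: indicator_def)
   qed
   also have "... = (\<Sum>p\<in>P. \<Sum>q\<in>P. ennreal (pl p q) * (\<integral>\<^sup>+z. kp p q z * indicator S z \<partial>gm))"
    by (rule MF[of "\<lambda>p q. indicator S"]) (use S g(2) in auto)
   also have "... = ennreal (\<Sum>p\<in>P. \<Sum>q\<in>P. pl p q * ?v (zt p q))"
    unfolding kpI[OF S] using pl(1) by (simp add: ennreal_mult[symmetric] sum_nonneg)
   also have "(\<Sum>p\<in>P. \<Sum>q\<in>P. pl p q * ?v (zt p q)) = (\<Sum>l\<in>Lm. w l * ?v l)"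
    unfolding w_def by (rule sum_relabel[OF fLm ztLm, symmetric])
   finally show ?thesis using w0 weighted_cells_bound[OF g(1) fLm, of cell S w "E + 1" N] S N w0 ent cell_pos cell_mult sets_cell g(2)
    unfolding Lm_def by (simp add: measure_def sum_nonneg)
  qed
 qed
qed

end

section \<open>From finitely many coordinates to the whole space\<close>

lemma coupling_cost_perturb:
 fixes x y x' y' :: "'a::real_normed_vector"
 assumes al: "0 < aa" "aa <= 1" and de: "0 <= dl" and p: "(norm (x - x'))^2 <= p" and q: "(norm (y - y'))^2 <= q"
  and n: "(norm (x - y))^2 <= 2 * a + 2 * b"
 defines "Err \<equiv> aa + 4 * dl * aa * (a + b) + 2 * (1 / aa + 2 * dl * aa + dl * (1 + 1 / aa)) * (p + q)"
 shows "pert_cost dl x y <= pert_cost dl x' y' + Err" "pert_cost dl x' y' <= pert_cost dl x y + Err"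
proof -
 define D where "D = norm (x - y)"
 define D' where "D' = norm (x' - y')"
 define h where "h = norm (x - x') + norm (y - y')"
 have h0: "h >= 0" "D >= 0" "D' >= 0" by (auto simp: h_def D_def D'_def)
 have DD: "D <= D' + h" "D' <= D + h" unfolding D_def D'_def h_def by norm+
 have hW: "h^2 <= 2 * (p + q)"
 proof -
  show ?thesis unfolding h_def using zero_le_power2[of "norm (x - x') - norm (y - y')"] p q by (simp add: power2_eq_square algebra_simps)
 qed
 \<comment> \<open>A small \<open>aa\<close> is chosen first and controls the terms with
   \<open>a + b\<close>; the squared errors \<open>p\<close> and \<open>q\<close> are taken small
   relative to \<open>aa\<close> afterwards.\<close>
 have young: "2 * u * v <= aa * u^2 + v^2 / aa" for u v :: real
 proof -
  have "0 <= (aa * u - v)^2 / aa" using al by simp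
  also have "... = aa * u^2 + v^2 / aa - 2 * u * v" using al by (simp add: power2_eq_square field_simps)
  finally show ?thesis by simp
 qed
 have hl: "h <= aa + h^2 / aa" using young[of 1 h] h0 by simp
 have sq: "A^2 <= (1 + aa) * B^2 + (1 + 1 / aa) * h^2" if "A <= B + h" "0 <= A" for A B :: real
 proof -
  have "A^2 <= (B + h)^2" using that by simp
  then show ?thesis using young[of B h] by (simp add: power2_sum algebra_simps)
 qed
 have D2: "D^2 <= 2 * (a + b)" using n by (simp add: D_def)
 have D'2: "D'^2 <= 2 * D^2 + 2 * h^2"
 proof -
  have "D'^2 <= (D + h)^2" using DD h0 by simp
  then show ?thesis using zero_le_power2[of "D - h"] by (simp add: power2_eq_square algebra_simps)
 qed
 have K: "h + dl * (aa * X + (1 + 1 / aa) * h^2) <= Err" if X: "X <= 4 * (a + b) + 2 * h^2" for X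
 proof -
  have "dl * (aa * X) <= dl * (aa * (4 * (a + b) + 2 * h^2))" using X al de by (intro mult_left_mono) auto
  then have "h + dl * (aa * X + (1 + 1 / aa) * h^2) <= aa + 4 * dl * aa * (a + b) + (1 / aa + 2 * dl * aa + dl * (1 + 1 / aa)) * h^2"
   using hl by (simp add: algebra_simps)
  also have "(1 / aa + 2 * dl * aa + dl * (1 + 1 / aa)) * h^2 <= (1 / aa + 2 * dl * aa + dl * (1 + 1 / aa)) * (2 * (p + q))"
   using hW al de by (intro mult_left_mono) auto
  finally show ?thesis unfolding Err_def by (simp only: mult.assoc mult.left_commute[of 2])
 qed
 have n1: "D'^2 <= 4 * (a + b) + 2 * h^2" using D'2 D2 by simp
 have ab: "0 <= a + b" using order_trans[OF zero_le_power2 D2] by simp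
 have n2: "D^2 <= 4 * (a + b) + 2 * h^2"
 proof -
  have "u <= 4 * v + 2 * w" if "u <= 2 * v" "0 <= v" "0 <= w" for u v w :: real using that by simp
  from this[OF D2 ab zero_le_power2] show ?thesis .
 qed
 have "dl * D^2 <= dl * ((1 + aa) * D'^2 + (1 + 1 / aa) * h^2)" using sq[OF DD(1) h0(2)] de by (intro mult_left_mono)
 then show "pert_cost dl x y <= pert_cost dl x' y' + Err"
  using DD(1) K[OF n1] unfolding pert_cost_def D_def[symmetric] D'_def[symmetric] by (simp add: algebra_simps)
 have "dl * D'^2 <= dl * ((1 + aa) * D^2 + (1 + 1 / aa) * h^2)" using sq[OF DD(2) h0(3)] de by (intro mult_left_mono)
 then show "pert_cost dl x' y' <= pert_cost dl x y + Err"
  using DD(2) K[OF n2] unfolding pert_cost_def D_def[symmetric] D'_def[symmetric] by (simp add: algebra_simps)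
qed

lemma nn_integral_tendsto_zero:
 fixes u :: "nat => 'a => real"
 assumes [measurable]: "\<And>n. u n : borel_measurable M" "w : borel_measurable M"
  and "\<And>n x. 0 <= u n x" "\<And>n x. u n x <= w x" and fin: "(\<integral>\<^sup>+x. ennreal (w x) \<partial>M) < \<infinity>"
  and lim: "AE x in M. (\<lambda>n. u n x) \<longlonglongrightarrow> 0"
 shows "(\<lambda>n. \<integral>\<^sup>+x. ennreal (u n x) \<partial>M) \<longlonglongrightarrow> 0"
proof -
 have "(\<lambda>n. \<integral>\<^sup>+x. ennreal (u n x) \<partial>M) \<longlonglongrightarrow> (\<integral>\<^sup>+x. 0 \<partial>M)"
 proof (rule nn_integral_dominated_convergence[where w = "\<lambda>x. ennreal (w x)"])
  show "AE x in M. (\<lambda>n. ennreal (u n x)) \<longlonglongrightarrow> 0"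
   using lim by eventually_elim (metis tendsto_ennrealI ennreal_0)
 qed (use assms in \<open>auto intro!: ennreal_leI\<close>)
 then show ?thesis by simp
qed

locale gaussian_pair =
 fixes gm rho0 rho1 :: "'h::{real_inner, polish_space} measure" and x0 :: 'h and e :: "nat => 'h" and c bt :: "nat => real"
  and I :: "nat set" and E :: real
 assumes g: "prob_space gm" "sets gm = sets borel" and r0: "prob_space rho0" "sets rho0 = sets borel" "entropy_bound gm rho0 E"
  and r1: "prob_space rho1" "sets rho1 = sets borel" "entropy_bound gm rho1 E"
  and onI: "PROP orthonormal_on e I" and cI: "\<And>i. i : I ==> 0 < c i"
  and law: "\<And>J. finite J ==> J \<subseteq> I ==> coord_law gm x0 e J = gaussPi J bt (\<lambda>i. sqrt (c i))"
  and tail: "AE x in gm. (\<lambda>n. (x - x0) - (\<Sum>i\<in>I \<inter> {..<n}. ((x - x0) \<bullet> e i) *\<^sub>R e i)) \<longlonglongrightarrow> 0"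
  and mom0: "(moment2 x0 rho0) < \<infinity>" and mom1: "(moment2 x0 rho1) < \<infinity>"
begin

lemma E_nonneg: "0 <= E" using r0(3) by (auto simp: entropy_bound_def)

lemma AE_entropy_bound:
 assumes "entropy_bound gm rho E" "AE x in gm. Q x" shows "AE x in rho. Q x"
proof -
 obtain f where [measurable]: "f : borel_measurable gm" and rho: "rho = density gm (\<lambda>x. ennreal (f x))"
  using assms(1) by (auto simp: entropy_bound_def)
 show ?thesis unfolding rho using assms(2) by (subst AE_density) auto
qed

definition resid :: "nat set => 'h => real" where
 "resid J x = norm ((x - x0) - (\<Sum>i\<in>J. ((x - x0) \<bullet> e i) *\<^sub>R e i))"

lemma resid_measurable [measurable]: "resid J : borel_measurable borel"
 unfolding resid_def by measurable

lemma resid_le: "finite J ==> J \<subseteq> I ==> (resid J x)^2 <= (norm (x - x0))^2"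
 using orthonormal_partial_sums(4)[OF onI, where F = J and p = "x - x0"] sum_nonneg[of J "\<lambda>i. ((x - x0) \<bullet> e i)^2"]
 unfolding resid_def by (smt (verit) zero_le_power2)

text \<open>Residuals are dominated by \<open>norm (x - x0)\<close> and tend to 0 almost everywhere
  for \<open>gm\<close>, hence for \<open>rho0\<close> and \<open>rho1\<close> by absolute
  continuity. One finite frame serves all three measures.\<close>

lemma choose_frame:
 assumes k: "0 < kp" and w: "0 < om"
 obtains J where "finite J" "J \<subseteq> I" "(\<integral>\<^sup>+x. ennreal ((resid J x)^2) \<partial>rho0) < ennreal kp" "(\<integral>\<^sup>+x. ennreal ((resid J x)^2) \<partial>rho1) < ennreal kp"
  "measure gm {x. om < resid J x} < kp"
proof -
 interpret g: prob_space gm by (rule g)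
 define J where "J n = I \<inter> {..<n}" for n
 have J: "finite (J n)" "J n \<subseteq> I" for n by (auto simp: J_def)
 have lim: "AE x in gm. (\<lambda>n. resid (J n) x) \<longlonglongrightarrow> 0"
  using tail unfolding resid_def J_def by eventually_elim (rule tendsto_norm_zero)
 have "AE x in gm. (\<lambda>n. (resid (J n) x)^2) \<longlonglongrightarrow> 0" using lim by simp
 note l2 = AE_entropy_bound[OF r0(3) this] AE_entropy_bound[OF r1(3) this]
 have 1: "(\<lambda>n. \<integral>\<^sup>+x. ennreal ((resid (J n) x)^2) \<partial>rho0) \<longlonglongrightarrow> 0"
  by (rule nn_integral_tendsto_zero[OF _ _ _ _ mom0 l2(1)]) (use resid_le J r0(2) in \<open>auto cong: measurable_cong_sets\<close>)
 have 2: "(\<lambda>n. \<integral>\<^sup>+x. ennreal ((resid (J n) x)^2) \<partial>rho1) \<longlonglongrightarrow> 0"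
  by (rule nn_integral_tendsto_zero[OF _ _ _ _ mom1 l2(2)]) (use resid_le J r1(2) in \<open>auto cong: measurable_cong_sets\<close>)
 have ms: "{x. om < resid (J n) x} : sets gm" for n unfolding g(2) by simp
 have "(\<lambda>n. \<integral>\<^sup>+x. ennreal (indicator {x. om < resid (J n) x} x) \<partial>gm) \<longlonglongrightarrow> 0"
 proof (rule nn_integral_tendsto_zero[where w = "\<lambda>_. 1"])
  show "AE x in gm. (\<lambda>n. indicator {x. om < resid (J n) x} x :: real) \<longlonglongrightarrow> 0"
   using lim
  proof eventually_elim
   case (elim x)
   then have "eventually (\<lambda>n. resid (J n) x < om) sequentially" using w by (rule order_tendstoD)
   then have "eventually (\<lambda>n. indicator {x. om < resid (J n) x} x = (0 :: real)) sequentially" by eventually_elim auto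
   then show ?case by (rule tendsto_eventually)
  qed
 qed (use ms g.emeasure_space_1 in \<open>auto simp: indicator_le_1\<close>)
 then have 3: "(\<lambda>n. emeasure gm {x. om < resid (J n) x}) \<longlonglongrightarrow> 0" using ms by (simp add: ennreal_indicator)
 have "eventually (\<lambda>n. (\<integral>\<^sup>+x. ennreal ((resid (J n) x)^2) \<partial>rho0) < ennreal kp \<and> (\<integral>\<^sup>+x. ennreal ((resid (J n) x)^2) \<partial>rho1) < ennreal kp \<and> emeasure gm {x. om < resid (J n) x} < ennreal kp) sequentially"
  using order_tendstoD(2)[OF 1, of "ennreal kp"] order_tendstoD(2)[OF 2, of "ennreal kp"] order_tendstoD(2)[OF 3, of "ennreal kp"] k
  by (intro eventually_conj) auto
 then obtain n where n: "(\<integral>\<^sup>+x. ennreal ((resid (J n) x)^2) \<partial>rho0) < ennreal kp" "(\<integral>\<^sup>+x. ennreal ((resid (J n) x)^2) \<partial>rho1) < ennreal kp"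
  "emeasure gm {x. om < resid (J n) x} < ennreal kp" by (auto simp: eventually_sequentially)
 show thesis using n(3) k that[OF J n(1,2)] by (simp add: g.emeasure_eq_measure ennreal_less_iff)
qed

definition outb :: "nat set => real => 'h set" where
 "outb J L = {x. \<exists>i\<in>J. L < \<bar>(x - x0) \<bullet> e i\<bar>}"

lemma outb_sets [measurable]: "finite J ==> outb J L : sets borel"
 unfolding outb_def by measurable

text \<open>The weight \<open>1 + (norm (x - x0))^2\<close> controls at once the mass outside the
  box and the squared error of moving it to \<open>x0\<close>.\<close>

lemma choose_box:
 assumes k: "0 < kp" and J: "finite J"
 obtains L where "0 <= L" "(\<integral>\<^sup>+x. ennreal ((1 + (norm (x - x0))^2) * indicator (outb J L) x) \<partial>rho0) < ennreal kp"
  "(\<integral>\<^sup>+x. ennreal ((1 + (norm (x - x0))^2) * indicator (outb J L) x) \<partial>rho1) < ennreal kp"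
proof -
 note outb_sets[OF J, measurable]
 let ?u = "\<lambda>n x. (1 + (norm (x - x0))^2) * indicator (outb J (real n)) x"
 have lim: "(\<lambda>n. ?u n x) \<longlonglongrightarrow> 0" for x
 proof -
  have "eventually (\<lambda>n. \<forall>i\<in>J. \<bar>(x - x0) \<bullet> e i\<bar> <= real n) sequentially"
  proof (rule eventually_ball_finite[OF J], rule ballI)
   fix i assume "i : J"
   show "eventually (\<lambda>n. \<bar>(x - x0) \<bullet> e i\<bar> <= real n) sequentially"
    using filterlim_real_sequentially by (auto simp: filterlim_at_top)
  qed
  then have "eventually (\<lambda>n. ?u n x = 0) sequentially" by eventually_elim (force simp: outb_def indicator_def)
  then show ?thesis by (rule tendsto_eventually)
 qed
 have fin: "(\<integral>\<^sup>+x. ennreal (1 + (norm (x - x0))^2) \<partial>rho) < \<infinity>" if "prob_space rho" "sets rho = sets borel" "(moment2 x0 rho) < \<infinity>" for rho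
 proof -
  note [measurable_cong] = that(2)
  show ?thesis using prob_space.emeasure_space_1[OF that(1)] that(3) by (simp add: ennreal_plus nn_integral_add)
 qed
 have 1: "(\<lambda>n. \<integral>\<^sup>+x. ennreal (?u n x) \<partial>rho0) \<longlonglongrightarrow> 0"
  by (rule nn_integral_tendsto_zero[OF _ _ _ _ fin[OF r0(1,2) mom0]]) (use lim r0(2) in \<open>auto simp: indicator_def cong: measurable_cong_sets\<close>)
 have 2: "(\<lambda>n. \<integral>\<^sup>+x. ennreal (?u n x) \<partial>rho1) \<longlonglongrightarrow> 0"
  by (rule nn_integral_tendsto_zero[OF _ _ _ _ fin[OF r1(1,2) mom1]]) (use lim r1(2) in \<open>auto simp: indicator_def cong: measurable_cong_sets\<close>)
 have "eventually (\<lambda>n. (\<integral>\<^sup>+x. ennreal (?u n x) \<partial>rho0) < ennreal kp \<and> (\<integral>\<^sup>+x. ennreal (?u n x) \<partial>rho1) < ennreal kp) sequentially"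
  using order_tendstoD(2)[OF 1, of "ennreal kp"] order_tendstoD(2)[OF 2, of "ennreal kp"] k
  by (intro eventually_conj) auto
 then obtain n where "(\<integral>\<^sup>+x. ennreal (?u n x) \<partial>rho0) < ennreal kp" "(\<integral>\<^sup>+x. ennreal (?u n x) \<partial>rho1) < ennreal kp"
  by (auto simp: eventually_sequentially)
 then show thesis using that[of "real n"] by simp
qed

end

lemma ennreal_plus3: "0 <= a ==> 0 <= b ==> 0 <= c ==> ennreal a + ennreal b + ennreal c = ennreal (a + b + c)"
 by (simp add: ennreal_plus)

lemma ennreal_le_plus3:
 "a <= b + (p + q + r) ==> 0 <= b ==> 0 <= p ==> 0 <= q ==> 0 <= r ==> ennreal a <= ennreal b + (ennreal p + ennreal q + ennreal r)"
 by (simp add: ennreal_leI flip: ennreal_plus)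

context gaussian_pair
begin

text \<open>The tolerance fixes \<open>aa\<close>, \<open>Q\<close>, \<open>N0\<close> and
  \<open>kp\<close>, then the frame \<open>J\<close>, the box \<open>L\<close> and
  \<open>eps\<close>, and only then the mesh \<open>s\<close>. The discrete plan is compared with a
  coupling \<open>th\<close> by rounding on both sides of the optimality inequality; the rounding
  error is a sum of functions of one endpoint, so it depends on the marginals only and is the same
  on both sides.\<close>

lemma interpolated_plan:
 assumes t: "0 < t" "t < 1" and de: "0 < dl" and om: "0 < om"
 obtains M where "prob_space M" "sets M = sets (borel \<Otimes>\<^sub>M (borel \<Otimes>\<^sub>M borel))"
  "PROP marginal M fst rho0"
  "PROP marginal M (\<lambda>u. fst (snd u)) rho1"
  "\<And>th. th : couplings rho0 rho1 ==> (\<integral>\<^sup>+u. ennreal (pert_cost dl (fst u) (fst (snd u))) \<partial>M)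
   <= (pert_int dl th) + ennreal om"
  "measure M {u. om < norm (snd (snd u) - ((1 - t) *\<^sub>R fst u + t *\<^sub>R fst (snd u)))} <= om"
  "\<And>S N. S : sets borel ==> 0 <= N ==> N * measure M {u. snd (snd u) : S} <= E + 3 + 2 * exp N * measure gm S"
proof -
 note E0 = E_nonneg
 define v0 where "v0 = enn2real (moment2 x0 rho0)"
 define v1 where "v1 = enn2real (moment2 x0 rho1)"
 have v: "(moment2 x0 rho0) = ennreal v0" "0 <= v0"
  "(moment2 x0 rho1) = ennreal v1" "0 <= v1"
  using mom0 mom1 by (simp_all add: v0_def v1_def)
 define V where "V = v0 + v1"
 have V: "V >= 0" using v by (simp add: V_def)
 define aa where "aa = min 1 (om / (8 * (1 + 4 * dl * V)))"
 have p8: "0 < 8 * (1 + 4 * dl * V)" using V de by (simp add: add_pos_nonneg)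
 have al: "0 < aa" "aa <= 1" unfolding aa_def using om p8 by auto
 have "aa <= om / (8 * (1 + 4 * dl * V))" unfolding aa_def by simp
 then have "aa * (8 * (1 + 4 * dl * V)) <= om" by (simp only: pos_le_divide_eq[OF p8])
 then have alV: "aa + 4 * dl * aa * V <= om / 8" by (simp add: algebra_simps)
 define Ka where "Ka = 2 * (1 / aa + 2 * dl * aa + dl * (1 + 1 / aa))"
 have Ka: "0 < Ka" unfolding Ka_def using al de by (auto intro!: add_pos_pos mult_pos_pos)
 \<comment> \<open>\<open>Ka * Q\<close> occurs twice in each rounding error, whence the first
   bound; \<open>om ^ 3 / 128\<close> is \<open>(om / 4)^2 * (om / 8)\<close>, as Chebyshev's
   inequality asks for rounding errors above \<open>om / 4\<close>.\<close>
 define Q where "Q = min (om / (8 * Ka)) (min (om ^ 3 / 128) om)"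
 have Q: "0 < Q" "Q <= om ^ 3 / 128" "Q <= om" unfolding Q_def using om Ka by auto
 have "Q <= om / (8 * Ka)" unfolding Q_def by simp
 then have QK: "2 * (Ka * Q) <= om / 4" using Ka by (simp add: field_simps)
 \<comment> \<open>Together with the last bound on \<open>kp\<close>, the entropy clause then limits
   the mass with a large residual to \<open>2 * (E + 3) / N0 = om / 4\<close>.\<close>
 define N0 where "N0 = 8 * (E + 3) / om"
 have N0: "0 < N0" unfolding N0_def using E0 om by simp
 define kp where "kp = min (Q / 6) ((E + 3) / (2 * exp N0))"
 have ka: "0 < kp" "kp <= Q / 6" "kp <= (E + 3) / (2 * exp N0)" unfolding kp_def using Q E0 by auto
 obtain J where J: "finite J" "J \<subseteq> I" and J0: "(\<integral>\<^sup>+x. ennreal ((resid J x)^2) \<partial>rho0) < ennreal kp"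
  and J1: "(\<integral>\<^sup>+x. ennreal ((resid J x)^2) \<partial>rho1) < ennreal kp" and Jg: "measure gm {x. om / 4 < resid J x} < kp"
  using choose_frame[OF ka(1), of "om / 4"] om by auto
 obtain L where L: "0 <= L" and L0: "(\<integral>\<^sup>+x. ennreal ((1 + (norm (x - x0))^2) * indicator (outb J L) x) \<partial>rho0) < ennreal kp"
  and L1: "(\<integral>\<^sup>+x. ennreal ((1 + (norm (x - x0))^2) * indicator (outb J L) x) \<partial>rho1) < ennreal kp"
  using choose_box[OF ka(1) J(1)] by auto
 note outb_sets[OF J(1), measurable]
 define eps where "eps = om / 8"
 have ep: "0 < eps" using om by (simp add: eps_def)
 define n where "n = real (card J)"
 interpret F: frame J e x0 by (rule frame.intro) (use J onI in blast)+
 have sg: "\<And>i. i : J ==> 0 < sqrt (c i)" using cI J by auto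
 obtain C s0 where C: "C >= 0" and s0: "0 < s0" "s0 <= 1"
  and cp: "\<And>s (l :: nat => int). 0 < s ==> 0 < measure (gaussPi J bt (\<lambda>i. sqrt (c i))) (cube J (lat s l) s)"
  and site: "\<And>(s :: real) A B l. [|0 < s; s <= s0; finite A; finite B;
   PROP F.in_box s L A;
   PROP F.in_box s L B;
   F.site_opt t eps dl L s A B l|]
   ==> F.site_near t C s A B l \<and>
    measure (gaussPi J bt (\<lambda>i. sqrt (c i))) (cubes J s A) powr (1 - t)
     * measure (gaussPi J bt (\<lambda>i. sqrt (c i))) (cubes J s B) powr t
    <= 2 * measure (gaussPi J bt (\<lambda>i. sqrt (c i))) (cube J (lat s l) s)"
 proof (rule F.site_gauss[OF t ep de L, where sg = "\<lambda>i. sqrt (c i)" and bt = bt], goal_cases)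
  case (1 i) then show ?case using sg by simp
 next
  case (2 C s0) show ?case by (rule 2(1)[OF 2(2-6)])
 qed
 have ev: "eventually (\<lambda>s. s <= s0 \<and> (C + n) * s < om / 4 \<and> slack t eps dl (n * s) < om / 8 \<and> 2 * (n * s^2)^2 < Q / 2) (at_right 0)"
 proof (intro eventually_conj)
  show "eventually (\<lambda>s. s <= s0) (at_right 0)" using s0 by (auto simp: eventually_at_right_field)
  have "((\<lambda>s. (C + n) * s) \<longlongrightarrow> (C + n) * 0) (at_right 0)" by (intro tendsto_intros)
  then show "eventually (\<lambda>s. (C + n) * s < om / 4) (at_right 0)" by (rule order_tendstoD) (use om in simp)
  have "((\<lambda>s. slack t eps dl (n * s)) \<longlongrightarrow> slack t eps dl (n * 0)) (at_right 0)"
   using t by (intro tendsto_intros) auto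
  then show "eventually (\<lambda>s. slack t eps dl (n * s) < om / 8) (at_right 0)" by (rule order_tendstoD) (use om in simp)
  have "((\<lambda>s. 2 * (n * s^2)^2) \<longlongrightarrow> 2 * (n * 0^2)^2) (at_right 0)" by (intro tendsto_intros)
  then show "eventually (\<lambda>s. 2 * (n * s^2)^2 < Q / 2) (at_right 0)" by (rule order_tendstoD) (use Q in simp)
 qed
 have "eventually (\<lambda>s::real. 0 < s) (at_right 0)" by (simp add: eventually_at_right_less)
 with ev have "eventually (\<lambda>s. 0 < s \<and> s <= s0 \<and> (C + n) * s < om / 4 \<and> slack t eps dl (n * s) < om / 8 \<and> 2 * (n * s^2)^2 < Q / 2) (at_right 0)"
  by eventually_elim auto
 then obtain s where s: "0 < s" "s <= s0" and Cs: "(C + n) * s < om / 4"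
  and Kc: "slack t eps dl (n * s) < om / 8" and ns: "2 * (n * s^2)^2 < Q / 2"
  using eventually_happens'[OF trivial_limit_at_right_real] by auto
 interpret G: grid J e x0 gm rho0 rho1 bt "\<lambda>i. sqrt (c i)" t eps dl L s C E
 proof (intro grid.intro grid_axioms.intro F.frame_axioms)
  fix A B :: "(nat => int) set" and l :: "nat => int"
  assume fin: "finite A" "finite B" and A: "\<forall>k\<in>A. \<forall>i\<in>J. \<bar>lat (s^2) k i\<bar> <= L + 1" and B: "\<forall>k\<in>B. \<forall>i\<in>J. \<bar>lat (s^2) k i\<bar> <= L + 1"
   and o: "F.site_opt t eps dl L s A B l"
  show "F.site_near t C s A B l \<and>
    measure (gaussPi J bt (\<lambda>i. sqrt (c i))) (cubes J s A) powr (1 - t)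
     * measure (gaussPi J bt (\<lambda>i. sqrt (c i))) (cubes J s B) powr t
    <= 2 * measure (gaussPi J bt (\<lambda>i. sqrt (c i))) (cube J (lat s l) s)"
   by (rule site[OF s fin _ _ o]) (use A B in auto)
 qed (rule g r0 r1 law[OF J] t ep de L s(1) order_trans[OF s(2) s0(2)] C cp[OF s(1)])+
 have vco: "norm (x - F.vec (G.co x)) = resid J x" for x
  unfolding resid_def F.vec_def G.co_def by (simp add: algebra_simps)
 have idxN: "G.idx x = None \<longleftrightarrow> x : outb J L" for x
  unfolding G.idx_def outb_def G.co_def by (auto simp: not_le)
 \<comment> \<open>One bound for the squared rounding error on both sides of the box: lattice error
   and dropped coordinates inside, distance to \<open>x0\<close> outside.\<close>
 define H where "H x = 2 * (n * s^2)^2 + 2 * (resid J x)^2 + (norm (x - x0))^2 * indicator (outb J L) x" for x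
 have H0: "0 <= H x" for x unfolding H_def by simp
 have [measurable]: "H : borel_measurable borel" unfolding H_def by simp
 have repH: "(norm (x - G.rep x))^2 <= H x" for x
 proof (cases "G.idx x")
  case None
  then show ?thesis unfolding G.rep_def F.vec_def using None idxN[of x] unfolding H_def by (simp add: G.pos_def)
 next
  case (Some k)
  have "norm (F.vec (G.co x) - G.rep x) <= real (card J) * s^2"
   unfolding G.rep_def using Some[unfolded G.idx_Some G.co_in_cube] Some by (intro F.norm_vec_diff_le) (auto simp: G.pos_def)
  then have "norm (x - G.rep x) <= resid J x + n * s^2"
   using norm_triangle_ineq[of "x - F.vec (G.co x)" "F.vec (G.co x) - G.rep x"] vco[of x] by (simp add: n_def)
  then have "(norm (x - G.rep x))^2 <= (resid J x + n * s^2)^2" by (intro power_mono) auto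
  also have "... <= 2 * (n * s^2)^2 + 2 * (resid J x)^2"
   using zero_le_power2[of "resid J x - n * s^2"] by (simp add: power2_eq_square algebra_simps)
  also have "... <= H x" unfolding H_def by simp
  finally show ?thesis .
 qed
 have HI: "(\<integral>\<^sup>+x. ennreal (H x) \<partial>rho) <= ennreal Q"
  and NI: "measure rho (outb J L) <= kp"
  if "prob_space rho" and sr: "sets rho = sets borel" and j: "(\<integral>\<^sup>+x. ennreal ((resid J x)^2) \<partial>rho) < ennreal kp"
   and l: "(\<integral>\<^sup>+x. ennreal ((1 + (norm (x - x0))^2) * indicator (outb J L) x) \<partial>rho) < ennreal kp" for rho
 proof -
  interpret prob_space rho by fact
  note [measurable_cong] = sr
  have "(\<integral>\<^sup>+x. ennreal (H x) \<partial>rho) = ennreal (2 * (n * s^2)^2) + ennreal 2 * (\<integral>\<^sup>+x. ennreal ((resid J x)^2) \<partial>rho) + (\<integral>\<^sup>+x. ennreal ((norm (x - x0))^2 * indicator (outb J L) x) \<partial>rho)"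
   unfolding H_def by (simp add: ennreal_mult nn_integral_add nn_integral_cmult emeasure_space_1)
  also have "... <= ennreal (2 * (n * s^2)^2) + ennreal 2 * ennreal kp + ennreal kp"
  proof (intro add_mono mult_left_mono)
   have "(\<integral>\<^sup>+x. ennreal ((norm (x - x0))^2 * indicator (outb J L) x) \<partial>rho) <= (\<integral>\<^sup>+x. ennreal ((1 + (norm (x - x0))^2) * indicator (outb J L) x) \<partial>rho)"
    by (intro nn_integral_mono ennreal_leI mult_right_mono) auto
   then show "(\<integral>\<^sup>+x. ennreal ((norm (x - x0))^2 * indicator (outb J L) x) \<partial>rho) <= ennreal kp" using l by simp
  qed (use j in auto)
  also have "ennreal 2 * ennreal kp = ennreal (2 * kp)" by (rule ennreal_mult[symmetric]) (use ka(1) in auto)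
  also have "ennreal (2 * (n * s^2)^2) + ennreal (2 * kp) + ennreal kp = ennreal (2 * (n * s^2)^2 + 2 * kp + kp)"
   by (rule ennreal_plus3) (use ka(1) in auto)
  also have "... <= ennreal Q" using ns ka by (intro ennreal_leI) linarith
  finally show "(\<integral>\<^sup>+x. ennreal (H x) \<partial>rho) <= ennreal Q" .
  have "emeasure rho (outb J L) = (\<integral>\<^sup>+x. ennreal (indicator (outb J L) x) \<partial>rho)" by (simp add: ennreal_indicator)
  also have "... <= (\<integral>\<^sup>+x. ennreal ((1 + (norm (x - x0))^2) * indicator (outb J L) x) \<partial>rho)"
   by (intro nn_integral_mono ennreal_leI) (auto simp: indicator_def)
  also have "... <= ennreal kp" using l by simp
  finally show "measure rho (outb J L) <= kp" using ka(1) by (simp add: emeasure_eq_measure)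
 qed
 note H0I = HI[OF r0(1,2) J0 L0] and H1I = HI[OF r1(1,2) J1 L1] and N0I = NI[OF r0(1,2) J0 L0] and N1I = NI[OF r1(1,2) J1 L1]
 define f where "f x = 4 * dl * aa * (norm (x - x0))^2 + Ka * H x" for x
 have f0: "0 <= f x" for x unfolding f_def using de al Ka H0[of x] by simp
 have [measurable]: "f : borel_measurable borel" unfolding f_def by simp
 have fI: "(\<integral>\<^sup>+x. ennreal (f x) \<partial>rho) <= ennreal (4 * dl * aa * v + Ka * Q)"
  if sr: "sets rho = sets borel" and vv: "(moment2 x0 rho) = ennreal v" "0 <= v" and h: "(\<integral>\<^sup>+x. ennreal (H x) \<partial>rho) <= ennreal Q" for rho v
 proof -
  note [measurable_cong] = sr
  have "(\<integral>\<^sup>+x. ennreal (f x) \<partial>rho) = ennreal (4 * dl * aa) * ennreal v + ennreal Ka * (\<integral>\<^sup>+x. ennreal (H x) \<partial>rho)"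
   unfolding f_def vv(1)[symmetric] using de al Ka H0 by (simp add: ennreal_mult nn_integral_add nn_integral_cmult)
  also have "... <= ennreal (4 * dl * aa) * ennreal v + ennreal Ka * ennreal Q"
   using h by (intro add_mono mult_left_mono) auto
  also have "... = ennreal (4 * dl * aa * v + Ka * Q)" using de al Ka Q vv by (simp add: ennreal_mult)
  finally show ?thesis .
 qed
 have err: "pert_cost dl x y <= pert_cost dl (G.rep x) (G.rep y) + (aa + f x + f y)"
  "pert_cost dl (G.rep x) (G.rep y) <= pert_cost dl x y + (aa + f x + f y)" for x y
 proof -
  have "(norm (x - y))^2 <= (norm (x - x0) + norm (y - x0))^2"
   using norm_triangle_ineq4[of "x - x0" "y - x0"] by simp
  also have "... <= 2 * (norm (x - x0))^2 + 2 * (norm (y - x0))^2"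
   using zero_le_power2[of "norm (x - x0) - norm (y - x0)"] by (simp add: power2_eq_square algebra_simps)
  finally have nn: "(norm (x - y))^2 <= 2 * (norm (x - x0))^2 + 2 * (norm (y - x0))^2" .
  have eq: "aa + 4 * dl * aa * ((norm (x - x0))^2 + (norm (y - x0))^2) + 2 * (1 / aa + 2 * dl * aa + dl * (1 + 1 / aa)) * (H x + H y) = aa + f x + f y"
   unfolding Ka_def[symmetric] f_def by (simp add: algebra_simps)
  show "pert_cost dl x y <= pert_cost dl (G.rep x) (G.rep y) + (aa + f x + f y)"
   "pert_cost dl (G.rep x) (G.rep y) <= pert_cost dl x y + (aa + f x + f y)"
   using coupling_cost_perturb[OF al less_imp_le[OF de] repH repH nn] unfolding eq by auto
 qed
 define eI where "eI = ennreal aa + (\<integral>\<^sup>+x. ennreal (f x) \<partial>rho0) + (\<integral>\<^sup>+x. ennreal (f x) \<partial>rho1)"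
 have eI: "eI <= ennreal (3 * om / 8)"
 proof -
  have "eI <= ennreal aa + ennreal (4 * dl * aa * v0 + Ka * Q) + ennreal (4 * dl * aa * v1 + Ka * Q)"
   unfolding eI_def by (intro add_mono order_refl fI r0 r1 v H0I H1I)
  also have "... = ennreal (aa + (4 * dl * aa * v0 + Ka * Q) + (4 * dl * aa * v1 + Ka * Q))"
   by (rule ennreal_plus3) (use al de Ka Q v in \<open>auto intro!: add_nonneg_nonneg mult_nonneg_nonneg\<close>)
  also have "... <= ennreal (3 * om / 8)" using alV QK unfolding V_def by (intro ennreal_leI) (simp add: algebra_simps)
  finally show ?thesis .
 qed
 have pc0: "0 <= pert_cost dl x y" for x y :: 'h using de by (simp add: pert_cost_def)
 have pcm: "(\<lambda>u. pert_cost dl (h u) (h' u)) : borel_measurable N" if [measurable]: "h : N \<rightarrow>\<^sub>M borel" "h' : N \<rightarrow>\<^sub>M borel"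
  for h h' :: "'n => 'h" and N unfolding pert_cost_def by simp
 obtain M where pM: "prob_space M" and sM: "sets M = sets (borel \<Otimes>\<^sub>M (borel \<Otimes>\<^sub>M borel))"
  and M0: "PROP marginal M fst rho0"
  and M1: "PROP marginal M (\<lambda>u. fst (snd u)) rho1"
  and Mo: "\<And>th. th : couplings rho0 rho1 ==> (\<integral>\<^sup>+u. ennreal (pert_cost dl (G.rep (fst u)) (G.rep (fst (snd u)))) \<partial>M)
   <= (\<integral>\<^sup>+v. ennreal (pert_cost dl (G.rep (fst v)) (G.rep (snd v))) \<partial>th)
    + ennreal (eps + slack t eps dl (real (card J) * s))"
  and Mn: "AE u in M. G.idx (fst u) \<noteq> None --> G.idx (fst (snd u)) \<noteq> None -->
   norm (F.vec (G.co (snd (snd u))) - ((1 - t) *\<^sub>R G.rep (fst u) + t *\<^sub>R G.rep (fst (snd u)))) <= (C + real (card J)) * s"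
  and Me: "\<And>S N. S : sets borel ==> 0 <= N ==> N * measure M {u. snd (snd u) : S} <= E + 3 + 2 * exp N * measure gm S"
  by (rule G.discrete_plan) blast
 interpret M: prob_space M by (rule pM)
 note [measurable_cong] = sM
 have spM: "space M = UNIV" using sets_eq_imp_space_eq[OF sM] by (simp add: space_pair_measure)
 show thesis
 proof (rule that[OF pM sM M0 M1 _ _ Me])
  fix th assume th: "th : couplings rho0 rho1"
  then have th': "prob_space th" "sets th = sets (borel \<Otimes>\<^sub>M borel)" "distr th borel fst = rho0" "distr th borel snd = rho1" by (auto simp: couplings_def)
  note [measurable_cong] = th'(2)
  interpret T: prob_space th by (rule th'(1))
  have [measurable]: "(\<lambda>u. pert_cost dl (G.rep (fst u)) (G.rep (fst (snd u)))) : borel_measurable M"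
   "(\<lambda>u. pert_cost dl (fst u) (snd u)) : borel_measurable th"
   by (intro pcm; measurable)+
  have Tf: "(\<integral>\<^sup>+v. ennreal (f (fst v)) \<partial>th) = (\<integral>\<^sup>+x. ennreal (f x) \<partial>rho0)" "(\<integral>\<^sup>+v. ennreal (f (snd v)) \<partial>th) = (\<integral>\<^sup>+x. ennreal (f x) \<partial>rho1)"
   unfolding th'(3,4)[symmetric] by (simp_all add: nn_integral_distr)
  have "(\<integral>\<^sup>+u. ennreal (pert_cost dl (fst u) (fst (snd u))) \<partial>M) \<le>
    (\<integral>\<^sup>+u. ennreal (pert_cost dl (G.rep (fst u)) (G.rep (fst (snd u)))) + (ennreal aa + ennreal (f (fst u)) + ennreal (f (fst (snd u)))) \<partial>M)"
   by (intro nn_integral_mono ennreal_le_plus3 err(1) pc0 f0) (use al in auto)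
  also have "... = (\<integral>\<^sup>+u. ennreal (pert_cost dl (G.rep (fst u)) (G.rep (fst (snd u)))) \<partial>M) + eI"
   unfolding eI_def using M0[of "\<lambda>x. ennreal (f x)"] M1[of "\<lambda>x. ennreal (f x)"]
   by (simp add: nn_integral_add M.emeasure_space_1)
  also have "... <= (\<integral>\<^sup>+v. ennreal (pert_cost dl (G.rep (fst v)) (G.rep (snd v))) \<partial>th) + ennreal (om / 4) + eI"
  proof (intro add_mono order_refl order_trans[OF Mo[OF th]])
   show "ennreal (eps + slack t eps dl (real (card J) * s)) <= ennreal (om / 4)"
    using Kc unfolding n_def eps_def by (intro ennreal_leI) linarith
  qed
  also have "... <= ((pert_int dl th) + eI) + ennreal (om / 4) + eI"
  proof (intro add_mono order_refl)
   have "(\<integral>\<^sup>+v. ennreal (pert_cost dl (G.rep (fst v)) (G.rep (snd v))) \<partial>th) \<le>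
    (\<integral>\<^sup>+v. ennreal (pert_cost dl (fst v) (snd v)) + (ennreal aa + ennreal (f (fst v)) + ennreal (f (snd v))) \<partial>th)"
    by (intro nn_integral_mono ennreal_le_plus3 err(2) pc0 f0) (use al in auto)
   also have "... = (pert_int dl th) + eI"
    unfolding eI_def using Tf by (simp add: nn_integral_add T.emeasure_space_1)
   finally show "(\<integral>\<^sup>+v. ennreal (pert_cost dl (G.rep (fst v)) (G.rep (snd v))) \<partial>th) <= (pert_int dl th) + eI" .
  qed
  also have "... = (pert_int dl th) + (eI + ennreal (om / 4) + eI)" by simp
  also have "... <= (pert_int dl th) + ennreal om"
  proof (intro add_mono order_refl)
   have "eI + ennreal (om / 4) + eI <= ennreal (3 * om / 8) + ennreal (om / 4) + ennreal (3 * om / 8)"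
    by (intro add_mono eI order_refl)
   also have "... = ennreal om" using om by (simp flip: ennreal_plus)
   finally show "eI + ennreal (om / 4) + eI <= ennreal om" .
  qed
  finally show "(\<integral>\<^sup>+u. ennreal (pert_cost dl (fst u) (fst (snd u))) \<partial>M) <= (pert_int dl th) + ennreal om" .
 next
  let ?m = "\<lambda>u. (1 - t) *\<^sub>R fst u + t *\<^sub>R fst (snd u) :: 'h"
  \<comment> \<open>Off these five events the third point is within \<open>om / 4\<close> of its
    projection to the frame, the projection within \<open>om / 4\<close> of the rounded interpolant,
    and that within \<open>om / 4\<close> of the true one.\<close>
  define B1 where "B1 = {u :: 'h \<times> 'h \<times> 'h. fst u : outb J L}"
  define B2 where "B2 = {u :: 'h \<times> 'h \<times> 'h. fst (snd u) : outb J L}"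
  define B3 where "B3 = {u :: 'h \<times> 'h \<times> 'h. snd (snd u) : {z. om / 4 < resid J z}}"
  define B4 where "B4 = {u :: 'h \<times> 'h \<times> 'h. (om / 4)^2 < H (fst u)}"
  define B5 where "B5 = {u :: 'h \<times> 'h \<times> 'h. (om / 4)^2 < H (fst (snd u))}"
  define BB where "BB = {u. om < norm (snd (snd u) - ?m u)}"
  have tri: "norm (a - b) <= norm (a - p) + norm (p - q) + norm (q - b)" for a b p q :: 'h by norm
  have pr: "{u. Q u} : sets M" if "Measurable.pred M Q" for Q using that by (simp add: pred_def spM)
  have m: "B1 : sets M" "B2 : sets M" "B3 : sets M" "B4 : sets M" "B5 : sets M" "BB : sets M"
   unfolding B1_def B2_def B3_def B4_def B5_def BB_def by (intro pr; measurable)+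
  have "measure M BB <= measure M (B1 \<union> B2 \<union> B3 \<union> B4 \<union> B5)"
  proof (rule M.finite_measure_mono_AE)
   show "AE u in M. u : BB --> u : B1 \<union> B2 \<union> B3 \<union> B4 \<union> B5"
    using Mn
   proof eventually_elim
    case (elim u)
    show ?case
    proof (rule impI, rule ccontr)
     assume u: "u : BB" "u \<notin> B1 \<union> B2 \<union> B3 \<union> B4 \<union> B5"
     define x where "x = fst u" define y where "y = fst (snd u)" define z where "z = snd (snd u)"
     have h: "G.idx x \<noteq> None" "G.idx y \<noteq> None" "resid J z <= om / 4" "H x <= (om / 4)^2" "H y <= (om / 4)^2"
      using u(2) unfolding B1_def B2_def B3_def B4_def B5_def idxN x_def y_def z_def by auto
     have vz: "norm (F.vec (G.co z) - ((1 - t) *\<^sub>R G.rep x + t *\<^sub>R G.rep y)) <= om / 4"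
      using elim h(1,2) Cs unfolding x_def y_def z_def n_def by simp
     have xr: "norm (x - G.rep x) <= om / 4" "norm (y - G.rep y) <= om / 4"
      using order_trans[OF repH h(4)] order_trans[OF repH h(5)] om by auto
     have "norm (((1 - t) *\<^sub>R G.rep x + t *\<^sub>R G.rep y) - ((1 - t) *\<^sub>R x + t *\<^sub>R y)) <= om / 4"
     proof -
      have "((1 - t) *\<^sub>R G.rep x + t *\<^sub>R G.rep y) - ((1 - t) *\<^sub>R x + t *\<^sub>R y) = (1 - t) *\<^sub>R (G.rep x - x) + t *\<^sub>R (G.rep y - y)"
       by (simp add: algebra_simps)
      also have "norm ... <= (1 - t) * norm (x - G.rep x) + t * norm (y - G.rep y)"
       using t by (intro order_trans[OF norm_triangle_ineq]) (simp add: norm_minus_commute)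
      also have "... <= (1 - t) * (om / 4) + t * (om / 4)" using xr t by (intro add_mono mult_left_mono) auto
      also have "... = om / 4" by (simp flip: distrib_right)
      finally show ?thesis .
     qed
     then show False using vz h(3) vco[of z] tri[of z "(1 - t) *\<^sub>R x + t *\<^sub>R y" "F.vec (G.co z)" "(1 - t) *\<^sub>R G.rep x + t *\<^sub>R G.rep y"] u(1) om unfolding BB_def x_def y_def z_def by simp
    qed
   qed
  qed (use m in auto)
  also have "... <= measure M B1 + measure M B2 + measure M B3 + measure M B4 + measure M B5"
   using m by (intro order_trans[OF measure_Un_le] add_mono) auto
  also have "... <= kp + kp + om / 4 + om / 8 + om / 8"
  proof (intro add_mono)
   have "emeasure M B1 = (\<integral>\<^sup>+u. indicator (outb J L) (fst u) \<partial>M)"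
   proof -
    have "(\<integral>\<^sup>+u. indicator B1 u \<partial>M) = (\<integral>\<^sup>+u. indicator (outb J L) (fst u) \<partial>M)"
     by (intro nn_integral_cong) (simp add: B1_def indicator_def)
    then show ?thesis using m(1) by simp
   qed
   also have "... = emeasure rho0 (outb J L)" by (subst M0) (use r0(2) in auto)
   finally show "measure M B1 <= kp" using N0I by (simp add: measure_def)
   have "emeasure M B2 = (\<integral>\<^sup>+u. indicator (outb J L) (fst (snd u)) \<partial>M)"
   proof -
    have "(\<integral>\<^sup>+u. indicator B2 u \<partial>M) = (\<integral>\<^sup>+u. indicator (outb J L) (fst (snd u)) \<partial>M)"
     by (intro nn_integral_cong) (simp add: B2_def indicator_def)
    then show ?thesis using m(2) by simp
   qed
   also have "... = emeasure rho1 (outb J L)" by (subst M1) (use r1(2) in auto)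
   finally show "measure M B2 <= kp" using N1I by (simp add: measure_def)
   then have "N0 * measure M B3 <= E + 3 + 2 * exp N0 * measure gm {z. om / 4 < resid J z}"
    unfolding B3_def using N0 by (intro Me) auto
   also have "... <= E + 3 + 2 * exp N0 * ((E + 3) / (2 * exp N0))"
    using Jg ka(3) by (intro add_mono mult_left_mono order_refl) auto
   also have "... = N0 * (om / 4)" using om by (simp add: N0_def)
   finally show "measure M B3 <= om / 4" using N0 by simp
   have mk: "measure M B <= om / 8" if B: "B = {u. (om / 4)^2 < H (k u)}" "B : sets M" and k: "(\<integral>\<^sup>+u. ennreal (H (k u)) \<partial>M) <= ennreal Q" for B and k :: "'h \<times> 'h \<times> 'h => 'h"
   proof -
    have "ennreal ((om / 4)^2) * emeasure M B = (\<integral>\<^sup>+u. ennreal ((om / 4)^2) * indicator B u \<partial>M)"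
     by (rule nn_integral_cmult_indicator[OF B(2), symmetric])
    also have "... <= (\<integral>\<^sup>+u. ennreal (H (k u)) \<partial>M)"
     unfolding B(1) by (intro nn_integral_mono) (auto simp: indicator_def intro!: ennreal_leI)
    also have "... <= ennreal (om ^ 3 / 128)" using k Q(2) by (meson ennreal_leI order_trans)
    finally have "(om / 4)^2 * measure M B <= om ^ 3 / 128"
     using om by (simp add: M.emeasure_eq_measure flip: ennreal_mult)
    also have "... = (om / 4)^2 * (om / 8)" by (simp add: power2_eq_square power3_eq_cube)
    finally show ?thesis using om by simp
   qed
   show "measure M B4 <= om / 8" by (rule mk[OF B4_def m(4)]) (use M0[of "\<lambda>x. ennreal (H x)"] H0I in simp)
   show "measure M B5 <= om / 8" by (rule mk[OF B5_def m(5)]) (use M1[of "\<lambda>x. ennreal (H x)"] H1I in simp)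
  qed
  also have "... <= om" using ka(2) Q(3) om by simp
  finally show "measure M {u. om < norm (snd (snd u) - ((1 - t) *\<^sub>R fst u + t *\<^sub>R fst (snd u)))} <= om" unfolding BB_def .
 qed
qed

end

section \<open>Swapping targets\<close>

text \<open>The maximal coupling of two laws on a finite set: the common part
  \<open>min (a p) (b p)\<close> stays on the diagonal, the rest is coupled as a product. The third
  component is the independent copy of \<open>A\<close> that \<open>finite_index_kernel\<close>
  supplies.\<close>

lemma index_coupling:
 fixes A :: "'a measure" and B :: "'b measure"
 assumes pA: "prob_space A" and pB: "prob_space B" and P: "finite P"
  and qa: "qa : A \<rightarrow>\<^sub>M count_space P" and qb: "qb : B \<rightarrow>\<^sub>M count_space P"
 defines "a \<equiv> \<lambda>p. measure A {x : space A. qa x = p}" and "b \<equiv> \<lambda>p. measure B {x : space B. qb x = p}"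
 obtains Q where "prob_space Q" "sets Q = sets (A \<Otimes>\<^sub>M (B \<Otimes>\<^sub>M A))"
  "\<And>f. f : borel_measurable A ==> (\<integral>\<^sup>+u. f (fst u) \<partial>Q) = (\<integral>\<^sup>+x. f x \<partial>A)"
  "\<And>f. f : borel_measurable B ==> (\<integral>\<^sup>+u. f (fst (snd u)) \<partial>Q) = (\<integral>\<^sup>+x. f x \<partial>B)"
  "\<And>D. D \<subseteq> P ==> (\<Sum>p\<in>D. ennreal (min (a p) (b p))) <= (\<integral>\<^sup>+u. (if qa (fst u) : D \<and> qb (fst (snd u)) = qa (fst u) then 1 else 0) \<partial>Q)"
proof -
 interpret A: prob_space A by fact
 interpret B: prob_space B by fact
 have ab0: "0 <= a p" "0 <= b p" for p by (simp_all add: a_def b_def)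
 have tot: "sum a P = 1" "sum b P = 1"
 proof -
  have "(\<integral>\<^sup>+x. 1 \<partial>A) = (\<Sum>p\<in>P. 1 * emeasure A {x : space A. qa x = p})" by (rule nn_integral_finite_index[OF P qa])
  then show "sum a P = 1" by (simp add: a_def A.emeasure_eq_measure A.prob_space)
  have "(\<integral>\<^sup>+x. 1 \<partial>B) = (\<Sum>p\<in>P. 1 * emeasure B {x : space B. qb x = p})" by (rule nn_integral_finite_index[OF P qb])
  then show "sum b P = 1" by (simp add: b_def B.emeasure_eq_measure B.prob_space)
 qed
 define s where "s p = min (a p) (b p)" for p
 define S where "S = sum s P"
 have s: "0 <= s p" "s p <= a p" "s p <= b p" for p unfolding s_def using ab0 by auto
 have S1: "S <= 1" unfolding S_def using sum_mono[of P s a] s tot by simp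
 \<comment> \<open>For \<open>S = 1\<close> the division yields 0, which is right: \<open>a\<close>
   and \<open>b\<close> then agree with \<open>s\<close>.\<close>
 define pl where "pl p q = (if p = q then s p else 0) + (a p - s p) * (b q - s q) / (1 - S)" for p q
 have pl0: "0 <= pl p q" for p q unfolding pl_def using s S1 by simp
 have one: "a p = s p" "b p = s p" if "S = 1" "p : P" for p
 proof -
  have "(\<Sum>p\<in>P. a p - s p) = 0" "(\<Sum>p\<in>P. b p - s p) = 0" using tot that by (simp_all add: S_def sum_subtractf)
  then show "a p = s p" "b p = s p" using s P that by (auto simp: sum_nonneg_eq_0_iff)
 qed
 have row: "(\<Sum>q\<in>P. pl p q) = a p" if "p : P" for p
 proof -
  have "(\<Sum>q\<in>P. pl p q) = s p + (a p - s p) * (\<Sum>q\<in>P. b q - s q) / (1 - S)"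
   unfolding pl_def using P that by (simp add: sum.distrib sum_distrib_left sum_divide_distrib)
  also have "(\<Sum>q\<in>P. b q - s q) = 1 - S" using tot by (simp add: S_def sum_subtractf)
  finally show ?thesis using one[of p] that by simp
 qed
 have col: "(\<Sum>p\<in>P. pl p q) = b q" if "q : P" for q
 proof -
  have "(\<Sum>p\<in>P. pl p q) = s q + (\<Sum>p\<in>P. a p - s p) * (b q - s q) / (1 - S)"
   unfolding pl_def using P that by (simp add: sum.distrib sum_distrib_right sum_divide_distrib)
  also have "(\<Sum>p\<in>P. a p - s p) = 1 - S" using tot by (simp add: S_def sum_subtractf)
  finally show ?thesis using one[of q] that by simp
 qed
 obtain Q where Q: "prob_space Q" "sets Q = sets (A \<Otimes>\<^sub>M (B \<Otimes>\<^sub>M A))"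
  "\<And>f. f : borel_measurable A ==> (\<integral>\<^sup>+u. f (fst u) \<partial>Q) = (\<integral>\<^sup>+x. f x \<partial>A)"
  "\<And>f. f : borel_measurable B ==> (\<integral>\<^sup>+u. f (fst (snd u)) \<partial>Q) = (\<integral>\<^sup>+x. f x \<partial>B)"
  and QF: "\<And>F :: 'c => 'c => 'a => ennreal. (\<And>p q. F p q : borel_measurable A) ==>
   (\<integral>\<^sup>+u. F (qa (fst u)) (qb (fst (snd u))) (snd (snd u)) \<partial>Q) =
   (\<Sum>p\<in>P. \<Sum>q\<in>P. ennreal (pl p q) * (\<integral>\<^sup>+z. 1 * F p q z \<partial>A))"
 proof (rule finite_index_kernel[OF pA pB pA P P qa qb, where pl = pl and kp = "\<lambda>_ _ _. 1"], goal_cases)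
  qed (use pl0 row col in \<open>auto simp: a_def b_def A.emeasure_space_1\<close>)
 show thesis
 proof (rule that[OF Q])
  fix D assume D: "D \<subseteq> P"
  have "(\<integral>\<^sup>+u. (if qa (fst u) : D \<and> qb (fst (snd u)) = qa (fst u) then 1 else 0) \<partial>Q) = (\<Sum>p\<in>P. \<Sum>q\<in>P. ennreal (pl p q) * (\<integral>\<^sup>+z. 1 * (if p : D \<and> q = p then 1 else 0) \<partial>A))"
   by (rule QF[of "\<lambda>p q z. if p : D \<and> q = p then 1 else 0"]) simp
  also have "... = (\<Sum>p\<in>P. \<Sum>q\<in>P. if q = p then (if p : D then ennreal (pl p p) else 0) else 0)"
   by (intro sum.cong refl) (auto simp: A.emeasure_space_1)
  also have "... = (\<Sum>p\<in>D. ennreal (pl p p))"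
   using P sum.inter_restrict[OF P, of "\<lambda>p. ennreal (pl p p)" D] D by (simp add: Int_absorb1)
  also have "... >= (\<Sum>p\<in>D. ennreal (min (a p) (b p)))"
   unfolding pl_def s_def[symmetric] using s S1 by (intro sum_mono ennreal_leI) (simp add: divide_nonneg_nonneg)
  finally show "(\<Sum>p\<in>D. ennreal (min (a p) (b p))) <= (\<integral>\<^sup>+u. (if qa (fst u) : D \<and> qb (fst (snd u)) = qa (fst u) then 1 else 0) \<partial>Q)" .
 qed
qed

text \<open>Pair a unit \<open>u\<close> of the first plan with a unit \<open>v\<close> of the
  second; if their indices agree and lie in \<open>D\<close>, exchange their targets. Neither of the
  two resulting families need have target law \<open>rho1\<close>, but together they have it twice;
  so a fair coin picks one of them, and costs appear doubled.\<close>

lemma swap_coupling: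
 fixes A :: "'a measure" and B :: "'b measure" and X Y :: "'a => 'h::{real_inner, polish_space}" and X' Y' :: "'b => 'h"
 assumes pA: "prob_space A" and pB: "prob_space B" and P: "finite P" and D: "D \<subseteq> P"
  and qa: "qa : A \<rightarrow>\<^sub>M count_space P" and qb: "qb : B \<rightarrow>\<^sub>M count_space P"
  and m [measurable]: "X : A \<rightarrow>\<^sub>M borel" "Y : A \<rightarrow>\<^sub>M borel" "X' : B \<rightarrow>\<^sub>M borel" "Y' : B \<rightarrow>\<^sub>M borel"
  and d: "distr A borel X = rho0" "distr A borel Y = rho1" "distr B borel X' = rho0" "distr B borel Y' = rho1"
 obtains th tau where "th : couplings rho0 rho1" "tau <= 1"
  "(\<Sum>p\<in>D. min (measure A {x : space A. qa x = p}) (measure B {x : space B. qb x = p})) <= tau"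
  "\<And>h :: 'h \<times> 'h => real. \<And>p q. [|h : borel_measurable (borel \<Otimes>\<^sub>M borel); \<And>v. 0 <= h v; 0 <= p; 0 <= q;
   \<And>u v. u : space A ==> v : space B ==> qa u : D ==> qb v = qa u ==>
    h (X u, Y' v) + h (X' v, Y u) + p <= h (X u, Y u) + h (X' v, Y' v) + q|]
  ==> 2 * (\<integral>\<^sup>+v. ennreal (h v) \<partial>th) + ennreal (p * tau) <= (\<integral>\<^sup>+u. ennreal (h (X u, Y u)) \<partial>A) + (\<integral>\<^sup>+v. ennreal (h (X' v, Y' v)) \<partial>B) + ennreal (q * tau)"
proof -
 obtain Q where pQ: "prob_space Q" and sQ: "sets Q = sets (A \<Otimes>\<^sub>M (B \<Otimes>\<^sub>M A))"
  and Q0: "\<And>f. f : borel_measurable A ==> (\<integral>\<^sup>+u. f (fst u) \<partial>Q) = (\<integral>\<^sup>+x. f x \<partial>A)"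
  and Q1: "\<And>f. f : borel_measurable B ==> (\<integral>\<^sup>+u. f (fst (snd u)) \<partial>Q) = (\<integral>\<^sup>+x. f x \<partial>B)"
  and QD: "\<And>D. D \<subseteq> P ==> (\<Sum>p\<in>D. ennreal (min (measure A {x : space A. qa x = p}) (measure B {x : space B. qb x = p}))) <= (\<integral>\<^sup>+u. (if qa (fst u) : D \<and> qb (fst (snd u)) = qa (fst u) then 1 else 0) \<partial>Q)"
  by (rule index_coupling[OF pA pB P qa qb]) blast
 interpret Q: prob_space Q by (rule pQ)
 note [measurable_cong] = sQ
 have spQ: "space Q = space A \<times> space B \<times> space A" using sets_eq_imp_space_eq[OF sQ] by (simp add: space_pair_measure)
 define sw where "sw u \<longleftrightarrow> qa (fst u) : D \<and> qb (fst (snd u)) = qa (fst u)" for u :: "'a \<times> 'b \<times> 'a"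
 have qam: "(\<lambda>u. qa (fst u)) : Q \<rightarrow>\<^sub>M count_space P" "(\<lambda>u. qb (fst (snd u))) : Q \<rightarrow>\<^sub>M count_space P"
  by (rule measurable_compose[OF _ qa], measurable) (rule measurable_compose[OF _ qb], measurable)
 have swm [measurable]: "Measurable.pred Q sw"
 proof -
  have "Measurable.pred Q (\<lambda>u. \<exists>p\<in>D. qa (fst u) = p \<and> qb (fst (snd u)) = p)"
  proof (rule pred_intros_finite(4))
   show "finite D" using D P finite_subset by auto
   fix p assume "p : D"
   then show "Measurable.pred Q (\<lambda>u. qa (fst u) = p \<and> qb (fst (snd u)) = p)" using pred_sets2 qam by simp
  qed
  moreover have "sw = (\<lambda>u. \<exists>p\<in>D. qa (fst u) = p \<and> qb (fst (snd u)) = p)" by (auto simp: sw_def)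
  ultimately show ?thesis by simp
 qed
 define tau where "tau = Q.prob {u : space Q. sw u}"
 have swI: "(\<integral>\<^sup>+u. (if sw u then ennreal c else 0) \<partial>Q) = ennreal (c * tau)" if "0 <= c" for c
 proof -
  have "(\<integral>\<^sup>+u. (if sw u then ennreal c else 0) \<partial>Q) = (\<integral>\<^sup>+u. ennreal c * indicator {u : space Q. sw u} u \<partial>Q)"
   by (intro nn_integral_cong) (auto simp: indicator_def)
  also have "... = ennreal c * emeasure Q {u : space Q. sw u}" by (rule nn_integral_cmult_indicator) measurable
  finally show ?thesis using that by (simp add: Q.emeasure_eq_measure tau_def ennreal_mult)
 qed
 define f1 where "f1 u = (X (fst u), if sw u then Y' (fst (snd u)) else Y (fst u))" for u
 define f2 where "f2 u = (X' (fst (snd u)), if sw u then Y (fst u) else Y' (fst (snd u)))" for u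
 have f12 [measurable]: "f1 : Q \<rightarrow>\<^sub>M borel \<Otimes>\<^sub>M borel" "f2 : Q \<rightarrow>\<^sub>M borel \<Otimes>\<^sub>M borel"
  unfolding f1_def f2_def by auto
 define C where "C = measure_pmf (bernoulli_pmf (1 / 2))"
 interpret C: prob_space C unfolding C_def by (rule measure_pmf.prob_space_axioms)
 interpret QC: pair_prob_space Q C ..
 have sC: "sets C = sets (count_space UNIV)" by (simp add: C_def)
 have [measurable]: "Measurable.pred (Q \<Otimes>\<^sub>M C) snd"
  by (rule measurable_snd[of Q C, unfolded measurable_cong_sets[OF refl sC]])
 define F where "F w = (if snd w then f1 (fst w) else f2 (fst w))" for w :: "('a \<times> 'b \<times> 'a) \<times> bool"
 have Fm [measurable]: "F : Q \<Otimes>\<^sub>M C \<rightarrow>\<^sub>M borel \<Otimes>\<^sub>M borel" unfolding F_def by simp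
 define th where "th = distr (Q \<Otimes>\<^sub>M C) (borel \<Otimes>\<^sub>M borel) F"
 have pth: "prob_space th" unfolding th_def by (intro QC.prob_space_distr) measurable
 have I: "2 * (\<integral>\<^sup>+v. g v \<partial>th) = (\<integral>\<^sup>+u. g (f1 u) + g (f2 u) \<partial>Q)" if [measurable]: "g : borel_measurable (borel \<Otimes>\<^sub>M borel)" for g :: "'h \<times> 'h => ennreal"
 proof -
  have "(\<integral>\<^sup>+v. g v \<partial>th) = (\<integral>\<^sup>+w. g (F w) \<partial>(Q \<Otimes>\<^sub>M C))" unfolding th_def by (rule nn_integral_distr) measurable
  also have "... = (\<integral>\<^sup>+u. \<integral>\<^sup>+b. g (F (u, b)) \<partial>C \<partial>Q)" by (rule C.nn_integral_fst[symmetric]) measurable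
  also have "... = (\<integral>\<^sup>+u. ennreal (1/2) * (g (f1 u) + g (f2 u)) \<partial>Q)"
   unfolding C_def by (intro nn_integral_cong) (simp add: F_def distrib_left mult.commute)
  also have "... = ennreal (1/2) * (\<integral>\<^sup>+u. g (f1 u) + g (f2 u) \<partial>Q)" by (rule nn_integral_cmult) measurable
  finally have "2 * (\<integral>\<^sup>+v. g v \<partial>th) = (2 * ennreal (1/2)) * (\<integral>\<^sup>+u. g (f1 u) + g (f2 u) \<partial>Q)" by (simp add: mult.assoc)
  also have "2 * ennreal (1/2) = 1" using ennreal_mult[of 2 "1/2"] by simp
  finally show ?thesis by simp
 qed
 have sd: "sets rho0 = sets borel" "sets rho1 = sets borel" using d by auto
 note [measurable_cong] = sd
 have QX: "(\<integral>\<^sup>+u. g (X (fst u)) \<partial>Q) = (\<integral>\<^sup>+x. g x \<partial>rho0)" "(\<integral>\<^sup>+u. g (X' (fst (snd u))) \<partial>Q) = (\<integral>\<^sup>+x. g x \<partial>rho0)"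
  "(\<integral>\<^sup>+u. g (Y (fst u)) \<partial>Q) = (\<integral>\<^sup>+x. g x \<partial>rho1)" "(\<integral>\<^sup>+u. g (Y' (fst (snd u))) \<partial>Q) = (\<integral>\<^sup>+x. g x \<partial>rho1)"
  if [measurable]: "g : borel_measurable borel" for g :: "'h => ennreal"
  using Q0[of "\<lambda>u. g (X u)"] Q0[of "\<lambda>u. g (Y u)"] Q1[of "\<lambda>u. g (X' u)"] Q1[of "\<lambda>u. g (Y' u)"]
   nn_integral_distr[OF m(1), of g] nn_integral_distr[OF m(2), of g] nn_integral_distr[OF m(3), of g] nn_integral_distr[OF m(4), of g] by (simp_all add: d)
 have marg: "distr th borel h = rho" if [measurable]: "h : borel \<Otimes>\<^sub>M borel \<rightarrow>\<^sub>M borel" and s: "sets rho = sets borel"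
  and e: "\<And>g. g : borel_measurable borel ==> (\<integral>\<^sup>+u. g (h (f1 u)) + g (h (f2 u)) \<partial>Q) = (\<integral>\<^sup>+x. g x \<partial>rho) + (\<integral>\<^sup>+x. g x \<partial>rho)" for h :: "'h \<times> 'h => 'h" and rho
 proof (rule measure_eqI)
  fix S assume "S : sets (distr th borel h)"
  then have S [measurable]: "S : sets borel" by simp
  have "(\<integral>\<^sup>+v. indicator S (h v) \<partial>th) = emeasure rho S" using I[of "\<lambda>v. indicator S (h v)"] e[of "indicator S"] s by (simp flip: mult_2 add: ennreal_mult_cancel_left)
  moreover have "(\<integral>\<^sup>+x. indicator S x \<partial>distr th borel h) = (\<integral>\<^sup>+v. indicator S (h v) \<partial>th)"
   by (rule nn_integral_distr) (auto simp: th_def)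
  ultimately show "emeasure (distr th borel h) S = emeasure rho S" by simp
 qed (simp add: s)
 have "distr th borel fst = rho0"
  by (rule marg) (auto simp: sd f1_def f2_def nn_integral_add QX)
 moreover have "distr th borel snd = rho1"
 proof (rule marg[OF measurable_snd sd(2)])
  fix g :: "'h => ennreal" assume [measurable]: "g : borel_measurable borel"
  have "(\<integral>\<^sup>+u. g (snd (f1 u)) + g (snd (f2 u)) \<partial>Q) = (\<integral>\<^sup>+u. g (Y (fst u)) + g (Y' (fst (snd u))) \<partial>Q)"
   unfolding f1_def f2_def by (intro nn_integral_cong) (simp add: add.commute)
  then show "(\<integral>\<^sup>+u. g (snd (f1 u)) + g (snd (f2 u)) \<partial>Q) = (\<integral>\<^sup>+x. g x \<partial>rho1) + (\<integral>\<^sup>+x. g x \<partial>rho1)" by (simp add: nn_integral_add QX)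
 qed
 ultimately have th: "th : couplings rho0 rho1" using pth by (simp add: couplings_def) (simp add: th_def)
 show thesis
 proof (rule that[OF th])
  show "tau <= 1" by (simp add: tau_def)
  have "ennreal (\<Sum>p\<in>D. min (measure A {x : space A. qa x = p}) (measure B {x : space B. qb x = p})) = (\<Sum>p\<in>D. ennreal (min (measure A {x : space A. qa x = p}) (measure B {x : space B. qb x = p})))"
   by simp
  also have "... <= (\<integral>\<^sup>+u. (if sw u then ennreal 1 else 0) \<partial>Q)" unfolding sw_def ennreal_1 by (rule QD[OF D])
  also have "... = ennreal tau" by (subst swI) auto
  finally show "(\<Sum>p\<in>D. min (measure A {x : space A. qa x = p}) (measure B {x : space B. qb x = p})) <= tau"
   by (simp add: tau_def)
  fix h :: "'h \<times> 'h => real" and p q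
  assume h [measurable]: "h : borel_measurable (borel \<Otimes>\<^sub>M borel)" and h0: "\<And>v. 0 <= h v" and pq: "0 <= p" "0 <= q"
   and ex: "\<And>u v. u : space A ==> v : space B ==> qa u : D ==> qb v = qa u ==>
    h (X u, Y' v) + h (X' v, Y u) + p <= h (X u, Y u) + h (X' v, Y' v) + q"
  have "2 * (\<integral>\<^sup>+v. ennreal (h v) \<partial>th) + ennreal (p * tau) = (\<integral>\<^sup>+u. ennreal (h (f1 u)) + ennreal (h (f2 u)) \<partial>Q) + (\<integral>\<^sup>+u. (if sw u then ennreal p else 0) \<partial>Q)"
   unfolding swI[OF pq(1)] by (subst I) auto
  also have "... = (\<integral>\<^sup>+u. ennreal (h (f1 u)) + ennreal (h (f2 u)) + (if sw u then ennreal p else 0) \<partial>Q)"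
   by (rule nn_integral_add[symmetric]) measurable
  also have "... <= (\<integral>\<^sup>+u. ennreal (h (X (fst u), Y (fst u))) + ennreal (h (X' (fst (snd u)), Y' (fst (snd u)))) + (if sw u then ennreal q else 0) \<partial>Q)"
  proof (intro nn_integral_mono)
   fix u assume u: "u : space Q"
   show "ennreal (h (f1 u)) + ennreal (h (f2 u)) + (if sw u then ennreal p else 0)
    <= ennreal (h (X (fst u), Y (fst u))) + ennreal (h (X' (fst (snd u)), Y' (fst (snd u)))) + (if sw u then ennreal q else 0)"
   proof (cases "sw u")
    case True
    then have "h (X (fst u), Y' (fst (snd u))) + h (X' (fst (snd u)), Y (fst u)) + p <= h (X (fst u), Y (fst u)) + h (X' (fst (snd u)), Y' (fst (snd u))) + q"
     using u unfolding sw_def spQ by (intro ex) auto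
    then show ?thesis using h0 pq by (simp add: f1_def f2_def flip: ennreal_plus)
   qed (simp add: f1_def f2_def)
  qed
  also have "... = (\<integral>\<^sup>+u. ennreal (h (X u, Y u)) \<partial>A) + (\<integral>\<^sup>+v. ennreal (h (X' v, Y' v)) \<partial>B) + ennreal (q * tau)"
   unfolding swI[OF pq(2), symmetric] using Q0[of "\<lambda>u. ennreal (h (X u, Y u))"] Q1[of "\<lambda>v. ennreal (h (X' v, Y' v))"] by (simp add: nn_integral_add)
  finally show "2 * (\<integral>\<^sup>+v. ennreal (h v) \<partial>th) + ennreal (p * tau) <= (\<integral>\<^sup>+u. ennreal (h (X u, Y u)) \<partial>A) + (\<integral>\<^sup>+v. ennreal (h (X' v, Y' v)) \<partial>B) + ennreal (q * tau)" .
 qed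
qed

section \<open>Secondary minimisation\<close>

definition Lcost :: "('h \<times> 'h::real_normed_vector) measure => real" where
 "Lcost th = enn2real (\<integral>\<^sup>+v. ennreal (norm (fst v - snd v)) \<partial>th)"

definition Scost :: "('h \<times> 'h::real_normed_vector) measure => real" where
 "Scost th = enn2real (sq_int th)"

definition endpoints :: "('h \<times> 'h \<times> 'h::topological_space) measure => ('h \<times> 'h) measure" where
 "endpoints M = distr M (borel \<Otimes>\<^sub>M borel) (\<lambda>u. (fst u, fst (snd u)))"

context gaussian_pair
begin

definition Lmin :: real where "Lmin = (INF th\<in>couplings rho0 rho1. Lcost th)"

definition Sinf :: "real => real" where "Sinf k = (INF th\<in>{th : couplings rho0 rho1. Lcost th <= Lmin + k}. Scost th)"

text \<open>The least quadratic cost among couplings of nearly minimal linear cost, as the tolerance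
  tends to 0. Being a limit of infima, it makes sense before any minimiser of the linear cost is
  known to exist.\<close>

definition Smin :: real where "Smin = (SUP k\<in>{0<..}. Sinf k)"

lemma coupling_moment_bound:
 obtains B where "0 <= B" "\<And>th. th : couplings rho0 rho1 ==> (sq_int th) <= ennreal B"
proof -
 define v0 where "v0 = enn2real (moment2 x0 rho0)"
 define v1 where "v1 = enn2real (moment2 x0 rho1)"
 have v: "(moment2 x0 rho0) = ennreal v0" "0 <= v0"
  "(moment2 x0 rho1) = ennreal v1" "0 <= v1"
  using mom0 mom1 by (simp_all add: v0_def v1_def)
 have "(sq_int th) <= ennreal (2 * v0 + 2 * v1)" if "th : couplings rho0 rho1" for th
 proof -
  have th: "sets th = sets (borel \<Otimes>\<^sub>M borel)" "distr th borel fst = rho0" "distr th borel snd = rho1" using that by (auto simp: couplings_def)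
  note [measurable_cong] = th(1)
  have "(sq_int th) <= (\<integral>\<^sup>+v. ennreal 2 * ennreal ((norm (fst v - x0))^2) + ennreal 2 * ennreal ((norm (snd v - x0))^2) \<partial>th)"
  proof (intro nn_integral_mono)
   fix v :: "'h \<times> 'h"
   have "(norm (fst v - snd v))^2 <= (norm (fst v - x0) + norm (snd v - x0))^2"
    using norm_triangle_ineq4[of "fst v - x0" "snd v - x0"] by simp
   also have "... <= 2 * (norm (fst v - x0))^2 + 2 * (norm (snd v - x0))^2"
    using zero_le_power2[of "norm (fst v - x0) - norm (snd v - x0)"] by (simp add: power2_eq_square algebra_simps)
   finally have "ennreal ((norm (fst v - snd v))^2) <= ennreal (2 * (norm (fst v - x0))^2 + 2 * (norm (snd v - x0))^2)" by (rule ennreal_leI)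
   then show "ennreal ((norm (fst v - snd v))^2) <= ennreal 2 * ennreal ((norm (fst v - x0))^2) + ennreal 2 * ennreal ((norm (snd v - x0))^2)"
    by (simp add: ennreal_mult)
  qed
  also have "... = ennreal 2 * (\<integral>\<^sup>+v. ennreal ((norm (fst v - x0))^2) \<partial>th) + ennreal 2 * (\<integral>\<^sup>+v. ennreal ((norm (snd v - x0))^2) \<partial>th)"
   by (simp add: nn_integral_add nn_integral_cmult)
  also have "(\<integral>\<^sup>+v. ennreal ((norm (fst v - x0))^2) \<partial>th) = ennreal v0"
   unfolding v(1)[symmetric] th(2)[symmetric] by (subst nn_integral_distr) auto
  also have "(\<integral>\<^sup>+v. ennreal ((norm (snd v - x0))^2) \<partial>th) = ennreal v1"
   unfolding v(3)[symmetric] th(3)[symmetric] by (subst nn_integral_distr) auto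
  also have "ennreal 2 * ennreal v0 + ennreal 2 * ennreal v1 = ennreal (2 * v0 + 2 * v1)"
   using v by (simp add: ennreal_mult)
  finally show ?thesis .
 qed
 then show thesis using that[of "2 * v0 + 2 * v1"] v by simp
qed

lemma Scost_eq: "th : couplings rho0 rho1 ==> (sq_int th) = ennreal (Scost th)"
proof -
 assume th: "th : couplings rho0 rho1"
 obtain B where "0 <= B" and B: "\<And>th. th : couplings rho0 rho1 ==> (sq_int th) <= ennreal B"
  by (rule coupling_moment_bound) blast
 from B[OF th] have "(sq_int th) < \<top>" by (rule le_less_trans) simp
 then show ?thesis by (simp add: Scost_def)
qed

lemma Lcost_eq: "th : couplings rho0 rho1 ==> (\<integral>\<^sup>+v. ennreal (norm (fst v - snd v)) \<partial>th) = ennreal (Lcost th)"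
proof -
 assume th: "th : couplings rho0 rho1"
 then have s [measurable_cong]: "sets th = sets (borel \<Otimes>\<^sub>M borel)" and p: "prob_space th" by (auto simp: couplings_def)
 have "(\<integral>\<^sup>+v. ennreal (norm (fst v - snd v)) \<partial>th) <= (\<integral>\<^sup>+v. 1 + ennreal ((norm (fst v - snd v))^2) \<partial>th)"
 proof (intro nn_integral_mono)
  fix v :: "'h \<times> 'h"
  have "2 * norm (fst v - snd v) <= (norm (fst v - snd v))^2 + 1"
   using zero_le_power2[of "norm (fst v - snd v) - 1"] by (simp add: power2_diff)
  moreover have "0 <= (norm (fst v - snd v))^2" by simp
  ultimately have "norm (fst v - snd v) <= 1 + (norm (fst v - snd v))^2" by linarith
  then show "ennreal (norm (fst v - snd v)) <= 1 + ennreal ((norm (fst v - snd v))^2)"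
   by (simp flip: ennreal_plus ennreal_1)
 qed
 also have "... < \<top>" using prob_space.emeasure_space_1[OF p] by (simp add: nn_integral_add Scost_eq[OF th])
 finally show ?thesis by (simp add: Lcost_def)
qed

lemma cost_nonneg: "0 <= Lcost th" "0 <= Scost th" by (simp_all add: Lcost_def Scost_def)

lemma Lmin_le: "th : couplings rho0 rho1 ==> Lmin <= Lcost th"
 unfolding Lmin_def by (rule cINF_lower) (auto intro!: bdd_belowI[of _ 0] simp: cost_nonneg)

lemma endpoints_coupling:
 assumes M: "prob_space M" "sets M = sets (borel \<Otimes>\<^sub>M (borel \<Otimes>\<^sub>M borel))"
  and m: "PROP marginal M fst rho0"
   "PROP marginal M (\<lambda>u. fst (snd u)) rho1"
 shows "endpoints M : couplings rho0 rho1" "distr M borel fst = rho0" "distr M borel (\<lambda>u. fst (snd u)) = rho1"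
  "\<And>h. h : borel_measurable (borel \<Otimes>\<^sub>M borel) ==> (\<integral>\<^sup>+v. h v \<partial>endpoints M) = (\<integral>\<^sup>+u. h (fst u, fst (snd u)) \<partial>M)"
proof -
 note [measurable_cong] = M(2)
 show h: "(\<integral>\<^sup>+v. h v \<partial>endpoints M) = (\<integral>\<^sup>+u. h (fst u, fst (snd u)) \<partial>M)" if "h : borel_measurable (borel \<Otimes>\<^sub>M borel)" for h
  unfolding endpoints_def by (rule nn_integral_distr) (use that in measurable)
 show d0: "distr M borel fst = rho0"
 proof (rule measure_eqI)
  fix S assume "S : sets (distr M borel fst)"
  then have S: "S : sets borel" by simp
  have "emeasure (distr M borel fst) S = (\<integral>\<^sup>+x. indicator S x \<partial>distr M borel fst)" using S by simp
  also have "... = (\<integral>\<^sup>+u. indicator S (fst u) \<partial>M)" by (rule nn_integral_distr) (use S in measurable)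
  also have "... = emeasure rho0 S" by (subst m(1)) (use S r0(2) in auto)
  finally show "emeasure (distr M borel fst) S = emeasure rho0 S" .
 qed (simp add: r0)
 show d1: "distr M borel (\<lambda>u. fst (snd u)) = rho1"
 proof (rule measure_eqI)
  fix S assume "S : sets (distr M borel (\<lambda>u. fst (snd u)))"
  then have S: "S : sets borel" by simp
  have "emeasure (distr M borel (\<lambda>u. fst (snd u))) S = (\<integral>\<^sup>+x. indicator S x \<partial>distr M borel (\<lambda>u. fst (snd u)))" using S by simp
  also have "... = (\<integral>\<^sup>+u. indicator S (fst (snd u)) \<partial>M)" by (rule nn_integral_distr) (use S in measurable)
  also have "... = emeasure rho1 S" by (subst m(2)) (use S r1(2) in auto)
  finally show "emeasure (distr M borel (\<lambda>u. fst (snd u))) S = emeasure rho1 S" .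
 qed (simp add: r1)
 have e: "(\<lambda>u. (fst u, fst (snd u))) : M \<rightarrow>\<^sub>M borel \<Otimes>\<^sub>M borel" by simp
 have "distr (endpoints M) borel fst = rho0" "distr (endpoints M) borel snd = rho1"
  unfolding d0[symmetric] d1[symmetric] endpoints_def by (simp_all add: distr_distr[OF _ e] comp_def)
 moreover have "prob_space (endpoints M)" unfolding endpoints_def by (rule prob_space.prob_space_distr[OF M(1) e])
 ultimately show "endpoints M : couplings rho0 rho1" by (simp add: couplings_def endpoints_def)
qed

lemma couplings_ne: "couplings rho0 rho1 \<noteq> {}"
proof -
 obtain M :: "('h \<times> 'h \<times> 'h) measure" where M: "prob_space M" "sets M = sets (borel \<Otimes>\<^sub>M (borel \<Otimes>\<^sub>M borel))"
  "PROP marginal M fst rho0"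
  "PROP marginal M (\<lambda>u. fst (snd u)) rho1"
 proof (rule interpolated_plan[OF _ _ zero_less_one zero_less_one, of "1/2"], goal_cases)
  qed simp_all
 show ?thesis using endpoints_coupling(1)[OF M] by blast
qed

lemma near_Lmin: "0 < k ==> \<exists>th\<in>couplings rho0 rho1. Lcost th <= Lmin + k"
 using cInf_lessD[of "Lcost ` couplings rho0 rho1" "Lmin + k"] couplings_ne unfolding Lmin_def by (auto intro: less_imp_le)

lemma Sinf_le: "th : couplings rho0 rho1 ==> Lcost th <= Lmin + k ==> Sinf k <= Scost th"
 unfolding Sinf_def by (rule cINF_lower) (auto intro!: bdd_belowI[of _ 0] simp: cost_nonneg)

lemma Sinf_bdd: "bdd_above (Sinf ` {0<..})"
proof -
 obtain B where B: "0 <= B" "\<And>th. th : couplings rho0 rho1 ==> (sq_int th) <= ennreal B"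
  by (rule coupling_moment_bound) blast
 have "Sinf k <= B" if k: "0 < k" for k
 proof -
  obtain th where th: "th : couplings rho0 rho1" "Lcost th <= Lmin + k" using near_Lmin[OF k] by auto
  show ?thesis using B(2)[OF th(1)] B(1) unfolding Scost_eq[OF th(1)] using Sinf_le[OF th] by simp
 qed
 then show ?thesis by (auto intro!: bdd_aboveI[of _ B])
qed

lemma Smin_nonneg: "0 <= Smin"
proof -
 have "0 <= Sinf 1" unfolding Sinf_def using near_Lmin[of 1] by (intro cINF_greatest) (auto simp: cost_nonneg)
 also have "... <= Smin" unfolding Smin_def by (rule cSUP_upper[OF _ Sinf_bdd]) simp
 finally show ?thesis .
qed

lemma Smin_lower:
 assumes "0 < eta"
 obtains k where "0 < k" "\<And>th. th : couplings rho0 rho1 ==> Lcost th <= Lmin + k ==> Smin - eta <= Scost th"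
proof -
 have "Smin - eta < (SUP k\<in>{0<..}. Sinf k)" using assms by (simp add: Smin_def)
 then obtain k where "0 < k" "Smin - eta < Sinf k" using less_cSUP_iff[OF _ Sinf_bdd] by auto
 then show thesis using that Sinf_le by (meson less_imp_le order_trans)
qed

lemma Smin_approx:
 assumes "0 < k" obtains th where "th : couplings rho0 rho1" "Lcost th <= Lmin + k" "Scost th <= Smin + k"
proof -
 have ne: "{th : couplings rho0 rho1. Lcost th <= Lmin + k} \<noteq> {}" using near_Lmin[OF assms] by auto
 have "Sinf k <= Smin" unfolding Smin_def by (rule cSUP_upper[OF _ Sinf_bdd]) (use assms in simp)
 then show thesis using assms unfolding Sinf_def using cInf_lessD[of "Scost ` {th : couplings rho0 rho1. Lcost th <= Lmin + k}" "Smin + k"] ne that by auto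
qed

text \<open>The third component is a point near the interpolant at time \<open>t\<close>. The
  constants of the last clause contain neither \<open>t\<close> nor \<open>eta\<close>, so it
  persists when both tend to 0.\<close>

definition plan :: "real => real => ('h \<times> 'h \<times> 'h) measure => bool" where
 "plan t eta M \<longleftrightarrow> prob_space M \<and> sets M = sets (borel \<Otimes>\<^sub>M (borel \<Otimes>\<^sub>M borel)) \<and> endpoints M : couplings rho0 rho1 \<and>
  distr M borel fst = rho0 \<and> distr M borel (\<lambda>u. fst (snd u)) = rho1 \<and>
  Lcost (endpoints M) <= Lmin + eta \<and> Scost (endpoints M) <= Smin + eta \<and>
  measure M {u. eta < norm (snd (snd u) - ((1 - t) *\<^sub>R fst u + t *\<^sub>R fst (snd u)))} <= eta \<and>
  (\<forall>S N. S : sets borel --> 0 <= N --> N * measure M {u. snd (snd u) : S} <= E + 3 + 2 * exp N * measure gm S)"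

text \<open>Minimise the linear plus \<open>dl\<close> times the quadratic cost up to
  \<open>om\<close>. Comparison with couplings nearly minimal in both senses gives
  \<open>L + dl * S <= Lmin + dl * Smin + om\<close>; then \<open>S >= 0\<close> bounds
  \<open>L\<close>, and \<open>L >= Lmin\<close> bounds \<open>S\<close> after division by
  \<open>dl\<close>. Hence \<open>dl * Smin\<close> is kept below \<open>eta / 2\<close> and
  \<open>om\<close> below \<open>dl * eta\<close>.\<close>

lemma plan_exists:
 assumes t: "0 < t" "t < 1" and eta: "0 < eta"
 shows "\<exists>M. plan t eta M"
proof -
 define dl where "dl = eta / (2 * (Smin + 1))"
 have de: "0 < dl" unfolding dl_def using eta Smin_nonneg by simp
 have dS: "dl * Smin <= eta / 2"
 proof -
  have "dl * Smin <= dl * (Smin + 1)" using de by simp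
  also have "... = eta / 2" unfolding dl_def using Smin_nonneg by (simp add: field_simps)
  finally show ?thesis .
 qed
 define om where "om = min (eta / 2) (dl * eta)"
 have om: "0 < om" "om <= eta / 2" "om <= dl * eta" unfolding om_def using eta de by auto
 obtain M where M: "prob_space M" "sets M = sets (borel \<Otimes>\<^sub>M (borel \<Otimes>\<^sub>M borel))"
  and m: "PROP marginal M fst rho0"
   "PROP marginal M (\<lambda>u. fst (snd u)) rho1"
  and opt: "\<And>th. th : couplings rho0 rho1 ==> (\<integral>\<^sup>+u. ennreal (pert_cost dl (fst u) (fst (snd u))) \<partial>M)
   <= (pert_int dl th) + ennreal om"
  and near: "measure M {u. om < norm (snd (snd u) - ((1 - t) *\<^sub>R fst u + t *\<^sub>R fst (snd u)))} <= om"
  and ent: "\<And>S N. S : sets borel ==> 0 <= N ==> N * measure M {u. snd (snd u) : S} <= E + 3 + 2 * exp N * measure gm S"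
  by (rule interpolated_plan[OF t de om(1)]) blast
 interpret M: prob_space M by (rule M)
 note [measurable_cong] = M(2)
 have spM: "space M = UNIV" using sets_eq_imp_space_eq[OF M(2)] by (simp add: space_pair_measure)
 have ep: "endpoints M : couplings rho0 rho1" "distr M borel fst = rho0" "distr M borel (\<lambda>u. fst (snd u)) = rho1"
  by (rule endpoints_coupling(1-3)[OF M m]; assumption)+
 have ep4: "(\<integral>\<^sup>+v. h v \<partial>endpoints M) = (\<integral>\<^sup>+u. h (fst u, fst (snd u)) \<partial>M)" if "h : borel_measurable (borel \<Otimes>\<^sub>M borel)" for h
  by (rule endpoints_coupling(4)[OF M m]) (use that in auto)
 have pc: "(pert_int dl th) = ennreal (Lcost th + dl * Scost th)" if th: "th : couplings rho0 rho1" for th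
 proof -
  have s [measurable_cong]: "sets th = sets (borel \<Otimes>\<^sub>M borel)" using th by (auto simp: couplings_def)
  have "(pert_int dl th) = (\<integral>\<^sup>+v. ennreal (norm (fst v - snd v)) + ennreal dl * ennreal ((norm (fst v - snd v))^2) \<partial>th)"
   unfolding pert_cost_def using de by (intro nn_integral_cong) (simp add: ennreal_plus ennreal_mult)
  also have "... = ennreal (Lcost th) + ennreal dl * ennreal (Scost th)"
   unfolding Lcost_eq[OF th, symmetric] Scost_eq[OF th, symmetric] by (simp add: nn_integral_add nn_integral_cmult)
  finally show ?thesis using de cost_nonneg[of th] by (simp add: ennreal_mult)
 qed
 define L where "L = Lcost (endpoints M)" define S where "S = Scost (endpoints M)"
 have LS: "0 <= L" "0 <= S" "Lmin <= L"
  unfolding L_def S_def by (rule cost_nonneg, rule cost_nonneg, rule Lmin_le[OF ep(1)])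
 have "L + dl * S <= Lcost th + dl * Scost th + om" if th: "th : couplings rho0 rho1" for th
 proof -
  have "(\<lambda>v :: 'h \<times> 'h. ennreal (pert_cost dl (fst v) (snd v))) : borel_measurable (borel \<Otimes>\<^sub>M borel)"
   unfolding pert_cost_def by simp
  from ep4[OF this] have "ennreal (L + dl * S) = (\<integral>\<^sup>+u. ennreal (pert_cost dl (fst u) (fst (snd u))) \<partial>M)"
   unfolding L_def S_def pc[OF ep(1)] by simp
  also have "... <= ennreal (Lcost th + dl * Scost th) + ennreal om" using opt[OF th] unfolding pc[OF th] .
  finally show ?thesis using de om cost_nonneg[of th] by (simp flip: ennreal_plus)
 qed
 then have key: "L + dl * S <= Lmin + dl * Smin + om + eps" if "0 < eps" for eps
 proof -
  define k where "k = eps / (1 + dl)"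
  have "k * (1 + dl) = eps" "0 < k" unfolding k_def using that de by auto
  then have k: "0 < k" "k + dl * k = eps" by (simp_all add: algebra_simps)
  obtain th where th: "th : couplings rho0 rho1" "Lcost th <= Lmin + k" "Scost th <= Smin + k" using Smin_approx[OF k(1)] by auto
  have "dl * Scost th <= dl * (Smin + k)" using th de by simp
  moreover have "L + dl * S <= Lcost th + dl * Scost th + om"
   by (rule \<open>\<And>th. th : couplings rho0 rho1 ==> L + dl * S <= Lcost th + dl * Scost th + om\<close>[OF th(1)])
  ultimately show ?thesis using th k(2) by (simp add: distrib_left)
 qed
 have key: "L + dl * S <= Lmin + dl * Smin + om" by (rule field_le_epsilon) (rule key)
 have "L <= Lmin + eta" using key LS de dS om mult_nonneg_nonneg[of dl S] by linarith
 moreover have "S <= Smin + eta"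
 proof -
  have "dl * S <= dl * (Smin + eta)" using key LS om by (simp add: distrib_left)
  then show ?thesis using de by simp
 qed
 moreover have "measure M {u. eta < norm (snd (snd u) - ((1 - t) *\<^sub>R fst u + t *\<^sub>R fst (snd u)))} <= eta"
 proof -
  have "{u. om < norm (snd (snd u) - ((1 - t) *\<^sub>R fst u + t *\<^sub>R fst (snd u)))} \<inter> space M : sets M" by simp
  then have "measure M {u. eta < norm (snd (snd u) - ((1 - t) *\<^sub>R fst u + t *\<^sub>R fst (snd u)))} <= measure M {u. om < norm (snd (snd u) - ((1 - t) *\<^sub>R fst u + t *\<^sub>R fst (snd u)))}"
   using om eta by (intro M.finite_measure_mono) (auto simp: spM)
  then show ?thesis using near om eta by simp
 qed
 ultimately show ?thesis using M ep(1-3) ent unfolding plan_def L_def S_def by auto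
qed

end

text \<open>\<open>a\<close> is sent to \<open>b\<close>; \<open>x\<close> lies near the interpolant
  at time \<open>t\<close> and is sent to \<open>y\<close>; the swap sends \<open>a\<close> to
  \<open>y\<close> and \<open>x\<close> to \<open>b\<close>. The triangle inequality alone makes the
  linear cost hardly worse. A gain of order \<open>t\<close> comes from the quadratic cost if
  \<open>y\<close> is nearer to \<open>a\<close> than \<open>b\<close> is, and from the linear cost
  if \<open>b\<close> and \<open>y\<close> are seen from \<open>a\<close> under a definite
  angle.\<close>

lemma swap_geometry:
 fixes a b x y :: "'a::real_inner"
 assumes t: "0 < t" "t < 1" and rho: "norm (x - ((1 - t) *\<^sub>R a + t *\<^sub>R b)) <= rho"
 defines "r \<equiv> norm (a - b)" and "p \<equiv> norm (a - y)"
 shows "p + norm (x - b) <= r + norm (x - y) + 2 * rho"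
  and "p^2 + (norm (x - b))^2 <= r^2 + (norm (x - y))^2 - 2 * t * r * (r - p) + t^2 * r^2 + rho * (2 * p + 2 * r + rho)"
  and "(b - a) \<bullet> (y - a) <= (1 - c0) * (r * p) ==> c0 <= 1 ==> p + norm (x - b) <= r + norm (x - y) - c0 * t * r + 2 * rho"
proof -
 define m where "m = (1 - t) *\<^sub>R a + t *\<^sub>R b"
 have rho0: "0 <= rho" using rho norm_ge_zero order_trans by blast
 have r0: "0 <= r" "0 <= p" by (simp_all add: r_def p_def)
 have "m - b = (1 - t) *\<^sub>R (a - b)" "a - m = t *\<^sub>R (a - b)" by (simp_all add: m_def algebra_simps)
 then have mb: "norm (m - b) = (1 - t) * r" and am: "norm (a - m) = t * r" using t by (simp_all add: r_def)
 have xb: "norm (x - b) <= (1 - t) * r + rho"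
  using norm_triangle_ineq[of "x - m" "m - b"] rho mb by (simp add: m_def)
 have py: "p <= t * r + rho + norm (x - y)"
  using norm_triangle_ineq[of "a - m" "m - y"] norm_triangle_ineq[of "m - x" "x - y"] rho am
  by (simp add: m_def[symmetric] p_def norm_minus_commute)
 show "p + norm (x - b) <= r + norm (x - y) + 2 * rho" using xb py by (simp add: algebra_simps)
 have "(norm (x - b))^2 <= ((1 - t) * r + rho)^2" using xb by (intro power_mono) auto
 also have "... = r^2 - 2 * t * r * r + t^2 * r^2 + 2 * ((1 - t) * (rho * r)) + rho^2" by (simp add: power2_eq_square algebra_simps)
 also have "(1 - t) * (rho * r) <= 1 * (rho * r)" using t rho0 r0 by (intro mult_right_mono) auto
 finally have 1: "(norm (x - b))^2 <= r^2 - 2 * t * r * r + t^2 * r^2 + 2 * (rho * r) + rho^2" by simp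
 have 2: "p^2 - (norm (x - y))^2 <= 2 * p * (t * r + rho)"
 proof (cases "p <= norm (x - y)")
  case True
  then have "p^2 <= (norm (x - y))^2" using r0 by simp
  moreover have "0 <= 2 * p * (t * r + rho)" using r0 t rho0 by simp
  ultimately show ?thesis by simp
 next
  case False
  have "p^2 - (norm (x - y))^2 = (p + norm (x - y)) * (p - norm (x - y))" by (simp add: power2_eq_square algebra_simps)
  also have "... <= (2 * p) * (t * r + rho)" using py False r0 by (intro mult_mono) auto
  finally show ?thesis .
 qed
 show "p^2 + (norm (x - b))^2 <= r^2 + (norm (x - y))^2 - 2 * t * r * (r - p) + t^2 * r^2 + rho * (2 * p + 2 * r + rho)"
  using 1 2 by (simp add: power2_eq_square algebra_simps)
 assume ang: "(b - a) \<bullet> (y - a) <= (1 - c0) * (r * p)" and c0: "c0 <= 1"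
 have "p - t * (1 - c0) * r <= norm (m - y)"
 proof (cases "p = 0")
  case True
  have "0 <= t * (1 - c0) * r" using t c0 r0 by simp
  then show ?thesis using True norm_ge_zero[of "m - y"] by linarith
 next
  case False
  have "p * (p - t * (1 - c0) * r) = p^2 - t * ((1 - c0) * (r * p))" by (simp add: power2_eq_square algebra_simps)
  also have "... <= p^2 - t * ((b - a) \<bullet> (y - a))" using ang t by simp
  also have "... = (a - y) \<bullet> (m - y)"
   unfolding p_def power2_norm_eq_inner m_def by (simp add: inner_commute algebra_simps)
  also have "... <= p * norm (m - y)" unfolding p_def by (rule norm_cauchy_schwarz)
  finally show ?thesis using False r0 by simp
 qed
 moreover have "norm (m - y) <= norm (x - y) + rho"
  using norm_triangle_ineq[of "m - x" "x - y"] rho by (simp add: m_def[symmetric] norm_minus_commute)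
 ultimately show "p + norm (x - b) <= r + norm (x - y) - c0 * t * r + 2 * rho" using xb by (simp add: algebra_simps)
qed

text \<open>\<open>k x\<close> is the index of the first point of a dense sequence within
  \<open>eps / 2\<close>; a finite subcover bounds it on compact sets.\<close>

lemma small_cells:
 assumes "0 < (eps :: real)"
 obtains k :: "'a::polish_space => nat" where "k : borel \<rightarrow>\<^sub>M count_space UNIV" "\<And>x y. k x = k y ==> dist x y < eps"
  "\<And>K. compact K ==> \<exists>n. \<forall>x\<in>K. k x < n"
proof -
 obtain D :: "'a set" where D: "countable D" "\<And>X. open X ==> X \<noteq> {} ==> \<exists>d\<in>D. d : X"
  by (rule countable_dense_setE) blast
 define c where "c = from_nat_into D"
 have ex: "\<exists>j. dist x (c j) < eps / 2" for x
 proof -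
  show ?thesis using D(2)[of "ball x (eps / 2)"] assms from_nat_into_surj[OF D(1)] unfolding c_def by auto
 qed
 define k where "k x = (LEAST j. dist x (c j) < eps / 2)" for x
 have k: "dist x (c (k x)) < eps / 2" for x unfolding k_def using ex by (rule LeastI_ex)
 show thesis
 proof (rule that)
  show "k : borel \<rightarrow>\<^sub>M count_space UNIV" unfolding k_def by simp
  show "dist x y < eps" if "k x = k y" for x y
   using k[of x] k[of y] dist_triangle2[of x y "c (k x)"] that by simp
  fix K :: "'a set" assume "compact K"
  moreover have "K \<subseteq> (\<Union>j. ball (c j) (eps / 2))" using ex by (auto simp: dist_commute)
  ultimately obtain J where J: "finite J" "K \<subseteq> (\<Union>j\<in>J. ball (c j) (eps / 2))"
   using compactE_image[of K UNIV "\<lambda>j. ball (c j) (eps / 2)"] by auto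
  have "k x < Suc (Max J)" if x: "x : K" for x
  proof -
   obtain j where j: "j : J" "dist x (c j) < eps / 2" using J(2) x by (auto simp: dist_commute)
   have "k x <= j" unfolding k_def using j(2) by (rule Least_le)
   then show ?thesis using Max_ge[OF J(1) j(1)] by simp
  qed
  then show "\<exists>n. \<forall>x\<in>K. k x < n" by auto
 qed
qed

section \<open>Setwise limits of approximate plans and the mass that can be swapped\<close>

context gaussian_pair
begin

definition mass :: "('h \<times> 'h \<times> 'h) measure => 'h set => 'h set => real" where
 "mass M A V = measure M {u. fst u : A \<and> fst (snd u) : V}"

text \<open>The masses of all pairs of sets form one point of a compact cube; along neighbourhoods
  of a cluster point they converge together. The limit is taken set by set, so it is available for
  arbitrary Borel sets and not only for continuity sets.\<close>

lemma limit_plan_exists: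
 obtains t eta :: "nat => real" and M :: "nat => ('h \<times> 'h \<times> 'h) measure" and F :: "nat filter" and \<l>
 where "F \<noteq> bot" "F <= sequentially" "\<And>A V. ((\<lambda>i. mass (M i) A V) \<longlongrightarrow> \<l> A V) F"
  "\<And>i. 0 < t i \<and> t i < 1" "t \<longlonglongrightarrow> 0" "\<And>i. 0 < eta i \<and> eta i <= (t i)^2"
  "\<And>i th. th : couplings rho0 rho1 ==> Lcost th <= Lmin + 3 * eta i ==> Smin - (t i)^2 <= Scost th"
  "\<And>i. plan (t i) (eta i) (M i)"
proof -
 define t where "t i = 1 / (real i + 2)" for i
 have t: "0 < t i" "t i < 1" for i by (auto simp: t_def)
 have tl: "t \<longlonglongrightarrow> 0" unfolding t_def using LIMSEQ_ignore_initial_segment[OF lim_1_over_n, of 2] by (simp add: add.commute)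
 \<comment> \<open>The 3 matches the loss of linear cost in a swap: after halving,
   \<open>eta\<close> from the near optimality of the two plans and \<open>2 * eta\<close> from the
   perturbed interpolant.\<close>
 have "\<forall>i. \<exists>eta. 0 < eta \<and> eta <= (t i)^2 \<and> (\<forall>th\<in>couplings rho0 rho1. Lcost th <= Lmin + 3 * eta --> Smin - (t i)^2 <= Scost th)"
 proof
  fix i
  have ti: "0 < (t i)^2" using t[of i] by simp
  obtain k where k: "0 < k" "\<And>th. th : couplings rho0 rho1 ==> Lcost th <= Lmin + k ==> Smin - (t i)^2 <= Scost th"
   by (rule Smin_lower[OF ti]) blast
  then show "\<exists>eta. 0 < eta \<and> eta <= (t i)^2 \<and> (\<forall>th\<in>couplings rho0 rho1. Lcost th <= Lmin + 3 * eta --> Smin - (t i)^2 <= Scost th)"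
   using ti by (intro exI[of _ "min (k / 3) ((t i)^2)"]) auto
 qed
 from choice[OF this] obtain eta where "\<forall>i. 0 < eta i \<and> eta i <= (t i)^2 \<and> (\<forall>th\<in>couplings rho0 rho1. Lcost th <= Lmin + 3 * eta i --> Smin - (t i)^2 <= Scost th)" ..
 then have eta: "\<And>i. 0 < eta i" "\<And>i. eta i <= (t i)^2"
  "\<And>i th. th : couplings rho0 rho1 ==> Lcost th <= Lmin + 3 * eta i ==> Smin - (t i)^2 <= Scost th" by auto
 define M where "M i = (SOME M. plan (t i) (eta i) M)" for i
 have M: "plan (t i) (eta i) (M i)" for i unfolding M_def by (rule someI_ex) (rule plan_exists[OF t eta(1)])
 define p where "p i = (\<lambda>(A, V). mass (M i) A V)" for i
 have "p i : PiE UNIV (\<lambda>_. {0..1})" for i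
 proof -
  interpret prob_space "M i" using M[of i] by (simp add: plan_def)
  show ?thesis by (auto simp: p_def mass_def)
 qed
 then obtain l where l: "inf (nhds l) (filtermap p sequentially) \<noteq> bot"
  using compact_unit_cube[where 'i = "'h set \<times> 'h set", unfolded compact_filter, rule_format, of "filtermap p sequentially"]
  by (auto simp: eventually_filtermap filtermap_bot_iff)
 \<comment> \<open>\<open>F\<close> refines the sequence by the neighbourhoods of the cluster point
   \<open>l\<close>; clustering is what makes it nontrivial.\<close>
 define F where "F = inf sequentially (filtercomap p (nhds l))"
 have Fb: "F \<noteq> bot"
 proof
  assume "F = bot"
  then obtain Q R where Q: "eventually Q sequentially" "eventually R (nhds l)" "\<And>i. Q i ==> R (p i) ==> False"
   unfolding F_def trivial_limit_def eventually_inf eventually_filtercomap by auto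
  have "eventually (\<lambda>v. \<not> R v) (filtermap p sequentially)" unfolding eventually_filtermap using Q(1) by eventually_elim (use Q(3) in blast)
  then have "eventually (\<lambda>v. False) (inf (nhds l) (filtermap p sequentially))"
   unfolding eventually_inf using Q(2) by auto
  then show False using l by simp
 qed
 have Fs: "F <= sequentially" by (simp add: F_def)
 have Fl: "((\<lambda>i. mass (M i) A V) \<longlongrightarrow> l (A, V)) F" for A V
 proof -
  have "(p \<longlongrightarrow> l) F" unfolding F_def filterlim_def filtermap_le_iff_le_filtercomap by simp
  then have "((\<lambda>i. p i (A, V)) \<longlongrightarrow> l (A, V)) F"
   by (rule continuous_on_tendsto_compose[OF continuous_on_product_coordinates]) auto
  then show ?thesis by (simp add: p_def)
 qed
 have tt: "0 < t i \<and> t i < 1" and ee: "0 < eta i \<and> eta i <= (t i)^2" for i using t eta by auto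
 show thesis by (rule that[OF Fb Fs Fl tt tl ee eta(3) M])
qed

end

text \<open>The two ways in which a swap can gain, with constants uniform over the three sets:
  \<open>V\<close> is farther away than \<open>U\<close> by a fixed gap, or the directions to
  \<open>U\<close> and \<open>V\<close> differ by a definite angle, with \<open>V\<close> at a
  definite distance.\<close>

definition sep3 :: "'a::real_inner set => 'a set => 'a set => bool" where
 "sep3 A U V \<longleftrightarrow> (\<exists>g>0. \<forall>a\<in>A. \<forall>u\<in>U. \<forall>v\<in>V. norm (a - u) + g <= norm (a - v)) \<or>
  (\<exists>c>0. c <= 1 \<and> (\<exists>g>0. \<forall>a\<in>A. \<forall>u\<in>U. \<forall>v\<in>V. (v - a) \<bullet> (u - a) <= (1 - c) * (norm (a - v) * norm (a - u)) \<and> g <= norm (a - v)))"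

lemma measurable_count_space_subset:
 "f : M \<rightarrow>\<^sub>M count_space UNIV ==> (\<And>x. x : space M ==> f x : P) ==> f : M \<rightarrow>\<^sub>M count_space P"
 by (auto simp: measurable_def)

locale gaussian_limit = gaussian_pair gm rho0 rho1 x0 e c bt I E
 for gm rho0 rho1 :: "'h::{real_inner, polish_space} measure" and x0 e c bt I E +
 fixes t eta :: "nat => real" and M :: "nat => ('h \<times> 'h \<times> 'h) measure" and F :: "nat filter" and \<l> :: "'h set => 'h set => real"
 assumes F: "F \<noteq> bot" "F <= sequentially" and lim: "\<And>A V. ((\<lambda>i. mass (M i) A V) \<longlongrightarrow> \<l> A V) F"
  and t: "\<And>i. 0 < t i \<and> t i < 1" "t \<longlonglongrightarrow> 0" and eta: "\<And>i. 0 < eta i \<and> eta i <= (t i)^2"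
  and second: "\<And>i th. th : couplings rho0 rho1 ==> Lcost th <= Lmin + 3 * eta i ==> Smin - (t i)^2 <= Scost th"
  and M: "\<And>i. plan (t i) (eta i) (M i)"
begin

definition near :: "nat => 'h \<times> 'h \<times> 'h => bool" where
 "near i u \<longleftrightarrow> norm (snd (snd u) - ((1 - t i) *\<^sub>R fst u + t i *\<^sub>R fst (snd u))) <= eta i"

text \<open>\<open>u\<close> is mass of the plan \<open>i\<close> going from \<open>A\<close> to
  \<open>V\<close>; \<open>v\<close> is mass, in general of a later plan, that starts near the
  interpolant of \<open>u\<close> and goes to \<open>U\<close>.\<close>

abbreviation matched where
 "matched i Q qa qb A V U \<equiv> \<forall>u v. qa u : Q --> qb v = qa u --> fst u : A \<and> fst (snd u) : V \<and> fst (snd v) : U \<and> near i u \<and> dist (fst v) (snd (snd u)) <= eta i"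

lemma planD: "prob_space (M i)" "sets (M i) = sets (borel \<Otimes>\<^sub>M (borel \<Otimes>\<^sub>M borel))" "endpoints (M i) : couplings rho0 rho1"
 "distr (M i) borel fst = rho0" "distr (M i) borel (\<lambda>u. fst (snd u)) = rho1"
 "Lcost (endpoints (M i)) <= Lmin + eta i" "Scost (endpoints (M i)) <= Smin + eta i" "measure (M i) {u. \<not> near i u} <= eta i"
 "S : sets borel ==> 0 <= N ==> N * measure (M i) {u. snd (snd u) : S} <= E + 3 + 2 * exp N * measure gm S"
 using M[of i] unfolding plan_def near_def not_le by auto

lemma space_M: "space (M i) = UNIV" using sets_eq_imp_space_eq[OF planD(2)] by (simp add: space_pair_measure)

lemma endpoint_costs:
 "(\<integral>\<^sup>+u. ennreal (norm (fst u - fst (snd u))) \<partial>M i) = ennreal (Lcost (endpoints (M i)))"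
 "(\<integral>\<^sup>+u. ennreal ((norm (fst u - fst (snd u)))^2) \<partial>M i) = ennreal (Scost (endpoints (M i)))"
proof -
 note [measurable_cong] = planD(2)[of i]
 have m: "(\<lambda>u. (fst u, fst (snd u))) : M i \<rightarrow>\<^sub>M borel \<Otimes>\<^sub>M borel" by simp
 show "(\<integral>\<^sup>+u. ennreal (norm (fst u - fst (snd u))) \<partial>M i) = ennreal (Lcost (endpoints (M i)))"
  using nn_integral_distr[OF m, of "\<lambda>v. ennreal (norm (fst v - snd v))"] Lcost_eq[OF planD(3)[of i]] by (simp add: endpoints_def)
 show "(\<integral>\<^sup>+u. ennreal ((norm (fst u - fst (snd u)))^2) \<partial>M i) = ennreal (Scost (endpoints (M i)))"
  using nn_integral_distr[OF m, of "\<lambda>v. ennreal ((norm (fst v - snd v))^2)"] Scost_eq[OF planD(3)[of i]] by (simp add: endpoints_def)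
qed

text \<open>The swapped coupling competes with near optimal ones: a gain of order \<open>t i\<close>
  per unit of mass against errors of order \<open>(t i)^2\<close> leaves mass of order
  \<open>t i\<close>. With a gap in distance the linear cost exceeds \<open>Lmin\<close> by at most
  \<open>3 * eta i\<close>, so \<open>second\<close> applies and the quadratic cost gains; with an
  angle the linear cost itself gains.\<close>

lemma swap_mass:
 assumes sep: "sep3 A U V" and D: "0 <= D" "\<And>a v. a : A ==> v : U \<union> V ==> norm (a - v) <= D"
 obtains K T where "0 < K" "0 < T" "\<And>i j (P :: nat set) Q qa qb. [|t i <= T; eta j <= eta i; finite P; Q \<subseteq> P;
  qa : M i \<rightarrow>\<^sub>M count_space P; qb : M j \<rightarrow>\<^sub>M count_space P;
  matched i Q qa qb A V U|]
  ==> (\<Sum>p\<in>Q. min (measure (M i) {u. qa u = p}) (measure (M j) {u. qb u = p})) <= K * t i"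
proof -
 \<comment> \<open>The swap of a single pair for the cost \<open>f\<close> of the distance, with
   gain \<open>k\<close> and loss \<open>l\<close>. The tolerance \<open>2 * eta i\<close> adds the
   error of the interpolant to the distance of matched points.\<close>
 define good where "good f i k l \<longleftrightarrow> 0 <= k \<and> 0 <= l \<and> (\<forall>a\<in>A. \<forall>v\<in>V. \<forall>u\<in>U. \<forall>x. norm (x - ((1 - t i) *\<^sub>R a + t i *\<^sub>R v)) <= 2 * eta i -->
  f (norm (a - u)) + f (norm (x - v)) + k <= f (norm (a - v)) + f (norm (x - u)) + l)" for f :: "real => real" and i k l
 have good0: "0 <= k" "0 <= l" if "good f i k l" for f i k l using that by (auto simp: good_def)
 have good: "f (norm (a - u)) + f (norm (x - v)) + k <= f (norm (a - v)) + f (norm (x - u)) + l"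
  if "good f i k l" "a : A" "v : V" "u : U" "norm (x - ((1 - t i) *\<^sub>R a + t i *\<^sub>R v)) <= 2 * eta i" for f i k l a v u x
  using that unfolding good_def by simp
 have tri: "norm (p - m) <= norm (p - z) + norm (z - m)" for p m z :: 'h by norm
 have main: "\<exists>tau\<le>1. (\<Sum>p\<in>Q. min (measure (M i) {u. qa u = p}) (measure (M j) {u. qb u = p})) <= tau \<and>
   (\<exists>th\<in>couplings rho0 rho1.
    (\<forall>k l. good (\<lambda>x. x) i k l --> 2 * Lcost th + k * tau <= 2 * Lmin + 2 * eta i + l * tau) \<and>
    (\<forall>k l. good power2 i k l --> 2 * Scost th + k * tau <= 2 * Smin + 2 * eta i + l * tau))"
  if a: "eta j <= eta i" "finite P" "Q \<subseteq> P" "qa : M i \<rightarrow>\<^sub>M count_space P" "qb : M j \<rightarrow>\<^sub>M count_space P"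
  and ex: "matched i Q qa qb A V U"
  for i j and P :: "nat set" and Q qa qb
 proof -
  note [measurable_cong] = planD(2)
  have x: "fst : M i' \<rightarrow>\<^sub>M borel" "(\<lambda>u. fst (snd u)) : M i' \<rightarrow>\<^sub>M borel" for i' by auto
  obtain th tau where th: "th : couplings rho0 rho1" and tau: "tau <= 1"
   "(\<Sum>p\<in>Q. min (measure (M i) {x : space (M i). qa x = p}) (measure (M j) {x : space (M j). qb x = p})) <= tau"
   and sw: "\<And>h :: 'h \<times> 'h => real. \<And>p q. [|h : borel_measurable (borel \<Otimes>\<^sub>M borel); \<And>v. 0 <= h v; 0 <= p; 0 <= q;
   \<And>u v. u : space (M i) ==> v : space (M j) ==> qa u : Q ==> qb v = qa u ==>
    h (fst u, fst (snd v)) + h (fst v, fst (snd u)) + p <= h (fst u, fst (snd u)) + h (fst v, fst (snd v)) + q|]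
   ==> 2 * (\<integral>\<^sup>+v. ennreal (h v) \<partial>th) + ennreal (p * tau) <= (\<integral>\<^sup>+u. ennreal (h (fst u, fst (snd u))) \<partial>M i) + (\<integral>\<^sup>+v. ennreal (h (fst v, fst (snd v))) \<partial>M j) + ennreal (q * tau)"
  proof (rule swap_coupling[OF planD(1) planD(1) a(2-5) x x planD(4) planD(5) planD(4) planD(5)], goal_cases)
   case (1 th tau)
   show ?case by (rule 1(1)[OF 1(2-5)])
  qed
  have tau0: "0 <= tau" by (rule order_trans[OF _ tau(2)]) (auto intro!: sum_nonneg)
  have dd: "norm (fst v - ((1 - t i) *\<^sub>R fst u + t i *\<^sub>R fst (snd u))) <= 2 * eta i" if "qa u : Q" "qb v = qa u" for u v
   using
    ex[rule_format, OF that] tri[of "fst v" "(1 - t i) *\<^sub>R fst u + t i *\<^sub>R fst (snd u)" "snd (snd u)"] by (simp add: near_def dist_norm)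
  \<comment> \<open>Both plans are nearly optimal, and \<open>eta j <= eta i\<close> lets
    \<open>2 * eta i\<close> cover both deviations.\<close>
  have red: "2 * x + k <= 2 * y + 2 * eta i + l"
   if "2 * ennreal x + ennreal (k) <= ennreal p + ennreal q + ennreal l" "0 <= x" "0 <= k" "0 <= p" "0 <= q" "0 <= l" "p <= y + eta i" "q <= y + eta j" for x k y l p q
  proof -
   have "ennreal (2 * x + k) <= ennreal (p + q + l)" using that(1-6) by (simp add: ennreal_mult)
   then show ?thesis using that a(1) by (subst (asm) ennreal_le_iff) auto
  qed
  have "2 * Lcost th + k * tau <= 2 * Lmin + 2 * eta i + l * tau"
   if h: "good (\<lambda>x. x) i k l" for k l
  proof -
   have "2 * (\<integral>\<^sup>+v. ennreal (norm (fst v - snd v)) \<partial>th) + ennreal (k * tau) <= (\<integral>\<^sup>+u. ennreal (norm (fst (fst u, fst (snd u)) - snd (fst u, fst (snd u)))) \<partial>M i) + (\<integral>\<^sup>+v. ennreal (norm (fst (fst v, fst (snd v)) - snd (fst v, fst (snd v)))) \<partial>M j) + ennreal (l * tau)"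
   proof (rule sw[of "\<lambda>v. norm (fst v - snd v)"], goal_cases)
    case (5 u v)
    then show ?case using good[OF h, of "fst u" "fst (snd u)" "fst (snd v)" "fst v"] ex dd by auto
   qed (use good0[OF h] in auto)
   then show ?thesis unfolding fst_conv snd_conv endpoint_costs Lcost_eq[OF th]
    by (rule red) (use planD(6) cost_nonneg good0[OF h] tau0 in auto)
  qed
  moreover have "2 * Scost th + k * tau <= 2 * Smin + 2 * eta i + l * tau"
   if h: "good power2 i k l" for k l
  proof -
   have "2 * (sq_int th) + ennreal (k * tau) <= (\<integral>\<^sup>+u. ennreal ((norm (fst (fst u, fst (snd u)) - snd (fst u, fst (snd u))))^2) \<partial>M i) + (\<integral>\<^sup>+v. ennreal ((norm (fst (fst v, fst (snd v)) - snd (fst v, fst (snd v))))^2) \<partial>M j) + ennreal (l * tau)"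
   proof (rule sw[of "\<lambda>v. (norm (fst v - snd v))^2"], goal_cases)
    case (5 u v)
    then show ?case using good[OF h, of "fst u" "fst (snd u)" "fst (snd v)" "fst v"] ex dd by auto
   qed (use good0[OF h] in auto)
   then show ?thesis unfolding fst_conv snd_conv endpoint_costs Scost_eq[OF th]
    by (rule red) (use planD(7) cost_nonneg good0[OF h] tau0 in auto)
  qed
  ultimately show ?thesis using th tau unfolding space_M by auto
 qed
 have ti: "0 < t i" "t i < 1" "0 < eta i" "eta i <= (t i)^2" for i using t(1) eta by auto
 from sep consider (1) g where "0 < g" "\<And>a u v. a : A ==> u : U ==> v : V ==> norm (a - u) + g <= norm (a - v)"
  | (2) c g where "0 < c" "c <= 1" "0 < g" "\<And>a u v. a : A ==> u : U ==> v : V ==> (v - a) \<bullet> (u - a) <= (1 - c) * (norm (a - v) * norm (a - u)) \<and> g <= norm (a - v)"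
  unfolding sep3_def by blast
 then show thesis
 proof cases
  case 1
  \<comment> \<open>Below \<open>T\<close> the terms of order \<open>t^2\<close> in
    \<open>swap_geometry(2)\<close> use up at most half of the gain
    \<open>2 * t * g^2\<close>.\<close>
  define T where "T = g^2 / (D^2 + 8 * D + 4)"
  have Dp: "0 < D^2 + 8 * D + 4" using D(1) by (simp add: add_nonneg_pos)
  show thesis
  proof (rule that[of "4 / g^2" T])
   show "0 < 4 / g^2" "0 < T" using 1(1) Dp by (auto simp: T_def)
   fix i j and P :: "nat set" and Q qa qb
   assume tT: "t i <= T" and a: "eta j <= eta i" "finite P" "Q \<subseteq> P" "qa : M i \<rightarrow>\<^sub>M count_space P" "qb : M j \<rightarrow>\<^sub>M count_space P"
   "matched i Q qa qb A V U"
   obtain tau th where tau: "tau <= 1" "(\<Sum>p\<in>Q. min (measure (M i) {u. qa u = p}) (measure (M j) {u. qb u = p})) <= tau" and th: "th : couplings rho0 rho1"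
    and Lc: "\<And>k l. good (\<lambda>x. x) i k l ==> 2 * Lcost th + k * tau <= 2 * Lmin + 2 * eta i + l * tau"
    and Sc: "\<And>k l. good power2 i k l ==> 2 * Scost th + k * tau <= 2 * Smin + 2 * eta i + l * tau"
    using main[OF a] by auto
   have "2 * Lcost th + 0 * tau <= 2 * Lmin + 2 * eta i + (4 * eta i) * tau"
    using swap_geometry(1)[OF ti(1,2)] ti(3)[of i] by (intro Lc) (fastforce simp: good_def)
   moreover have "(4 * eta i) * tau <= (4 * eta i) * 1" using tau ti(3)[of i] by simp
   ultimately have "Smin - (t i)^2 <= Scost th" by (intro second[OF th]) linarith
   moreover have "2 * Scost th + (t i * g^2) * tau <= 2 * Smin + 2 * eta i + 0 * tau"
   proof (rule Sc, unfold good_def, intro conjI ballI allI impI)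
     fix a v u x assume m: "a : A" "v : V" "u : U" and x: "norm (x - ((1 - t i) *\<^sub>R a + t i *\<^sub>R v)) <= 2 * eta i"
     define r where "r = norm (a - v)" define p where "p = norm (a - u)"
     have rp: "p + g <= r" "0 <= p" "0 <= r" "r <= D" "p <= D" using 1(2)[OF m(1,3,2)] D(2) m by (auto simp: r_def p_def)
     have geo: "p^2 + (norm (x - v))^2 <= r^2 + (norm (x - u))^2 - 2 * t i * r * (r - p) + (t i)^2 * r^2 + (2 * eta i) * (2 * p + 2 * r + 2 * eta i)"
      unfolding r_def p_def by (rule swap_geometry(2)[OF ti(1,2) x])
     have "2 * t i * (g * g) <= 2 * t i * (r * (r - p))" using rp 1(1) ti(1)[of i] by (intro mult_mono) auto
     moreover have "(t i)^2 * r^2 <= (t i)^2 * D^2" using rp by (intro mult_left_mono power_mono) auto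
     moreover have "(2 * eta i) * (2 * p + 2 * r + 2 * eta i) <= (2 * (t i)^2) * (4 * D + 2)"
     proof -
      have "(t i)^2 <= 1" using ti[of i] by (simp add: power_le_one)
      then show ?thesis using ti(3,4)[of i] rp by (intro mult_mono) auto
     qed
     moreover have "t i * (t i * (D^2 + 8 * D + 4)) <= t i * g^2"
      using tT Dp ti(1)[of i] unfolding T_def by (intro mult_left_mono) (auto simp: pos_le_divide_eq)
     ultimately show "(norm (a - u))^2 + (norm (x - v))^2 + t i * g^2 <= (norm (a - v))^2 + (norm (x - u))^2 + 0"
      using geo by (simp add: power2_eq_square algebra_simps r_def p_def)
   qed (use ti(1)[of i] in auto)
   ultimately have "(t i * g^2) * tau <= 4 * (t i)^2" using ti(4)[of i] by simp
   then have "tau <= 4 / g^2 * t i" using ti(1)[of i] 1(1) by (simp add: power2_eq_square mult_ac field_simps)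
   then show "(\<Sum>p\<in>Q. min (measure (M i) {u. qa u = p}) (measure (M j) {u. qb u = p})) <= 4 / g^2 * t i" using tau by simp
  qed
 next
  case 2
  show thesis
  proof (rule that[of "4 / (c * g)" "c * g / 8"])
   show "0 < 4 / (c * g)" "0 < c * g / 8" using 2 by auto
   fix i j and P :: "nat set" and Q qa qb
   assume tT: "t i <= c * g / 8" and a: "eta j <= eta i" "finite P" "Q \<subseteq> P" "qa : M i \<rightarrow>\<^sub>M count_space P" "qb : M j \<rightarrow>\<^sub>M count_space P"
   "matched i Q qa qb A V U"
   obtain tau th where tau: "tau <= 1" "(\<Sum>p\<in>Q. min (measure (M i) {u. qa u = p}) (measure (M j) {u. qb u = p})) <= tau" and th: "th : couplings rho0 rho1"
    and Lc: "\<And>k l. good (\<lambda>x. x) i k l ==> 2 * Lcost th + k * tau <= 2 * Lmin + 2 * eta i + l * tau"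
    using main[OF a] by auto
   have "2 * Lcost th + (c * g * t i / 2) * tau <= 2 * Lmin + 2 * eta i + 0 * tau"
   proof (rule Lc, unfold good_def, intro conjI ballI allI impI)
     fix a v u x assume m: "a : A" "v : V" "u : U" and x: "norm (x - ((1 - t i) *\<^sub>R a + t i *\<^sub>R v)) <= 2 * eta i"
     have "norm (a - u) + norm (x - v) <= norm (a - v) + norm (x - u) - c * t i * norm (a - v) + 2 * (2 * eta i)"
      by (rule swap_geometry(3)[OF ti(1,2) x]) (use 2 m in auto)
     moreover have "c * t i * g <= c * t i * norm (a - v)" using 2 m ti(1)[of i] by simp
     moreover have "4 * eta i <= c * g * t i / 2"
     proof -
      have "t i * t i <= t i * (c * g / 8)" using tT ti(1)[of i] by simp
      then show ?thesis using ti(4)[of i] by (simp add: power2_eq_square algebra_simps)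
     qed
     ultimately show "norm (a - u) + norm (x - v) + c * g * t i / 2 <= norm (a - v) + norm (x - u) + 0" by (simp add: algebra_simps)
   qed (use ti(1)[of i] 2 in auto)
   then have "(c * g * t i / 2) * tau <= 2 * (t i)^2" using Lmin_le[OF th] ti(4)[of i] by simp
   then have "tau <= 4 / (c * g) * t i" using ti(1)[of i] 2 by (simp add: power2_eq_square mult_ac field_simps)
   then show "(\<Sum>p\<in>Q. min (measure (M i) {u. qa u = p}) (measure (M j) {u. qb u = p})) <= 4 / (c * g) * t i" using tau by simp
  qed
 qed
qed

end

context gaussian_limit
begin

text \<open>The condition \<open>0 < infdist z A\<close> makes the rings decrease to the empty set,
  so continuity from above applies.\<close>

lemma shrinking_ring:
 assumes A: "compact A" and k: "0 < k"
 obtains r where "0 < r" "measure gm {z. 0 < infdist z A \<and> infdist z A <= r} < k"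
proof -
 interpret g: prob_space gm by (rule g)
 define R where "R n = {z. 0 < infdist z A \<and> infdist z A <= 1 / real (Suc n)}" for n
 have [measurable]: "(\<lambda>z. infdist z A) : borel_measurable borel" by (intro borel_measurable_continuous_onI continuous_intros)
 have "(\<lambda>n. g.prob (R n)) \<longlonglongrightarrow> g.prob (\<Inter>n. R n)"
 proof (rule g.finite_Lim_measure_decseq)
  show "range R \<subseteq> sets gm" unfolding g(2) R_def by auto
  show "decseq R" unfolding R_def by (intro decseq_SucI subsetI) (auto elim!: order_trans simp: frac_le)
 qed
 moreover have "(\<Inter>n. R n) = {}"
 proof (rule ccontr)
  assume "(\<Inter>n. R n) \<noteq> {}"
  then obtain z where z: "\<And>n. z : R n" by auto
  then have "0 < infdist z A" by (auto simp: R_def)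
  then obtain n where "inverse (real (Suc n)) < infdist z A" using reals_Archimedean by auto
  then show False using z[of n] by (simp add: R_def inverse_eq_divide)
 qed
 ultimately have "(\<lambda>n. g.prob (R n)) \<longlonglongrightarrow> 0" by simp
 then have "eventually (\<lambda>n. g.prob (R n) < k) sequentially" using k by (rule order_tendstoD)
 then obtain n where "g.prob (R n) < k" by (auto simp: eventually_sequentially)
 then show thesis using that[of "1 / real (Suc n)"] by (simp add: R_def)
qed

text \<open>Fix \<open>i\<close> with \<open>t i\<close> small, at which more than
  \<open>m / 2\<close> goes from \<open>A\<close> to \<open>V\<close>. Its interpolants are mostly
  within \<open>r\<close> of \<open>A\<close>, and by the entropy clause mostly in \<open>A\<close>
  itself, since the ring around \<open>A\<close> has small \<open>gm\<close>-measure. Cut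
  \<open>A\<close> into cells finer than \<open>eta i\<close>, and only then take \<open>j\<close>
  so late that every cell sends a definite share of its \<open>gm\<close>-measure to
  \<open>U\<close>. Cells where the mass sent to \<open>U\<close> is at least the interpolated mass
  are governed by \<open>swap_mass\<close>; the others have small total \<open>gm\<close>-measure,
  so the entropy clause bounds their mass too.\<close>

lemma exchange_contradiction:
 assumes A: "compact A" and UV [measurable]: "U : sets borel" "V : sets borel" and sep: "sep3 A U V"
  and D: "0 <= D" "\<And>a v. a : A ==> v : U \<union> V ==> norm (a - v) <= D"
  and b: "0 < b" "\<And>X. X : sets borel ==> X \<subseteq> A ==> b * measure gm X <= \<l> X U" and m: "0 < m" "m <= \<l> A V"
 shows False
proof -
 interpret g: prob_space gm by (rule g)
 obtain K T where K: "0 < K" and T: "0 < T" and swap: "\<And>i j (P :: nat set) Q qa qb. [|t i <= T; eta j <= eta i; finite P; Q \<subseteq> P;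
  qa : M i \<rightarrow>\<^sub>M count_space P; qb : M j \<rightarrow>\<^sub>M count_space P;
  matched i Q qa qb A V U|]
  ==> (\<Sum>p\<in>Q. min (measure (M i) {u. qa u = p}) (measure (M j) {u. qb u = p})) <= K * t i"
 proof (rule swap_mass[OF sep D(1)], goal_cases)
  case (1 a v) then show ?case by (intro D(2))
 next
  case (2 K T) show ?case by (rule 2(1)[OF 2(2-4)])
 qed
 \<comment> \<open>Chosen together with \<open>k\<close> so that \<open>measure gm S <= k\<close>
   forces mass at most \<open>2 * (E + 3) / N = m / 32\<close> in \<open>S\<close>.\<close>
 define N where "N = 64 * (E + 3) / m"
 have N: "0 < N" unfolding N_def using E_nonneg m by simp
 define k where "k = (E + 3) / (2 * exp N)"
 have k: "0 < k" unfolding k_def using E_nonneg by simp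
 have small: "measure (M i) {u. snd (snd u) : S} <= m / 32" if "S : sets borel" "measure gm S <= k" for S i
 proof -
  have "2 * exp N * measure gm S <= 2 * exp N * k" using that by simp
  also have "... = E + 3" by (simp add: k_def)
  finally have "N * measure (M i) {u. snd (snd u) : S} <= N * (m / 32)"
   using planD(9)[OF that(1), of N i] N by (simp add: N_def)
  then show ?thesis using N by simp
 qed
 obtain r where r: "0 < r" "measure gm {z. 0 < infdist z A \<and> infdist z A <= r} < k" by (rule shrinking_ring[OF A k])
 have ev: "eventually (\<lambda>i. t i < x) F" if "0 < x" for x
  using order_tendstoD(2)[OF t(2) that] F(2) by (rule filter_leD[rotated])
 define x where "x = min (min T (m / 32)) (min (m / (32 * K)) (min (k * b / (2 * K)) (r / (D + 1))))"
 have x: "0 < x" unfolding x_def using T m K k b r D by simp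
 have "eventually (\<lambda>i. mass (M i) A V > m / 2) F" using order_tendstoD(1)[OF lim[of A V], of "m / 2"] m by simp
 with ev[OF x] have "eventually (\<lambda>i. t i < x \<and> mass (M i) A V > m / 2) F" by eventually_elim simp
 then obtain i where i: "t i < x" "mass (M i) A V > m / 2" using eventually_happens'[OF F(1)] by auto
 have ti: "0 < t i" "t i < 1" "0 < eta i" "eta i <= (t i)^2" using t(1) eta by auto
 have "(t i)^2 <= t i" using ti by (simp add: power2_eq_square)
 then have et: "eta i <= t i" using ti by simp
 have iT: "t i <= T" "t i <= m / 32" "K * t i <= m / 32" "2 * (K * t i) <= k * b" "t i * D + eta i <= r"
 proof -
  have "t i <= T" "t i <= m / 32" "t i <= m / (32 * K)" "t i <= k * b / (2 * K)" "t i <= r / (D + 1)" using i(1) by (simp_all add: x_def)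
  then show "t i <= T" "t i <= m / 32" "K * t i <= m / 32" "2 * (K * t i) <= k * b" using K by (simp_all add: field_simps)
  show "t i * D + eta i <= r" using \<open>t i <= r / (D + 1)\<close> D et by (simp add: field_simps algebra_simps)
 qed
 obtain c :: "'h => nat" where c [measurable]: "c : borel \<rightarrow>\<^sub>M count_space UNIV" and cd: "\<And>x y. c x = c y ==> dist x y < eta i"
  and cK: "\<And>K. compact K ==> \<exists>n. \<forall>x\<in>K. c x < n" by (rule small_cells[OF ti(3)]) blast
 obtain n where n: "\<And>x. x : A ==> c x < n" using cK[OF A] by auto
 have Am [measurable]: "A : sets borel" using A by (simp add: borel_compact)
 \<comment> \<open>Cells are numbered from 1, because index 0 is reserved for mass that takes no
   part in the swap.\<close>
 define X where "X p = {x : A. Suc (c x) = p}" for p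
 have X [measurable]: "X p : sets borel" "X p \<subseteq> A" for p unfolding X_def by auto
 define P where "P = {0..n}" define Q where "Q = {1..n}"
 define qa where "qa u = (if fst u : A \<and> fst (snd u) : V \<and> near i u \<and> snd (snd u) : A then Suc (c (snd (snd u))) else 0)" for u
 define qb where "qb v = (if fst (snd v) : U \<and> fst v : A then Suc (c (fst v)) else 0)" for v :: "'h \<times> 'h \<times> 'h"
 note [measurable_cong] = planD(2)
 have qam: "qa : M i \<rightarrow>\<^sub>M count_space UNIV" unfolding qa_def near_def by simp
 have qbm: "qb : M j \<rightarrow>\<^sub>M count_space UNIV" for j unfolding qb_def by simp
 have qP: "qa u : P" "qb u : P" for u using n by (auto simp: qa_def qb_def P_def Suc_le_eq)
 have qbX: "{v. qb v = p} = {v. fst v : X p \<and> fst (snd v) : U}" if "p : Q" for p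
  using that by (auto simp: qb_def X_def Q_def)
 \<comment> \<open>Finitely many cells are involved, so one late \<open>j\<close> serves all of
   them, with \<open>b / 2\<close> in place of \<open>b\<close>. Cells of \<open>gm\<close>-measure
   0 are separate because they leave no strict inequality.\<close>
 have "eventually (\<lambda>j. \<forall>p\<in>Q. b / 2 * measure gm (X p) <= mass (M j) (X p) U) F"
 proof (intro eventually_ball_finite ballI)
  fix p
  show "eventually (\<lambda>j. b / 2 * measure gm (X p) <= mass (M j) (X p) U) F"
  proof (cases "measure gm (X p) = 0")
   case False
   then have "0 < b * measure gm (X p)" using b(1) by (simp add: zero_less_measure_iff)
   then have "b / 2 * measure gm (X p) < \<l> (X p) U" using b(2)[OF X, of p] by simp
   from order_tendstoD(1)[OF lim this] show ?thesis by (rule eventually_mono) (rule less_imp_le)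
  qed (simp add: mass_def)
 qed (simp add: Q_def)
 moreover have "eventually (\<lambda>j. eta j <= eta i) F"
 proof -
  have "eventually (\<lambda>j. t j < eta i) F" using ti by (intro ev)
  then show ?thesis
  proof eventually_elim
   case (elim j)
   have "(t j)^2 <= t j" using t(1)[of j] by (simp add: power2_eq_square)
   then show ?case using eta[of j] elim by simp
  qed
 qed
 ultimately have "eventually (\<lambda>j. (\<forall>p\<in>Q. b / 2 * measure gm (X p) <= mass (M j) (X p) U) \<and> eta j <= eta i) F" by eventually_elim simp
 then obtain j where j: "\<And>p. p : Q ==> b / 2 * measure gm (X p) <= mass (M j) (X p) U" "eta j <= eta i"
  using eventually_happens'[OF F(1)] by blast
 define f where "f p = measure (M i) {u. qa u = p}" for p
 define h where "h p = measure (M j) {u. qb u = p}" for p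
 have fh: "(\<Sum>p\<in>Q. min (f p) (h p)) <= K * t i" unfolding f_def h_def
 proof (rule swap[OF iT(1) j(2)])
  show "qa : M i \<rightarrow>\<^sub>M count_space P" "qb : M j \<rightarrow>\<^sub>M count_space P"
   using measurable_count_space_subset[OF qam] measurable_count_space_subset[OF qbm] qP by auto
  show "matched i Q qa qb A V U"
   using cd by (auto simp: qa_def qb_def Q_def less_imp_le)
 qed (auto simp: P_def Q_def)
 have hX: "b / 2 * measure gm (X p) <= h p" if "p : Q" for p
  using j(1)[OF that] qbX[OF that] by (simp add: h_def mass_def)
 interpret Mi: prob_space "M i" by (rule planD(1))
 have f0: "0 <= f p" "0 <= h p" for p by (simp_all add: f_def h_def)
 define Bd where "Bd = {p : Q. h p < f p}"
 have fin: "finite Q" "finite Bd" by (auto simp: Q_def Bd_def)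
 have "measure gm (\<Union>p\<in>Bd. X p) <= (\<Sum>p\<in>Bd. measure gm (X p))"
  using fin X g(2) by (intro g.finite_measure_subadditive_finite) auto
 also have "... <= (\<Sum>p\<in>Bd. 2 / b * min (f p) (h p))"
 proof (intro sum_mono)
  fix p assume p: "p : Bd"
  then have "b / 2 * measure gm (X p) <= min (f p) (h p)" using hX[of p] by (auto simp: Bd_def)
  then have "2 / b * (b / 2 * measure gm (X p)) <= 2 / b * min (f p) (h p)" using b(1) by (intro mult_left_mono) auto
  then show "measure gm (X p) <= 2 / b * min (f p) (h p)" using b(1) by simp
 qed
 also have "... <= (\<Sum>p\<in>Q. 2 / b * min (f p) (h p))"
  using fin f0 b(1) by (intro sum_mono2) (auto simp: Bd_def)
 also have "... = 2 / b * (\<Sum>p\<in>Q. min (f p) (h p))" by (simp add: sum_distrib_left)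
 also have "... <= k" using fh b(1) iT(4) b(1) by (simp add: field_simps)
 finally have bad: "measure gm (\<Union>p\<in>Bd. X p) <= k" .
 define R where "R = {z. 0 < infdist z A \<and> infdist z A <= r}"
 have Rm: "R : sets borel"
 proof -
  have [measurable]: "(\<lambda>z. infdist z A) : borel_measurable borel" by (intro borel_measurable_continuous_onI continuous_intros)
  show ?thesis unfolding R_def by simp
 qed
 define W where "W S = {u :: 'h \<times> 'h \<times> 'h. snd (snd u) : S}" for S
 have Wm: "W S : sets (M i)" if [measurable]: "S : sets borel" for S
 proof -
  have "{u : space (M i). snd (snd u) : S} : sets (M i)" by simp
  then show ?thesis by (simp add: W_def space_M)
 qed
 have Nm: "{u. \<not> near i u} : sets (M i)"
 proof -
  have "{u : space (M i). \<not> near i u} : sets (M i)" unfolding near_def by simp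
  then show ?thesis by (simp add: space_M)
 qed
 have qs: "{u. qa u = p} : sets (M i)" for p using measurable_sets[OF qam, of "{p}"] by (simp add: vimage_def space_M)
 have BXm: "(\<Union>p\<in>Bd. X p) : sets borel" by simp
 have "mass (M i) A V <= measure (M i) ({u. \<not> near i u} \<union> W R \<union> W (\<Union>p\<in>Bd. X p) \<union> (\<Union>p\<in>Q - Bd. {u. qa u = p}))"
  unfolding mass_def
 proof (rule Mi.finite_measure_mono)
  show "{u. \<not> near i u} \<union> W R \<union> W (\<Union>p\<in>Bd. X p) \<union> (\<Union>p\<in>Q - Bd. {u. qa u = p}) : Mi.events"
   using Nm Wm[OF Rm] Wm[OF BXm] qs fin by simp
  show "{u :: 'h \<times> 'h \<times> 'h. fst u : A \<and> fst (snd u) : V} \<subseteq> {u. \<not> near i u} \<union> W R \<union> W (\<Union>p\<in>Bd. X p) \<union> (\<Union>p\<in>Q - Bd. {u. qa u = p})"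
  proof
   fix u assume u: "u : {u :: 'h \<times> 'h \<times> 'h. fst u : A \<and> fst (snd u) : V}"
   define z where "z = snd (snd u)"
   show "u : {u. \<not> near i u} \<union> W R \<union> W (\<Union>p\<in>Bd. X p) \<union> (\<Union>p\<in>Q - Bd. {u. qa u = p})"
   proof (cases "near i u \<and> z : A")
    case True
    then have "qa u = Suc (c z)" "Suc (c z) : Q" "z : X (Suc (c z))"
     using u n by (auto simp: qa_def z_def Q_def X_def Suc_le_eq)
    then show ?thesis by (cases "Suc (c z) : Bd") (auto simp: W_def z_def)
   next
    case False
    show ?thesis
    proof (cases "near i u")
     case True
     then have zA: "z \<notin> A" using False by simp
     have "norm (z - fst u) <= norm (z - ((1 - t i) *\<^sub>R fst u + t i *\<^sub>R fst (snd u))) + norm (t i *\<^sub>R (fst (snd u) - fst u))"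
      by (rule order_trans[OF _ norm_triangle_ineq]) (simp add: algebra_simps)
     also have "... <= eta i + t i * D"
      using True D(2)[of "fst u" "fst (snd u)"] u ti(1) by (auto simp: near_def z_def norm_minus_commute intro!: add_mono)
     finally have "dist z (fst u) <= r" using iT(5) by (simp add: dist_norm)
     moreover have "infdist z A <= dist z (fst u)" using u by (intro infdist_le) auto
     moreover have "0 < infdist z A"
      using zA in_closed_iff_infdist_zero[OF compact_imp_closed[OF A], of z] u infdist_nonneg[of z A] by (auto simp: less_le)
     ultimately show ?thesis by (simp add: R_def W_def z_def)
    qed simp
   qed
  qed
 qed
 also have "... <= measure (M i) {u. \<not> near i u} + measure (M i) (W R) + measure (M i) (W (\<Union>p\<in>Bd. X p)) + measure (M i) (\<Union>p\<in>Q - Bd. {u. qa u = p})"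
  using Nm Wm[OF Rm] Wm[OF BXm] qs fin by (intro order_trans[OF measure_Un_le] add_mono sets.Un sets.finite_UN order_refl) auto
 also have "... <= m / 32 + m / 32 + m / 32 + m / 32"
 proof (intro add_mono)
  show "measure (M i) {u. \<not> near i u} <= m / 32" using planD(8)[of i] et iT(2) by simp
  show "measure (M i) (W R) <= m / 32" unfolding W_def by (rule small[OF Rm]) (use r in \<open>auto simp: R_def\<close>)
  show "measure (M i) (W (\<Union>p\<in>Bd. X p)) <= m / 32" unfolding W_def by (rule small[OF BXm bad])
  have "measure (M i) (\<Union>p\<in>Q - Bd. {u. qa u = p}) <= (\<Sum>p\<in>Q - Bd. f p)"
   unfolding f_def using fin qs by (intro Mi.finite_measure_subadditive_finite) auto
  also have "... = (\<Sum>p\<in>Q - Bd. min (f p) (h p))" by (intro sum.cong) (auto simp: Bd_def)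
  also have "... <= (\<Sum>p\<in>Q. min (f p) (h p))" using fin f0 by (intro sum_mono2) auto
  finally show "measure (M i) (\<Union>p\<in>Q - Bd. {u. qa u = p}) <= m / 32" using fh iT(3) by simp
 qed
 finally show False using i(2) m by simp
qed

end

section \<open>Conditional densities of the limit plan\<close>

lemma dist_triple:
 assumes "dist p p' < e / 3" "dist u u' < e / 3" "dist v v' < e / 3"
 shows "dist (p, u, v) (p', u', v') < e"
proof -
 have "dist (p, u, v) (p', u', v') <= dist p p' + dist (u, v) (u', v')"
  unfolding dist_Pair_Pair[of p] by (rule sqrt_sum_squares_le_sum) auto
 also have "dist (u, v) (u', v') <= dist u u' + dist v v'"
  unfolding dist_Pair_Pair[of u] by (rule sqrt_sum_squares_le_sum) auto
 finally show ?thesis using assms by simp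
qed

lemma sep3_mono: "sep3 A U V ==> A' \<subseteq> A ==> U' \<subseteq> U ==> V' \<subseteq> V ==> sep3 A' U' V'"
 unfolding sep3_def by (meson subsetD)

text \<open>If \<open>u\<close> and \<open>v\<close> are at different distances from
  \<open>p\<close>, the triangle inequality preserves a gap nearby. If the distances are equal,
  \<open>u \<noteq> v\<close> makes Cauchy-Schwarz strict for \<open>v - p\<close> and
  \<open>u - p\<close>, and the resulting condition on the angle is open.\<close>

lemma sep3_local:
 fixes p u v :: "'a::real_inner"
 assumes "u \<noteq> v"
 obtains e where "0 < e" "sep3 (ball p e) (ball u e) (ball v e) \<or> sep3 (ball p e) (ball v e) (ball u e)"
proof -
 have gap: "sep3 (ball p ((norm (p - v) - norm (p - u)) / 8)) (ball u ((norm (p - v) - norm (p - u)) / 8)) (ball v ((norm (p - v) - norm (p - u)) / 8))"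
  if "norm (p - u) < norm (p - v)" for u v
 proof -
  define d where "d = norm (p - v) - norm (p - u)"
  have "norm (a - u') + d / 2 <= norm (a - v')" if a: "a : ball p (d / 8)" "u' : ball u (d / 8)" "v' : ball v (d / 8)" for a u' v'
  proof -
   have tri: "norm (a - u') <= norm (p - a) + norm (p - u) + norm (u - u')" "norm (p - v) <= norm (p - a) + norm (a - v') + norm (v - v')" by norm+
   have "norm (p - a) < d / 8" "norm (u - u') < d / 8" "norm (v - v') < d / 8" using a by (auto simp: dist_norm)
   moreover have "norm (p - v) = norm (p - u) + d" by (simp add: d_def)
   ultimately show ?thesis using tri by simp
  qed
  moreover have "0 < d / 2" using that by (simp add: d_def)
  ultimately show ?thesis unfolding sep3_def d_def[symmetric] by blast
 qed
 consider "norm (p - u) < norm (p - v)" | "norm (p - v) < norm (p - u)" | "norm (p - u) = norm (p - v)" by linarith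
 then show thesis
 proof cases
  case 1 then show ?thesis using gap[OF 1] that[of "(norm (p - v) - norm (p - u)) / 8"] by simp
 next
  case 2 then show ?thesis using gap[OF 2] that[of "(norm (p - u) - norm (p - v)) / 8"] by simp
 next
  case 3
  define r where "r = norm (p - u)"
  have r: "norm (p - v) = r" "norm (p - u) = r" using 3 by (simp_all add: r_def)
  have r0: "0 < r"
  proof (rule ccontr)
   assume "\<not> 0 < r"
   then show False using r assms by auto
  qed
  have "(norm (u - v))^2 = (norm (p - v))^2 + (norm (p - u))^2 - 2 * ((v - p) \<bullet> (u - p))"
   unfolding power2_norm_eq_inner by (simp add: inner_simps inner_commute)
  moreover have "0 < (norm (u - v))^2" using assms by simp
  ultimately have ip: "(v - p) \<bullet> (u - p) < r^2" using r by simp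
  define c where "c = min 1 ((r^2 - (v - p) \<bullet> (u - p)) / (2 * r^2))"
  have c: "0 < c" "c <= 1" unfolding c_def using ip r0 by auto
  have "c * r^2 <= (r^2 - (v - p) \<bullet> (u - p)) / (2 * r^2) * r^2" unfolding c_def by (intro mult_right_mono) auto
  also have "... = (r^2 - (v - p) \<bullet> (u - p)) / 2" using r0 by simp
  finally have neg: "(v - p) \<bullet> (u - p) < (1 - c) * (r * r)" using ip by (simp add: power2_eq_square algebra_simps)
  define S where "S = {w :: 'a \<times> 'a \<times> 'a. (snd (snd w) - fst w) \<bullet> (fst (snd w) - fst w) < (1 - c) * (norm (fst w - snd (snd w)) * norm (fst w - fst (snd w)))} \<inter> {w. r / 2 < norm (fst w - snd (snd w))}"
  have "open S" unfolding S_def by (intro open_Int open_Collect_less continuous_intros)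
  moreover have "(p, u, v) : S" unfolding S_def using neg r r0 by simp
  ultimately obtain e where e: "0 < e" "ball (p, u, v) e \<subseteq> S" using open_contains_ball by blast
  have "(v' - a) \<bullet> (u' - a) <= (1 - c) * (norm (a - v') * norm (a - u')) \<and> r / 2 <= norm (a - v')"
   if "a : ball p (e / 3)" "u' : ball u (e / 3)" "v' : ball v (e / 3)" for a u' v'
  proof -
   have "(a, u', v') : S" using that by (intro subsetD[OF e(2)]) (auto intro: dist_triple)
   then show ?thesis by (simp add: S_def)
  qed
  moreover have "0 < r / 2" using r0 by simp
  ultimately have "sep3 (ball p (e / 3)) (ball u (e / 3)) (ball v (e / 3))" unfolding sep3_def using c by blast
  then show ?thesis using that[of "e / 3"] e(1) by simp
 qed
qed

context gaussian_limit
begin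

lemma mass_bounds: "0 <= mass (M i) A V" "mass (M i) A V <= 1"
 using prob_space.prob_le_1[OF planD(1)] by (auto simp: mass_def)

lemma mass_sets: "A : sets borel ==> V : sets borel ==> {u. fst u : A \<and> fst (snd u) : V} : sets (M i)"
proof -
 assume [measurable]: "A : sets borel" "V : sets borel"
 note [measurable_cong] = planD(2)
 have "{u : space (M i). fst u : A \<and> fst (snd u) : V} : sets (M i)" by simp
 then show ?thesis by (simp add: space_M)
qed

lemma mass_marginal: "A : sets borel ==> mass (M i) A UNIV = measure rho0 A" "V : sets borel ==> mass (M i) UNIV V = measure rho1 V"
proof -
 note [measurable_cong] = planD(2)
 have m: "fst : M i \<rightarrow>\<^sub>M borel" "(\<lambda>u. fst (snd u)) : M i \<rightarrow>\<^sub>M borel" by auto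
 show "A : sets borel ==> mass (M i) A UNIV = measure rho0 A"
  unfolding planD(4)[of i, symmetric] mass_def by (subst measure_distr[OF m(1)]) (auto simp: vimage_def space_M)
 show "V : sets borel ==> mass (M i) UNIV V = measure rho1 V"
  unfolding planD(5)[of i, symmetric] mass_def by (subst measure_distr[OF m(2)]) (auto simp: vimage_def space_M)
qed

lemma lim_eq: "(\<And>i. mass (M i) A V = x) ==> \<l> A V = x"
 using tendsto_unique[OF F(1) lim[of A V], of x] by simp

lemma l_marginal: "A : sets borel ==> \<l> A UNIV = measure rho0 A" "V : sets borel ==> \<l> UNIV V = measure rho1 V"
 using lim_eq mass_marginal by auto

lemma l_nonneg: "0 <= \<l> A V"
 using mass_bounds by (intro tendsto_lowerbound[OF lim _ F(1)]) auto

lemma l_add1: "A : sets borel ==> B : sets borel ==> V : sets borel ==> A \<inter> B = {} ==> \<l> (A \<union> B) V = \<l> A V + \<l> B V"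
proof -
 assume a: "A : sets borel" "B : sets borel" "V : sets borel" "A \<inter> B = {}"
 have "mass (M i) (A \<union> B) V = mass (M i) A V + mass (M i) B V" for i
 proof -
  interpret prob_space "M i" by (rule planD(1))
  have "{u :: 'h \<times> 'h \<times> 'h. fst u : A \<union> B \<and> fst (snd u) : V} = {u. fst u : A \<and> fst (snd u) : V} \<union> {u. fst u : B \<and> fst (snd u) : V}" by auto
  then show ?thesis unfolding mass_def using a by (simp only:) (intro finite_measure_Union mass_sets; auto)
 qed
 then have "((\<lambda>i. mass (M i) (A \<union> B) V) \<longlongrightarrow> \<l> A V + \<l> B V) F" using tendsto_add[OF lim[of A V] lim[of B V]] by simp
 then show ?thesis by (rule tendsto_unique[OF F(1) lim])
qed

lemma l_add2: "A : sets borel ==> U : sets borel ==> V : sets borel ==> U \<inter> V = {} ==> \<l> A (U \<union> V) = \<l> A U + \<l> A V"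
proof -
 assume a: "A : sets borel" "U : sets borel" "V : sets borel" "U \<inter> V = {}"
 have "mass (M i) A (U \<union> V) = mass (M i) A U + mass (M i) A V" for i
 proof -
  interpret prob_space "M i" by (rule planD(1))
  have "{u :: 'h \<times> 'h \<times> 'h. fst u : A \<and> fst (snd u) : U \<union> V} = {u. fst u : A \<and> fst (snd u) : U} \<union> {u. fst u : A \<and> fst (snd u) : V}" by auto
  then show ?thesis unfolding mass_def using a by (simp only:) (intro finite_measure_Union mass_sets; auto)
 qed
 then have "((\<lambda>i. mass (M i) A (U \<union> V)) \<longlongrightarrow> \<l> A U + \<l> A V) F" using tendsto_add[OF lim[of A U] lim[of A V]] by simp
 then show ?thesis by (rule tendsto_unique[OF F(1) lim])
qed

lemma l_le: "A : sets borel ==> V : sets borel ==> \<l> A V <= measure rho0 A"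
 using l_add2[of A V "- V"] l_marginal(1)[of A] l_nonneg[of A "- V"] by (simp add: Compl_partition)

text \<open>Setwise limits are only finitely additive, but \<open>\<l> A V <= measure rho0 A\<close>
  gives continuity at the empty set, hence countable additivity in \<open>A\<close>, and absolute
  continuity as well. In \<open>V\<close> finite additivity is what is used.\<close>

lemma density_exists:
 assumes V: "V : sets borel"
 shows "\<exists>f \<in> borel_measurable borel. \<forall>A\<in>sets borel. (\<integral>\<^sup>+x. f x * indicator A x \<partial>rho0) = ennreal (\<l> A V)"
proof -
 interpret r0: prob_space rho0 by (rule r0)
 interpret B: sigma_algebra UNIV "sets (borel :: 'h measure)" using sets.sigma_algebra_axioms[of "borel :: 'h measure"] by simp
 define nu where "nu = measure_of UNIV (sets borel) (\<lambda>A. ennreal (\<l> A V))"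
 have l0: "\<l> {} V = 0" using l_le[of "{}" V] V l_nonneg[of "{}" V] by simp
 have "countably_additive (sets borel) (\<lambda>A. ennreal (\<l> A V))"
 proof (rule B.empty_continuous_imp_countably_additive)
  show "positive (sets borel) (\<lambda>A. ennreal (\<l> A V))" by (simp add: positive_def l0)
  show "additive (sets borel) (\<lambda>A. ennreal (\<l> A V))"
   unfolding additive_def using V l_add1 l_nonneg by simp
  fix A :: "nat => 'h set" assume A: "range A \<subseteq> sets borel" "decseq A" "(\<Inter>i. A i) = {}"
  have "(\<lambda>i. measure rho0 (A i)) \<longlonglongrightarrow> measure rho0 (\<Inter>i. A i)"
   using A r0(2) by (intro r0.finite_Lim_measure_decseq) auto
  then have l: "(\<lambda>i. measure rho0 (A i)) \<longlonglongrightarrow> 0" using A(3) by simp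
  have "(\<lambda>i. \<l> (A i) V) \<longlonglongrightarrow> 0"
   by (rule tendsto_sandwich[OF _ _ tendsto_const l]) (use A(1) V l_le l_nonneg in \<open>auto intro!: always_eventually\<close>)
  then show "(\<lambda>i. ennreal (\<l> (A i) V)) \<longlonglongrightarrow> 0" using tendsto_ennrealI by force
 qed simp
 then have em: "emeasure nu A = ennreal (\<l> A V)" if "A : sets borel" for A
  unfolding nu_def using that by (intro emeasure_measure_of_sigma B.sigma_algebra_axioms) (auto simp: positive_def l0)
 have sn: "sets nu = sets borel" unfolding nu_def by simp
 have "absolutely_continuous rho0 nu"
  unfolding absolutely_continuous_def null_sets_def
 proof safe
  fix A assume A: "A : sets rho0" "emeasure rho0 A = 0"
  then show "A : sets nu" by (simp add: sn r0(2))
  show "emeasure nu A = 0" using l_le[of A V] A V r0(2) A r0(2) em[of A] by (simp add: measure_def ennreal_neg)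
 qed
 then obtain f where f: "f : borel_measurable rho0" "density rho0 f = nu"
  using r0.Radon_Nikodym[of nu] sn r0(2) by auto
 show ?thesis
 proof (intro bexI[of _ f] ballI)
  show "f : borel_measurable borel" using f(1) r0(2) by simp
  fix A :: "'h set" assume A: "A : sets borel"
  show "(\<integral>\<^sup>+x. f x * indicator A x \<partial>rho0) = ennreal (\<l> A V)" using f A r0(2) em[OF A] by (simp add: emeasure_density flip: f(2))
 qed
qed

text \<open>A version of the conditional probability that the target lies in \<open>V\<close>, given
  the source. It is determined up to null sets of \<open>rho0\<close>, so identities hold almost
  everywhere for fixed sets.\<close>

definition dn :: "'h set => 'h => ennreal" where
 "dn V = (SOME f. f : borel_measurable borel \<and> (\<forall>A\<in>sets borel. (\<integral>\<^sup>+x. f x * indicator A x \<partial>rho0) = ennreal (\<l> A V)))"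

lemma dn_measurable: "V : sets borel ==> dn V : borel_measurable borel"
 and dn_int: "V : sets borel ==> A : sets borel ==> (\<integral>\<^sup>+x. dn V x * indicator A x \<partial>rho0) = ennreal (\<l> A V)"
proof -
 assume V: "V : sets borel"
 have "dn V : borel_measurable borel \<and> (\<forall>A\<in>sets borel. (\<integral>\<^sup>+x. dn V x * indicator A x \<partial>rho0) = ennreal (\<l> A V))"

  unfolding dn_def by (rule someI_ex[OF density_exists[OF V, unfolded Bex_def]])
 then show "dn V : borel_measurable borel" "A : sets borel ==> (\<integral>\<^sup>+x. dn V x * indicator A x \<partial>rho0) = ennreal (\<l> A V)" by auto
qed

lemma dn_unique:
 assumes "g : borel_measurable borel" "V : sets borel" "\<And>A. A : sets borel ==> (\<integral>\<^sup>+x. g x * indicator A x \<partial>rho0) = ennreal (\<l> A V)"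
 shows "AE x in rho0. dn V x = g x"
proof -
 interpret r0: prob_space rho0 by (rule r0)
 have m: "dn V : borel_measurable rho0" "g : borel_measurable rho0" using dn_measurable assms(1,2) r0(2) by auto
 have "density rho0 (dn V) = density rho0 g"
  by (rule measure_eqI) (use m assms dn_int[OF assms(2)] r0(2) in \<open>auto simp: emeasure_density\<close>)
 then show ?thesis using r0.density_unique[OF m] by simp
qed

lemma dn_add:
 assumes "U : sets borel" "V : sets borel" "U \<inter> V = {}"
 shows "AE x in rho0. dn (U \<union> V) x = dn U x + dn V x"
proof (rule dn_unique)
 note [measurable] = dn_measurable[OF assms(1)] dn_measurable[OF assms(2)]
 note [measurable_cong] = r0(2)
 show "(\<lambda>x. dn U x + dn V x) : borel_measurable borel" by simp
 fix A :: "'h set" assume A [measurable]: "A : sets borel"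
 have "(\<integral>\<^sup>+x. (dn U x + dn V x) * indicator A x \<partial>rho0) = (\<integral>\<^sup>+x. dn U x * indicator A x \<partial>rho0) + (\<integral>\<^sup>+x. dn V x * indicator A x \<partial>rho0)"
  by (subst nn_integral_add[symmetric]) (auto simp: distrib_right)
 then show "(\<integral>\<^sup>+x. (dn U x + dn V x) * indicator A x \<partial>rho0) = ennreal (\<l> A (U \<union> V))"
  using dn_int[OF assms(1) A] dn_int[OF assms(2) A] l_add2[OF A assms] l_nonneg by simp
qed (use assms in auto)

lemma dn_UNIV: "AE x in rho0. dn UNIV x = 1"
proof (rule dn_unique)
 interpret r0: prob_space rho0 by (rule r0)
 fix A :: "'h set" assume "A : sets borel"
 then show "(\<integral>\<^sup>+x. 1 * indicator A x \<partial>rho0) = ennreal (\<l> A UNIV)" using r0(2) by (simp add: l_marginal r0.emeasure_eq_measure)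
qed auto

lemma dn_compl: "V : sets borel ==> AE x in rho0. dn V x + dn (- V) x = 1"
 using dn_add[of V "- V"] dn_UNIV by (auto simp: Compl_partition elim: eventually_elim2)

lemma dn_le_1: "V : sets borel ==> AE x in rho0. dn V x <= 1"
proof -
 assume "V : sets borel"
 from dn_compl[OF this] show ?thesis
 proof eventually_elim
  case (elim x)
  have "dn V x <= dn V x + dn (- V) x" by simp
  then show ?case using elim by simp
 qed
qed

lemma dn_total: "V : sets borel ==> (\<integral>\<^sup>+x. dn V x \<partial>rho0) = ennreal (measure rho1 V)"
 using dn_int[of V UNIV] l_marginal(2)[of V] by simp

lemma dn_finite_sum:
 fixes n :: nat
 assumes "\<And>k. S k : sets borel" "disjoint_family S"
 shows "AE x in rho0. dn (\<Union>k<n. S k) x = (\<Sum>k<n. dn (S k) x)"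
proof (induction n)
 case 0
 show ?case by (rule dn_unique) (use l_le[of _ "{}"] l_add2[of _ "{}" "{}"] in auto)
next
 case (Suc n)
 have "(\<Union>k<n. S k) \<inter> S n = {}" using assms(2) by (auto simp: disjoint_family_on_def) (metis IntI empty_iff less_irrefl)
 then have "AE x in rho0. dn ((\<Union>k<n. S k) \<union> S n) x = dn (\<Union>k<n. S k) x + dn (S n) x" using assms(1) by (intro dn_add) auto
 moreover have "(\<Union>k<n. S k) \<union> S n = (\<Union>k<Suc n. S k)" by (auto simp: less_Suc_eq)
 ultimately show ?case using Suc by auto
qed

end

section \<open>Disjoint target sets have mutually exclusive densities\<close>

context gaussian_limit
begin

lemma positive_compact:
 assumes "sets rho = sets borel" "finite_measure rho" "B : sets borel" "emeasure rho B \<noteq> 0"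
 obtains K :: "'h set" where "compact K" "K \<subseteq> B" "emeasure rho K \<noteq> 0"
proof -
 interpret finite_measure rho by fact
 have "emeasure rho B = (SUP K\<in>{K. K \<subseteq> B \<and> compact K}. emeasure rho K)"
  by (rule inner_regular) (use assms emeasure_finite in auto)
 then show thesis using that assms(4) by (metis (mono_tags, lifting) SUP_eqI mem_Collect_eq zero_le)
qed

text \<open>If both densities were positive on a non-null part of \<open>W\<close>, some compact
  \<open>A\<close> of positive measure would carry lower bounds on both densities and on
  \<open>f\<close>, and \<open>exchange_contradiction\<close> would apply. The bound on
  \<open>f\<close> enters because the entropy argument measures sets by \<open>gm\<close>.\<close>

lemma dn_sep3:
 assumes B [measurable]: "W : sets borel" "U : sets borel" "V : sets borel" and sep: "sep3 W U V" and bd: "bounded U" "bounded V"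
 shows "AE x in rho0. x : W --> dn U x * dn V x = 0"
proof -
 interpret r0: prob_space rho0 by (rule r0)
 interpret g: prob_space gm by (rule g)
 note [measurable] = dn_measurable[OF B(2)] dn_measurable[OF B(3)]
 obtain f where "f : borel_measurable gm" and f0: "\<And>x. 0 <= f x" and rho: "rho0 = density gm (\<lambda>x. ennreal (f x))"
  using r0(3) by (auto simp: entropy_bound_def)
 then have [measurable]: "f : borel_measurable borel" using g(2) by simp
 have fm: "f : borel_measurable gm" using g(2) by simp
 define B where "B n = {x : W. ennreal (1 / real (Suc n)) <= dn U x \<and> ennreal (1 / real (Suc n)) <= dn V x \<and> 1 / real (Suc n) <= f x}" for n
 have Bm [measurable]: "B n : sets borel" for n unfolding B_def by simp
 have null: "emeasure rho0 (B n) = 0" for n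
 proof (rule ccontr)
  assume "emeasure rho0 (B n) \<noteq> 0"
  then obtain A where A: "compact A" "A \<subseteq> B n" and Ap: "emeasure rho0 A \<noteq> 0"
   by (rule positive_compact[OF r0(2) r0.finite_measure_axioms Bm])
  have [measurable]: "A : sets borel" using A by (simp add: borel_compact)
  define s where "s = 1 / real (Suc n)"
  have s: "0 < s" by (simp add: s_def)
  have lower: "s * measure rho0 X <= \<l> X S" if X [measurable]: "X : sets borel" "X \<subseteq> A" and S: "S : {U, V}" for X S
  proof -
   have "ennreal (s * measure rho0 X) = (\<integral>\<^sup>+x. ennreal s * indicator X x \<partial>rho0)"
    using s r0(2) by (subst nn_integral_cmult_indicator) (auto simp: r0.emeasure_eq_measure ennreal_mult)
   also have "... <= (\<integral>\<^sup>+x. dn S x * indicator X x \<partial>rho0)"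
    using A(2) X(2) S by (intro nn_integral_mono) (auto simp: indicator_def B_def s_def)
   also have "... = ennreal (\<l> X S)" by (rule dn_int) (use S in auto)
   finally show ?thesis using l_nonneg by simp
  qed
  have lower2: "s * measure gm X <= measure rho0 X" if X [measurable]: "X : sets borel" "X \<subseteq> A" for X
  proof -
   have "ennreal (s * measure gm X) = (\<integral>\<^sup>+x. ennreal s * indicator X x \<partial>gm)"
    using s g(2) by (subst nn_integral_cmult_indicator) (auto simp: g.emeasure_eq_measure ennreal_mult)
   also have "... <= (\<integral>\<^sup>+x. ennreal (f x) * indicator X x \<partial>gm)"
    using A(2) X(2) by (intro nn_integral_mono) (auto simp: indicator_def B_def s_def intro!: ennreal_leI)
   also have "... = emeasure rho0 X" unfolding rho using fm g(2) by (subst emeasure_density) auto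
   finally show ?thesis by (simp add: r0.emeasure_eq_measure)
  qed
  have "bounded (A \<union> (U \<union> V))" using bd compact_imp_bounded[OF A(1)] by simp
  then obtain D where "\<And>x. x : A \<union> (U \<union> V) ==> norm x <= D" by (auto simp: bounded_iff)
  then have D: "norm (a - v) <= 2 * \<bar>D\<bar>" if "a : A" "v : U \<union> V" for a v
   using norm_triangle_ineq4[of a v] that by (smt (verit) UnCI)
  show False
  proof (rule exchange_contradiction[OF A(1) B(2,3) _ _ D])
   show "sep3 A U V" by (rule sep3_mono[OF sep]) (use A(2) in \<open>auto simp: B_def\<close>)
   show "0 < s * s" using s by simp
   show "s * s * measure gm X <= \<l> X U" if "X : sets borel" "X \<subseteq> A" for X
   proof -
    have "s * (s * measure gm X) <= s * measure rho0 X" using lower2[OF that] s by simp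
    also have "... <= \<l> X U" by (rule lower[OF that]) simp
    finally show ?thesis by simp
   qed
   show "0 < s * measure rho0 A" using s Ap by (simp add: r0.emeasure_eq_measure zero_less_measure_iff)
   show "s * measure rho0 A <= \<l> A V" by (rule lower) auto
  qed simp_all
 qed
 have "AE x in rho0. 0 < f x" unfolding rho using fm f0 by (subst AE_density) (auto simp: less_le)
 moreover have "AE x in rho0. \<forall>n. x \<notin> B n"
  unfolding AE_all_countable using null r0(2) by (auto intro!: AE_not_in)
 ultimately show ?thesis
 proof eventually_elim
  case (elim x)
  show ?case
  proof (intro impI, rule ccontr)
   assume x: "x : W" "dn U x * dn V x \<noteq> 0"
   \<comment> \<open>Capping at 1 keeps the value finite, so that \<open>enn2real\<close> does not
     fall back to 0.\<close>
   define y where "y = min (f x) (enn2real (min 1 (min (dn U x) (dn V x))))"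
   have "0 < min 1 (min (dn U x) (dn V x))" "min 1 (min (dn U x) (dn V x)) < \<top>"
    using x(2) by (auto simp: zero_less_iff_neq_zero min_less_iff_disj)
   then have ey: "ennreal (enn2real (min 1 (min (dn U x) (dn V x)))) = min 1 (min (dn U x) (dn V x))" "0 < enn2real (min 1 (min (dn U x) (dn V x)))"
    by (simp_all add: enn2real_positive_iff)
   then have "0 < y" using elim unfolding y_def by simp
   then obtain n where "inverse (real (Suc n)) < y" using reals_Archimedean by auto
   then have n: "1 / real (Suc n) <= f x" "1 / real (Suc n) <= enn2real (min 1 (min (dn U x) (dn V x)))" by (simp_all add: y_def inverse_eq_divide)
   show False using ennreal_leI[OF n(2)] ey(1) x(1) n(1) elim by (simp add: B_def)
  qed
 qed
qed

text \<open>\<open>sep3_local\<close> covers \<open>A \<times> U \<times> V\<close> by products of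
  separated balls. Below a Lebesgue number of this cover every triple of cells is separated, and by
  compactness finitely many cells suffice.\<close>

lemma dn_compact:
 assumes K: "compact U" "compact V" "U \<inter> V = {}"
 shows "AE x in rho0. dn U x * dn V x = 0"
proof -
 interpret r0: prob_space rho0 by (rule r0)
 have UV [measurable]: "U : sets borel" "V : sets borel" using K by (simp_all add: borel_compact)
 note [measurable] = dn_measurable[OF UV(1)] dn_measurable[OF UV(2)]
 define B where "B = {x. dn U x * dn V x \<noteq> 0}"
 have Bm: "B : sets borel" unfolding B_def by simp
 have "emeasure rho0 B = 0"
 proof (rule ccontr)
  assume "emeasure rho0 B \<noteq> 0"
  then obtain A where A: "compact A" "A \<subseteq> B" and Ap: "emeasure rho0 A \<noteq> 0"
   by (rule positive_compact[OF r0(2) r0.finite_measure_axioms Bm])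
  have Am: "A : sets borel" using A by (simp add: borel_compact)
  define \<G> where "\<G> = {ball p e \<times> ball u e \<times> ball v e |(p :: 'h) u v e. 0 < e \<and> (sep3 (ball p e) (ball u e) (ball v e) \<or> sep3 (ball p e) (ball v e) (ball u e))}"
  have cov: "A \<times> U \<times> V \<subseteq> \<Union>\<G>"
  proof safe
   fix p u v assume "u : U" "v : V"
   then have "u \<noteq> v" using K(3) by auto
   then obtain e where "0 < e" "sep3 (ball p e) (ball u e) (ball v e) \<or> sep3 (ball p e) (ball v e) (ball u e)" by (rule sep3_local[of u v p])
   then show "(p, u, v) : \<Union>\<G>" unfolding \<G>_def by (intro UnionI[of "ball p e \<times> ball u e \<times> ball v e"]) auto
  qed
  have op: "open G" if "G : \<G>" for G using that unfolding \<G>_def by (auto intro!: open_Times)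
  obtain e where e: "0 < e" "\<And>w. w : A \<times> U \<times> V ==> \<exists>G\<in>\<G>. ball w e \<subseteq> G"
   by (rule Heine_Borel_lemma[OF compact_Times[OF A(1) compact_Times[OF K(1,2)]] cov op]) auto
  obtain c :: "'h => nat" where c [measurable]: "c : borel \<rightarrow>\<^sub>M count_space UNIV" and cd: "\<And>x y. c x = c y ==> dist x y < e / 3"
   and cK: "\<And>K. compact K ==> \<exists>n. \<forall>x\<in>K. c x < n" using small_cells[of "e / 3"] e(1) by auto
  obtain n where n: "\<And>x. x : A \<union> U \<union> V ==> c x < n" using cK[OF compact_Un[OF compact_Un[OF A(1) K(1)] K(2)]] by auto
  define S where "S X k = {x : X. c x = k}" for X k
  have Sm: "S X k : sets borel" if [measurable]: "X : sets borel" for X k unfolding S_def by simp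
  have un: "(\<Union>k<n. S X k) = X" if "X \<subseteq> A \<union> U \<union> V" for X using n that by (auto simp: S_def)
  have cells: "AE x in rho0. x : S A j --> dn (S U k) x * dn (S V l) x = 0" for j k l
  proof -
   have "sep3 (S A j) (S U k) (S V l) \<or> sep3 (S A j) (S V l) (S U k)"
   proof (cases "S A j = {} \<or> S U k = {} \<or> S V l = {}")
    case True
    then have "sep3 (S A j) (S U k) (S V l)" unfolding sep3_def by (intro disjI1 exI[of _ 1]) auto
    then show ?thesis ..
   next
    case False
    then obtain p u v where w: "p : S A j" "u : S U k" "v : S V l" by auto
    then obtain G where G: "G : \<G>" "ball (p, u, v) e \<subseteq> G" using e(2)[of "(p, u, v)"] by (auto simp: S_def)
    have "S A j \<times> S U k \<times> S V l \<subseteq> ball (p, u, v) e"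
     using w by (auto simp: S_def intro!: dist_triple cd)
    then have sub: "S A j \<times> S U k \<times> S V l \<subseteq> G" using G(2) by simp
    obtain p' u' v' e' where G': "G = ball p' e' \<times> ball u' e' \<times> ball v' e'"
     "sep3 (ball p' e') (ball u' e') (ball v' e') \<or> sep3 (ball p' e') (ball v' e') (ball u' e')"
     using G(1) unfolding \<G>_def by auto
    have "S A j \<subseteq> ball p' e'" "S U k \<subseteq> ball u' e'" "S V l \<subseteq> ball v' e'" using sub w unfolding G'(1) by auto
    then show ?thesis using G'(2) sep3_mono by meson
   qed
   moreover have "bounded (S U k)" "bounded (S V l)"
    using K(1,2)[THEN compact_imp_bounded] by (auto intro: bounded_subset simp: S_def)
   ultimately show ?thesis using dn_sep3[of "S A j" "S U k" "S V l"] dn_sep3[of "S A j" "S V l" "S U k"] Sm Am UV by auto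
  qed
  have a1: "AE x in rho0. \<forall>j<n. \<forall>k<n. \<forall>l<n. x : S A j --> dn (S U k) x * dn (S V l) x = 0"
   using cells by (simp add: AE_all_countable)
  have dj: "disjoint_family (S X)" for X by (auto simp: disjoint_family_on_def S_def)
  have a2: "AE x in rho0. dn X x = (\<Sum>k<n. dn (S X k) x)" if "X : {U, V}" for X
  proof -
   have "(\<Union>k<n. S X k) = X" using un[of X] that by auto
   with dn_finite_sum[of "S X" n] Sm[of X] UV that dj[of X] show ?thesis by auto
  qed
  have "AE x in rho0. x \<notin> A"
   using a1 a2[of U, simplified] a2[of V, simplified]
  proof eventually_elim
   case (elim x)
   show ?case
   proof
    assume x: "x : A"
    then have "dn (S U k) x * dn (S V l) x = 0" if "k < n" "l < n" for k l using n elim(1) that by (auto simp: S_def)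
    then have "dn U x * dn V x = 0" unfolding elim(2,3) sum_product by simp
    then show False using x A(2) by (auto simp: B_def)
   qed
  qed
  then show False using AE_iff_null_sets[of A rho0] Ap Am r0(2) by auto
 qed
 then show ?thesis using Bm r0(2) by (intro AE_I[of _ _ B]) (auto simp: B_def)
qed

text \<open>Inner regularity of \<open>rho1\<close> reduces Borel sets to compact ones:
  \<open>dn X\<close> integrates to \<open>measure rho1 X\<close>, so removing a set of small
  \<open>rho1\<close>-measure changes the densities little in the mean.\<close>

lemma dn_disjoint:
 assumes UV: "U : sets borel" "V : sets borel" "U \<inter> V = {}"
 shows "AE x in rho0. dn U x * dn V x = 0"
proof -
 interpret r1: prob_space rho1 by (rule r1)
 note [measurable_cong] = r0(2)
 note [measurable] = dn_measurable[OF UV(1)] dn_measurable[OF UV(2)]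
 have bnd: "(\<integral>\<^sup>+x. dn U x * dn V x \<partial>rho0) <= 0 + ennreal eps" if ep: "0 < eps" for eps
 proof -
  have appr: "\<exists>K. compact K \<and> K \<subseteq> X \<and> measure rho1 (X - K) < eps / 2" if X: "X : sets borel" for X
  proof -
   have "emeasure rho1 X = (SUP K\<in>{K. K \<subseteq> X \<and> compact K}. emeasure rho1 K)"
    by (rule inner_regular) (use r1 X r1.emeasure_finite in auto)
   then have "\<exists>K\<in>{K. K \<subseteq> X \<and> compact K}. emeasure rho1 X < emeasure rho1 K + ennreal (eps / 2)"
    by (rule SUP_approx_ennreal[rotated 2]) (use ep r1.emeasure_finite in auto)
   then obtain K where K: "compact K" "K \<subseteq> X" "emeasure rho1 X < emeasure rho1 K + ennreal (eps / 2)" by auto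
   have "measure rho1 X < measure rho1 K + eps / 2" using K(3) ep by (simp add: r1.emeasure_eq_measure ennreal_less_iff flip: ennreal_plus)
   then show ?thesis using r1.finite_measure_Diff[of X K] X K(1,2) r1(2) K by (auto simp: borel_compact)
  qed
  obtain U' where U': "compact U'" "U' \<subseteq> U" "measure rho1 (U - U') < eps / 2" using appr[OF UV(1)] by auto
  obtain V' where V': "compact V'" "V' \<subseteq> V" "measure rho1 (V - V') < eps / 2" using appr[OF UV(2)] by auto
  have m: "U' : sets borel" "V' : sets borel" "U - U' : sets borel" "V - V' : sets borel" using U' V' UV by (auto simp: borel_compact)
  have e: "U' \<union> (U - U') = U" "V' \<union> (V - V') = V" using U'(2) V'(2) by auto
  note [measurable] = dn_measurable[OF m(3)] dn_measurable[OF m(4)]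
  have d1: "AE x in rho0. dn U x = dn U' x + dn (U - U') x" and d2: "AE x in rho0. dn V x = dn V' x + dn (V - V') x"
   using dn_add[OF m(1,3)] dn_add[OF m(2,4)] e by auto
  have d3: "AE x in rho0. dn U' x * dn V' x = 0" using U'(1,2) V'(1,2) UV(3) by (intro dn_compact) auto
  have "AE x in rho0. dn U x * dn V x <= dn (U - U') x + dn (V - V') x"
   using d1 d2 dn_le_1[OF UV(1)] dn_le_1[OF UV(2)] d3
  proof eventually_elim
   case (elim x)
   have "dn U x * dn V x = dn U' x * dn V' x + dn U' x * dn (V - V') x + dn (U - U') x * dn V x"
    unfolding elim(1,2) by (simp add: distrib_left distrib_right)
   also have "... <= 0 + 1 * dn (V - V') x + dn (U - U') x * 1"
   proof (intro add_mono mult_mono)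
    have "dn U' x <= dn U x" using elim(1) by simp
    then show "dn U' x <= 1" using elim(3) by simp
   qed (use elim in auto)
   finally show ?case by (simp add: add.commute)
  qed
  then have "(\<integral>\<^sup>+x. dn U x * dn V x \<partial>rho0) <= (\<integral>\<^sup>+x. dn (U - U') x + dn (V - V') x \<partial>rho0)" by (rule nn_integral_mono_AE)
  also have "... = (\<integral>\<^sup>+x. dn (U - U') x \<partial>rho0) + (\<integral>\<^sup>+x. dn (V - V') x \<partial>rho0)" by (rule nn_integral_add) measurable
  also have "... = ennreal (measure rho1 (U - U') + measure rho1 (V - V'))" by (simp add: dn_total m)
  also have "... <= ennreal eps" using U'(3) V'(3) by (intro ennreal_leI) simp
  finally show ?thesis by simp
 qed
 have "(\<integral>\<^sup>+x. dn U x * dn V x \<partial>rho0) <= 0" by (rule ennreal_le_epsilon) (rule bnd)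
 then have "(\<integral>\<^sup>+x. dn U x * dn V x \<partial>rho0) = 0" by simp
 then show ?thesis by (subst (asm) nn_integral_0_iff_AE) auto
qed

end

section \<open>The transport map\<close>

text \<open>On complements the inequality reverses, so it holds the other way round on open sets;
  shrinking open neighbourhoods to \<open>V\<close> gives the missing direction on closed sets,
  which generate.\<close>

lemma prob_eq_of_closed_le:
 fixes mu nu :: "'a::metric_space measure"
 assumes p: "prob_space mu" "prob_space nu" and s: "sets mu = sets borel" "sets nu = sets borel"
  and le: "\<And>V. closed V ==> measure mu V <= measure nu V"
 shows "mu = nu"
proof -
 interpret m: prob_space mu by (rule p)
 interpret n: prob_space nu by (rule p)
 have sp: "space mu = UNIV" "space nu = UNIV" using sets_eq_imp_space_eq[OF s(1)] sets_eq_imp_space_eq[OF s(2)] by auto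
 have eq: "measure mu V = measure nu V" if V: "closed V" for V
 proof (cases "V = {}")
  case False
  define W where "W k = {x. infdist x V < 1 / real (Suc k)}" for k
  have o: "open (W k)" for k unfolding W_def by (intro open_Collect_less continuous_intros)
  have ge: "measure nu V <= measure mu (W k)" for k
  proof -
   have "measure mu (- W k) <= measure nu (- W k)" by (rule le) (use o in auto)
   then have "measure nu (W k) <= measure mu (W k)"
    using m.prob_compl[of "W k"] n.prob_compl[of "W k"] o[of k] s by (simp add: sp Compl_eq_Diff_UNIV)
   moreover have "measure nu V <= measure nu (W k)" using o[of k] s by (intro n.finite_measure_mono) (auto simp: W_def)
   ultimately show ?thesis by simp
  qed
  have "(\<lambda>k. measure mu (W k)) \<longlonglongrightarrow> measure mu (\<Inter>k. W k)"
  proof (rule m.finite_Lim_measure_decseq)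
   show "range W \<subseteq> sets mu" using o s by auto
   show "decseq W" unfolding W_def by (intro decseq_SucI subsetI) (auto elim!: less_le_trans simp: frac_le)
  qed
  moreover have "(\<Inter>k. W k) = V"
  proof
   show "(\<Inter>k. W k) \<subseteq> V"
   proof
    fix x assume x: "x : (\<Inter>k. W k)"
    have "infdist x V <= 0"
    proof (rule ccontr)
     assume "\<not> infdist x V <= 0"
     then obtain k where "inverse (real (Suc k)) < infdist x V" using reals_Archimedean[of "infdist x V"] by auto
     moreover have "infdist x V < 1 / real (Suc k)" using x by (auto simp: W_def)
     ultimately show False by (simp add: inverse_eq_divide)
    qed
    then show "x : V" using in_closed_iff_infdist_zero[OF V False] infdist_nonneg[of x V] by simp
   qed
  qed (auto simp: W_def)
  ultimately have "measure nu V <= measure mu V" using ge by (intro LIMSEQ_le_const) auto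
  then show ?thesis using le[OF V] by simp
 qed simp
 show ?thesis
 proof (rule measure_eqI_generator_eq[where E = "Collect closed" and \<Omega> = UNIV and A = "\<lambda>_. UNIV"])
  show "sets mu = sigma_sets UNIV (Collect closed)" "sets nu = sigma_sets UNIV (Collect closed)"
   using s by (simp_all add: borel_eq_closed)
  show "emeasure mu X = emeasure nu X" if "X : Collect closed" for X using eq that by (simp add: m.emeasure_eq_measure n.emeasure_eq_measure)
 qed (auto simp: Int_stable_def)
qed

context gaussian_limit
begin

lemma dn_zero_one: "V : sets borel ==> AE x in rho0. dn V x = 0 \<or> dn V x = 1"
proof -
 assume V: "V : sets borel"
 then have "AE x in rho0. dn V x * dn (- V) x = 0" by (intro dn_disjoint) auto
 with dn_compl[OF V] show ?thesis by auto
qed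

text \<open>At level \<open>n\<close> a source is assigned a cell of diameter at most
  \<open>eps n\<close> whose density at it is nonzero. Cells of different levels with nonzero
  density at one source must meet, by \<open>dn_disjoint\<close>; so points chosen in them form a
  Cauchy sequence, whose limit is the target.\<close>

lemma optimal_map_exists:
 obtains T where "T : borel \<rightarrow>\<^sub>M borel" "distr rho0 borel T = rho1" "(\<integral>\<^sup>+x. ennreal (norm (x - T x)) \<partial>rho0) <= ennreal Lmin"
proof -
 interpret r0: prob_space rho0 by (rule r0)
 interpret r1: prob_space rho1 by (rule r1)
 note [measurable_cong] = r0(2)
 have sp0: "space rho0 = UNIV" "space rho1 = UNIV" using sets_eq_imp_space_eq[OF r0(2)] sets_eq_imp_space_eq[OF r1(2)] by auto
 define eps where "eps n = (1 / 2 :: real) ^ n" for n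
 have ep: "0 < eps n" for n by (simp add: eps_def)
 have el: "eps \<longlonglongrightarrow> 0" unfolding eps_def by (rule LIMSEQ_power_zero) simp
 have "\<exists>k :: 'h => nat. k : borel \<rightarrow>\<^sub>M count_space UNIV \<and> (\<forall>x y. k x = k y --> dist x y < eps n)" for n
  using small_cells[OF ep[of n]] by metis
 then obtain cl where clm: "\<And>n. cl n : (borel :: 'h measure) \<rightarrow>\<^sub>M count_space (UNIV :: nat set)" and cld: "\<And>n x y. cl n x = cl n y ==> dist x y < eps n" by metis
 note [measurable] = clm
 define C where "C n k = {y. cl n y = k}" for n k
 have Cm [measurable]: "C n k : sets borel" for n k
  by (simp add: C_def)
 have Cd: "dist x y < eps n" if "x : C n k" "y : C n k" for x y n k using that by (intro cld) (simp add: C_def)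
 note dm [measurable] = dn_measurable[OF Cm]
 have disj: "AE x in rho0. \<forall>n m k j. C n k \<inter> C m j = {} --> dn (C n k) x * dn (C m j) x = 0"
 proof (simp only: AE_all_countable, intro allI)
  fix n m k j
  show "AE x in rho0. C n k \<inter> C m j = {} --> dn (C n k) x * dn (C m j) x = 0"
   using dn_disjoint[OF Cm[of n k] Cm[of m j]] by simp
 qed
 have ex: "AE x in rho0. \<exists>k. dn (C n k) x \<noteq> 0" for n
 proof -
  define Z where "Z = {x. \<exists>k. dn (C n k) x \<noteq> 0}"
  have Zm [measurable]: "Z : sets borel" unfolding Z_def by simp
  have le: "measure rho1 (\<Union>k<N. C n k) <= measure rho0 Z" for N
  proof -
   have U: "(\<Union>k<N. C n k) : sets borel" by auto
   have "disjoint_family (C n)" by (auto simp: disjoint_family_on_def C_def)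
   then have "AE x in rho0. dn (\<Union>k<N. C n k) x = (\<Sum>k<N. dn (C n k) x)" by (intro dn_finite_sum Cm)
   with dn_le_1[OF U] have "AE x in rho0. dn (\<Union>k<N. C n k) x <= indicator Z x"
    by eventually_elim (auto simp: indicator_def Z_def)
   then have "(\<integral>\<^sup>+x. dn (\<Union>k<N. C n k) x \<partial>rho0) <= (\<integral>\<^sup>+x. indicator Z x \<partial>rho0)" by (rule nn_integral_mono_AE)
   then show ?thesis unfolding dn_total[OF U] by (simp add: r0.emeasure_eq_measure)
  qed
  have "(\<lambda>N. measure rho1 (\<Union>k<N. C n k)) \<longlonglongrightarrow> measure rho1 (\<Union>N. \<Union>k<N. C n k)"
  proof (rule r1.finite_Lim_measure_incseq)
   show "range (\<lambda>N. \<Union>k<N. C n k) \<subseteq> sets rho1" unfolding r1(2) by auto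
   show "incseq (\<lambda>N. \<Union>k<N. C n k)" by (rule incseq_SucI) (auto simp: less_Suc_eq)
  qed
  moreover have "(\<Union>N. \<Union>k<N. C n k) = UNIV" by (auto simp: C_def)
  ultimately have "measure rho1 UNIV <= measure rho0 Z" using le by (intro LIMSEQ_le_const2) auto
  then have "measure rho0 Z = 1" using r1.prob_space by (intro antisym r0.prob_le_1) (simp add: sp0)
  then show ?thesis using r0.prob_eq_1[of Z] by (simp add: Z_def)
 qed
 define kp where "kp n x = (LEAST k. dn (C n k) x \<noteq> 0)" for n x
 have kpm [measurable]: "kp n : borel \<rightarrow>\<^sub>M count_space UNIV" for n
  unfolding kp_def by simp
 define y where "y n k = (SOME y. y : C n k)" for n k
 have y: "y n k : C n k" if "C n k \<noteq> {}" for n k unfolding y_def using that by (simp add: some_in_eq)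
 define T' where "T' n x = y n (kp n x)" for n x
 have T'm [measurable]: "T' n : borel \<rightarrow>\<^sub>M borel" for n unfolding T'_def by simp
 \<comment> \<open>Described by the Cauchy estimate itself, this set is Borel; off it
   \<open>T\<close> takes the default value 0.\<close>
 define G where "G = {x. \<forall>n m. dist (T' n x) (T' m x) <= eps n + eps m}"
 have Gm [measurable]: "G : sets borel" unfolding G_def by simp
 have good: "AE x in rho0. \<forall>n. dn (C n (kp n x)) x \<noteq> 0"
 proof -
  have "AE x in rho0. \<forall>n. \<exists>k. dn (C n k) x \<noteq> 0" using ex by (simp add: AE_all_countable)
  then show ?thesis unfolding kp_def by eventually_elim (metis (mono_tags, lifting) LeastI)
 qed
 have GA: "AE x in rho0. x : G"
  using disj good
 proof eventually_elim
  case (elim x)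
  have "dist (T' n x) (T' m x) <= eps n + eps m" for n m
  proof -
   have "C n (kp n x) \<inter> C m (kp m x) \<noteq> {}" using elim by (metis mult_eq_0_iff)
   then obtain z where z: "z : C n (kp n x)" "z : C m (kp m x)" by auto
   have "dist (T' n x) z < eps n" "dist (T' m x) z < eps m" unfolding T'_def using y z by (auto intro!: Cd)
   then show ?thesis using dist_triangle2[of "T' n x" "T' m x" z] by simp
  qed
  then show ?case by (simp add: G_def)
 qed
 define T where "T x = (if x : G then lim (\<lambda>n. T' n x) else 0)" for x
 have conv: "(\<lambda>n. T' n x) \<longlonglongrightarrow> T x" if x: "x : G" for x
 proof -
  have "Cauchy (\<lambda>n. T' n x)"
  proof (rule metric_CauchyI)
   fix e :: real assume "0 < e"
   then have "eventually (\<lambda>n. eps n < e / 2) sequentially" by (intro order_tendstoD(2)[OF el]) simp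
   then obtain n0 where n0: "\<And>n. n0 <= n ==> eps n < e / 2" by (auto simp: eventually_sequentially)
   have "dist (T' m x) (T' n x) < e" if "n0 <= m" "n0 <= n" for m n
   proof -
    have "dist (T' m x) (T' n x) <= eps m + eps n" using x unfolding G_def by simp
    then show ?thesis using n0[OF that(1)] n0[OF that(2)] by simp
   qed
   then show "\<exists>n0. \<forall>m\<ge>n0. \<forall>n\<ge>n0. dist (T' m x) (T' n x) < e" by auto
  qed
  then show ?thesis using x by (simp add: Cauchy_convergent_iff T_def convergent_LIMSEQ_iff)
 qed
 have TT: "dist (T' n x) (T x) <= eps n" if x: "x : G" for x n
 proof -
  have "(\<lambda>m. dist (T' n x) (T' m x)) \<longlonglongrightarrow> dist (T' n x) (T x)" by (intro tendsto_intros conv[OF x])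
  moreover have "(\<lambda>m. eps n + eps m) \<longlonglongrightarrow> eps n + 0" by (intro tendsto_intros el)
  ultimately show ?thesis using x unfolding G_def by (intro LIMSEQ_le) auto
 qed
 have Tm [measurable]: "T : borel \<rightarrow>\<^sub>M borel"
 proof (rule borel_measurable_LIMSEQ_metric)
  show "(\<lambda>x. if x : G then T' n x else 0) : borel_measurable borel" for n by simp
  show "(\<lambda>n. if x : G then T' n x else 0) \<longlonglongrightarrow> T x" for x
   using conv[of x] by (cases "x : G") (auto simp: T_def)
 qed
 have pT: "prob_space (distr rho0 borel T)" by (rule r0.prob_space_distr) measurable
 \<comment> \<open>Where \<open>dn V x\<close> is nonzero, every cell assigned to \<open>x\<close>
   meets \<open>V\<close>, and closedness puts \<open>T x\<close> into \<open>V\<close>. This yields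
   one inequality on closed sets, which is enough.\<close>
 have law: "rho1 = distr rho0 borel T"
 proof (rule prob_eq_of_closed_le[OF r1(1) pT r1(2)])
  fix V :: "'h set" assume V: "closed V"
  then have Vm [measurable]: "V : sets borel" by simp
  have cap: "AE x in rho0. \<forall>n k. C n k \<inter> V = {} --> dn (C n k) x * dn V x = 0"
  proof (simp only: AE_all_countable, intro allI)
   fix n k
   show "AE x in rho0. C n k \<inter> V = {} --> dn (C n k) x * dn V x = 0"
    using dn_disjoint[OF Cm[of n k] Vm] by simp
  qed
  have "AE x in rho0. dn V x <= indicator {x. T x : V} x"
   using cap good GA dn_le_1[OF Vm]
  proof eventually_elim
   case (elim x)
   have "T x : V" if nz: "dn V x \<noteq> 0"
   proof -
    have ne: "\<exists>v. v : C n (kp n x) \<and> v : V" for n using elim(1,2) nz by (metis disjoint_iff mult_eq_0_iff)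
    have le: "infdist (T x) V <= 2 * eps n" for n
    proof -
     obtain v where v: "v : C n (kp n x)" "v : V" using ne by auto
     have "infdist (T x) V <= dist (T x) v" using v by (rule_tac infdist_le)
     also have "... <= dist (T' n x) (T x) + dist (T' n x) v" by (rule dist_triangle3)
     also have "... <= eps n + eps n" using TT[OF elim(3), of n] v y[of n "kp n x"] Cd[of "T' n x" n "kp n x" v] by (force simp: T'_def)
     finally show ?thesis by simp
    qed
    have "(\<lambda>n. 2 * eps n) \<longlonglongrightarrow> 2 * 0" by (intro tendsto_intros el)
    then have "infdist (T x) V <= 2 * 0" by (rule LIMSEQ_le_const) (use le in blast)
    then show ?thesis using in_closed_iff_infdist_zero[OF V] ne infdist_nonneg[of "T x" V] by auto
   qed
   then show ?case using elim(4) by (auto simp: indicator_def)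
  qed
  then have "(\<integral>\<^sup>+x. dn V x \<partial>rho0) <= (\<integral>\<^sup>+x. indicator {x. T x : V} x \<partial>rho0)" by (rule nn_integral_mono_AE)
  moreover have TV: "{x. T x : V} : sets borel" by simp
  ultimately have "measure rho1 V <= measure rho0 {x. T x : V}" by (simp add: dn_total r0(2) r0.emeasure_eq_measure)
  also have "... = measure (distr rho0 borel T) V" by (subst measure_distr) (auto simp: sp0 vimage_def)
  finally show "measure rho1 V <= measure (distr rho0 borel T) V" .
 qed simp
 \<comment> \<open>Restriction to the first \<open>N\<close> cells on either side makes the cost a
   finite sum of masses, which converges along \<open>F\<close>. Rounding both endpoints enters
   twice, as the margin \<open>2 * eps n\<close> inside \<open>d\<close> and again in the comparison
   with the plans; hence \<open>4 * eps n\<close>.\<close>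
 have part: "(\<integral>\<^sup>+x. ennreal (norm (x - T x)) * indicator {x. cl n x < N \<and> kp n x < N} x \<partial>rho0) <= ennreal (Lmin + 4 * eps n)" for n N
 proof -
  define d where "d j k = dist (y n j) (y n k) + 2 * eps n" for j k
  have d0: "0 <= d j k" for j k using ep[of n] by (simp add: d_def)
  \<comment> \<open>The zero-one law turns nonzero density into weight 1, so the assigned cell can
    be weighted by its density at no loss.\<close>
  have "AE x in rho0. \<forall>k. dn (C n k) x = 0 \<or> dn (C n k) x = 1" using dn_zero_one[OF Cm] by (simp add: AE_all_countable)
  then have "AE x in rho0. ennreal (norm (x - T x)) * indicator {x. cl n x < N \<and> kp n x < N} x <= (\<Sum>j<N. \<Sum>k<N. ennreal (d j k) * (dn (C n k) x * indicator (C n j) x))"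
   using good GA disj
  proof eventually_elim
   case (elim x)
   show ?case
   proof (cases "cl n x < N \<and> kp n x < N")
    case True
    let ?j = "cl n x" and ?k = "kp n x"
    have xC: "x : C n ?j" by (simp add: C_def)
    have "norm (x - T x) <= dist x (y n ?j) + dist (y n ?j) (y n ?k) + dist (T' n x) (T x)"
     unfolding T'_def dist_norm by norm
    also have "... <= d ?j ?k" using TT[OF elim(3), of n] Cd[OF xC y] xC unfolding d_def by fastforce
    finally have "ennreal (norm (x - T x)) <= ennreal (d ?j ?k) * (dn (C n ?k) x * indicator (C n ?j) x)"
     using elim(1,2) xC by (simp add: ennreal_leI) (metis ennreal_leI mult.right_neutral)
    also have "... <= (\<Sum>k<N. ennreal (d ?j k) * (dn (C n k) x * indicator (C n ?j) x))"
     by (rule member_le_sum[of ?k "{..<N}" "\<lambda>k. ennreal (d ?j k) * (dn (C n k) x * indicator (C n ?j) x)"]) (use True in auto)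
    also have "... <= (\<Sum>j<N. \<Sum>k<N. ennreal (d j k) * (dn (C n k) x * indicator (C n j) x))"
     by (rule member_le_sum[of ?j "{..<N}" "\<lambda>j. \<Sum>k<N. ennreal (d j k) * (dn (C n k) x * indicator (C n j) x)"]) (use True in auto)
    finally show ?thesis using True by simp
   qed simp
  qed
  then have "(\<integral>\<^sup>+x. ennreal (norm (x - T x)) * indicator {x. cl n x < N \<and> kp n x < N} x \<partial>rho0) <= (\<integral>\<^sup>+x. (\<Sum>j<N. \<Sum>k<N. ennreal (d j k) * (dn (C n k) x * indicator (C n j) x)) \<partial>rho0)"
   by (rule nn_integral_mono_AE)
  also have "... = (\<Sum>j<N. \<Sum>k<N. ennreal (d j k) * ennreal (\<l> (C n j) (C n k)))"
   by (simp add: nn_integral_sum nn_integral_cmult dn_int)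
  also have "... = ennreal (\<Sum>j<N. \<Sum>k<N. d j k * \<l> (C n j) (C n k))"
   using d0 l_nonneg by (simp add: sum_nonneg flip: ennreal_mult)
  also have "... <= ennreal (Lmin + 4 * eps n)"
  proof (rule ennreal_leI)
   have le: "(\<Sum>j<N. \<Sum>k<N. d j k * mass (M i) (C n j) (C n k)) <= Lmin + t i + 4 * eps n" for i
   proof -
    interpret Mi: prob_space "M i" by (rule planD(1))
    note [measurable_cong] = planD(2)[of i]
    define W where "W j k = {u :: 'h \<times> 'h \<times> 'h. fst u : C n j \<and> fst (snd u) : C n k}" for j k
    have Wm [measurable]: "W j k : sets (M i)" for j k unfolding W_def by (rule mass_sets[OF Cm Cm])
    have "ennreal (\<Sum>j<N. \<Sum>k<N. d j k * mass (M i) (C n j) (C n k)) = (\<Sum>j<N. \<Sum>k<N. ennreal (d j k) * emeasure (M i) (W j k))"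
     using d0 by (simp add: mass_def W_def Mi.emeasure_eq_measure ennreal_mult[symmetric] sum_nonneg)
    also have "... = (\<integral>\<^sup>+u. (\<Sum>j<N. \<Sum>k<N. ennreal (d j k) * indicator (W j k) u) \<partial>M i)"
     by (simp add: nn_integral_sum nn_integral_cmult_indicator del: sum_mult_indicator)
    also have "... <= (\<integral>\<^sup>+u. ennreal (norm (fst u - fst (snd u))) + ennreal (4 * eps n) \<partial>M i)"
    proof (intro nn_integral_mono)
     fix u :: "'h \<times> 'h \<times> 'h"
     let ?j = "cl n (fst u)" and ?k = "cl n (fst (snd u))"
     have c: "fst u : C n ?j" "fst (snd u) : C n ?k" by (simp_all add: C_def)
     have "(\<Sum>j<N. \<Sum>k<N. ennreal (d j k) * indicator (W j k) u)
      = (\<Sum>j<N. if j = ?j then (\<Sum>k<N. if k = ?k then ennreal (d ?j ?k) else 0) else 0)"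
      by (intro sum.cong refl) (auto simp: W_def C_def indicator_def intro!: sum.cong)
     also have "... <= ennreal (d ?j ?k)" by simp
     also have "d ?j ?k <= norm (fst u - fst (snd u)) + 4 * eps n"
     proof -
      have "dist (y n ?j) (fst u) < eps n" "dist (y n ?k) (fst (snd u)) < eps n" using Cd[OF y c(1)] Cd[OF y c(2)] c by auto
      moreover have "dist (y n ?j) (y n ?k) <= dist (y n ?j) (fst u) + norm (fst u - fst (snd u)) + dist (y n ?k) (fst (snd u))"
       unfolding dist_norm by norm
      ultimately show ?thesis unfolding d_def by simp
     qed
     finally show "(\<Sum>j<N. \<Sum>k<N. ennreal (d j k) * indicator (W j k) u) <= ennreal (norm (fst u - fst (snd u))) + ennreal (4 * eps n)"
      using ep[of n] by (simp add: ennreal_leI)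
    qed
    also have "... = ennreal (Lcost (endpoints (M i)) + 4 * eps n)"
     using cost_nonneg(1)[of "endpoints (M i)"] ep[of n] by (simp add: nn_integral_add endpoint_costs Mi.emeasure_space_1)
    finally have "(\<Sum>j<N. \<Sum>k<N. d j k * mass (M i) (C n j) (C n k)) <= Lcost (endpoints (M i)) + 4 * eps n"
     by (subst (asm) ennreal_le_iff) (use cost_nonneg(1)[of "endpoints (M i)"] ep[of n] in auto)
    moreover have "(t i)^2 <= t i" using t(1)[of i] by (simp add: power2_eq_square)
    ultimately show ?thesis using planD(6)[of i] eta[of i] by simp
   qed
   have tF: "(t \<longlongrightarrow> 0) F" using t(2) F(2) by (rule filterlim_mono[OF _ order_refl])
   have tL: "((\<lambda>i. \<Sum>j<N. \<Sum>k<N. d j k * mass (M i) (C n j) (C n k)) \<longlongrightarrow> (\<Sum>j<N. \<Sum>k<N. d j k * \<l> (C n j) (C n k))) F"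
    by (intro tendsto_intros lim)
   have tR: "((\<lambda>i. Lmin + t i + 4 * eps n) \<longlongrightarrow> Lmin + 0 + 4 * eps n) F" by (intro tendsto_intros tF)
   have "(\<Sum>j<N. \<Sum>k<N. d j k * \<l> (C n j) (C n k)) <= Lmin + 0 + 4 * eps n"
    by (rule tendsto_le[OF F(1) tR tL]) (use le in auto)
   then show "(\<Sum>j<N. \<Sum>k<N. d j k * \<l> (C n j) (C n k)) <= Lmin + 4 * eps n" by simp
  qed
  finally show ?thesis .
 qed
 have whole: "(\<integral>\<^sup>+x. ennreal (norm (x - T x)) \<partial>rho0) <= ennreal (Lmin + 4 * eps n)" for n
 proof -
  let ?S = "\<lambda>N. {x. cl n x < N \<and> kp n x < N}"
  have Sm: "?S N : sets borel" for N by simp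
  have inc: "incseq ?S" by (auto simp: incseq_def)
  have "(\<integral>\<^sup>+x. ennreal (norm (x - T x)) \<partial>rho0) = emeasure (density rho0 (\<lambda>x. ennreal (norm (x - T x)))) (\<Union>N. ?S N)"
  proof -
   have "x : ?S (Suc (max (cl n x) (kp n x)))" for x by auto
   then have "(\<Union>N. ?S N) = UNIV" by auto
   then show ?thesis by (simp add: emeasure_density)
  qed
  also have "... = (SUP N. emeasure (density rho0 (\<lambda>x. ennreal (norm (x - T x)))) (?S N))"
   by (rule SUP_emeasure_incseq[symmetric, OF _ inc], rule image_subsetI) (simp add: Sm r0(2))
  also have "... <= ennreal (Lmin + 4 * eps n)"
   using part[of n] Sm r0(2) by (intro SUP_least) (simp add: emeasure_density)
  finally show ?thesis .
 qed
 have "(\<lambda>n. ennreal (Lmin + 4 * eps n)) \<longlonglongrightarrow> ennreal (Lmin + 4 * 0)" by (intro tendsto_intros tendsto_ennrealI el)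
 then have "(\<integral>\<^sup>+x. ennreal (norm (x - T x)) \<partial>rho0) <= ennreal (Lmin + 4 * 0)" using whole by (intro LIMSEQ_le_const) auto
 then show thesis using that[OF Tm law[symmetric]] by simp
qed

end

context gaussian_pair
begin

lemma monge_cost_ge:
 assumes "S : transport_maps rho0 rho1"
 shows "ennreal Lmin <= monge_cost rho0 S"
proof -
 have S [measurable]: "S : borel \<rightarrow>\<^sub>M borel" "distr rho0 borel S = rho1" using assms by (auto simp: transport_maps_def)
 note [measurable_cong] = r0(2)
 define th where "th = distr rho0 (borel \<Otimes>\<^sub>M borel) (\<lambda>x. (x, S x))"
 have m: "(\<lambda>x. (x, S x)) : rho0 \<rightarrow>\<^sub>M borel \<Otimes>\<^sub>M borel" by simp
 have "distr th borel fst = distr rho0 borel (\<lambda>x. x)" "distr th borel snd = rho1"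
  unfolding th_def S(2)[symmetric] by (simp_all add: distr_distr[OF _ m] comp_def)
 moreover have "distr rho0 borel (\<lambda>x. x) = rho0" by (rule distr_id2) (simp add: r0)
 ultimately have th: "th : couplings rho0 rho1"
  using prob_space.prob_space_distr[OF r0(1) m] by (simp add: couplings_def th_def)
 have "monge_cost rho0 S = (\<integral>\<^sup>+v. ennreal (norm (fst v - snd v)) \<partial>th)"
  unfolding monge_cost_def th_def by (subst nn_integral_distr[OF m]) auto
 also have "... = ennreal (Lcost th)" by (rule Lcost_eq[OF th])
 finally show ?thesis using Lmin_le[OF th] by (simp add: ennreal_leI)
qed

lemma optimal_transport_map:
 "\<exists>T\<in>transport_maps rho0 rho1. monge_cost rho0 T = (INF S\<in>transport_maps rho0 rho1. monge_cost rho0 S)"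
proof -
 obtain t eta :: "nat => real" and M :: "nat => ('h \<times> 'h \<times> 'h) measure" and F :: "nat filter" and \<l>
  where L: "F \<noteq> bot" "F <= sequentially" "\<And>A V. ((\<lambda>i. mass (M i) A V) \<longlongrightarrow> \<l> A V) F"
  "\<And>i. 0 < t i \<and> t i < 1" "t \<longlonglongrightarrow> 0" "\<And>i. 0 < eta i \<and> eta i <= (t i)^2"
  "\<And>i th. th : couplings rho0 rho1 ==> Lcost th <= Lmin + 3 * eta i ==> Smin - (t i)^2 <= Scost th"
  "\<And>i. plan (t i) (eta i) (M i)"
  by (rule limit_plan_exists) blast
 interpret gaussian_limit gm rho0 rho1 x0 e c bt I E t eta M F \<l>
  by (intro gaussian_limit.intro gaussian_limit_axioms.intro gaussian_pair_axioms L)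
 obtain T where T: "T : borel \<rightarrow>\<^sub>M borel" "distr rho0 borel T = rho1" "(\<integral>\<^sup>+x. ennreal (norm (x - T x)) \<partial>rho0) <= ennreal Lmin"
  by (rule optimal_map_exists)
 have Tt: "T : transport_maps rho0 rho1" using T by (simp add: transport_maps_def)
 show ?thesis
 proof (rule bexI[OF _ Tt], rule antisym)
  show "monge_cost rho0 T <= (INF S\<in>transport_maps rho0 rho1. monge_cost rho0 S)"
   using T(3) monge_cost_ge unfolding monge_cost_def[of rho0 T] by (intro INF_greatest) (rule order_trans)
  show "(INF S\<in>transport_maps rho0 rho1. monge_cost rho0 S) <= monge_cost rho0 T" by (rule INF_lower[OF Tt])
 qed
qed

end

lemma entropy_bound_mono: "entropy_bound gm rho E ==> E <= E' ==> entropy_bound gm rho E'"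
proof -
 assume "entropy_bound gm rho E" and E: "E <= E'"
 then show "entropy_bound gm rho E'"
  unfolding entropy_bound_def using order_trans[OF _ ennreal_leI[OF E]] E by auto
qed

theorem theorem1p1:
 fixes \<gamma> \<rho>\<^sub>0 \<rho>\<^sub>1 :: "'h::{real_inner, polish_space} measure"
  and R :: "'h \<Rightarrow> 'h" and c :: "nat \<Rightarrow> real" and e :: "nat \<Rightarrow> 'h" and a :: real
 assumes infinite_dim: "\<nexists>B :: 'h set. finite B \<and> span B = UNIV"
  and gaussian: "gaussian_measure \<gamma>"
  and covariance: "has_covariance_operator \<gamma> R"
  and orthonormal: "\<And>i j. i \<ge> 1 \<Longrightarrow> j \<ge> 1 \<Longrightarrow> e i \<bullet> e j = (if i = j then 1 else 0)"
  and diagonal: "\<And>x. ((\<lambda>i. (c i * (x \<bullet> e i)) *\<^sub>R e i) has_sum R x) {1..}"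
  and a: "a > 5 / 2"
  and decay: "\<And>i. i \<ge> 1 \<Longrightarrow> c (i + 1) \<le> c i / real i powr a"
  and \<rho>\<^sub>0: "prob_space \<rho>\<^sub>0" "sets \<rho>\<^sub>0 = sets borel" "\<bar>rel_entropy \<gamma> \<rho>\<^sub>0\<bar> \<noteq> \<infinity>"
  and \<rho>\<^sub>1: "prob_space \<rho>\<^sub>1" "sets \<rho>\<^sub>1 = sets borel" "\<bar>rel_entropy \<gamma> \<rho>\<^sub>1\<bar> \<noteq> \<infinity>"
 shows "\<exists>T \<in> transport_maps \<rho>\<^sub>0 \<rho>\<^sub>1.
     monge_cost \<rho>\<^sub>0 T = (INF S \<in> transport_maps \<rho>\<^sub>0 \<rho>\<^sub>1. monge_cost \<rho>\<^sub>0 S)"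
proof -
 have g: "prob_space \<gamma>" "sets \<gamma> = sets borel" using gaussian by (auto simp: gaussian_measure_def)
 obtain E0 where E0: "entropy_bound \<gamma> \<rho>\<^sub>0 E0" using rel_entropy_finite_imp_bound[OF g(1) \<rho>\<^sub>0(1) _ \<rho>\<^sub>0(3)] \<rho>\<^sub>0 g by auto
 obtain E1 where E1: "entropy_bound \<gamma> \<rho>\<^sub>1 E1" using rel_entropy_finite_imp_bound[OF g(1) \<rho>\<^sub>1(1) _ \<rho>\<^sub>1(3)] \<rho>\<^sub>1 g by auto
 \<comment> \<open>Coordinates of variance zero are left to the choice of \<open>x0\<close>.\<close>
 define I where "I = {i. 1 \<le> i \<and> 0 < c i}"
 obtain x0 \<beta> where gc: "\<And>J. finite J \<Longrightarrow> J \<subseteq> I \<Longrightarrow> coord_law \<gamma> x0 e J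
    = gaussPi J \<beta> (\<lambda>i. sqrt (c i))"
  "AE x in \<gamma>. (\<lambda>n. (x - x0) - (\<Sum>i\<in>I \<inter> {..<n}. ((x - x0) \<bullet> e i) *\<^sub>R e i)) \<longlonglongrightarrow> 0"
  "\<And>\<rho> E. entropy_bound \<gamma> \<rho> E \<Longrightarrow> (moment2 x0 \<rho>) < \<infinity>"
 proof (rule gaussian_coordinates[OF gaussian covariance orthonormal diagonal a decay, folded I_def], goal_cases)
  case (4 x0 \<beta>)
  show ?case by (rule 4(1)[OF 4(2-4)])
 qed assumption+
 have "gaussian_pair \<gamma> \<rho>\<^sub>0 \<rho>\<^sub>1 x0 e c \<beta> I (max E0 E1)"
 proof (rule gaussian_pair.intro)
  show "entropy_bound \<gamma> \<rho>\<^sub>0 (max E0 E1)" "entropy_bound \<gamma> \<rho>\<^sub>1 (max E0 E1)"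
   by (rule entropy_bound_mono[OF E0] entropy_bound_mono[OF E1], simp)+
  show "e i \<bullet> e j = (if i = j then 1 else 0)" if "i \<in> I" "j \<in> I" for i j using that orthonormal by (auto simp: I_def)
  show "0 < c i" if "i \<in> I" for i using that by (auto simp: I_def)
 qed (fact g \<rho>\<^sub>0 \<rho>\<^sub>1 gc(2) gc(3)[OF E0] gc(3)[OF E1] | rule gc(1), assumption+)+
 then show ?thesis by (rule gaussian_pair.optimal_transport_map)
qed

end
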